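(* Let $\mathbf{A}$ be a real $n\times d$ matrix, $\mathbf{y}\in\mathbb{R}^n$, $\mu>0$ and $\mathbf{x}(0)\in\mathbb{R}^d$. For $\varepsilon>0$ let $\mathbf{x}^\varepsilon=(\mathbf{x}^\varepsilon(t))_{t\in[0,1]}$ be the unique strong solution of $$d\mathbf{x}^\varepsilon=-\{\mathbf{A}^\top(\mathbf{A}\mathbf{x}^\varepsilon-\mathbf{y})+\mu\,\mathrm{sgn}(\mathbf{x}^\varepsilon)\}\,dt+\varepsilon\,d\mathbf{w},\qquad \mathbf{x}^\varepsilon(0)=\mathbf{x}(0).$$ Then for every bounded continuous map $h:C([0,1],\mathbb{R}^d)\to\mathbb{R}$, $$\lim_{\varepsilon\to0}\left(-\varepsilon^2\ln \mathbb{E}_{\mathbf{x}(0)}\left[\exp\left\{-\frac{h(\mathbf{x}^\varepsilon)}{\varepsilon^2}\right\}\right]\right)=\inf\left\{\tfrac12 I_{\mathbf{x}(0)}(\varphi)+h(\varphi):\ \varphi\in C([0,1],\mathbb{R}^d)\right\},$$ where $$I_{\mathbf{x}(0)}(\varphi)=\sum_{i=1}^d\int_0^1\tilde L_i\left(\varphi(t),\frac{d\varphi_i}{dt}(t)\right)dt$$ if $\varphi$ is absolutely continuous with $\varphi(0)=\mathbf{x}(0)$, and $I_{\mathbf{x}(0)}(\varphi)=+\infty$ otherwise.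
   Context: Here $\mathbf{w}$ is a standard $d$-dimensional Brownian motion and $\mathbb{E}_{\mathbf{x}(0)}$ is expectation for the solution started at $\mathbf{x}(0)$. For $u\in\mathbb{R}$, $\mathrm{sgn}(u)=1$ if $u>0$, $\mathrm{sgn}(u)=-1$ if $u<0$, and $\mathrm{sgn}(0)$ is any element of $[-1,1]$; for $\mathbf{x}\in\mathbb{R}^d$, $\mathrm{sgn}(\mathbf{x})=(\mathrm{sgn}(x_1),\dots,\mathrm{sgn}(x_d))^\top$. Thus $\mathbf{A}^\top(\mathbf{A}\mathbf{x}-\mathbf{y})+\mu\,\mathrm{sgn}(\mathbf{x})$ is the subdifferential of the convex function $U(\mathbf{x})=\frac12\|\mathbf{A}\mathbf{x}-\mathbf{y}\|^2+\mu\|\mathbf{x}\|_1$, and a solution of the stochastic differential equation is a continuous adapted process with $\mathbf{x}^\varepsilon(t)=\mathbf{x}(0)-\int_0^t\mathbf{v}^\varepsilon(s)\,ds+\varepsilon\mathbf{w}(t)$ for all $t$, where $\mathbf{v}^\varepsilon$ is measurable and $\mathbf{v}^\varepsilon(t)\in\partial U(\mathbf{x}^\varepsilon(t))$ for a.e. $t$. The space $C([0,1],\mathbb{R}^d)$ carries the supremum norm. Let $\mathbf{A}_i^\top$ be the $i$-th row of $\mathbf{A}^\top$. For $i=1,\dots,d$ set $$b_i^1(\mathbf{x})=-\mathbf{A}_i^\top(\mathbf{A}\mathbf{x}-\mathbf{y})+\mu,\qquad b_i^2(\mathbf{x})=-\mathbf{A}_i^\top(\mathbf{A}\mathbf{x}-\mathbf{y})-\mu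 .$$ For $\mathbf{x}\in\mathbb{R}^d$ and $\beta\in\mathbb{R}$ define $L_i^1(\mathbf{x},\beta)=|\beta-b_i^1(\mathbf{x})|^2$, $L_i^2(\mathbf{x},\beta)=|\beta-b_i^2(\mathbf{x})|^2$, and $$L_i^0(\mathbf{x},\beta)=\inf\{p^1|\beta^1-b_i^1(\mathbf{x})|^2+p^2|\beta^2-b_i^2(\mathbf{x})|^2\},$$ the infimum being over $p^1,p^2>0$ with $p^1+p^2=1$ and $\beta^1\ge0$, $\beta^2\le0$ with $p^1\beta^1+p^2\beta^2=\beta$. Finally $\tilde L_i(\mathbf{x},\beta)=L_i^1(\mathbf{x},\beta)$ if $x_i<0$, $\tilde L_i(\mathbf{x},\beta)=L_i^2(\mathbf{x},\beta)$ if $x_i>0$, and $\tilde L_i(\mathbf{x},\beta)=L_i^0(\mathbf{x},\beta)$ if $x_i=0$. *)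

theory Defs
  imports "HOL-Probability.Probability"
begin

text \<open>The space \<open>C([0,1], \<real>\<^sup>d)\<close> with the supremum metric. Its elements are extensional, i.e.
  \<^const>\<open>undefined\<close> outside \<open>[0,1]\<close>.\<close>

definition path_space :: "(real \<Rightarrow> real ^ 'd) metric" where
  "path_space = cfunspace (top_of_set {0..1}) euclidean_metric"

definition sample_path :: "(real \<Rightarrow> 'a \<Rightarrow> real ^ 'd) \<Rightarrow> 'a \<Rightarrow> real \<Rightarrow> real ^ 'd" where
  "sample_path X \<omega> = (\<lambda>t\<in>{0..1}. X t \<omega>)"

lemma mspace_path_space:
  "mspace (path_space :: (real \<Rightarrow> real ^ 'd) metric) = {f \<in> extensional {0..1}. continuous_on {0..1} f}"
proof -
  have "bounded (f ` {0..1})" if "continuous_on {0..1} f" for f :: "real \<Rightarrow> real ^ 'd"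
    using that by (intro compact_imp_bounded compact_continuous_image) auto
  then show ?thesis
    by (auto simp: path_space_def)
qed

lemma mdist_path_space:
  fixes f g :: "real \<Rightarrow> real ^ 'd"
  assumes "f \<in> mspace path_space" "g \<in> mspace path_space"
  shows "mdist path_space f g = (SUP t\<in>{0..1}. dist (f t) (g t))"
proof -
  have "mdist path_space f g = Met_TC.fdist {0..1} f g"
    by (simp add: path_space_def mdist_cfunspace_eq_mdist_funspace)
  moreover have "f \<in> Met_TC.fspace {0..1}" "g \<in> Met_TC.fspace {0..1}"
    using assms by (auto simp: path_space_def Met_TC.fspace_def)
  ultimately show ?thesis
    by (simp add: Met_TC.fdist_def)
qed

text \<open>Standard \<open>d\<close>-dimensional Brownian motion on \<open>[0,\<infinity>)\<close>. Negative times play no role.\<close>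

definition (in prob_space) standard_brownian_motion :: "(real \<Rightarrow> 'a \<Rightarrow> real ^ 'd) \<Rightarrow> bool" where
  "standard_brownian_motion w \<longleftrightarrow>
     (\<forall>t\<ge>0. random_variable borel (w t)) \<and>
     (AE \<omega> in M. w 0 \<omega> = 0) \<and>
     (AE \<omega> in M. continuous_on {0..} (\<lambda>t. w t \<omega>)) \<and>
     (\<forall>s t. 0 \<le> s \<and> s < t \<longrightarrow>
        distributed M lborel (\<lambda>\<omega>. w t \<omega> - w s \<omega>)
          (\<lambda>z. ennreal (\<Prod>i\<in>UNIV. normal_density 0 (sqrt (t - s)) (z $ i)))) \<and>
     (\<forall>\<tau> :: nat \<Rightarrow> real. 0 \<le> \<tau> 0 \<and> mono \<tau> \<longrightarrow>
        indep_vars (\<lambda>_. borel) (\<lambda>k \<omega>. w (\<tau> (Suc k)) \<omega> - w (\<tau> k) \<omega>) UNIV)"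

text \<open>The filtration generated by \<open>w\<close>, augmented by the null sets of \<open>M\<close>.\<close>

definition augmented_filtration :: "'a measure \<Rightarrow> (real \<Rightarrow> 'a \<Rightarrow> real ^ 'd) \<Rightarrow> real \<Rightarrow> 'a measure" where
  "augmented_filtration M w t =
     sigma (space M) ({w s -` B \<inter> space M | s B. s \<in> {0..t} \<and> B \<in> sets borel} \<union> null_sets M)"

definition subdifferential :: "('v :: real_inner \<Rightarrow> real) \<Rightarrow> 'v \<Rightarrow> 'v set" where
  "subdifferential f x = {g. \<forall>z. f z \<ge> f x + inner g (z - x)}"

definition lasso_objective :: "real ^ 'd ^ 'n \<Rightarrow> real ^ 'n \<Rightarrow> real \<Rightarrow> real ^ 'd \<Rightarrow> real" where
  "lasso_objective A y \<mu> x = 1/2 * (norm (A *v x - y))\<^sup>2 + \<mu> * (\<Sum>i\<in>UNIV. \<bar>x $ i\<bar>)"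

definition sgn_set :: "real \<Rightarrow> real set" where
  "sgn_set u = (if u > 0 then {1} else if u < 0 then {-1} else {-1..1})"

text \<open>The two descriptions of the set-valued drift agree.\<close>

lemma linear_le_quadratic:
  fixes a c \<delta> :: real
  assumes "\<delta> > 0" and le: "\<And>h. 0 < h \<Longrightarrow> h < \<delta> \<Longrightarrow> a * h \<le> c * h\<^sup>2"
  shows "a \<le> 0"
proof (rule tendsto_lowerbound[where F = "at_right 0"])
  show "((\<lambda>h. c * h) \<longlongrightarrow> 0) (at_right 0)"
    by (auto intro!: tendsto_eq_intros)
  have "a \<le> c * h" if "0 < h" "h < \<delta>" for h
    using le[OF that] that by (simp add: power2_eq_square)
  then show "\<forall>\<^sub>F h in at_right 0. a \<le> c * h"
    using assms(1) by (auto simp: eventually_at_right_field)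
qed simp

lemma lasso_objective_diff:
  fixes A :: "real ^ 'd ^ 'n"
  shows "lasso_objective A y \<mu> (x + u) - lasso_objective A y \<mu> x =
    inner (transpose A *v (A *v x - y)) u + 1/2 * (norm (A *v u))\<^sup>2
      + \<mu> * (\<Sum>i\<in>UNIV. \<bar>x $ i + u $ i\<bar> - \<bar>x $ i\<bar>)"
proof -
  have *: "A *v (x + u) - y = (A *v x - y) + A *v u"
    by (simp add: matrix_vector_right_distrib)
  have "(norm (A *v (x + u) - y))\<^sup>2 =
      (norm (A *v x - y))\<^sup>2 + 2 * inner (A *v x - y) (A *v u) + (norm (A *v u))\<^sup>2"
    unfolding * by (simp add: power2_norm_eq_inner inner_add_left inner_add_right inner_commute)
  moreover have "inner (A *v x - y) (A *v u) = inner (transpose A *v (A *v x - y)) u"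
    by (simp add: dot_lmul_matrix)
  ultimately show ?thesis
    by (simp add: lasso_objective_def sum_subtractf algebra_simps)
qed

lemma subdifferential_lasso_objective:
  fixes A :: "real ^ 'd ^ 'n"
  assumes "\<mu> > 0"
  shows "subdifferential (lasso_objective A y \<mu>) x =
    {transpose A *v (A *v x - y) + \<mu> *\<^sub>R \<zeta> | \<zeta>. \<forall>i. \<zeta> $ i \<in> sgn_set (x $ i)}"
proof (intro set_eqI iffI)
  fix g assume "g \<in> {transpose A *v (A *v x - y) + \<mu> *\<^sub>R \<zeta> | \<zeta>. \<forall>i. \<zeta> $ i \<in> sgn_set (x $ i)}"
  then obtain \<zeta> where g: "g = transpose A *v (A *v x - y) + \<mu> *\<^sub>R \<zeta>"
    and \<zeta>: "\<And>i. \<zeta> $ i \<in> sgn_set (x $ i)"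
    by blast
  have "lasso_objective A y \<mu> x + inner g (z - x) \<le> lasso_objective A y \<mu> z" for z
  proof -
    have "\<zeta> $ i * (z - x) $ i \<le> \<bar>x $ i + (z - x) $ i\<bar> - \<bar>x $ i\<bar>" for i
    proof -
      have a: "\<bar>\<zeta> $ i\<bar> \<le> 1" and b: "\<zeta> $ i * x $ i = \<bar>x $ i\<bar>"
        using \<zeta>[of i] by (auto simp: sgn_set_def split: if_splits)
      have "\<zeta> $ i * z $ i \<le> \<bar>\<zeta> $ i\<bar> * \<bar>z $ i\<bar>"
        by (metis abs_ge_self abs_mult)
      also have "\<dots> \<le> \<bar>z $ i\<bar>"
        using mult_right_mono[OF a, of "\<bar>z $ i\<bar>"] by simp
      finally show ?thesis using b by (simp add: right_diff_distrib)
    qed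
    then have "inner \<zeta> (z - x) \<le> (\<Sum>i\<in>UNIV. \<bar>x $ i + (z - x) $ i\<bar> - \<bar>x $ i\<bar>)"
      unfolding inner_vec_def inner_real_def by (intro sum_mono)
    then have "\<mu> * inner \<zeta> (z - x) \<le> \<mu> * (\<Sum>i\<in>UNIV. \<bar>x $ i + (z - x) $ i\<bar> - \<bar>x $ i\<bar>)"
      using assms by (intro mult_left_mono) auto
    moreover have "0 \<le> 1/2 * (norm (A *v (z - x)))\<^sup>2"
      by simp
    ultimately show ?thesis
      using lasso_objective_diff[of A y \<mu> x "z - x"]
      unfolding g inner_add_left inner_scaleR_left
      by (simp only: add_diff_eq add_diff_cancel_left')
  qed
  then show "g \<in> subdifferential (lasso_objective A y \<mu>) x"
    by (simp add: subdifferential_def)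
next
  fix g assume "g \<in> subdifferential (lasso_objective A y \<mu>) x"
  then have sub: "lasso_objective A y \<mu> x + inner g u \<le> lasso_objective A y \<mu> (x + u)" for u
    unfolding subdifferential_def mem_Collect_eq by (metis add_diff_cancel_left')
  define r where "r = g - transpose A *v (A *v x - y)"
  have r: "r $ i * k \<le> 1/2 * (norm (A *v axis i 1))\<^sup>2 * k\<^sup>2 + \<mu> * (\<bar>x $ i + k\<bar> - \<bar>x $ i\<bar>)" for i k
  proof -
    define u :: "real ^ 'd" where "u = k *\<^sub>R axis i 1"
    have 1: "(\<Sum>j\<in>UNIV. \<bar>x $ j + u $ j\<bar> - \<bar>x $ j\<bar>) = \<bar>x $ i + k\<bar> - \<bar>x $ i\<bar>"
    proof -
      have "(\<Sum>j\<in>UNIV. \<bar>x $ j + u $ j\<bar> - \<bar>x $ j\<bar>) =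
            (\<Sum>j\<in>UNIV. if j = i then \<bar>x $ i + k\<bar> - \<bar>x $ i\<bar> else 0)"
        by (intro sum.cong) (auto simp: axis_def u_def)
      then show ?thesis by simp
    qed
    have "inner r u = r $ i * k"
      by (simp add: inner_axis u_def)
    then have 2: "inner g u - inner (transpose A *v (A *v x - y)) u = r $ i * k"
      by (simp only: r_def inner_diff_left)
    have 3: "1/2 * (norm (A *v u))\<^sup>2 = 1/2 * (norm (A *v axis i 1))\<^sup>2 * k\<^sup>2"
      by (simp add: u_def matrix_vector_mult_scaleR power_mult_distrib)
    show ?thesis
      using sub[of u] lasso_objective_diff[of A y \<mu> x u] 2 unfolding 1 3 by linarith
  qed
  define \<zeta> where "\<zeta> = (1 / \<mu>) *\<^sub>R r"
  have "\<zeta> $ i \<in> sgn_set (x $ i)" for i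
  proof -
    define c where "c = 1/2 * (norm (A *v axis i 1))\<^sup>2"
    have r': "r $ i * k \<le> c * k\<^sup>2 + \<mu> * (\<bar>x $ i + k\<bar> - \<bar>x $ i\<bar>)" for k
      using r[of i k] by (simp add: c_def)
    consider "x $ i > 0" | "x $ i < 0" | "x $ i = 0" by linarith
    then show ?thesis
    proof cases
      case 1
      have "r $ i - \<mu> \<le> 0"
      proof (rule linear_le_quadratic[OF 1])
        fix k assume "0 < k" "k < x $ i"
        then show "(r $ i - \<mu>) * k \<le> c * k\<^sup>2" using r'[of k] 1 by (simp add: algebra_simps)
      qed
      moreover have "\<mu> - r $ i \<le> 0"
      proof (rule linear_le_quadratic[OF 1])
        fix k assume "0 < k" "k < x $ i"
        then show "(\<mu> - r $ i) * k \<le> c * k\<^sup>2" using r'[of "-k"] 1 by (simp add: algebra_simps)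
      qed
      ultimately show ?thesis using 1 assms by (simp add: \<zeta>_def sgn_set_def)
    next
      case 2
      then have p: "- x $ i > 0" by simp
      have "r $ i + \<mu> \<le> 0"
      proof (rule linear_le_quadratic[OF p])
        fix k assume "0 < k" "k < - x $ i"
        then show "(r $ i + \<mu>) * k \<le> c * k\<^sup>2" using r'[of k] 2 by (simp add: algebra_simps)
      qed
      moreover have "- \<mu> - r $ i \<le> 0"
      proof (rule linear_le_quadratic[OF p])
        fix k assume "0 < k" "k < - x $ i"
        then show "(- \<mu> - r $ i) * k \<le> c * k\<^sup>2" using r'[of "-k"] 2 by (simp add: algebra_simps)
      qed
      ultimately have "r $ i = - \<mu>" by linarith
      then show ?thesis using 2 assms by (simp add: \<zeta>_def sgn_set_def)
    next
      case 3
      have "r $ i - \<mu> \<le> 0"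
      proof (rule linear_le_quadratic[OF zero_less_one])
        fix k :: real assume "0 < k" "k < 1"
        then show "(r $ i - \<mu>) * k \<le> c * k\<^sup>2" using r'[of k] 3 by (simp add: algebra_simps)
      qed
      moreover have "- \<mu> - r $ i \<le> 0"
      proof (rule linear_le_quadratic[OF zero_less_one])
        fix k :: real assume "0 < k" "k < 1"
        then show "(- \<mu> - r $ i) * k \<le> c * k\<^sup>2" using r'[of "-k"] 3 by (simp add: algebra_simps)
      qed
      ultimately show ?thesis using 3 assms by (simp add: \<zeta>_def sgn_set_def field_simps)
    qed
  qed
  moreover have "g = transpose A *v (A *v x - y) + \<mu> *\<^sub>R \<zeta>"
    using assms by (simp add: \<zeta>_def r_def)
  ultimately show "g \<in> {transpose A *v (A *v x - y) + \<mu> *\<^sub>R \<zeta> | \<zeta>. \<forall>i. \<zeta> $ i \<in> sgn_set (x $ i)}"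
    by blast
qed

text \<open>All paths of \<open>X\<close> are continuous, not just almost all of them, so that
  \<open>\<omega> \<mapsto> h (sample_path X \<omega>)\<close> is measurable for every continuous \<open>h\<close> on the path space.\<close>

definition (in prob_space) strong_solution ::
  "(real \<Rightarrow> 'a \<Rightarrow> real ^ 'd) \<Rightarrow> real ^ 'd ^ 'n \<Rightarrow> real ^ 'n \<Rightarrow> real \<Rightarrow> real ^ 'd \<Rightarrow> real
     \<Rightarrow> (real \<Rightarrow> 'a \<Rightarrow> real ^ 'd) \<Rightarrow> bool" where
  "strong_solution w A y \<mu> x0 \<epsilon> X \<longleftrightarrow>
     (\<forall>t\<in>{0..1}. X t \<in> borel_measurable (augmented_filtration M w t)) \<and>
     (\<forall>\<omega>\<in>space M. continuous_on {0..1} (\<lambda>t. X t \<omega>)) \<and>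
     (\<exists>v. (\<lambda>(t, \<omega>). v t \<omega>) \<in> borel_measurable (restrict_space borel {0..1} \<Otimes>\<^sub>M M) \<and>
        (AE \<omega> in M.
           set_integrable lborel {0..1} (\<lambda>t. v t \<omega>) \<and>
           (AE t in lborel. t \<in> {0..1} \<longrightarrow> v t \<omega> \<in> subdifferential (lasso_objective A y \<mu>) (X t \<omega>)) \<and>
           (\<forall>t\<in>{0..1}. X t \<omega> = x0 - (LINT s:{0..t}|lborel. v s \<omega>) + \<epsilon> *\<^sub>R w t \<omega>)))"

definition b1 :: "real ^ 'd ^ 'n \<Rightarrow> real ^ 'n \<Rightarrow> real \<Rightarrow> 'd \<Rightarrow> real ^ 'd \<Rightarrow> real" where
  "b1 A y \<mu> i x = - (inner (row i (transpose A)) (A *v x - y)) + \<mu>"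

definition b2 :: "real ^ 'd ^ 'n \<Rightarrow> real ^ 'n \<Rightarrow> real \<Rightarrow> 'd \<Rightarrow> real ^ 'd \<Rightarrow> real" where
  "b2 A y \<mu> i x = - (inner (row i (transpose A)) (A *v x - y)) - \<mu>"

definition L1 :: "real ^ 'd ^ 'n \<Rightarrow> real ^ 'n \<Rightarrow> real \<Rightarrow> 'd \<Rightarrow> real ^ 'd \<Rightarrow> real \<Rightarrow> real" where
  "L1 A y \<mu> i x \<beta> = \<bar>\<beta> - b1 A y \<mu> i x\<bar>\<^sup>2"

definition L2 :: "real ^ 'd ^ 'n \<Rightarrow> real ^ 'n \<Rightarrow> real \<Rightarrow> 'd \<Rightarrow> real ^ 'd \<Rightarrow> real \<Rightarrow> real" where
  "L2 A y \<mu> i x \<beta> = \<bar>\<beta> - b2 A y \<mu> i x\<bar>\<^sup>2"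

text \<open>The set below is nonempty and bounded below by 0, so \<^const>\<open>Inf\<close> is the true infimum.\<close>

definition L0 :: "real ^ 'd ^ 'n \<Rightarrow> real ^ 'n \<Rightarrow> real \<Rightarrow> 'd \<Rightarrow> real ^ 'd \<Rightarrow> real \<Rightarrow> real" where
  "L0 A y \<mu> i x \<beta> =
     Inf {p1 * \<bar>\<beta>1 - b1 A y \<mu> i x\<bar>\<^sup>2 + p2 * \<bar>\<beta>2 - b2 A y \<mu> i x\<bar>\<^sup>2 | p1 p2 \<beta>1 \<beta>2.
           p1 > 0 \<and> p2 > 0 \<and> p1 + p2 = 1 \<and> \<beta>1 \<ge> 0 \<and> \<beta>2 \<le> 0 \<and> p1 * \<beta>1 + p2 * \<beta>2 = \<beta>}"

definition L_tilde :: "real ^ 'd ^ 'n \<Rightarrow> real ^ 'n \<Rightarrow> real \<Rightarrow> 'd \<Rightarrow> real ^ 'd \<Rightarrow> real \<Rightarrow> real" where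
  "L_tilde A y \<mu> i x \<beta> =
     (if x $ i < 0 then L1 A y \<mu> i x \<beta>
      else if x $ i > 0 then L2 A y \<mu> i x \<beta>
      else L0 A y \<mu> i x \<beta>)"

definition abs_continuous_on_interval :: "real \<Rightarrow> real \<Rightarrow> (real \<Rightarrow> 'v :: real_normed_vector) \<Rightarrow> bool" where
  "abs_continuous_on_interval a b f \<longleftrightarrow>
     (\<forall>e>0. \<exists>\<delta>>0. \<forall>(n :: nat) s t.
        (\<forall>k<n. a \<le> s k \<and> s k \<le> t k \<and> t k \<le> b) \<and>
        pairwise (\<lambda>j k. {s j<..<t j} \<inter> {s k<..<t k} = {}) {..<n} \<and>
        (\<Sum>k<n. t k - s k) < \<delta> \<longrightarrow>
        (\<Sum>k<n. norm (f (t k) - f (s k))) < e)"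

text \<open>Each integrand is nonnegative, so the integrals are taken in \<open>[0,\<infinity>]\<close>. An absolutely continuous
  function is differentiable almost everywhere on \<open>[0,1]\<close>, and the value of \<^const>\<open>deriv\<close> on the
  exceptional null set (together with the endpoints) does not matter.\<close>

definition rate_function ::
  "real ^ 'd ^ 'n \<Rightarrow> real ^ 'n \<Rightarrow> real \<Rightarrow> real ^ 'd \<Rightarrow> (real \<Rightarrow> real ^ 'd) \<Rightarrow> ereal" where
  "rate_function A y \<mu> x0 \<phi> =
     (if abs_continuous_on_interval 0 1 \<phi> \<and> \<phi> 0 = x0
      then enn2ereal (\<Sum>i\<in>UNIV. \<integral>\<^sup>+t\<in>{0..1}.
             ennreal (L_tilde A y \<mu> i (\<phi> t) (deriv (\<lambda>s. \<phi> s $ i) t)) \<partial>lborel)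
      else \<infinity>)"

end

theory Submission
  imports Defs "HOL-Complex_Analysis.Great_Picard" "HOL-Real_Asymp.Real_Asymp"
begin

text \<open>Put \<open>U(x) = |Ax - y|\<^sup>2/2 + \<mu> |x|\<^sub>1\<close>. The solution is a deterministic function of the path
  \<open>\<epsilon> w\<close>: whenever \<open>x = x0 - \<integral>v + u\<close> with \<open>v \<in> \<partial>U(x)\<close>, monotonicity of \<open>\<partial>U\<close> makes \<open>x\<close> depend on the driving path \<open>u\<close>
  uniformly continuously in the supremum norm, globally. It therefore suffices to prove the Laplace principle for \<open>\<epsilon> w\<close>.
  For the upper bound on \<open>-\<epsilon>\<^sup>2 ln E\<close> a small ball around a path of finite energy has the Cameron--Martin
  probability, obtained on dyadic increments by a shift of the Gaussian density. For the lower bound, \<open>\<epsilon> w\<close>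
  is superexponentially close to its dyadic polygons, whose energy is a sum of squares of independent Gaussians
  and hence has explicit exponential moments. Finally \<open>L_tilde\<close>, summed over the coordinates, is the minimum of
  \<open>|\<phi>' + v|\<^sup>2\<close> over \<open>v \<in> \<partial>U(\<phi>)\<close> for almost every \<open>t\<close>, since \<open>\<phi>\<^sub>i' = 0\<close> almost everywhere on \<open>{\<phi>\<^sub>i = 0}\<close>; so
  \<open>I(\<phi>)\<close> is the least energy of a path driving \<open>\<phi>\<close>.

  Solutions driven by polygons are needed too. They exist because \<open>\<epsilon> w\<close> stays with positive
  probability close to any path of finite energy, it has a solution by hypothesis, and limits of driven solutions are
  driven solutions.\<close>

section \<open>Absolutely continuous functions\<close>

text \<open>The level of the dyadic polygons is fixed by the required accuracy before
  \<open>\<epsilon>\<close> tends to 0. Constants that depend on the level, such as products of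
  \<open>2 ^ n\<close> Gaussian factors, are then removed by the factor
  \<open>\<epsilon>\<^sup>2\<close> in front of the logarithm. One level can serve for all noise
  paths because \<open>h\<close> is bounded: driving polygons of large energy are left to the
  trivial bound, and only a relatively compact set of polygons needs care.

  The analytic obstacle is that the rate function speaks of \<open>deriv\<close> of an arbitrary
  absolutely continuous path, while the drift is merely measurable. To pass between a path, its
  derivative and its driving path, absolutely continuous functions are differentiated almost
  everywhere and recovered by integration. The same facts justify differentiating the squared
  distance of two solutions after their driving paths have been subtracted.\<close>

lemma abs_continuous_on_interval_subinterval:
  assumes "abs_continuous_on_interval a b f" "a \<le> c" "d \<le> b"
  shows "abs_continuous_on_interval c d f"
  unfolding abs_continuous_on_interval_def
proof (intro allI impI)
  fix e :: real assume "e > 0"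
  then obtain \<delta> where "\<delta> > 0" and \<delta>: "\<And>n s t. (\<forall>k<n. a \<le> s k \<and> s k \<le> t k \<and> t k \<le> b) \<and>
        pairwise (\<lambda>j k. {s j<..<t j} \<inter> {s k<..<t k} = {}) {..<n::nat} \<and>
        (\<Sum>k<n. t k - s k) < \<delta> \<Longrightarrow> (\<Sum>k<n. norm (f (t k) - f (s k))) < e"
    using assms(1) unfolding abs_continuous_on_interval_def by meson
  show "\<exists>\<delta>>0. \<forall>n s t. (\<forall>k<n. c \<le> s k \<and> s k \<le> t k \<and> t k \<le> d) \<and>
        pairwise (\<lambda>j k. {s j<..<t j} \<inter> {s k<..<t k} = {}) {..<n::nat} \<and>
        (\<Sum>k<n. t k - s k) < \<delta> \<longrightarrow> (\<Sum>k<n. norm (f (t k) - f (s k))) < e"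
    by (intro exI[of _ \<delta>] conjI allI impI \<open>\<delta> > 0\<close> \<delta>) (use assms in force)+
qed

text \<open>The definition numbers its intervals by naturals; the families below are indexed by
  pairs of reals, nested covers or tagged divisions. The index type \<open>'i\<close> is fixed
  before \<open>\<delta>\<close> is chosen, so every use instantiates it.\<close>

lemma abs_continuous_on_interval_finite:
  fixes f :: "real \<Rightarrow> 'v :: real_normed_vector"
  assumes "abs_continuous_on_interval a b f" "e > 0"
  shows "\<exists>\<delta>>0. \<forall>(I :: 'i set) s t. finite I \<longrightarrow> (\<forall>i\<in>I. a \<le> s i \<and> s i \<le> t i \<and> t i \<le> b) \<longrightarrow>
    pairwise (\<lambda>i j. {s i<..<t i} \<inter> {s j<..<t j} = {}) I \<longrightarrow> (\<Sum>i\<in>I. t i - s i) < \<delta> \<longrightarrow>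
    (\<Sum>i\<in>I. norm (f (t i) - f (s i))) < e"
proof -
  obtain \<delta> where "\<delta> > 0" and \<delta>: "\<And>n s t. (\<forall>k<n. a \<le> s k \<and> s k \<le> t k \<and> t k \<le> b) \<and>
        pairwise (\<lambda>j k. {s j<..<t j} \<inter> {s k<..<t k} = {}) {..<n::nat} \<and>
        (\<Sum>k<n. t k - s k) < \<delta> \<Longrightarrow> (\<Sum>k<n. norm (f (t k) - f (s k))) < e"
    using assms unfolding abs_continuous_on_interval_def by meson
  have "(\<Sum>i\<in>I. norm (f (t i) - f (s i))) < e"
    if fin: "finite I" and st: "\<forall>i\<in>I. a \<le> s i \<and> s i \<le> t i \<and> t i \<le> b"
      and pw: "pairwise (\<lambda>i j. {s i<..<t i} \<inter> {s j<..<t j} = {}) I"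
      and sm: "(\<Sum>i\<in>I. t i - s i) < \<delta>" for I :: "'i set" and s t
  proof -
    obtain h where h: "bij_betw h {..<card I} I"
      using ex_bij_betw_nat_finite[OF fin] by (auto simp: atLeast0LessThan)
    have hI: "h k \<in> I" if "k < card I" for k
      using h that by (auto simp: bij_betw_def)
    have hinj: "h j \<noteq> h k" if "j < card I" "k < card I" "j \<noteq> k" for j k
      using h that by (auto simp: bij_betw_def inj_on_def)
    have "(\<Sum>k<card I. norm (f (t (h k)) - f (s (h k)))) < e"
    proof (rule \<delta>, intro conjI allI impI)
      show "pairwise (\<lambda>j k. {s (h j)<..<t (h j)} \<inter> {s (h k)<..<t (h k)} = {}) {..<card I}"
        using pw hI hinj by (auto simp: pairwise_def)
      show "(\<Sum>k<card I. t (h k) - s (h k)) < \<delta>"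
        using sm sum.reindex_bij_betw[OF h, of "\<lambda>i. t i - s i"] by simp
    qed (use st hI in auto)
    then show ?thesis
      using sum.reindex_bij_betw[OF h, of "\<lambda>i. norm (f (t i) - f (s i))"] by simp
  qed
  then show ?thesis using \<open>\<delta> > 0\<close> by blast
qed

lemma abs_continuous_on_interval_imp_continuous_on:
  assumes "abs_continuous_on_interval a b f"
  shows "continuous_on {a..b} f"
  unfolding continuous_on_iff
proof (intro ballI allI impI)
  fix x e :: real assume x: "x \<in> {a..b}" and "e > 0"
  obtain \<delta> where "\<delta> > 0" and \<delta>: "\<And>(I :: unit set) s t. finite I \<Longrightarrow> (\<forall>i\<in>I. a \<le> s i \<and> s i \<le> t i \<and> t i \<le> b) \<Longrightarrow>
    pairwise (\<lambda>i j. {s i<..<t i} \<inter> {s j<..<t j} = {}) I \<Longrightarrow> (\<Sum>i\<in>I. t i - s i) < \<delta> \<Longrightarrow>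
    (\<Sum>i\<in>I. norm (f (t i) - f (s i))) < e"
    using abs_continuous_on_interval_finite[OF assms \<open>e > 0\<close>, where 'i=unit] by blast
  have *: "norm (f t - f s) < e" if "a \<le> s" "s \<le> t" "t \<le> b" "t - s < \<delta>" for s t
    using \<delta>[of UNIV "\<lambda>_. s" "\<lambda>_. t"] that by (simp add: pairwise_def)
  show "\<exists>d>0. \<forall>x'\<in>{a..b}. dist x' x < d \<longrightarrow> dist (f x') (f x) < e"
  proof (intro exI[of _ \<delta>] conjI ballI impI \<open>\<delta> > 0\<close>)
    fix x' assume "x' \<in> {a..b}" "dist x' x < \<delta>"
    then show "dist (f x') (f x) < e"
      using *[of x x'] *[of x' x] x by (cases "x \<le> x'") (auto simp: dist_norm norm_minus_commute)
  qed
qed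

lemma lipschitz_imp_abs_continuous_on_interval:
  assumes L: "\<And>s t. a \<le> s \<Longrightarrow> s \<le> t \<Longrightarrow> t \<le> b \<Longrightarrow> norm (f t - f s) \<le> B * (t - s)"
  shows "abs_continuous_on_interval a b f"
  unfolding abs_continuous_on_interval_def
proof (intro allI impI)
  fix e :: real assume "e > 0"
  \<comment> \<open>Truncation at 1 makes \<open>B'\<close> positive, so that \<open>e / B'\<close>
    is an admissible \<open>\<delta>\<close> for every \<open>B\<close>.\<close>
  define B' where "B' = max B 1"
  have "B' > 0" by (simp add: B'_def)
  show "\<exists>\<delta>>0. \<forall>(n :: nat) s t. (\<forall>k<n. a \<le> s k \<and> s k \<le> t k \<and> t k \<le> b) \<and>
        pairwise (\<lambda>j k. {s j<..<t j} \<inter> {s k<..<t k} = {}) {..<n} \<and>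
        (\<Sum>k<n. t k - s k) < \<delta> \<longrightarrow> (\<Sum>k<n. norm (f (t k) - f (s k))) < e"
  proof (intro exI[of _ "e / B'"] conjI allI impI)
    fix n :: nat and s t
    assume H: "(\<forall>k<n. a \<le> s k \<and> s k \<le> t k \<and> t k \<le> b) \<and>
        pairwise (\<lambda>j k. {s j<..<t j} \<inter> {s k<..<t k} = {}) {..<n} \<and> (\<Sum>k<n. t k - s k) < e / B'"
    have "(\<Sum>k<n. norm (f (t k) - f (s k))) \<le> (\<Sum>k<n. B' * (t k - s k))"
    proof (rule sum_mono)
      fix k assume "k \<in> {..<n}"
      then have k: "a \<le> s k" "s k \<le> t k" "t k \<le> b" using H by auto
      have "norm (f (t k) - f (s k)) \<le> B * (t k - s k)" using L k by blast
      also have "\<dots> \<le> B' * (t k - s k)" using k by (intro mult_right_mono) (auto simp: B'_def)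
      finally show "norm (f (t k) - f (s k)) \<le> B' * (t k - s k)" .
    qed
    also have "\<dots> < e"
      using H \<open>B' > 0\<close> by (simp only: sum_distrib_left[symmetric]) (simp add: field_simps)
    finally show "(\<Sum>k<n. norm (f (t k) - f (s k))) < e" .
  qed (use \<open>e > 0\<close> \<open>B' > 0\<close> in simp)
qed

section \<open>Vitali covers and almost everywhere differentiability\<close>

lemma Vitali_finite_cover_interval:
  fixes E U :: "real set"
  assumes E: "E \<in> sets borel" "bounded E" and U: "open U" "E \<subseteq> U" and "\<eta> > 0"
    and P: "\<forall>x\<in>E. \<forall>d>0. \<exists>s t. s < t \<and> x \<in> {s..t} \<and> t - s < d \<and> P s t"
  shows "\<exists>F. finite F \<and> (\<forall>s t. (s, t) \<in> F \<longrightarrow> s < t \<and> {s..t} \<subseteq> U \<and> P s t) \<and>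
    pairwise (\<lambda>(s, t) (s', t'). {s..t} \<inter> {s'..t'} = {}) F \<and>
    measure lborel (E - (\<Union>(s, t)\<in>F. {s..t})) < \<eta>"
proof -
  define K where "K = {(s, t). s < t \<and> {s..t} \<subseteq> U \<and> P s t}"
  \<comment> \<open>An interval is the closed ball about its midpoint, the form in which Vitali's
    theorem is applied.\<close>
  define c r where "c = (\<lambda>(s, t). (s + t) / 2 :: real)" and "r = (\<lambda>(s, t). (t - s) / 2 :: real)"
  have cb: "cball (c p) (r p) = {fst p..snd p}" for p
    by (cases p) (auto simp: c_def r_def cball_eq_atLeastAtMost field_simps)
  have fine: "\<exists>i. i \<in> K \<and> x \<in> cball (c i) (r i) \<and> r i < d" if x: "x \<in> E" and "d > 0" for x d
  proof -
    obtain e where e: "e > 0" "ball x e \<subseteq> U" using U x open_contains_ball by blast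
    obtain s t where st: "s < t" "x \<in> {s..t}" "t - s < min d e" "P s t"
      using P[rule_format, OF x, of "min d e"] e \<open>d > 0\<close> by auto
    have "{s..t} \<subseteq> ball x e" using st by (auto simp: dist_real_def)
    then have "(s, t) \<in> K" using st e by (auto simp: K_def)
    moreover have "r (s, t) < d" using st by (simp add: r_def)
    ultimately show ?thesis using st cb[of "(s, t)"] by (intro exI[of _ "(s, t)"]) auto
  qed
  have rpos: "0 < r i" if "i \<in> K" for i using that by (auto simp: K_def r_def)
  obtain C where C: "countable C" "C \<subseteq> K"
     "pairwise (\<lambda>i j. disjnt (cball (c i) (r i)) (cball (c j) (r j))) C"
     "negligible (E - (\<Union>i \<in> C. cball (c i) (r i)))"
    by (rule Vitali_covering_theorem_cballs[OF rpos fine]) blast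
  have "E \<in> sets lborel" using E by simp
  have Efin: "emeasure lborel E < \<infinity>" by (rule emeasure_bounded_finite[OF E(2)])
  show ?thesis
  proof (cases "C = {}")
    \<comment> \<open>\<open>from_nat_into\<close> enumerates only nonempty countable sets; if
      \<open>C\<close> is empty, then \<open>E\<close> itself is null.\<close>
    case True
    then have "negligible E" using C by simp
    then have "measure lborel E = 0"
      using E by (simp add: negligible_iff_null_sets null_sets_completion_iff measure_eq_0_null_sets)
    then show ?thesis using \<open>\<eta> > 0\<close> by (intro exI[of _ "{}"]) auto
  next
    case False
    define g where "g = from_nat_into C"
    have g: "range g = C" using False C by (simp add: g_def range_from_nat_into)
    \<comment> \<open>\<open>B n\<close> is what the first \<open>n\<close> balls leave of
      \<open>E\<close>. These sets decrease to a null set and \<open>E\<close> has finite measure,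
      so some finite stage leaves less than \<open>\<eta>\<close>.\<close>
    define B where "B n = E - (\<Union>k<n. cball (c (g k)) (r (g k)))" for n :: nat
    have Bm: "B n \<in> sets lborel" for n using E by (auto simp: B_def)
    have "(\<lambda>n. measure lborel (B n)) \<longlonglongrightarrow> measure lborel (\<Inter>n. B n)"
    proof (rule Lim_measure_decseq)
      show "range B \<subseteq> sets lborel" using Bm by auto
      show "decseq B" unfolding decseq_def B_def by (intro allI impI Diff_mono order_refl UN_mono) auto
      show "emeasure lborel (B n) \<noteq> \<infinity>" for n
        using emeasure_mono[of "B n" E lborel] E Efin by (auto simp: B_def top.not_eq_extremum less_top)
    qed
    moreover have "(\<Inter>n. B n) = E - (\<Union>i \<in> C. cball (c i) (r i))"
      unfolding g[symmetric] B_def by auto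
    moreover have "(\<Inter>n. B n) \<in> sets borel" using Bm by auto
    ultimately have "(\<lambda>n. measure lborel (B n)) \<longlonglongrightarrow> 0"
      using C(4) by (simp add: negligible_iff_null_sets null_sets_completion_iff measure_eq_0_null_sets)
    then obtain n where n: "measure lborel (B n) < \<eta>"
      using \<open>\<eta> > 0\<close> by (metis eventually_sequentially order_tendstoD(2) order_refl)
    show ?thesis
    proof (intro exI[of _ "g ` {..<n}"] conjI allI impI)
      show "finite (g ` {..<n})" by simp
      fix s t assume "(s, t) \<in> g ` {..<n}"
      then have "(s, t) \<in> K" using g C(2) by auto
      then show "s < t" "{s..t} \<subseteq> U" "P s t" by (auto simp: K_def)
    next
      have "pairwise (\<lambda>i j. disjnt (cball (c i) (r i)) (cball (c j) (r j))) (g ` {..<n})"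
        by (rule pairwise_subset[OF C(3)]) (use g in auto)
      then show "pairwise (\<lambda>(s, t) (s', t'). {s..t} \<inter> {s'..t'} = {}) (g ` {..<n})"
        unfolding cb disjnt_def by (rule pairwise_mono) (auto simp: split_beta)
      have "(\<Union>(s, t)\<in>g ` {..<n}. {s..t}) = (\<Union>k<n. cball (c (g k)) (r (g k)))"
        unfolding cb by (auto simp: split_beta)
      then show "measure lborel (E - (\<Union>(s, t)\<in>g ` {..<n}. {s..t})) < \<eta>"
        using n by (simp add: B_def)
    qed
  qed
qed

text \<open>Induction removes the rightmost interval of \<open>G\<close> and adds the gap between it
  and \<open>d\<close>. The telescoping identity is stated for all \<open>f\<close> at once because
  the same gaps are later measured both by their length and by the increment of a given
  function.\<close>

lemma interval_gaps:
  fixes G :: "(real \<times> real) set"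
  assumes "finite G" "c \<le> d" "\<And>s t. (s, t) \<in> G \<Longrightarrow> c \<le> s \<and> s < t \<and> t \<le> d"
    and "pairwise (\<lambda>(s, t) (s', t'). {s..t} \<inter> {s'..t'} = {}) G"
  shows "\<exists>H. finite H \<and> (\<forall>(s, t)\<in>H. c \<le> s \<and> s \<le> t \<and> t \<le> d) \<and>
    pairwise (\<lambda>(s, t) (s', t'). {s<..<t} \<inter> {s'<..<t'} = {}) H \<and>
    (\<forall>f :: real \<Rightarrow> real. (\<Sum>(s, t)\<in>H. f t - f s) = f d - f c - (\<Sum>(s, t)\<in>G. f t - f s))"
  using assms
proof (induction "card G" arbitrary: G d)
  case 0
  then have "G = {}" by simp
  then show ?case using 0 by (intro exI[of _ "{(c, d)}"]) auto
next
  case (Suc n)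
  then have "G \<noteq> {}" by auto
  obtain p where p: "p \<in> G" "\<And>q. q \<in> G \<Longrightarrow> snd q \<le> snd p"
  proof -
    have "Max (snd ` G) \<in> snd ` G" using \<open>finite G\<close> \<open>G \<noteq> {}\<close> by (intro Max_in) auto
    then obtain p where "p \<in> G" "snd p = Max (snd ` G)" by auto
    then show thesis using \<open>finite G\<close> by (intro that[of p]) auto
  qed
  obtain s0 t0 where p0: "p = (s0, t0)" by force
  have b0: "c \<le> s0" "s0 < t0" "t0 \<le> d" using Suc.prems(3) p p0 by auto
  define G' where "G' = G - {p}"
  have G: "G = insert p G'" "p \<notin> G'" "finite G'" using p Suc.prems(1) by (auto simp: G'_def)
  have le: "t \<le> s0" if "(s, t) \<in> G'" for s t
  proof -
    have "(s, t) \<in> G" "(s, t) \<noteq> p" using that by (auto simp: G'_def)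
    then have "{s..t} \<inter> {s0..t0} = {}" "s < t" "t \<le> t0"
      using Suc.prems(3,4) p p0 by (fastforce simp: pairwise_def)+
    then show ?thesis by auto
  qed
  have "\<exists>H. finite H \<and> (\<forall>(s, t)\<in>H. c \<le> s \<and> s \<le> t \<and> t \<le> s0) \<and>
    pairwise (\<lambda>(s, t) (s', t'). {s<..<t} \<inter> {s'<..<t'} = {}) H \<and>
    (\<forall>f :: real \<Rightarrow> real. (\<Sum>(s, t)\<in>H. f t - f s) = f s0 - f c - (\<Sum>(s, t)\<in>G'. f t - f s))"
  proof (rule Suc.hyps(1))
    show "n = card G'" using Suc.hyps(2) G by simp
    show "c \<le> s \<and> s < t \<and> t \<le> s0" if "(s, t) \<in> G'" for s t
      using le[OF that] Suc.prems(3)[of s t] that by (auto simp: G'_def)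
    show "pairwise (\<lambda>(s, t) (s', t'). {s..t} \<inter> {s'..t'} = {}) G'"
      by (rule pairwise_subset[OF Suc.prems(4)]) (auto simp: G'_def)
  qed (use G b0 in auto)
  then obtain H where H: "finite H" and H2: "\<forall>(s, t)\<in>H. c \<le> s \<and> s \<le> t \<and> t \<le> s0"
    and H3: "pairwise (\<lambda>(s, t) (s', t'). {s<..<t} \<inter> {s'<..<t'} = {}) H"
    and H4: "\<forall>f :: real \<Rightarrow> real. (\<Sum>(s, t)\<in>H. f t - f s) = f s0 - f c - (\<Sum>(s, t)\<in>G'. f t - f s)"
    by blast
  have H2: "c \<le> s \<and> s \<le> t \<and> t \<le> s0" if "(s, t) \<in> H" for s t using H2 that by blast
  have new: "(t0, d) \<notin> H" using H2[of t0 d] b0 by auto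
  show ?case
  proof (intro exI[of _ "insert (t0, d) H"] conjI allI)
    show "\<forall>(s, t)\<in>insert (t0, d) H. c \<le> s \<and> s \<le> t \<and> t \<le> d"
      using H2 b0 by fastforce
    have "{t0<..<d} \<inter> {s<..<t} = {} \<and> {s<..<t} \<inter> {t0<..<d} = {}" if "(s, t) \<in> H" for s t
      using H2[OF that] b0 by auto
    then show "pairwise (\<lambda>(s, t) (s', t'). {s<..<t} \<inter> {s'<..<t'} = {}) (insert (t0, d) H)"
      using H3 by (auto simp: pairwise_insert split: prod.splits)
    show "(\<Sum>(s, t)\<in>insert (t0, d) H. f t - f s) = f d - f c - (\<Sum>(s, t)\<in>G. f t - f s)" for f :: "real \<Rightarrow> real"
      using H spec[OF H4, of f] new G p0 by simp
  qed (use H in auto)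
qed

lemma fmeasurable_lborel_Icc: "{a..b::real} \<in> fmeasurable lborel"
  by (simp add: fmeasurable_def emeasure_lborel_Icc_eq)

lemma fmeasurable_lborel_bounded:
  fixes A :: "real set"
  assumes "A \<in> sets borel" "A \<subseteq> {a<..<b}"
  shows "A \<in> fmeasurable lborel"
  using assms by (intro fmeasurableI2[OF fmeasurable_lborel_Icc[of a b]]) auto

lemma measure_disjoint_intervals:
  fixes F :: "(real \<times> real) set"
  assumes "finite F" "\<And>s t. (s, t) \<in> F \<Longrightarrow> s < t"
    and "pairwise (\<lambda>(s, t) (s', t'). {s..t} \<inter> {s'..t'} = {}) F"
  shows "measure lborel (\<Union>(s, t)\<in>F. {s..t}) = (\<Sum>(s, t)\<in>F. t - s)"
proof -
  have "measure lborel (\<Union>p\<in>F. {fst p..snd p}) = (\<Sum>p\<in>F. measure lborel {fst p..snd p})"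
    by (rule measure_UNION') (use assms in \<open>auto simp: disjnt_def split_beta pairwise_def fmeasurable_lborel_Icc\<close>)
  also have "\<dots> = (\<Sum>p\<in>F. snd p - fst p)"
    using assms(2) by (intro sum.cong) (auto simp: less_imp_le)
  finally show ?thesis by (simp add: split_beta)
qed

text \<open>Two Vitali covers are nested: intervals of mean slope at most \<open>p\<close> that nearly exhaust \<open>E\<close>, and inside
  them intervals of mean slope at least \<open>q\<close> that nearly exhaust \<open>E\<close> again. The gaps between them have small
  total length, so absolute continuity makes \<open>f\<close> vary little there and \<open>(q - p) * measure E\<close> is small.\<close>

lemma two_slopes_null_sets:
  fixes f :: "real \<Rightarrow> real"
  assumes AC: "abs_continuous_on_interval a b f" and "p < q"
    and E: "E \<in> sets borel" "E \<subseteq> {a<..<b}"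
    and lo: "\<And>x d. x \<in> E \<Longrightarrow> d > 0 \<Longrightarrow>
      \<exists>s t. s < t \<and> x \<in> {s..t} \<and> t - s < d \<and> f t - f s \<le> p * (t - s)"
    and hi: "\<And>x d. x \<in> E \<Longrightarrow> d > 0 \<Longrightarrow>
      \<exists>s t. s < t \<and> x \<in> {s..t} \<and> t - s < d \<and> f t - f s \<ge> q * (t - s)"
  shows "measure lborel E = 0"
proof (rule ccontr)
  define L where "L = measure lborel E"
  assume "measure lborel E \<noteq> 0"
  then have "L > 0" by (simp add: L_def zero_less_measure_iff)
  have bE: "bounded E" using E(2) bounded_subset[OF bounded_closed_interval[of a b], of E] by force
  have Efm: "A \<in> fmeasurable lborel" if "A \<in> sets borel" "A \<subseteq> {a<..<b}" for A
    using that by (rule fmeasurable_lborel_bounded)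
  define e where "e = (q - p) * L / 2"
  have "e > 0" using \<open>L > 0\<close> \<open>p < q\<close> by (simp add: e_def)
  obtain \<delta> where "\<delta> > 0" and \<delta>: "\<And>(I :: ((real \<times> real) \<times> (real \<times> real)) set) s t.
    finite I \<Longrightarrow> (\<forall>i\<in>I. a \<le> s i \<and> s i \<le> t i \<and> t i \<le> b) \<Longrightarrow>
    pairwise (\<lambda>i j. {s i<..<t i} \<inter> {s j<..<t j} = {}) I \<Longrightarrow> (\<Sum>i\<in>I. t i - s i) < \<delta> \<Longrightarrow>
    (\<Sum>i\<in>I. norm (f (t i) - f (s i))) < e"
    using abs_continuous_on_interval_finite[OF AC \<open>e > 0\<close>, where 'i="(real \<times> real) \<times> (real \<times> real)"]
    by blast
  \<comment> \<open>\<open>D\<close> collects the errors of the final estimate: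
    \<open>q * len F2 - p * len F1\<close> is at least \<open>(q - p) * (L - 2 * \<eta>) - 3 *
    \<bar>p\<bar> * \<eta> = 2 * e - D * \<eta>\<close>, and \<open>\<eta> \<le> e / D\<close> keeps
    this at least \<open>e\<close>. The other bound, \<open>\<eta> \<le> \<delta> / 4\<close>, keeps
    the total length of the gaps, below \<open>3 * \<eta>\<close>, under
    \<open>\<delta>\<close>.\<close>
  define D where "D = 2 * (q - p) + 3 * \<bar>p\<bar>"
  have "D > 0" using \<open>p < q\<close> by (simp add: D_def)
  define \<eta> where "\<eta> = min (\<delta> / 4) (e / D)"
  have "\<eta> > 0" using \<open>\<delta> > 0\<close> \<open>e > 0\<close> \<open>D > 0\<close> by (simp add: \<eta>_def)
  obtain U0 where U0: "open U0" "E \<subseteq> U0" "emeasure lborel (U0 - E) < \<eta>"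
    using outer_regular_lborel[OF E(1) \<open>\<eta> > 0\<close>] by blast
  define U where "U = U0 \<inter> {a<..<b}"
  have U: "open U" "E \<subseteq> U" "U \<subseteq> {a<..<b}" using U0 E by (auto simp: U_def)
  have "measure lborel (U - E) \<le> \<eta>"
  proof -
    have "emeasure lborel (U - E) \<le> emeasure lborel (U0 - E)"
      by (intro emeasure_mono) (use U0 E in \<open>auto simp: U_def\<close>)
    then show ?thesis using U0(3) \<open>\<eta> > 0\<close>
      unfolding measure_def by (intro enn2real_leI) auto
  qed
  moreover have "measure lborel U = measure lborel E + measure lborel (U - E)"
  proof -
    have "E \<in> fmeasurable lborel" "U - E \<in> fmeasurable lborel" using E U by (auto intro!: Efm)
    then have "measure lborel (E \<union> (U - E)) = measure lborel E + measure lborel (U - E)"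
      by (intro measure_Union) (auto simp: fmeasurable_def)
    then show ?thesis using U by (simp add: Un_absorb1)
  qed
  ultimately have mU: "measure lborel U \<le> L + \<eta>" by (simp add: L_def)
  have lo0: "\<forall>x\<in>E. \<forall>d>0. \<exists>s t. s < t \<and> x \<in> {s..t} \<and> t - s < d \<and> f t - f s \<le> p * (t - s)"
    using lo by blast
  obtain F1 where "finite F1 \<and> (\<forall>s t. (s, t) \<in> F1 \<longrightarrow> s < t \<and> {s..t} \<subseteq> U \<and> f t - f s \<le> p * (t - s)) \<and>
      pairwise (\<lambda>(s, t) (s', t'). {s..t} \<inter> {s'..t'} = {}) F1 \<and>
      measure lborel (E - (\<Union>(s, t)\<in>F1. {s..t})) < \<eta>"
      using Vitali_finite_cover_interval[OF E(1) bE U(1,2) \<open>\<eta> > 0\<close>, of "\<lambda>s t. f t - f s \<le> p * (t - s)", OF lo0] by (rule exE)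
    then have F1: "finite F1" "\<And>s t. (s, t) \<in> F1 \<Longrightarrow> s < t \<and> {s..t} \<subseteq> U \<and> f t - f s \<le> p * (t - s)"
      "pairwise (\<lambda>(s, t) (s', t'). {s..t} \<inter> {s'..t'} = {}) F1" "measure lborel (E - (\<Union>(s, t)\<in>F1. {s..t})) < \<eta>"
      by simp_all

  define U1 where "U1 = (\<Union>(s, t)\<in>F1. {s<..<t})"
  define E1 where "E1 = E \<inter> U1"
  have U1: "open U1" "E1 \<subseteq> U1" "E1 \<subseteq> E" by (auto simp: U1_def E1_def)
  have E1: "E1 \<in> sets borel" "bounded E1"
    using E(1) U1(1) bE by (auto simp: E1_def intro: bounded_subset)
  have hi1: "\<exists>s t. s < t \<and> x \<in> {s..t} \<and> t - s < d \<and> f t - f s \<ge> q * (t - s)" if "x \<in> E1" "d > 0" for x d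
    using hi that U1 by blast
  then have hi1: "\<forall>x\<in>E1. \<forall>d>0. \<exists>s t. s < t \<and> x \<in> {s..t} \<and> t - s < d \<and> f t - f s \<ge> q * (t - s)" by blast
  obtain F2 where "finite F2 \<and> (\<forall>s t. (s, t) \<in> F2 \<longrightarrow> s < t \<and> {s..t} \<subseteq> U1 \<and> f t - f s \<ge> q * (t - s)) \<and>
      pairwise (\<lambda>(s, t) (s', t'). {s..t} \<inter> {s'..t'} = {}) F2 \<and>
      measure lborel (E1 - (\<Union>(s, t)\<in>F2. {s..t})) < \<eta>"
      using Vitali_finite_cover_interval[OF E1 U1(1,2) \<open>\<eta> > 0\<close>, of "\<lambda>s t. f t - f s \<ge> q * (t - s)", OF hi1] by (rule exE)
    then have F2: "finite F2" "\<And>s t. (s, t) \<in> F2 \<Longrightarrow> s < t \<and> {s..t} \<subseteq> U1 \<and> f t - f s \<ge> q * (t - s)"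
      "pairwise (\<lambda>(s, t) (s', t'). {s..t} \<inter> {s'..t'} = {}) F2" "measure lborel (E1 - (\<Union>(s, t)\<in>F2. {s..t})) < \<eta>"
      by simp_all

  define len where "len F = (\<Sum>(s, t)\<in>F. t - s :: real)" for F
  define inc where "inc F = (\<Sum>(s, t)\<in>F. f t - f s)" for F
  have len1: "len F1 = measure lborel (\<Union>(s, t)\<in>F1. {s..t})"
    unfolding len_def using F1 by (intro measure_disjoint_intervals[symmetric]) auto
  have len2: "len F2 = measure lborel (\<Union>(s, t)\<in>F2. {s..t})"
    unfolding len_def using F2 by (intro measure_disjoint_intervals[symmetric]) auto
  have sub1: "(\<Union>(s, t)\<in>F1. {s..t}) \<subseteq> U" using F1(2) by auto
  have U1sub: "U1 \<subseteq> (\<Union>(s, t)\<in>F1. {s..t})"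
    unfolding U1_def by (intro UN_mono order_refl) (auto split: prod.splits)
  have sub2: "(\<Union>(s, t)\<in>F2. {s..t}) \<subseteq> U1" using F2(2) by auto
  have borF: "(\<Union>(s, t)\<in>F. {s..t}) \<in> sets borel" if "finite F" for F :: "(real \<times> real) set"
    using that by (intro sets.finite_UN) auto
  have len1_le: "len F1 \<le> L + \<eta>"
  proof -
    have "len F1 \<le> measure lborel U" unfolding len1
      by (rule measure_mono_fmeasurable) (use sub1 borF F1 U in \<open>auto intro!: Efm\<close>)
    then show ?thesis using mU by simp
  qed
  have len2_ge: "len F2 > L - 2 * \<eta>"
  proof -
    define N where "N = fst ` F1 \<union> snd ` F1"
    have N: "finite N" using F1(1) by (simp add: N_def)
    have cov: "E \<subseteq> (\<Union>(s, t)\<in>F2. {s..t}) \<union> (E - (\<Union>(s, t)\<in>F1. {s..t})) \<union> (E1 - (\<Union>(s, t)\<in>F2. {s..t})) \<union> (N \<inter> {a<..<b})"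
    proof
      fix x assume x: "x \<in> E"
      show "x \<in> (\<Union>(s, t)\<in>F2. {s..t}) \<union> (E - (\<Union>(s, t)\<in>F1. {s..t})) \<union> (E1 - (\<Union>(s, t)\<in>F2. {s..t})) \<union> (N \<inter> {a<..<b})"
      proof (cases "x \<in> (\<Union>(s, t)\<in>F1. {s..t}) \<and> x \<notin> N")
        case True
        then obtain s t where st: "(s, t) \<in> F1" "x \<in> {s..t}" by auto
        then have "s \<in> N" "t \<in> N" by (force simp: N_def)+
        then have "x \<noteq> s" "x \<noteq> t" using True by auto
        then have "x \<in> {s<..<t}" using st by auto
        then have "x \<in> E1" using x st(1) unfolding E1_def U1_def by (auto intro!: bexI[of _ "(s, t)"])
        then show ?thesis by auto
      qed (use x E in auto)
    qed
    have m: "(\<Union>(s, t)\<in>F2. {s..t}) \<in> fmeasurable lborel" "E - (\<Union>(s, t)\<in>F1. {s..t}) \<in> fmeasurable lborel"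
      "E1 - (\<Union>(s, t)\<in>F2. {s..t}) \<in> fmeasurable lborel" "N \<inter> {a<..<b} \<in> fmeasurable lborel"
    proof -
      have "(\<Union>(s, t)\<in>F2. {s..t}) \<subseteq> {a<..<b}" using sub2 U1sub sub1 U(3) by blast
      then show "(\<Union>(s, t)\<in>F2. {s..t}) \<in> fmeasurable lborel" by (intro Efm borF F2(1))
    qed (use E E1 U1 borF[OF F1(1)] borF[OF F2(1)] N in \<open>auto intro!: Efm dest: finite_imp_closed\<close>)
    have "measure lborel E \<le> measure lborel ((\<Union>(s, t)\<in>F2. {s..t}) \<union> (E - (\<Union>(s, t)\<in>F1. {s..t})) \<union> (E1 - (\<Union>(s, t)\<in>F2. {s..t})) \<union> (N \<inter> {a<..<b}))"
      by (rule measure_mono_fmeasurable[OF cov]) (use E fmeasurable.Un[OF fmeasurable.Un[OF fmeasurable.Un[OF m(1,2)] m(3)] m(4)] in auto)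
    also have "\<dots> \<le> measure lborel (\<Union>(s, t)\<in>F2. {s..t}) + measure lborel (E - (\<Union>(s, t)\<in>F1. {s..t}))
       + measure lborel (E1 - (\<Union>(s, t)\<in>F2. {s..t})) + measure lborel (N \<inter> {a<..<b})"
      using m by (intro order_trans[OF measure_Un_le] add_right_mono) (simp_all add: fmeasurable_def sets.Un)
    also have "measure lborel (N \<inter> {a<..<b}) = 0"
      using N by (simp add: measure_def emeasure_lborel_countable countable_finite)
    finally show ?thesis using F1(4) F2(4) len2 by (simp add: L_def)
  qed
  define G where "G i = {j\<in>F2. {fst j..snd j} \<subseteq> {fst i<..<snd i}}" for i :: "real \<times> real"
  have Gfin: "finite (G i)" for i using F2(1) by (simp add: G_def)
  have GF2: "F2 = (\<Union>i\<in>F1. G i)"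
  proof (intro equalityI subsetI)
    fix j assume j: "j \<in> F2"
    obtain s' t' where j0: "j = (s', t')" by force
    have j1: "s' < t'" "{s'..t'} \<subseteq> U1" using F2(2) j j0 by auto
    then have "s' \<in> U1" by auto
    then obtain s t where st: "(s, t) \<in> F1" "s < s'" "s' < t" by (auto simp: U1_def)
    \<comment> \<open>If \<open>{s'..t'}\<close> reached beyond \<open>t\<close>, the point
      \<open>t\<close> would lie in \<open>U1\<close>, hence inside another interval of
      \<open>F1\<close>, against the disjointness of the closed intervals.\<close>
    have "t' < t"
    proof (rule ccontr)
      assume "\<not> t' < t"
      then have "t \<in> U1" using j1 st by auto
      then obtain s2 t2 where st2: "(s2, t2) \<in> F1" "s2 < t" "t < t2" by (auto simp: U1_def)
      then have "{s..t} \<inter> {s2..t2} = {}"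
        using pairwiseD[OF F1(3) st(1) st2(1)] st2 by auto
      moreover have "t \<in> {s..t} \<inter> {s2..t2}" using st st2 by auto
      ultimately show False by blast
    qed
    then have "j \<in> G (s, t)" using j j0 st by (auto simp: G_def)
    then show "j \<in> (\<Union>i\<in>F1. G i)" using st by blast
  qed (auto simp: G_def)
  have Gdisj: "G i \<inter> G i' = {}" if "i \<in> F1" "i' \<in> F1" "i \<noteq> i'" for i i'
  proof (rule ccontr)
    assume "G i \<inter> G i' \<noteq> {}"
    then obtain j where j: "j \<in> F2" "{fst j..snd j} \<subseteq> {fst i<..<snd i}" "{fst j..snd j} \<subseteq> {fst i'<..<snd i'}"
      unfolding G_def by blast
    have "fst j < snd j" using F2(2)[of "fst j" "snd j"] j(1) by simp
    then have "fst j \<in> {fst i..snd i} \<inter> {fst i'..snd i'}"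
      using subsetD[OF j(2), of "fst j"] subsetD[OF j(3), of "fst j"] by auto
    moreover have "{fst i..snd i} \<inter> {fst i'..snd i'} = {}"
      using pairwiseD[OF F1(3) that] by (simp add: split_beta)
    ultimately show False by blast
  qed
  have Hex: "\<exists>H. finite H \<and> (\<forall>(s, t)\<in>H. fst i \<le> s \<and> s \<le> t \<and> t \<le> snd i) \<and>
    pairwise (\<lambda>(s, t) (s', t'). {s<..<t} \<inter> {s'<..<t'} = {}) H \<and>
    (\<forall>f :: real \<Rightarrow> real. (\<Sum>(s, t)\<in>H. f t - f s) = f (snd i) - f (fst i) - (\<Sum>(s, t)\<in>G i. f t - f s))"
    if "i \<in> F1" for i
  proof (rule interval_gaps)
    show "fst i \<le> snd i" using F1(2)[of "fst i" "snd i"] that by auto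
    show "fst i \<le> s \<and> s < t \<and> t \<le> snd i" if "(s, t) \<in> G i" for s t
    proof -
      have st: "s < t" "{s..t} \<subseteq> {fst i<..<snd i}" using that F2(2) by (auto simp: G_def)
      then have "s \<in> {fst i<..<snd i}" "t \<in> {fst i<..<snd i}" using st(1) by (intro subsetD[OF st(2)], simp)+
      then show ?thesis using st(1) by auto
    qed
    show "pairwise (\<lambda>(s, t) (s', t'). {s..t} \<inter> {s'..t'} = {}) (G i)"
      by (rule pairwise_subset[OF F2(3)]) (auto simp: G_def)
  qed (rule Gfin)
  have "\<forall>i\<in>F1. \<exists>H. finite H \<and> (\<forall>(s, t)\<in>H. fst i \<le> s \<and> s \<le> t \<and> t \<le> snd i) \<and>
    pairwise (\<lambda>(s, t) (s', t'). {s<..<t} \<inter> {s'<..<t'} = {}) H \<and>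
    (\<forall>f :: real \<Rightarrow> real. (\<Sum>(s, t)\<in>H. f t - f s) = f (snd i) - f (fst i) - (\<Sum>(s, t)\<in>G i. f t - f s))"
    by (intro ballI Hex)
  from bchoice[OF this] obtain H where H: "\<forall>i\<in>F1. finite (H i) \<and> (\<forall>(s, t)\<in>H i. fst i \<le> s \<and> s \<le> t \<and> t \<le> snd i) \<and>
    pairwise (\<lambda>(s, t) (s', t'). {s<..<t} \<inter> {s'<..<t'} = {}) (H i) \<and>
    (\<forall>f :: real \<Rightarrow> real. (\<Sum>(s, t)\<in>H i. f t - f s) = f (snd i) - f (fst i) - (\<Sum>(s, t)\<in>G i. f t - f s))"
    by (rule exE)
  have Hfin: "\<And>i. i \<in> F1 \<Longrightarrow> finite (H i)"
    and Hb: "\<And>i. i \<in> F1 \<Longrightarrow> \<forall>(s, t)\<in>H i. fst i \<le> s \<and> s \<le> t \<and> t \<le> snd i"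
    and Hd: "\<And>i. i \<in> F1 \<Longrightarrow> pairwise (\<lambda>(s, t) (s', t'). {s<..<t} \<inter> {s'<..<t'} = {}) (H i)"
    and Hs: "\<And>i. i \<in> F1 \<Longrightarrow> \<forall>f :: real \<Rightarrow> real. (\<Sum>(s, t)\<in>H i. f t - f s) = f (snd i) - f (fst i) - (\<Sum>(s, t)\<in>G i. f t - f s)"
    using H by blast+
  have Hsum: "(\<Sum>z\<in>Sigma F1 H. \<phi> (snd (snd z)) - \<phi> (fst (snd z))) =
      (\<Sum>(s, t)\<in>F1. \<phi> t - \<phi> s) - (\<Sum>(s, t)\<in>F2. \<phi> t - \<phi> s)" for \<phi> :: "real \<Rightarrow> real"
  proof -
    have "(\<Sum>z\<in>Sigma F1 H. \<phi> (snd (snd z)) - \<phi> (fst (snd z))) = (\<Sum>i\<in>F1. \<Sum>(s, t)\<in>H i. \<phi> t - \<phi> s)"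
      using F1(1) Hfin by (simp add: sum.Sigma split_beta)
    also have "\<dots> = (\<Sum>i\<in>F1. \<phi> (snd i) - \<phi> (fst i)) - (\<Sum>i\<in>F1. \<Sum>(s, t)\<in>G i. \<phi> t - \<phi> s)"
      using Hs by (simp add: sum_subtractf)
    also have "(\<Sum>i\<in>F1. \<Sum>(s, t)\<in>G i. \<phi> t - \<phi> s) = (\<Sum>(s, t)\<in>F2. \<phi> t - \<phi> s)"
      unfolding GF2 using F1(1) Gfin Gdisj by (intro sum.UNION_disjoint[symmetric]) auto
    finally show ?thesis by (simp add: split_beta)
  qed
  have "len F1 - len F2 < \<delta>"
  proof -
    have "\<eta> \<le> \<delta> / 4" unfolding \<eta>_def by (rule min.cobounded1)
    then show ?thesis using len1_le len2_ge \<open>\<eta> > 0\<close> by linarith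
  qed
  have "(\<Sum>z\<in>Sigma F1 H. norm (f (snd (snd z)) - f (fst (snd z)))) < e"
  proof (rule \<delta>)
    show "finite (Sigma F1 H)" using F1(1) Hfin by auto
    show "\<forall>z\<in>Sigma F1 H. a \<le> fst (snd z) \<and> fst (snd z) \<le> snd (snd z) \<and> snd (snd z) \<le> b"
    proof
      fix z assume z: "z \<in> Sigma F1 H"
      have zz: "fst (fst z) < snd (fst z)" "{fst (fst z)..snd (fst z)} \<subseteq> U"
      proof -
        have "(fst (fst z), snd (fst z)) \<in> F1" using z by auto
        from F1(2)[OF this] show "fst (fst z) < snd (fst z)" "{fst (fst z)..snd (fst z)} \<subseteq> U"
          by (simp_all only:)
      qed
      have "{fst (fst z)..snd (fst z)} \<subseteq> {a<..<b}" by (rule order_trans[OF zz(2) U(3)])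
      note zz(1) this
      with zz(1) have "a < fst (fst z)" "snd (fst z) < b"
        by (meson atLeastAtMost_iff greaterThanLessThan_iff less_imp_le order_refl subsetD)+
      then show "a \<le> fst (snd z) \<and> fst (snd z) \<le> snd (snd z) \<and> snd (snd z) \<le> b"
        using bspec[OF Hb[of "fst z"], of "snd z"] z by (auto simp: split_beta)
    qed
    show "pairwise (\<lambda>z z'. {fst (snd z)<..<snd (snd z)} \<inter> {fst (snd z')<..<snd (snd z')} = {}) (Sigma F1 H)"
    proof (rule pairwiseI)
      fix z z' assume z: "z \<in> Sigma F1 H" "z' \<in> Sigma F1 H" "z \<noteq> z'"
      show "{fst (snd z)<..<snd (snd z)} \<inter> {fst (snd z')<..<snd (snd z')} = {}"
      proof (cases "fst z = fst z'")
        case True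
        then have "snd z \<noteq> snd z'" "snd z \<in> H (fst z)" "snd z' \<in> H (fst z)" using z by (auto simp: prod_eq_iff)
        then show ?thesis using pairwiseD[OF Hd[of "fst z"], of "snd z" "snd z'"] z by (auto simp: split_beta)
      next
        case False
        then have "{fst (fst z)..snd (fst z)} \<inter> {fst (fst z')..snd (fst z')} = {}"
          using pairwiseD[OF F1(3), of "fst z" "fst z'"] z by (auto simp: split_beta)
        moreover have "{fst (snd z)<..<snd (snd z)} \<subseteq> {fst (fst z)..snd (fst z)}"
          "{fst (snd z')<..<snd (snd z')} \<subseteq> {fst (fst z')..snd (fst z')}"
          using bspec[OF Hb[of "fst z"], of "snd z"] bspec[OF Hb[of "fst z'"], of "snd z'"] z by (auto simp: split_beta)
        ultimately show ?thesis by blast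
      qed
    qed
    show "(\<Sum>z\<in>Sigma F1 H. snd (snd z) - fst (snd z)) < \<delta>"
      using Hsum[of "\<lambda>x. x"] \<open>len F1 - len F2 < \<delta>\<close> by (simp add: len_def)
  qed
  then have "\<bar>inc F1 - inc F2\<bar> < e"
    using Hsum[of f] sum_abs[of "\<lambda>z. f (snd (snd z)) - f (fst (snd z))" "Sigma F1 H"] by (simp add: inc_def)
  moreover have "inc F1 \<le> p * len F1"
    unfolding inc_def len_def sum_distrib_left by (rule sum_mono) (use F1(2) in auto)
  moreover have "inc F2 \<ge> q * len F2"
    unfolding inc_def len_def sum_distrib_left by (rule sum_mono) (use F2(2) in auto)
  ultimately have "q * len F2 - p * len F1 < e" by linarith
  moreover have "len F1 - len F2 \<ge> 0"
  proof -
    have "len F2 \<le> len F1" unfolding len1 len2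
      by (rule measure_mono_fmeasurable) (use sub1 sub2 U1sub U borF[OF F1(1)] borF[OF F2(1)] in \<open>auto intro!: Efm\<close>)
    then show ?thesis by simp
  qed
  ultimately have False if "D * \<eta> \<le> e"
  proof -
    define g where "g = len F1 - len F2"
    have g: "0 \<le> g" "g \<le> 3 * \<eta>" using \<open>len F1 - len F2 \<ge> 0\<close> len1_le len2_ge by (auto simp: g_def)
    have "p * g \<le> \<bar>p\<bar> * (3 * \<eta>)"
      using mult_mono[OF order_refl g(2), of "\<bar>p\<bar>"] g(1) \<open>\<eta> > 0\<close> abs_ge_self[of "p * g"] by (simp add: abs_mult)
    moreover have "(q - p) * (L - 2 * \<eta>) \<le> (q - p) * len F2"
      using len2_ge \<open>p < q\<close> by (intro mult_left_mono) auto
    moreover have "q * len F2 - p * len F1 = (q - p) * len F2 - p * g"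
      by (simp add: g_def algebra_simps)
    ultimately have "(q - p) * (L - 2 * \<eta>) - \<bar>p\<bar> * (3 * \<eta>) < e"
      using \<open>q * len F2 - p * len F1 < e\<close> by linarith
    moreover have "(q - p) * (L - 2 * \<eta>) - \<bar>p\<bar> * (3 * \<eta>) = 2 * e - D * \<eta>"
      by (simp add: e_def D_def field_simps)
    ultimately show False using that by linarith
  qed
  moreover have "D * \<eta> \<le> e"
    using \<open>D > 0\<close> by (simp add: \<eta>_def min_def field_simps)
  ultimately show False by blast
qed

text \<open>Inside an interval of length \<open>\<delta> / 2\<close>, disjoint intervals have total
  length below \<open>\<delta>\<close> and so total increment below 1. If \<open>E\<close> had
  measure \<open>L > 0\<close> there, a Vitali cover with slopes at least \<open>2 / L\<close> and
  total length above \<open>L / 2\<close> would have total increment above 1. Intervals with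
  rational left endpoint exhaust \<open>E\<close>.\<close>

lemma infinite_slope_null_sets:
  fixes f :: "real \<Rightarrow> real"
  assumes AC: "abs_continuous_on_interval a b f"
    and E: "E \<in> sets borel" "E \<subseteq> {a<..<b}"
    and hi: "\<And>x d K. x \<in> E \<Longrightarrow> d > 0 \<Longrightarrow>
      \<exists>s t. s < t \<and> x \<in> {s..t} \<and> t - s < d \<and> \<bar>f t - f s\<bar> \<ge> K * (t - s)"
  shows "E \<in> null_sets lborel"
proof -
  obtain \<delta> where "\<delta> > 0" and \<delta>: "\<And>(I :: (real \<times> real) set) s t.
    finite I \<Longrightarrow> (\<forall>i\<in>I. a \<le> s i \<and> s i \<le> t i \<and> t i \<le> b) \<Longrightarrow>
    pairwise (\<lambda>i j. {s i<..<t i} \<inter> {s j<..<t j} = {}) I \<Longrightarrow> (\<Sum>i\<in>I. t i - s i) < \<delta> \<Longrightarrow>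
    (\<Sum>i\<in>I. norm (f (t i) - f (s i))) < 1"
    using abs_continuous_on_interval_finite[OF AC, of 1, where 'i="real \<times> real"] by auto
  have fm: "A \<in> fmeasurable lborel" if "A \<in> sets borel" "A \<subseteq> {a<..<b}" for A
    using that by (rule fmeasurable_lborel_bounded)
  have small: "E \<inter> {c<..<c + \<delta> / 2} \<in> null_sets lborel" for c
  proof (rule ccontr)
    define E' where "E' = E \<inter> {c<..<c + \<delta> / 2}"
    have E': "E' \<in> sets borel" "E' \<subseteq> {a<..<b}" using E by (auto simp: E'_def)
    assume "E \<inter> {c<..<c + \<delta> / 2} \<notin> null_sets lborel"
    then have "emeasure lborel E' \<noteq> 0" using E' by (auto simp: E'_def null_sets_def)
    then have "measure lborel E' \<noteq> 0" using fm[OF E'] by (auto simp: fmeasurable_def measure_def enn2real_eq_0_iff)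
    then have L: "measure lborel E' > 0" by (simp add: zero_less_measure_iff)
    define L where "L = measure lborel E'"
    have "L > 0" using L by (simp add: L_def)
    define U where "U = {max a c<..<min b (c + \<delta> / 2)}"
    have U: "open U" "E' \<subseteq> U" using E by (auto simp: U_def E'_def)
    have bE: "bounded E'" using E'(2) bounded_subset[OF bounded_closed_interval[of a b], of E'] by force
    have hi': "\<exists>s t. s < t \<and> x \<in> {s..t} \<and> t - s < d \<and> \<bar>f t - f s\<bar> \<ge> (2 / L) * (t - s)" if "x \<in> E'" "d > 0" for x d
      using hi[of x d "2 / L"] that by (auto simp: E'_def)
    then have hi': "\<forall>x\<in>E'. \<forall>d>0. \<exists>s t. s < t \<and> x \<in> {s..t} \<and> t - s < d \<and> \<bar>f t - f s\<bar> \<ge> (2 / L) * (t - s)" by blast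
    obtain F where "finite F \<and> (\<forall>s t. (s, t) \<in> F \<longrightarrow> s < t \<and> {s..t} \<subseteq> U \<and> \<bar>f t - f s\<bar> \<ge> (2 / L) * (t - s)) \<and>
      pairwise (\<lambda>(s, t) (s', t'). {s..t} \<inter> {s'..t'} = {}) F \<and>
      measure lborel (E' - (\<Union>(s, t)\<in>F. {s..t})) < L / 2"
      using Vitali_finite_cover_interval[OF E'(1) bE U half_gt_zero[OF \<open>L > 0\<close>], of "\<lambda>s t. \<bar>f t - f s\<bar> \<ge> (2 / L) * (t - s)", OF hi'] by (rule exE)
    then have F: "finite F" "\<And>s t. (s, t) \<in> F \<Longrightarrow> s < t \<and> {s..t} \<subseteq> U \<and> \<bar>f t - f s\<bar> \<ge> (2 / L) * (t - s)"
      "pairwise (\<lambda>(s, t) (s', t'). {s..t} \<inter> {s'..t'} = {}) F" "measure lborel (E' - (\<Union>(s, t)\<in>F. {s..t})) < L / 2"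
      by simp_all

    have FU: "(\<Union>(s, t)\<in>F. {s..t}) \<subseteq> U" using F(2) by auto
    have Usub: "U \<subseteq> {a<..<b}" by (auto simp: U_def)
    have bF: "(\<Union>(s, t)\<in>F. {s..t}) \<in> sets borel" using F(1) by (intro sets.finite_UN) auto
    have len: "measure lborel (\<Union>(s, t)\<in>F. {s..t}) = (\<Sum>(s, t)\<in>F. t - s)"
      using F by (intro measure_disjoint_intervals) auto
    have "L \<le> measure lborel (\<Union>(s, t)\<in>F. {s..t}) + measure lborel (E' - (\<Union>(s, t)\<in>F. {s..t}))"
    proof -
      have m: "(\<Union>(s, t)\<in>F. {s..t}) \<in> fmeasurable lborel" "E' - (\<Union>(s, t)\<in>F. {s..t}) \<in> fmeasurable lborel"
        using FU Usub bF E' by (auto intro!: fm)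
      have "L \<le> measure lborel ((\<Union>(s, t)\<in>F. {s..t}) \<union> (E' - (\<Union>(s, t)\<in>F. {s..t})))"
        unfolding L_def by (rule measure_mono_fmeasurable) (use E' fmeasurable.Un[OF m] in auto)
      also have "\<dots> \<le> measure lborel (\<Union>(s, t)\<in>F. {s..t}) + measure lborel (E' - (\<Union>(s, t)\<in>F. {s..t}))"
        using m by (intro measure_Un_le) auto
      finally show ?thesis .
    qed
    then have lenL: "(\<Sum>(s, t)\<in>F. t - s) > L / 2" using F(4) len by simp
    have lenU: "(\<Sum>(s, t)\<in>F. t - s) < \<delta>"
    proof -
      have "(\<Sum>(s, t)\<in>F. t - s) \<le> measure lborel {c<..<c + \<delta> / 2}"
        unfolding len[symmetric] by (rule measure_mono_fmeasurable)
          (use FU bF \<open>\<delta> > 0\<close> in \<open>auto simp: U_def fmeasurable_def subset_iff\<close>)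
      then show ?thesis using \<open>\<delta> > 0\<close> by simp
    qed
    have "(\<Sum>i\<in>F. norm (f (snd i) - f (fst i))) < 1"
    proof (rule \<delta>)
      show "\<forall>i\<in>F. a \<le> fst i \<and> fst i \<le> snd i \<and> snd i \<le> b"
      proof
        fix i assume "i \<in> F"
        then have "fst i < snd i" "{fst i..snd i} \<subseteq> {a<..<b}"
          using F(2)[of "fst i" "snd i"] Usub by auto
        then show "a \<le> fst i \<and> fst i \<le> snd i \<and> snd i \<le> b"
          by (meson atLeastAtMost_iff greaterThanLessThan_iff less_imp_le order_refl subsetD)
      qed
      show "pairwise (\<lambda>i j. {fst i<..<snd i} \<inter> {fst j<..<snd j} = {}) F"
        by (rule pairwise_mono[OF F(3)]) (auto simp: split_beta)
      show "(\<Sum>i\<in>F. snd i - fst i) < \<delta>" using lenU by (simp add: split_beta)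
    qed (rule F(1))
    moreover have "(\<Sum>i\<in>F. norm (f (snd i) - f (fst i))) \<ge> (\<Sum>i\<in>F. (2 / L) * (snd i - fst i))"
      by (rule sum_mono) (use F(2) in auto)
    moreover have "(\<Sum>i\<in>F. (2 / L) * (snd i - fst i)) > 1"
      using lenL \<open>L > 0\<close> by (simp only: sum_distrib_left[symmetric]) (simp add: split_beta field_simps)
    ultimately show False by linarith
  qed
  have n1: "(\<Union>c\<in>\<rat>. E \<inter> {c<..<c + \<delta> / 2}) \<in> null_sets lborel"
    by (rule null_sets_UN') (use small countable_rat in auto)
  have n2: "E \<subseteq> (\<Union>c\<in>\<rat>. E \<inter> {c<..<c + \<delta> / 2})"
  proof
    fix x assume "x \<in> E"
    have "x - \<delta> / 2 < x" using \<open>\<delta> > 0\<close> by simp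
    from Rats_dense_in_real[OF this] obtain c where c: "c \<in> \<rat>" "x - \<delta> / 2 < c" "c < x" by blast
    have "x \<in> E \<inter> {c<..<c + \<delta> / 2}" using c(2,3) \<open>x \<in> E\<close> by simp
    then show "x \<in> (\<Union>c\<in>\<rat>. E \<inter> {c<..<c + \<delta> / 2})" using c(1) by (rule UN_I[rotated])
  qed
  show ?thesis using null_sets_subset[OF n1 _ n2] E(1) by simp
qed

text \<open>Straddling the point strictly makes each inner set a union of open intervals, hence open
  for an arbitrary \<open>P\<close>, and the whole set a countable intersection of open sets. For
  this reason differentiability is studied through slopes over intervals around a point instead of
  difference quotients at it.\<close>

lemma straddle_set_borel: "{x::real. \<forall>n::nat. \<exists>s t. s < x \<and> x < t \<and> P n s t} \<in> sets borel"
proof -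
  have "{x::real. \<forall>n::nat. \<exists>s t. s < x \<and> x < t \<and> P n s t} = (\<Inter>n. \<Union>(s, t)\<in>{(s, t). P n s t}. {s<..<t})"
    by (auto simp: set_eq_iff Bex_def) blast+
  moreover have "open (\<Union>(s, t)\<in>{(s, t). P n s t}. {s<..<t})" for n by auto
  ultimately show ?thesis by (simp add: sets.countable_INT')
qed

text \<open>Letting the endpoint on one side of \<open>x\<close> tend to \<open>x\<close>, with
  continuity of \<open>f\<close>, turns the straddling estimate into an estimate of the difference
  quotient on the other side.\<close>

lemma straddle_imp_has_real_derivative:
  fixes f :: "real \<Rightarrow> real"
  assumes "isCont f x"
    and S: "\<And>e. e > 0 \<Longrightarrow> \<exists>d>0. \<forall>s t. s < x \<longrightarrow> x < t \<longrightarrow> t - s < d \<longrightarrow> \<bar>f t - f s - L * (t - s)\<bar> \<le> e * (t - s)"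
  shows "(f has_real_derivative L) (at x)"
  unfolding has_field_derivative_iff
proof (rule LIM_I)
  fix e :: real assume "e > 0"
  then obtain d where "d > 0" and d: "\<And>s t. s < x \<Longrightarrow> x < t \<Longrightarrow> t - s < d \<Longrightarrow> \<bar>f t - f s - L * (t - s)\<bar> \<le> e / 2 * (t - s)"
    using S[of "e / 2"] by auto
  have right: "\<bar>f t - f x - L * (t - x)\<bar> \<le> e / 2 * (t - x)" if "x < t" "t - x < d" for t
  proof (rule tendsto_le)
    show "((\<lambda>s. \<bar>f t - f s - L * (t - s)\<bar>) \<longlongrightarrow> \<bar>f t - f x - L * (t - x)\<bar>) (at_left x)"
      by (intro tendsto_intros) (use assms(1) in \<open>auto simp: isCont_def intro: filterlim_mono[OF _ order_refl at_le]\<close>)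
    show "((\<lambda>s. e / 2 * (t - s)) \<longlongrightarrow> e / 2 * (t - x)) (at_left x)"
      by (intro tendsto_intros)
    have "t - d < x" using that by simp
    then show "\<forall>\<^sub>F s in at_left x. \<bar>f t - f s - L * (t - s)\<bar> \<le> e / 2 * (t - s)"
      unfolding eventually_at_left[OF \<open>t - d < x\<close>] by (intro exI[of _ "t - d"]) (use that d in auto)
  qed simp
  have left: "\<bar>f x - f s - L * (x - s)\<bar> \<le> e / 2 * (x - s)" if "s < x" "x - s < d" for s
  proof (rule tendsto_le)
    show "((\<lambda>t. \<bar>f t - f s - L * (t - s)\<bar>) \<longlongrightarrow> \<bar>f x - f s - L * (x - s)\<bar>) (at_right x)"
      by (intro tendsto_intros) (use assms(1) in \<open>auto simp: isCont_def intro: filterlim_mono[OF _ order_refl at_le]\<close>)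
    show "((\<lambda>t. e / 2 * (t - s)) \<longlongrightarrow> e / 2 * (x - s)) (at_right x)"
      by (intro tendsto_intros)
    have "x < s + d" using that by simp
    then show "\<forall>\<^sub>F t in at_right x. \<bar>f t - f s - L * (t - s)\<bar> \<le> e / 2 * (t - s)"
      unfolding eventually_at_right[OF \<open>x < s + d\<close>] by (intro exI[of _ "s + d"]) (use that d in auto)
  qed simp
  show "\<exists>d>0. \<forall>y. y \<noteq> x \<and> norm (y - x) < d \<longrightarrow> norm ((f y - f x) / (y - x) - L) < e"
  proof (intro exI[of _ d] conjI allI impI \<open>d > 0\<close>)
    fix y assume y: "y \<noteq> x \<and> norm (y - x) < d"
    have "\<bar>f y - f x - L * (y - x)\<bar> \<le> e / 2 * \<bar>y - x\<bar>"
      using right[of y] left[of y] y by (cases "x < y") (auto simp: abs_minus_commute algebra_simps)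
    moreover have "(f y - f x) / (y - x) - L = (f y - f x - L * (y - x)) / (y - x)"
      using y by (simp add: diff_divide_distrib)
    ultimately have "\<bar>(f y - f x) / (y - x) - L\<bar> \<le> e / 2"
      using y by (simp add: abs_divide divide_le_eq)
    then show "norm ((f y - f x) / (y - x) - L) < e" using \<open>e > 0\<close> by simp
  qed
qed

text \<open>Points of \<open>A\<close> have unbounded slopes over ever shorter intervals around
  them; at points of \<open>B q \<inter> C p\<close> with \<open>p < q\<close>, slopes at least
  \<open>q\<close> and slopes at most \<open>p\<close> both occur on arbitrarily short intervals.
  These sets are null by the two slope lemmas, and countably many rational pairs suffice. Elsewhere
  the slopes converge to the supremum \<open>L\<close> of their eventual lower bounds.\<close>

lemma abs_continuous_on_interval_ae_differentiable:
  fixes f :: "real \<Rightarrow> real"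
  assumes AC: "abs_continuous_on_interval a b f"
  obtains N where "N \<in> null_sets lborel" "\<And>x. x \<in> {a<..<b} - N \<Longrightarrow> \<exists>D. (f has_real_derivative D) (at x)"
proof -
  define near where "near n s t \<longleftrightarrow> a < s \<and> t < b \<and> t - s < 1 / Suc n" for n :: nat and s t
  define A where "A = {x. \<forall>n::nat. \<exists>s t. s < x \<and> x < t \<and> (near n s t \<and> \<bar>f t - f s\<bar> \<ge> real n * (t - s))}"
  define B where "B q = {x. \<forall>n::nat. \<exists>s t. s < x \<and> x < t \<and> (near n s t \<and> f t - f s \<ge> q * (t - s))}" for q
  define C where "C p = {x. \<forall>n::nat. \<exists>s t. s < x \<and> x < t \<and> (near n s t \<and> f t - f s \<le> p * (t - s))}" for p
  define N where "N = A \<union> (\<Union>(p, q)\<in>{(p, q). p \<in> \<rat> \<and> q \<in> \<rat> \<and> p < q}. B q \<inter> C p)"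
  have borel: "A \<in> sets borel" "B q \<in> sets borel" "C p \<in> sets borel" for p q
    unfolding A_def B_def C_def by (rule straddle_set_borel)+
  have sub: "A \<subseteq> {a<..<b}" "B q \<subseteq> {a<..<b}" for q
    by (auto simp: A_def B_def near_def dest: less_trans)
  have Arch: "\<exists>n. 1 / Suc n < d \<and> K \<le> real n" if "d > 0" for d K :: real
  proof -
    obtain n1 where n1: "inverse (real (Suc n1)) < d" using reals_Archimedean[OF \<open>d > 0\<close>] by blast
    obtain n2 :: nat where n2: "K \<le> real n2" using real_arch_simple by blast
    have "1 / Suc (max n1 n2) \<le> inverse (Suc n1)" by (simp add: field_simps)
    then show ?thesis using n1 n2 by (intro exI[of _ "max n1 n2"]) (auto simp: max_def)
  qed
  have "A \<in> null_sets lborel"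
  proof (rule infinite_slope_null_sets[OF AC borel(1) sub(1)])
    fix x d K :: real assume x: "x \<in> A" and "d > 0"
    obtain n where n: "1 / Suc n < d" "K \<le> real n" using Arch[OF \<open>d > 0\<close>] by blast
    obtain s t where st: "s < x" "x < t" "near n s t" "\<bar>f t - f s\<bar> \<ge> real n * (t - s)"
      using x unfolding A_def by blast
    have "K * (t - s) \<le> real n * (t - s)" using n st by (intro mult_right_mono) auto
    then have "K * (t - s) \<le> \<bar>f t - f s\<bar>" using st by linarith
    then show "\<exists>s t. s < t \<and> x \<in> {s..t} \<and> t - s < d \<and> \<bar>f t - f s\<bar> \<ge> K * (t - s)"
      using st n by (intro exI[of _ s] exI[of _ t]) (auto simp: near_def)
  qed
  moreover have BC: "B q \<inter> C p \<in> null_sets lborel" if "p < q" for p q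
  proof -
    have "measure lborel (B q \<inter> C p) = 0"
    proof (rule two_slopes_null_sets[OF AC that])
      fix x d :: real assume x: "x \<in> B q \<inter> C p" and "d > 0"
      obtain n where n: "1 / Suc n < d" using Arch[OF \<open>d > 0\<close>] by blast
      obtain s t where st: "s < x" "x < t" "near n s t" "f t - f s \<le> p * (t - s)"
        using x unfolding C_def by blast
      show "\<exists>s t. s < t \<and> x \<in> {s..t} \<and> t - s < d \<and> f t - f s \<le> p * (t - s)"
        using st n by (intro exI[of _ s] exI[of _ t]) (auto simp: near_def)
      obtain s t where st: "s < x" "x < t" "near n s t" "f t - f s \<ge> q * (t - s)"
        using x unfolding B_def by blast
      show "\<exists>s t. s < t \<and> x \<in> {s..t} \<and> t - s < d \<and> f t - f s \<ge> q * (t - s)"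
        using st n by (intro exI[of _ s] exI[of _ t]) (auto simp: near_def)
    qed (use borel sub(2)[of q] in auto)
    moreover have "emeasure lborel (B q \<inter> C p) < \<infinity>"
      using fmeasurable_lborel_bounded[where A="B q \<inter> C p" and a=a and b=b] borel sub(2)[of q] by (auto simp: fmeasurable_def)
    ultimately show ?thesis
      using borel by (auto simp: null_sets_def measure_def enn2real_eq_0_iff)
  qed
  moreover have "countable {(p, q). p \<in> \<rat> \<and> q \<in> \<rat> \<and> p < (q::real)}"
    by (rule countable_subset[OF _ countable_SIGMA[OF countable_rat, of "\<lambda>_. \<rat>"]]) (auto simp: countable_rat)
  ultimately have N: "N \<in> null_sets lborel"
    unfolding N_def by (intro null_sets.Un null_sets_UN') auto
  show thesis
  proof (rule that[OF N])
    fix x assume x: "x \<in> {a<..<b} - N"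
    have "\<exists>d>0. \<forall>s t. a < s \<longrightarrow> t < b \<longrightarrow> s < x \<longrightarrow> x < t \<longrightarrow> t - s < d \<longrightarrow> Q s t"
      if "\<not> (\<exists>s t. s < x \<and> x < t \<and> near n s t \<and> \<not> Q s t)" for Q :: "real \<Rightarrow> real \<Rightarrow> bool" and n
      using that by (intro exI[of _ "1 / Suc n"]) (auto simp: near_def)
    note ev = this
    define \<epsilon> where "\<epsilon> = min (x - a) (b - x)"
    have "\<epsilon> > 0" using x by (auto simp: \<epsilon>_def)
    have ev': "\<exists>d>0. \<forall>s t. s < x \<longrightarrow> x < t \<longrightarrow> t - s < d \<longrightarrow> Q s t"
      if nQ: "\<not> (\<exists>s t. s < x \<and> x < t \<and> near n s t \<and> \<not> Q s t)" for Q :: "real \<Rightarrow> real \<Rightarrow> bool" and n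
    proof -
      obtain d where "d > 0" "\<forall>s t. a < s \<longrightarrow> t < b \<longrightarrow> s < x \<longrightarrow> x < t \<longrightarrow> t - s < d \<longrightarrow> Q s t"
        using ev[OF nQ] by blast
      then show ?thesis using \<open>\<epsilon> > 0\<close>
        by (intro exI[of _ "min d \<epsilon>"]) (auto simp: \<epsilon>_def)
    qed
    have "x \<notin> A" using x by (auto simp: N_def)
    then obtain n where "\<not> (\<exists>s t. s < x \<and> x < t \<and> (near n s t \<and> \<bar>f t - f s\<bar> \<ge> real n * (t - s)))"
      unfolding A_def by blast
    then have "\<not> (\<exists>s t. s < x \<and> x < t \<and> near n s t \<and> \<not> \<bar>f t - f s\<bar> < real n * (t - s))"
      by (meson not_less)
    from ev'[OF this] obtain d0 where d0: "d0 > 0"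
      "\<And>s t. s < x \<Longrightarrow> x < t \<Longrightarrow> t - s < d0 \<Longrightarrow> \<bar>f t - f s\<bar> < real n * (t - s)" by blast
    define P where "P p \<longleftrightarrow> (\<exists>d>0. \<forall>s t. s < x \<longrightarrow> x < t \<longrightarrow> t - s < d \<longrightarrow> f t - f s \<ge> p * (t - s))" for p
    define Q where "Q q \<longleftrightarrow> (\<exists>d>0. \<forall>s t. s < x \<longrightarrow> x < t \<longrightarrow> t - s < d \<longrightarrow> f t - f s \<le> q * (t - s))" for q
    have PQ: "P p \<or> Q q" if "p \<in> \<rat>" "q \<in> \<rat>" "p < q" for p q
    proof -
      have "x \<notin> B q \<or> x \<notin> C p" using x that by (auto simp: N_def)
      then show ?thesis
      proof
        assume "x \<notin> B q"
        then obtain n where "\<not> (\<exists>s t. s < x \<and> x < t \<and> near n s t \<and> f t - f s \<ge> q * (t - s))"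
          unfolding B_def by blast
        then have "\<not> (\<exists>s t. s < x \<and> x < t \<and> near n s t \<and> \<not> f t - f s \<le> q * (t - s))"
          by (meson linear)
        from ev'[OF this] show ?thesis unfolding Q_def by blast
      next
        assume "x \<notin> C p"
        then obtain n where "\<not> (\<exists>s t. s < x \<and> x < t \<and> near n s t \<and> f t - f s \<le> p * (t - s))"
          unfolding C_def by blast
        then have "\<not> (\<exists>s t. s < x \<and> x < t \<and> near n s t \<and> \<not> f t - f s \<ge> p * (t - s))"
          by (meson linear)
        from ev'[OF this] show ?thesis unfolding P_def by blast
      qed
    qed
    have Pn: "P (- real n)" unfolding P_def
      using d0 by (intro exI[of _ d0]) (auto, smt (verit) mult_minus_left)
    have Pbd: "p \<le> real n" if "P p" for p
    proof -
      obtain d where d: "d > 0" "\<And>s t. s < x \<Longrightarrow> x < t \<Longrightarrow> t - s < d \<Longrightarrow> f t - f s \<ge> p * (t - s)"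
        using \<open>P p\<close> unfolding P_def by blast
      define r where "r = min d d0 / 4"
      have r: "r > 0" "4 * r \<le> d" "4 * r \<le> d0" using d(1) d0(1) by (auto simp: r_def)
      have "p * (2 * r) \<le> f (x + r) - f (x - r)" "f (x + r) - f (x - r) \<le> real n * (2 * r)"
        using d(2)[of "x - r" "x + r"] d0(2)[of "x - r" "x + r"] r by (auto simp: algebra_simps)
      then have "p * (2 * r) \<le> real n * (2 * r)" by linarith
      then show ?thesis using r(1) by simp
    qed
    define L where "L = Sup (Collect P)"
    have bdd: "bdd_above (Collect P)" using Pbd by (intro bdd_aboveI[of _ "real n"]) auto
    have "(f has_real_derivative L) (at x)"
    proof (rule straddle_imp_has_real_derivative)
      show "isCont f x"
        using abs_continuous_on_interval_imp_continuous_on[OF AC] x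
        by (intro continuous_on_interior[of "{a..b}"]) auto
      fix e :: real assume "e > 0"
      obtain p where p: "P p" "L - e < p"
        using less_cSup_iff[of "Collect P" "L - e"] Pn bdd \<open>e > 0\<close> by (auto simp: L_def)
      have "L < L + e / 2" "L + e / 2 < L + e" using \<open>e > 0\<close> by auto
      from Rats_dense_in_real[OF this(1)] Rats_dense_in_real[OF this(2)]
      obtain p' q' where p': "p' \<in> \<rat>" "L < p'" "p' < L + e / 2" and q': "q' \<in> \<rat>" "L + e / 2 < q'" "q' < L + e"
        by blast
      \<comment> \<open>Two rationals \<open>p' < q'\<close> lie between \<open>L\<close> and
        \<open>L + e\<close>. As \<open>L\<close> is the supremum, \<open>p'\<close> is no eventual
        lower bound, so \<open>q'\<close> must be an eventual upper bound.\<close>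
      have "\<not> P p'" using cSup_upper[of p' "Collect P"] bdd p' by (auto simp: L_def)
      then have "Q q'" using PQ[of p' q'] p' q' by auto
      obtain d1 where d1: "d1 > 0" "\<And>s t. s < x \<Longrightarrow> x < t \<Longrightarrow> t - s < d1 \<Longrightarrow> f t - f s \<ge> p * (t - s)"
        using p(1) unfolding P_def by blast
      obtain d2 where d2: "d2 > 0" "\<And>s t. s < x \<Longrightarrow> x < t \<Longrightarrow> t - s < d2 \<Longrightarrow> f t - f s \<le> q' * (t - s)"
        using \<open>Q q'\<close> unfolding Q_def by blast
      show "\<exists>d>0. \<forall>s t. s < x \<longrightarrow> x < t \<longrightarrow> t - s < d \<longrightarrow> \<bar>f t - f s - L * (t - s)\<bar> \<le> e * (t - s)"
      proof (intro exI[of _ "min d1 d2"] conjI allI impI)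
        fix s t assume st: "s < x" "x < t" "t - s < min d1 d2"
        have "(L - e) * (t - s) \<le> p * (t - s)" "q' * (t - s) \<le> (L + e) * (t - s)"
          using st p q' by (auto intro!: mult_right_mono)
        then show "\<bar>f t - f s - L * (t - s)\<bar> \<le> e * (t - s)"
          using d1(2)[of s t] d2(2)[of s t] st unfolding left_diff_distrib distrib_right by auto
      qed (use d1 d2 in auto)
    qed
    then show "\<exists>D. (f has_real_derivative D) (at x)" by blast
  qed
qed

section \<open>The fundamental theorem of calculus\<close>

text \<open>The gauge keeps intervals tagged in \<open>N\<close> inside an open set of small measure, where absolute
  continuity bounds the increments of \<open>f\<close>.\<close>

lemma abs_continuous_on_interval_FTC:
  fixes f :: "real \<Rightarrow> real"
  assumes AC: "abs_continuous_on_interval a b f" and "a \<le> b" and N: "N \<in> null_sets lborel"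
    and der: "\<And>x. x \<in> {a..b} - N \<Longrightarrow> (f has_real_derivative g x) (at x)"
    and zero: "\<And>x. x \<in> N \<Longrightarrow> g x = 0"
  shows "(g has_integral (f b - f a)) {a..b}"
proof (cases "a = b")
  case True
  then show ?thesis using has_integral_refl(2)[of g b] by simp
next
  case False
  then have "a < b" using \<open>a \<le> b\<close> by simp
  show ?thesis
    unfolding has_integral_factor_content_real
  proof (intro allI impI)
    fix e :: real assume "e > 0"
    \<comment> \<open>Half of the error is for tags outside \<open>N\<close>, where the derivative
      controls the increment of \<open>f\<close>, and half for tags in \<open>N\<close>, where
      \<open>g\<close> vanishes.\<close>
    define e1 where "e1 = e / 2"
    define e2 where "e2 = e / 2 * (b - a)"
    have "e1 > 0" "e2 > 0" using \<open>e > 0\<close> \<open>a < b\<close> by (auto simp: e1_def e2_def)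
    obtain \<delta> where "\<delta> > 0" and \<delta>: "\<And>(I :: (real \<times> real set) set) s t.
      finite I \<Longrightarrow> (\<forall>i\<in>I. a \<le> s i \<and> s i \<le> t i \<and> t i \<le> b) \<Longrightarrow>
      pairwise (\<lambda>i j. {s i<..<t i} \<inter> {s j<..<t j} = {}) I \<Longrightarrow> (\<Sum>i\<in>I. t i - s i) < \<delta> \<Longrightarrow>
      (\<Sum>i\<in>I. norm (f (t i) - f (s i))) < e2"
      using abs_continuous_on_interval_finite[OF AC \<open>e2 > 0\<close>, where 'i="real \<times> real set"] by blast
    obtain U where U: "open U" "N \<subseteq> U" "emeasure lborel (U - N) < \<delta>"
      using outer_regular_lborel[of N \<delta>] N \<open>\<delta> > 0\<close> by (auto simp: null_sets_def)
    have U\<delta>: "emeasure lborel U < \<delta>"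
    proof -
      have "emeasure lborel (U - N) = emeasure lborel U"
        using N U(1) by (intro emeasure_Diff_null_set) auto
      then show ?thesis using U(3) by simp
    qed
    have "\<forall>x. \<exists>d>0. x \<in> {a..b} - N \<longrightarrow>
         (\<forall>y. norm (y - x) < d \<longrightarrow> norm (f y - f x - (y - x) *\<^sub>R g x) \<le> e1 * norm (y - x))"
      using der[unfolded has_real_derivative_iff_has_vector_derivative has_vector_derivative_def has_derivative_at_alt] \<open>e1 > 0\<close>
      by (metis zero_less_one)
    then obtain d where d: "\<And>x. 0 < d x"
      "\<And>x y. x \<in> {a..b} - N \<Longrightarrow> norm (y - x) < d x \<Longrightarrow> norm (f y - f x - (y - x) *\<^sub>R g x) \<le> e1 * norm (y - x)"
      by metis
    have "\<forall>x\<in>N. \<exists>r>0. ball x r \<subseteq> U" using U open_contains_ball by blast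
    then obtain r where r: "\<And>x. x \<in> N \<Longrightarrow> r x > 0" "\<And>x. x \<in> N \<Longrightarrow> ball x (r x) \<subseteq> U" by metis
    define \<gamma> where "\<gamma> x = ball x (if x \<in> N then r x else d x)" for x
    show "\<exists>d. gauge d \<and> (\<forall>p. p tagged_division_of {a..b} \<and> d fine p \<longrightarrow>
      norm ((\<Sum>(x, k)\<in>p. measure lborel k *\<^sub>R g x) - (f b - f a)) \<le> e * measure lborel {a..b})"
    proof (intro exI[of _ \<gamma>] conjI allI impI)
      show "gauge \<gamma>" unfolding \<gamma>_def using r d by (auto simp: gauge_def)
      fix p assume "p tagged_division_of {a..b} \<and> \<gamma> fine p"
      then have p: "p tagged_division_of {a..b}" and fine: "\<gamma> fine p" by auto
      note pD = tagged_division_ofD[OF p]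
      have K: "\<exists>u v. K = {u..v} \<and> u \<le> v \<and> a \<le> u \<and> v \<le> b \<and> u \<le> x \<and> x \<le> v \<and> {u..v} \<subseteq> \<gamma> x" if xK: "(x, K) \<in> p" for x K
      proof -
        obtain u v where "K = cbox u v" using pD(4)[OF xK] by blast
        then have "K = {u..v}" by simp
        moreover have "x \<in> K" "K \<subseteq> {a..b}" using pD(2,3)[OF xK] by auto
        moreover have "K \<subseteq> \<gamma> x" using fine xK by (auto simp: fine_def)
        ultimately show ?thesis by (intro exI[of _ u] exI[of _ v]) auto
      qed
      define p1 where "p1 = {z\<in>p. fst z \<notin> N}"
      define p2 where "p2 = {z\<in>p. fst z \<in> N}"
      have pp: "finite p1" "finite p2" "p = p1 \<union> p2" "p1 \<inter> p2 = {}" using pD(1) by (auto simp: p1_def p2_def)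
      have len: "(\<Sum>(x, K)\<in>p. Sup K - Inf K) = b - a" "(\<Sum>(x, K)\<in>p. f (Sup K) - f (Inf K)) = f b - f a"
        using additive_tagged_division_1[OF \<open>a \<le> b\<close> p, of "\<lambda>x. x"] additive_tagged_division_1[OF \<open>a \<le> b\<close> p, of f] by auto
      have split: "(\<Sum>z\<in>p. \<phi> z) = (\<Sum>z\<in>p1. \<phi> z) + (\<Sum>z\<in>p2. \<phi> z)" for \<phi> :: "real \<times> real set \<Rightarrow> real"
        using pp sum.union_disjoint[of p1 p2 \<phi>] by simp
      have 1: "\<bar>\<Sum>(x, K)\<in>p1. measure lborel K *\<^sub>R g x - (f (Sup K) - f (Inf K))\<bar> \<le> e1 * (b - a)"
      proof -
        have "\<bar>\<Sum>(x, K)\<in>p1. measure lborel K *\<^sub>R g x - (f (Sup K) - f (Inf K))\<bar>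
          \<le> (\<Sum>(x, K)\<in>p1. \<bar>measure lborel K *\<^sub>R g x - (f (Sup K) - f (Inf K))\<bar>)"
          by (rule order_trans[OF sum_abs]) (simp add: split_beta)
        also have "\<dots> \<le> (\<Sum>(x, K)\<in>p1. e1 * (Sup K - Inf K))"
        proof (rule sum_mono, clarify)
          fix x K assume z: "(x, K) \<in> p1"
          then have "(x, K) \<in> p" "x \<notin> N" by (auto simp: p1_def)
          then obtain u v where uv: "K = {u..v}" "u \<le> v" "a \<le> u" "v \<le> b" "u \<le> x" "x \<le> v" "{u..v} \<subseteq> ball x (d x)"
            using K[of x K] by (auto simp: \<gamma>_def)
          have xab: "x \<in> {a..b} - N" using uv \<open>x \<notin> N\<close> by auto
          have "u \<in> ball x (d x)" "v \<in> ball x (d x)"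
            using subsetD[OF uv(7), of u] subsetD[OF uv(7), of v] uv(2) by auto
          then have "norm (u - x) < d x" "norm (v - x) < d x" by (auto simp: dist_norm norm_minus_commute)
          then have "\<bar>f u - f x - (u - x) * g x\<bar> \<le> e1 * (x - u)" "\<bar>f v - f x - (v - x) * g x\<bar> \<le> e1 * (v - x)"
            using d(2)[OF xab, of u] d(2)[OF xab, of v] uv by auto
          moreover have "measure lborel K *\<^sub>R g x - (f (Sup K) - f (Inf K)) = (f u - f x - (u - x) * g x) - (f v - f x - (v - x) * g x)"
            using uv by (simp add: algebra_simps)
          moreover have "e1 * (Sup K - Inf K) = e1 * (x - u) + e1 * (v - x)"
            using uv by (simp add: algebra_simps)
          ultimately show "\<bar>measure lborel K *\<^sub>R g x - (f (Sup K) - f (Inf K))\<bar> \<le> e1 * (Sup K - Inf K)"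
            by linarith
        qed
        also have "\<dots> \<le> (\<Sum>(x, K)\<in>p. e1 * (Sup K - Inf K))"
        proof (rule sum_mono2)
          fix z assume "z \<in> p - p1"
          then obtain u v where "snd z = {u..v}" "u \<le> v" using K[of "fst z" "snd z"] by auto
          then show "0 \<le> (case z of (x, K) \<Rightarrow> e1 * (Sup K - Inf K))" using \<open>e1 > 0\<close> by (simp add: split_beta)
        qed (use pD(1) pp in auto)
        also have "\<dots> = e1 * (b - a)"
          using len(1) by (simp add: split_beta sum_distrib_left[symmetric])
        finally show ?thesis .
      qed
      have 2: "\<bar>\<Sum>(x, K)\<in>p2. measure lborel K *\<^sub>R g x - (f (Sup K) - f (Inf K))\<bar> \<le> e2"
      proof -
        have "(\<Sum>(x, K)\<in>p2. measure lborel K *\<^sub>R g x - (f (Sup K) - f (Inf K))) = (\<Sum>z\<in>p2. - (f (Sup (snd z)) - f (Inf (snd z))))"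
          by (intro sum.cong) (auto simp: p2_def zero)
        then have "\<bar>\<Sum>(x, K)\<in>p2. measure lborel K *\<^sub>R g x - (f (Sup K) - f (Inf K))\<bar> \<le> (\<Sum>z\<in>p2. norm (f (Sup (snd z)) - f (Inf (snd z))))"
          using sum_abs[of "\<lambda>z. - (f (Sup (snd z)) - f (Inf (snd z)))" p2] by (simp add: abs_minus_commute)
        also have "\<dots> < e2"
        proof (rule \<delta>)
          have p2K: "\<exists>u v. snd z = {u..v} \<and> u \<le> v \<and> a \<le> u \<and> v \<le> b \<and> {u..v} \<subseteq> U" if "z \<in> p2" for z
            using K[of "fst z" "snd z"] that r(2)[of "fst z"] unfolding p2_def \<gamma>_def by fastforce
          show "finite p2" by (rule pp)
          show "\<forall>z\<in>p2. a \<le> Inf (snd z) \<and> Inf (snd z) \<le> Sup (snd z) \<and> Sup (snd z) \<le> b"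
            using p2K by fastforce
          have int: "interior (snd z) = {Inf (snd z)<..<Sup (snd z)}" if "z \<in> p2" for z
            using p2K[OF that] by auto
          show pw: "pairwise (\<lambda>z z'. {Inf (snd z)<..<Sup (snd z)} \<inter> {Inf (snd z')<..<Sup (snd z')} = {}) p2"
          proof (rule pairwiseI)
            fix z z' assume z: "z \<in> p2" "z' \<in> p2" "z \<noteq> z'"
            then have "interior (snd z) \<inter> interior (snd z') = {}"
              using pD(5)[of "fst z" "snd z" "fst z'" "snd z'"] by (auto simp: p2_def)
            then show "{Inf (snd z)<..<Sup (snd z)} \<inter> {Inf (snd z')<..<Sup (snd z')} = {}"
              using int z by auto
          qed
          have "(\<Sum>z\<in>p2. Sup (snd z) - Inf (snd z)) = (\<Sum>z\<in>p2. measure lborel {Inf (snd z)<..<Sup (snd z)})"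
            using p2K by (intro sum.cong) (auto, fastforce)
          also have "\<dots> = measure lborel (\<Union>z\<in>p2. {Inf (snd z)<..<Sup (snd z)})"
            using pw pp by (intro measure_UNION'[symmetric])
              (auto simp: disjnt_def intro!: fmeasurable_lborel_bounded[OF _ order_refl])
          also have "\<dots> < \<delta>"
          proof -
            have "(\<Union>z\<in>p2. {Inf (snd z)<..<Sup (snd z)}) \<subseteq> U"
            proof (rule UN_least)
              fix z assume "z \<in> p2"
              then obtain u v where "snd z = {u..v}" "u \<le> v" "{u..v} \<subseteq> U" using p2K by blast
              then show "{Inf (snd z)<..<Sup (snd z)} \<subseteq> U" by (auto simp: subset_iff)
            qed
            then have "emeasure lborel (\<Union>z\<in>p2. {Inf (snd z)<..<Sup (snd z)}) \<le> emeasure lborel U"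
              using U(1) by (intro emeasure_mono) auto
            then have lt: "emeasure lborel (\<Union>z\<in>p2. {Inf (snd z)<..<Sup (snd z)}) < ennreal \<delta>" using U\<delta> by (rule le_less_trans)
            then have "emeasure lborel (\<Union>z\<in>p2. {Inf (snd z)<..<Sup (snd z)}) = ennreal (measure lborel (\<Union>z\<in>p2. {Inf (snd z)<..<Sup (snd z)}))"
              by (intro emeasure_eq_ennreal_measure) (auto simp: less_top[symmetric] dest: order_less_le_trans)
            then show ?thesis using lt \<open>\<delta> > 0\<close> by (simp add: ennreal_less_iff)
          qed
          finally show "(\<Sum>z\<in>p2. Sup (snd z) - Inf (snd z)) < \<delta>" .
        qed
        finally show ?thesis by simp
      qed
      have "(\<Sum>(x, k)\<in>p. measure lborel k *\<^sub>R g x) - (f b - f a) = (\<Sum>(x, K)\<in>p. measure lborel K *\<^sub>R g x - (f (Sup K) - f (Inf K)))"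
        unfolding len(2)[symmetric] by (simp add: split_beta sum_subtractf)
      also have "\<bar>\<dots>\<bar> \<le> e1 * (b - a) + e2"
        unfolding split using 1 2 by linarith
      also have "\<dots> = e * measure lborel {a..b}" using \<open>a < b\<close> by (simp add: e1_def e2_def field_simps)
      finally show "norm ((\<Sum>(x, k)\<in>p. measure lborel k *\<^sub>R g x) - (f b - f a)) \<le> e * measure lborel {a..b}"
        by simp
    qed
  qed
qed

text \<open>The derivative is replaced by a Borel representative, since \<^const>\<open>deriv\<close> is arbitrary on the exceptional set.\<close>

lemma abs_continuous_on_interval_borel_derivative:
  fixes f :: "real \<Rightarrow> real"
  assumes AC: "abs_continuous_on_interval a b f" and "a \<le> b"
  shows "\<exists>g. g \<in> borel_measurable borel \<and>
    (AE t in lborel. t \<in> {a..b} \<longrightarrow> (f has_real_derivative g t) (at t)) \<and>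
    (\<forall>s t. a \<le> s \<longrightarrow> s \<le> t \<longrightarrow> t \<le> b \<longrightarrow> (g has_integral (f t - f s)) {s..t})"
proof -
  obtain N0 where N0: "N0 \<in> null_sets lborel" "\<And>x. x \<in> {a<..<b} - N0 \<Longrightarrow> \<exists>D. (f has_real_derivative D) (at x)"
    by (rule abs_continuous_on_interval_ae_differentiable[OF AC]) blast
  \<comment> \<open>The endpoints join \<open>N\<close> because \<open>f\<close> is not known to
    have a two-sided derivative there.\<close>
  define N where "N = N0 \<union> {a, b}"
  have N: "N \<in> null_sets lborel" unfolding N_def using N0(1) by (intro null_sets.Un finite_imp_null_set_lborel[of "{a, b}"]) auto
  define g0 where "g0 t = (if t \<in> {a..b} - N then deriv f t else 0)" for t
  have der: "(f has_real_derivative g0 x) (at x)" if x: "x \<in> {a..b} - N" for x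
  proof -
    have "x \<in> {a<..<b} - N0" using x by (auto simp: N_def)
    then obtain D where "(f has_real_derivative D) (at x)" using N0(2) by blast
    then show ?thesis using x by (simp add: g0_def DERIV_imp_deriv)
  qed
  have int0: "(g0 has_integral (f t - f s)) {s..t}" if st: "a \<le> s" "s \<le> t" "t \<le> b" for s t
  proof (rule abs_continuous_on_interval_FTC[OF _ st(2) N])
    show "abs_continuous_on_interval s t f" using abs_continuous_on_interval_subinterval[OF AC st(1,3)] .
  qed (use der st in \<open>auto simp: g0_def\<close>)
  have "(\<lambda>t. if t \<in> {a..b} then g0 t else 0) integrable_on UNIV"
    using int0[of a b] \<open>a \<le> b\<close> by (subst integrable_restrict_UNIV) (auto simp: integrable_on_def)
  moreover have "(\<lambda>t. if t \<in> {a..b} then g0 t else 0) = g0" by (auto simp: g0_def)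
  ultimately have "g0 integrable_on UNIV" by simp
  \<comment> \<open>Gauge integrability of \<open>g0\<close> yields its Lebesgue measurability, from
    which the Borel representative is obtained.\<close>
  then have "g0 \<in> borel_measurable (lebesgue_on UNIV)" by (rule integrable_imp_measurable)
  then have "g0 \<in> borel_measurable (completion lborel)" by simp
  then obtain g where g: "g \<in> borel_measurable lborel" "AE x in lborel. g0 x = g x"
    using completion_ex_borel_measurable_real by blast
  show ?thesis
  proof (intro exI[of _ g] conjI allI impI)
    show "g \<in> borel_measurable borel" using g(1) by simp
    have "AE x in lborel. x \<notin> N" using N by (rule AE_not_in)
    then show "AE t in lborel. t \<in> {a..b} \<longrightarrow> (f has_real_derivative g t) (at t)"
      using g(2) by eventually_elim (use der in force)
    obtain N' where N': "{x \<in> space lborel. \<not> g0 x = g x} \<subseteq> N'" "emeasure lborel N' = 0" "N' \<in> sets lborel"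
      using AE_E[OF g(2)] by auto
    have "negligible N'" using N' by (auto simp: negligible_iff_null_sets null_sets_completionI null_sets_def)
    moreover have "g x = g0 x" if "x \<notin> N'" for x
      by (rule ccontr) (use that subsetD[OF N'(1), of x] in auto)
    ultimately show "(g has_integral (f t - f s)) {s..t}" if "a \<le> s" "s \<le> t" "t \<le> b" for s t
      by (rule has_integral_spike[OF _ _ int0[OF that]]) auto
  qed
qed

section \<open>Integrals of bounded functions on intervals\<close>

text \<open>The half-lines \<open>{..a}\<close> form an intersection-stable generator of the Borel
  sets. The sets over which \<open>f\<close> integrates to 0 are closed under complements, by
  \<open>f0\<close>, and under countable disjoint unions, so they are all Borel sets; a density is
  determined by its integrals.\<close>

lemma AE_eq_zero_of_atMost_integrals:
  fixes f :: "real \<Rightarrow> real"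
  assumes f: "integrable lborel f" and f0: "integral\<^sup>L lborel f = 0"
    and atMost: "\<And>a. (LINT x:{..a}|lborel. f x) = 0"
  shows "AE x in lborel. f x = 0"
proof (rule density_unique_real[OF f])
  show "integrable lborel (\<lambda>x. 0 :: real)" by simp
  have int: "set_integrable lborel A f" if "A \<in> sets borel" for A
    using f that unfolding set_integrable_def by (intro integrable_mult_indicator) auto
  fix A :: "real set" assume "A \<in> sets lborel"
  then have A: "A \<in> sigma_sets UNIV (range (\<lambda>a. {..a}))" by (simp add: borel_eq_atMost)
  have st: "Int_stable (range (\<lambda>a::real. {..a}))" by (auto simp: Int_stable_def)
  have sub: "range atMost \<subseteq> Pow (UNIV :: real set)" by simp
  have "(LINT x:A|lborel. f x) = 0"
    using st sub A
  proof (induction rule: sigma_sets_induct_disjoint)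
    fix A :: "real set" assume "A \<in> range atMost"
    then show "(LINT x:A|lborel. f x) = 0" using atMost by auto
  next
    fix A :: "real set" assume A: "A \<in> sigma_sets UNIV (range atMost)" "(LINT x:A|lborel. f x) = 0"
    then have "A \<in> sets borel" by (simp add: borel_eq_atMost)
    moreover from this have "- A \<in> sets borel" by (simp add: Compl_in_sets_lebesgue borel_comp)
    ultimately have "(LINT x:A \<union> (- A)|lborel. f x) = (LINT x:A|lborel. f x) + (LINT x:- A|lborel. f x)"
      using int by (intro set_integral_Un) auto
    then show "(LINT x:UNIV - A|lborel. f x) = 0"
      using A f0 by (simp add: set_lebesgue_integral_def Compl_eq_Diff_UNIV)
  next
    fix A :: "nat \<Rightarrow> real set" assume A: "disjoint_family A" "range A \<subseteq> sigma_sets UNIV (range atMost)"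
      "\<And>i. (LINT x:A i|lborel. f x) = 0"
    then have Ab: "A i \<in> sets borel" for i by (auto simp: borel_eq_atMost)
    have "(LINT x:(\<Union>i. A i)|lborel. f x) = (\<Sum>i. LINT x:A i|lborel. f x)"
      using A(1) Ab int by (intro lebesgue_integral_countable_add) (auto simp: disjoint_family_on_def)
    then show "(LINT x:(\<Union>i. A i)|lborel. f x) = 0" using A(3) by simp
  qed (auto simp: set_lebesgue_integral_def)
  then show "(LINT x:A|lborel. f x) = (LINT x:A|lborel. 0)" by (simp add: set_lebesgue_integral_def)
qed

section \<open>Vector-valued integrals and derivatives\<close>

lemma set_integral_vec_nth:
  fixes f :: "'a \<Rightarrow> real ^ 'd"
  assumes "set_integrable M S f"
  shows "set_integrable M S (\<lambda>x. f x $ i)" "(LINT x:S|M. f x) $ i = (LINT x:S|M. f x $ i)"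
proof -
  have bl: "bounded_linear (\<lambda>x :: real ^ 'd. x $ i)" by (rule bounded_linear_vec_nth)
  show "set_integrable M S (\<lambda>x. f x $ i)"
    using integrable_bounded_linear[OF bl assms[unfolded set_integrable_def]] by (simp add: set_integrable_def)
  show "(LINT x:S|M. f x) $ i = (LINT x:S|M. f x $ i)"
    using integral_bounded_linear[OF bl assms[unfolded set_integrable_def]] by (simp add: set_lebesgue_integral_def)
qed

lemma borel_measurable_vec_lambda:
  fixes f :: "'d :: finite \<Rightarrow> 'a \<Rightarrow> real"
  assumes "\<And>i. f i \<in> borel_measurable M"
  shows "(\<lambda>x. \<chi> i. f i x) \<in> borel_measurable M"
  unfolding borel_measurable_euclidean_space[of "\<lambda>x. \<chi> i. f i x"]
  using assms by (auto simp: Basis_vec_def inner_axis)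

lemma borel_measurable_vec_nth[measurable]:
  fixes f :: "'a \<Rightarrow> real ^ 'd"
  assumes "f \<in> borel_measurable M"
  shows "(\<lambda>x. f x $ i) \<in> borel_measurable M"
  by (rule measurable_compose[OF assms borel_measurable_continuous_onI]) (intro continuous_intros)

lemma has_vector_derivative_vec_iff:
  fixes f :: "real \<Rightarrow> real ^ 'd"
  shows "(f has_vector_derivative D) (at t) \<longleftrightarrow> (\<forall>i. ((\<lambda>t. f t $ i) has_real_derivative D $ i) (at t))"
proof -
  have "(f has_vector_derivative D) (at t) \<longleftrightarrow>
    (\<forall>i\<in>Basis. ((\<lambda>x. f x \<bullet> i) has_derivative (\<lambda>x. (x *\<^sub>R D) \<bullet> i)) (at t))"
    unfolding has_vector_derivative_def by (rule has_derivative_componentwise_within)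
  also have "\<dots> \<longleftrightarrow> (\<forall>i. ((\<lambda>x. f x $ i) has_derivative (\<lambda>x. x * D $ i)) (at t))"
    by (auto simp: Basis_vec_def inner_axis)
  finally show ?thesis
    by (simp add: has_field_derivative_def mult_commute_abs)
qed

lemma lipschitz_has_real_derivative_bound:
  fixes f :: "real \<Rightarrow> real"
  assumes L: "\<And>s t. a \<le> s \<Longrightarrow> s \<le> t \<Longrightarrow> t \<le> b \<Longrightarrow> \<bar>f t - f s\<bar> \<le> B * (t - s)"
    and D: "(f has_real_derivative D) (at x)" and x: "x \<in> {a<..<b}"
  shows "\<bar>D\<bar> \<le> B"
proof (rule tendsto_upperbound)
  show "((\<lambda>y. \<bar>(f y - f x) / (y - x)\<bar>) \<longlongrightarrow> \<bar>D\<bar>) (at x)"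
    using D unfolding has_field_derivative_iff by (rule tendsto_rabs)
  have "\<forall>\<^sub>F y in at x. y \<in> {a<..<b}"
    using x by (intro eventually_at_in_open') auto
  moreover have "\<forall>\<^sub>F y in at x. y \<noteq> x" by (rule eventually_neq_at_within)
  ultimately show "\<forall>\<^sub>F y in at x. \<bar>(f y - f x) / (y - x)\<bar> \<le> B"
  proof eventually_elim
    case (elim y)
    have "\<bar>f y - f x\<bar> \<le> B * \<bar>y - x\<bar>"
        using L[of x y] L[of y x] elim x by (cases "x < y") (auto simp: abs_minus_commute)
    then show "\<bar>(f y - f x) / (y - x)\<bar> \<le> B" using elim by (simp add: abs_divide divide_le_eq)
  qed
qed simp

lemma AE_lborel_Icc_imp_Ioo:
  assumes "AE t in lborel. t \<in> {0<..<1::real} \<longrightarrow> P t"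
  shows "AE t in lborel. t \<in> {0..1} \<longrightarrow> P t"
proof -
  have "AE t in lborel. t \<noteq> 0 \<and> t \<noteq> (1::real)" using AE_lborel_singleton[of 0] AE_lborel_singleton[of "1::real"] by auto
  with assms show ?thesis by eventually_elim auto
qed

lemma set_integrable_bounded_Icc:
  fixes g :: "real \<Rightarrow> 'b :: {banach, second_countable_topology}"
  assumes "g \<in> borel_measurable borel" "AE t in lborel. t \<in> {a..b} \<longrightarrow> norm (g t) \<le> B"
  shows "set_integrable lborel {a..b} g"
  unfolding set_integrable_def
  by (rule integrableI_bounded_set[where A="{a..b}" and B=B])
    (use assms in \<open>auto simp: emeasure_lborel_Icc_eq indicator_def\<close>)

text \<open>The Lipschitz bound passes to the derivative and makes it Lebesgue integrable, so that
  the gauge integrals of the coordinates given by the fundamental theorem combine to a Lebesgue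
  integral of vectors.\<close>

lemma lipschitz_vector_derivative:
  fixes z :: "real \<Rightarrow> real ^ 'd"
  assumes L: "\<And>s t. 0 \<le> s \<Longrightarrow> s \<le> t \<Longrightarrow> t \<le> 1 \<Longrightarrow> norm (z t - z s) \<le> B * (t - s)"
  shows "\<exists>g. g \<in> borel_measurable borel \<and> set_integrable lborel {0..1} g \<and>
    (AE t in lborel. t \<in> {0..1} \<longrightarrow> (z has_vector_derivative g t) (at t)) \<and>
    (\<forall>s t. 0 \<le> s \<longrightarrow> s \<le> t \<longrightarrow> t \<le> 1 \<longrightarrow> z t - z s = (LINT r:{s..t}|lborel. g r))"
proof -
  have Li: "\<bar>z t $ i - z s $ i\<bar> \<le> B * (t - s)" if "0 \<le> s" "s \<le> t" "t \<le> 1" for s t i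
    using L[OF that] component_le_norm_cart[of "z t - z s" i] by simp
  have AC: "abs_continuous_on_interval 0 1 (\<lambda>t. z t $ i)" for i
    by (rule lipschitz_imp_abs_continuous_on_interval[where B=B]) (use Li in auto)
  define Q where "Q i g \<longleftrightarrow> g \<in> borel_measurable borel \<and>
    (AE t in lborel. t \<in> {0..1} \<longrightarrow> ((\<lambda>t. z t $ i) has_real_derivative g t) (at t)) \<and>
    (\<forall>s t. 0 \<le> s \<longrightarrow> s \<le> t \<longrightarrow> t \<le> 1 \<longrightarrow> (g has_integral (z t $ i - z s $ i)) {s..t})" for i g
  have "\<forall>i. \<exists>g. Q i g"
    unfolding Q_def by (intro allI abs_continuous_on_interval_borel_derivative[OF AC]) simp
  from choice[OF this] obtain g where Q: "\<forall>i. Q i (g i)" by (rule exE)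
  have g: "g i \<in> borel_measurable borel"
    "AE t in lborel. t \<in> {0..1} \<longrightarrow> ((\<lambda>t. z t $ i) has_real_derivative g i t) (at t)"
    "0 \<le> s \<Longrightarrow> s \<le> t \<Longrightarrow> t \<le> 1 \<Longrightarrow> (g i has_integral (z t $ i - z s $ i)) {s..t}" for i s t
    using Q[rule_format, of i] unfolding Q_def by blast+
  define G where "G t = (\<chi> i. g i t)" for t
  have Gm: "G \<in> borel_measurable borel"
    unfolding G_def using g(1) by (rule borel_measurable_vec_lambda)
  have "AE t in lborel. \<forall>i\<in>UNIV. t \<in> {0..1} \<longrightarrow> ((\<lambda>t. z t $ i) has_real_derivative g i t) (at t)"
    using g(2) by (intro AE_finite_allI) auto
  then have der: "AE t in lborel. t \<in> {0..1} \<longrightarrow> (z has_vector_derivative G t) (at t)"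
    by eventually_elim (auto simp: has_vector_derivative_vec_iff G_def)
  have "AE t in lborel. t \<in> {0<..<1} \<longrightarrow> norm (G t) \<le> real CARD('d) * B"
    using der
  proof eventually_elim
    case (elim t)
    show ?case
    proof
      assume t: "t \<in> {0<..<1}"
      have "\<bar>G t $ i\<bar> \<le> B" for i
        by (rule lipschitz_has_real_derivative_bound[where f="\<lambda>t. z t $ i" and a=0 and b=1 and x=t])
          (use Li elim t in \<open>auto simp: has_vector_derivative_vec_iff\<close>)
      then have "(\<Sum>i\<in>UNIV. \<bar>G t $ i\<bar>) \<le> real CARD('d) * B"
        using sum_bounded_above[of UNIV "\<lambda>i. \<bar>G t $ i\<bar>" B] by simp
      then show "norm (G t) \<le> real CARD('d) * B" using norm_le_l1_cart[of "G t"] by simp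
    qed
  qed
  then have Gi: "set_integrable lborel {0..1} G"
    by (intro set_integrable_bounded_Icc[OF Gm] AE_lborel_Icc_imp_Ioo)
  show ?thesis
  proof (intro exI[of _ G] conjI allI impI Gm Gi der)
    fix s t :: real assume st: "0 \<le> s" "s \<le> t" "t \<le> 1"
    have Gst: "set_integrable lborel {s..t} G"
      by (rule set_integrable_subset[OF Gi]) (use st in auto)
    show "z t - z s = (LINT r:{s..t}|lborel. G r)"
    proof (rule vec_eq_iff[THEN iffD2], rule allI)
      fix i
      have "(LINT r:{s..t}|lborel. G r) $ i = (LINT r:{s..t}|lborel. G r $ i)"
        by (rule set_integral_vec_nth[OF Gst])
      also have "\<dots> = integral {s..t} (\<lambda>r. G r $ i)"
        using set_integral_vec_nth(1)[OF Gst] by (rule set_borel_integral_eq_integral(2))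
      also have "\<dots> = z t $ i - z s $ i"
        using g(3)[OF st, of i] by (intro integral_unique) (simp add: G_def)
      finally show "(z t - z s) $ i = (LINT r:{s..t}|lborel. G r) $ i" by simp
    qed
  qed
qed

lemma set_integral_Icc_split:
  fixes v :: "real \<Rightarrow> real ^ 'd"
  assumes "set_integrable lborel {0..1} v" "0 \<le> s" "s \<le> t" "t \<le> 1"
  shows "(LINT r:{0..t}|lborel. v r) - (LINT r:{0..s}|lborel. v r) = (LINT r:{s..t}|lborel. v r)"
proof -
  have i: "set_integrable lborel {a..b} v" if "0 \<le> a" "b \<le> 1" for a b
    by (rule set_integrable_subset[OF assms(1)]) (use that in auto)
  have "(LINT r:{a..b}|lborel. v r) = integral {a..b} v" "v integrable_on {a..b}" if "0 \<le> a" "b \<le> 1" for a b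
    using set_borel_integral_eq_integral[OF i[OF that]] by auto
  then show ?thesis using Henstock_Kurzweil_Integration.integral_combine[of 0 s t v] assms(2-4) by (auto simp: algebra_simps)
qed

lemma norm_set_integral_le_bound:
  fixes v :: "real \<Rightarrow> real ^ 'd"
  assumes v: "set_integrable lborel {0..1} v" and B: "AE t in lborel. t \<in> {0..1} \<longrightarrow> norm (v t) \<le> B"
    and st: "0 \<le> s" "s \<le> t" "t \<le> 1"
  shows "norm (LINT r:{s..t}|lborel. v r) \<le> B * (t - s)"
proof -
  have i: "set_integrable lborel {s..t} v"
    by (rule set_integrable_subset[OF v]) (use st in auto)
  have "norm (LINT r:{s..t}|lborel. v r) \<le> (LINT r:{s..t}|lborel. norm (v r))"
    by (rule set_integral_norm_bound[OF i])
  also have "\<dots> \<le> (LINT r:{s..t}|lborel. B)"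
    by (rule set_integral_mono_AE) (use set_integrable_norm[OF i] B st in \<open>auto elim!: eventually_mono simp: set_integrable_def\<close>)
  also have "\<dots> = B * (t - s)" using st by (simp add: set_integral_const)
  finally show ?thesis .
qed

text \<open>Lebesgue's differentiation theorem for bounded \<open>v\<close>: the function
  \<open>z\<close> is Lipschitz, so it has an almost everywhere derivative \<open>g\<close> with the
  same integrals over the intervals \<open>{0..a}\<close>, and these determine a density up to a
  null set.\<close>

lemma bounded_integral_has_vector_derivative:
  fixes v :: "real \<Rightarrow> real ^ 'd"
  assumes v: "set_integrable lborel {0..1} v" and B: "AE t in lborel. t \<in> {0..1} \<longrightarrow> norm (v t) \<le> B"
    and z: "\<And>t. t \<in> {0..1} \<Longrightarrow> z t = c + (LINT r:{0..t}|lborel. v r)"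
  shows "AE t in lborel. t \<in> {0..1} \<longrightarrow> (z has_vector_derivative v t) (at t)"
proof -
  have zst: "z t - z s = (LINT r:{s..t}|lborel. v r)" if "0 \<le> s" "s \<le> t" "t \<le> 1" for s t
    using set_integral_Icc_split[OF v that] z[of s] z[of t] that by simp
  then have "norm (z t - z s) \<le> B * (t - s)" if "0 \<le> s" "s \<le> t" "t \<le> 1" for s t :: real
    using norm_set_integral_le_bound[OF v B that] that by simp
  from lipschitz_vector_derivative[of z, OF this]
  obtain g where g: "g \<in> borel_measurable borel" "set_integrable lborel {0..1} g"
    "AE t in lborel. t \<in> {0..1} \<longrightarrow> (z has_vector_derivative g t) (at t)"
    "\<And>s t. 0 \<le> s \<Longrightarrow> s \<le> t \<Longrightarrow> t \<le> 1 \<Longrightarrow> z t - z s = (LINT r:{s..t}|lborel. g r)"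
    by blast
  have "AE t in lborel. indicator {0..1} t * (v t $ i - g t $ i) = 0" for i
  proof (rule AE_eq_zero_of_atMost_integrals)
    have vi: "set_integrable lborel {0..a} (\<lambda>x. v x $ i)" "set_integrable lborel {0..a} (\<lambda>x. g x $ i)" if "a \<le> 1" for a
      using set_integrable_subset[OF v, of "{0..a}"] set_integrable_subset[OF g(2), of "{0..a}"] that
      by (auto intro!: set_integral_vec_nth)
    show i: "integrable lborel (\<lambda>t. indicator {0..1} t * (v t $ i - g t $ i))"
      using set_integral_diff(1)[OF vi[of 1]] by (simp add: set_integrable_def)
    have zero: "(LINT t:{0..a}|lborel. v t $ i - g t $ i) = 0" if "a \<le> 1" for a
    proof (cases "a \<ge> 0")
      case True
      have "(LINT t:{0..a}|lborel. v t) = (LINT t:{0..a}|lborel. g t)"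
        using zst[of 0 a] g(4)[of 0 a] True that by simp
      then have "(LINT t:{0..a}|lborel. v t $ i) = (LINT t:{0..a}|lborel. g t $ i)"
        using set_integral_vec_nth(2)[OF set_integrable_subset[OF v, of "{0..a}"], of i]
          set_integral_vec_nth(2)[OF set_integrable_subset[OF g(2), of "{0..a}"], of i] that by simp
      then show ?thesis using set_integral_diff(2)[OF vi[OF that]] by simp
    qed (simp add: set_lebesgue_integral_def)
    show "(LINT x:{..a}|lborel. indicator {0..1} x * (v x $ i - g x $ i)) = 0" for a
    proof -
      have "(LINT x:{..a}|lborel. indicator {0..1} x * (v x $ i - g x $ i)) = (LINT x:{0..min a 1}|lborel. v x $ i - g x $ i)"
        unfolding set_lebesgue_integral_def by (intro Bochner_Integration.integral_cong) (auto simp: indicator_def)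
      then show ?thesis using zero[of "min a 1"] by simp
    qed
    show "(LINT t|lborel. indicator {0..1} t * (v t $ i - g t $ i)) = 0"
      using zero[of 1] by (simp add: set_lebesgue_integral_def)
  qed
  then have "AE t in lborel. \<forall>i\<in>UNIV. indicator {0..1} t * (v t $ i - g t $ i) = 0"
    by (intro AE_finite_allI) auto
  with g(3) show ?thesis
    by eventually_elim (auto simp: indicator_def has_vector_derivative_vec_iff)
qed

lemma nn_integral_Cauchy_Schwarz_interval:
  fixes g :: "real \<Rightarrow> real ^ 'd"
  assumes g: "set_integrable lborel {s..t} g" "g \<in> borel_measurable borel" and "s \<le> t"
  shows "ennreal ((norm (LINT r:{s..t}|lborel. g r))\<^sup>2) \<le>
    ennreal (t - s) * (\<integral>\<^sup>+r\<in>{s..t}. ennreal ((norm (g r))\<^sup>2) \<partial>lborel)"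
proof (cases "s = t")
  case True
  have "(LINT r:{s..s}|lborel. g r) = integral {s..s} g"
    using g True by (intro set_borel_integral_eq_integral(2)) auto
  then show ?thesis using True by simp
next
  case False
  then have "s < t" using \<open>s \<le> t\<close> by simp
  show ?thesis
  proof (cases "(\<integral>\<^sup>+r\<in>{s..t}. ennreal ((norm (g r))\<^sup>2) \<partial>lborel) = \<infinity>")
    case True
    then show ?thesis using \<open>s < t\<close> by (simp add: ennreal_mult_top)
  next
    case False
    have i2: "set_integrable lborel {s..t} (\<lambda>r. (norm (g r))\<^sup>2)"
      unfolding set_integrable_def
    proof (rule integrableI_nonneg)
      show "(\<lambda>x. indicator {s..t} x *\<^sub>R (norm (g x))\<^sup>2) \<in> borel_measurable lborel" using g(2) by measurable
      have "(\<integral>\<^sup>+x. ennreal (indicator {s..t} x *\<^sub>R (norm (g x))\<^sup>2) \<partial>lborel) = (\<integral>\<^sup>+r\<in>{s..t}. ennreal ((norm (g r))\<^sup>2) \<partial>lborel)"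
        by (intro nn_integral_cong) (auto simp: indicator_def)
      then show "(\<integral>\<^sup>+x. ennreal (indicator {s..t} x *\<^sub>R (norm (g x))\<^sup>2) \<partial>lborel) < \<infinity>"
        using False by (simp add: less_top)
    qed simp
    have i1: "set_integrable lborel {s..t} (\<lambda>r. norm (g r))" using g(1) by (rule set_integrable_norm)
    have ic: "set_integrable lborel {s..t} (\<lambda>r. c)" for c :: real
      by (rule set_integrable_bounded_Icc[where B="\<bar>c\<bar>"]) auto
    define m Q where "m = (LINT r:{s..t}|lborel. norm (g r))" and "Q = (LINT r:{s..t}|lborel. (norm (g r))\<^sup>2)"
    \<comment> \<open>\<open>c\<close> is the mean of \<open>norm (g r)\<close> over the interval;
      the inequality is the nonnegativity of the variance about it.\<close>
    define c where "c = m / (t - s)"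
    have "0 \<le> (LINT r:{s..t}|lborel. (norm (g r) - c)\<^sup>2)"
      unfolding set_lebesgue_integral_def by (intro Bochner_Integration.integral_nonneg) simp
    also have "\<dots> = (LINT r:{s..t}|lborel. ((norm (g r))\<^sup>2 - (2 * c) * norm (g r)) + c\<^sup>2)"
      by (simp add: power2_diff algebra_simps)
    also have "\<dots> = (Q - 2 * c * m) + c\<^sup>2 * (t - s)"
      using i1 i2 ic \<open>s < t\<close> by (simp add: set_integral_add set_integral_diff Q_def m_def set_integral_const)
    also have "\<dots> = Q - m\<^sup>2 / (t - s)"
    proof -
      have "c * (t - s) = m" using \<open>s < t\<close> by (simp add: c_def)
      then have "c\<^sup>2 * (t - s) = c * m" by (simp add: power2_eq_square mult.assoc)
      moreover have "c * m = m\<^sup>2 / (t - s)" by (simp add: c_def power2_eq_square)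
      ultimately show ?thesis by simp
    qed
    finally have "m\<^sup>2 \<le> (t - s) * Q" using \<open>s < t\<close> by (simp add: field_simps)
    moreover have "norm (LINT r:{s..t}|lborel. g r) \<le> m"
      unfolding m_def by (rule set_integral_norm_bound[OF g(1)])
    then have "(norm (LINT r:{s..t}|lborel. g r))\<^sup>2 \<le> m\<^sup>2" by (intro power_mono) auto
    ultimately have "(norm (LINT r:{s..t}|lborel. g r))\<^sup>2 \<le> (t - s) * Q" by linarith
    then have "ennreal ((norm (LINT r:{s..t}|lborel. g r))\<^sup>2) \<le> ennreal (t - s) * ennreal Q"
      using \<open>s < t\<close> by (simp add: ennreal_mult'[symmetric] ennreal_leI)
    also have "ennreal Q = (\<integral>\<^sup>+r\<in>{s..t}. ennreal ((norm (g r))\<^sup>2) \<partial>lborel)"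
    proof -
      have "(\<integral>\<^sup>+x. ennreal (indicator {s..t} x *\<^sub>R (norm (g x))\<^sup>2) \<partial>lborel) = ennreal Q"
        unfolding Q_def set_lebesgue_integral_def
        by (rule nn_integral_eq_integral) (use i2 in \<open>auto simp: set_integrable_def\<close>)
      moreover have "(\<integral>\<^sup>+x. ennreal (indicator {s..t} x *\<^sub>R (norm (g x))\<^sup>2) \<partial>lborel) = (\<integral>\<^sup>+r\<in>{s..t}. ennreal ((norm (g r))\<^sup>2) \<partial>lborel)"
        by (intro nn_integral_cong) (auto simp: indicator_def)
      ultimately show ?thesis by simp
    qed
    finally show ?thesis .
  qed
qed

section \<open>Solutions driven by a continuous path\<close>

text \<open>The integral equation of a strong solution along a single noise path, with
  \<open>u\<close> in the place of \<open>\<lambda>t. \<epsilon> *\<^sub>R w t \<omega>\<close>.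
  Probability and adaptedness have disappeared, so that solutions for deterministic \<open>u\<close>
  make sense.\<close>

definition driven_solution ::
  "real ^ 'd ^ 'n \<Rightarrow> real ^ 'n \<Rightarrow> real \<Rightarrow> real ^ 'd \<Rightarrow> (real \<Rightarrow> real ^ 'd) \<Rightarrow> (real \<Rightarrow> real ^ 'd) \<Rightarrow> bool" where
  "driven_solution A y \<mu> x0 u x \<longleftrightarrow> continuous_on {0..1} x \<and>
     (\<exists>v. set_integrable lborel {0..1} v \<and>
       (AE t in lborel. t \<in> {0..1} \<longrightarrow> v t \<in> subdifferential (lasso_objective A y \<mu>) (x t)) \<and>
       (\<forall>t\<in>{0..1}. x t = x0 - (LINT s:{0..t}|lborel. v s) + u t))"

section \<open>A priori bounds on the drift and stability of solutions\<close>

lemma norm_vec_le_card: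
  fixes z :: "real ^ 'd"
  assumes "\<And>i. \<bar>z $ i\<bar> \<le> c"
  shows "norm z \<le> real CARD('d) * c"
proof -
  have "(\<Sum>i\<in>UNIV. \<bar>z $ i\<bar>) \<le> real CARD('d) * c"
    using sum_bounded_above[of UNIV "\<lambda>i. \<bar>z $ i\<bar>" c] assms by simp
  then show ?thesis using norm_le_l1_cart[of z] by linarith
qed

lemma norm_matrix_vector_le: "norm (A *v x) \<le> onorm ((*v) A) * norm (x :: real ^ 'd)"
  by (rule onorm) (simp add: matrix_vector_mul_bounded_linear)

lemma subdifferential_lasso_bounded:
  fixes A :: "real ^ 'd ^ 'n"
  assumes "\<mu> > 0"
  shows "\<exists>C. \<forall>x v. norm x \<le> R \<longrightarrow> v \<in> subdifferential (lasso_objective A y \<mu>) x \<longrightarrow> norm v \<le> C"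
proof -
  have "norm v \<le> onorm ((*v) (transpose A)) * (onorm ((*v) A) * R + norm y) + \<mu> * real CARD('d)"
    if x: "norm x \<le> R" and v: "v \<in> subdifferential (lasso_objective A y \<mu>) x" for x v
  proof -
    obtain \<zeta> where v: "v = transpose A *v (A *v x - y) + \<mu> *\<^sub>R \<zeta>" and \<zeta>: "\<And>i. \<zeta> $ i \<in> sgn_set (x $ i)"
      using v unfolding subdifferential_lasso_objective[OF assms] by blast
    have "\<bar>\<zeta> $ i\<bar> \<le> 1" for i using \<zeta>[of i] by (auto simp: sgn_set_def split: if_splits)
    then have "norm \<zeta> \<le> real CARD('d) * 1" by (rule norm_vec_le_card)
    then have 1: "norm (\<mu> *\<^sub>R \<zeta>) \<le> \<mu> * real CARD('d)" using assms by simp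
    have "norm (A *v x - y) \<le> norm (A *v x) + norm y" by (rule norm_triangle_ineq4)
    also have "norm (A *v x) \<le> onorm ((*v) A) * R"
      using norm_matrix_vector_le[of A x] mult_left_mono[OF x, of "onorm ((*v) A)"]
        onorm_pos_le[OF matrix_vector_mul_bounded_linear[of A]] by linarith
    finally have "norm (A *v x - y) \<le> onorm ((*v) A) * R + norm y" by simp
    from mult_left_mono[OF this, of "onorm ((*v) (transpose A))"]
    have "norm (transpose A *v (A *v x - y)) \<le> onorm ((*v) (transpose A)) * (onorm ((*v) A) * R + norm y)"
      using norm_matrix_vector_le[of "transpose A" "A *v x - y"]
        onorm_pos_le[OF matrix_vector_mul_bounded_linear[of "transpose A"]] by linarith
    then show ?thesis using 1 norm_triangle_ineq[of "transpose A *v (A *v x - y)" "\<mu> *\<^sub>R \<zeta>"] unfolding v by linarith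
  qed
  then show ?thesis by blast
qed

lemma drift_bounded:
  fixes A :: "real ^ 'd ^ 'n" and x v :: "real \<Rightarrow> real ^ 'd"
  assumes "\<mu> > 0" "continuous_on {0..1} x"
    "AE t in lborel. t \<in> {0..1} \<longrightarrow> v t \<in> subdifferential (lasso_objective A y \<mu>) (x t)"
  shows "\<exists>B. AE t in lborel. t \<in> {0..1} \<longrightarrow> norm (v t) \<le> B"
proof -
  have "bounded (x ` {0..1})"
    using assms(2) by (intro compact_imp_bounded compact_continuous_image) auto
  then obtain R where "\<forall>t\<in>{0..1}. norm (x t) \<le> R" unfolding bounded_iff by blast
  then have R: "\<And>t. t \<in> {0..1} \<Longrightarrow> norm (x t) \<le> R" by blast
  obtain C where C: "\<And>x v. norm x \<le> R \<Longrightarrow> v \<in> subdifferential (lasso_objective A y \<mu>) x \<Longrightarrow> norm v \<le> C"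
    using subdifferential_lasso_bounded[OF assms(1)] by blast
  show ?thesis using assms(3) R C by (intro exI[of _ C]) (auto elim!: eventually_mono)
qed

text \<open>A bound for half the growth rate of the squared distance of two solutions, each taken
  minus its driving path, when the driving paths differ by at most \<open>r\<close>. The first term
  arises from completing a square; the second from the fact that two elements of
  \<open>sgn_set\<close> values differ by at most 2 in each of the \<open>CARD('d)\<close>
  coordinates. It vanishes as \<open>r\<close> tends to 0.\<close>

definition stability_const :: "real ^ 'd ^ 'n \<Rightarrow> real \<Rightarrow> real \<Rightarrow> real" where
  "stability_const A \<mu> r = (onorm ((*v) A) * r)\<^sup>2 / 4 + 2 * \<mu> * real CARD('d) * r"

text \<open>Only the monotone and cocoercive parts of the drift enter, so no a priori bound on the
  solutions is needed: \<open>\<langle>a, b\<rangle> - \<langle>a, a\<rangle> \<le> \<parallel>b\<parallel>\<^sup>2 / 4\<close> absorbs the quadratic part of the objective.\<close>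

lemma subdifferential_lasso_quasi_monotone:
  fixes A :: "real ^ 'd ^ 'n"
  assumes "\<mu> > 0" and v1: "v1 \<in> subdifferential (lasso_objective A y \<mu>) x1"
    and v2: "v2 \<in> subdifferential (lasso_objective A y \<mu>) x2" and "norm w \<le> r"
  shows "(v1 - v2) \<bullet> w - (v1 - v2) \<bullet> (x1 - x2) \<le> stability_const A \<mu> r"
proof -
  obtain \<zeta>1 where v1: "v1 = transpose A *v (A *v x1 - y) + \<mu> *\<^sub>R \<zeta>1" and \<zeta>1: "\<And>i. \<zeta>1 $ i \<in> sgn_set (x1 $ i)"
    using v1 unfolding subdifferential_lasso_objective[OF assms(1)] by blast
  obtain \<zeta>2 where v2: "v2 = transpose A *v (A *v x2 - y) + \<mu> *\<^sub>R \<zeta>2" and \<zeta>2: "\<And>i. \<zeta>2 $ i \<in> sgn_set (x2 $ i)"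
    using v2 unfolding subdifferential_lasso_objective[OF assms(1)] by blast
  define a where "a = A *v (x1 - x2)"
  have "r \<ge> 0" using \<open>norm w \<le> r\<close> norm_ge_zero order_trans by blast
  have tr: "(transpose A *v p) \<bullet> q = p \<bullet> (A *v q)" for p q by (simp add: dot_lmul_matrix)
  have dv: "(v1 - v2) \<bullet> q = a \<bullet> (A *v q) + \<mu> * ((\<zeta>1 - \<zeta>2) \<bullet> q)" for q
  proof -
    have "v1 - v2 = transpose A *v a + \<mu> *\<^sub>R (\<zeta>1 - \<zeta>2)"
      by (simp add: v1 v2 a_def matrix_vector_mult_diff_distrib algebra_simps)
    then show ?thesis by (simp only: inner_add_left tr inner_scaleR_left)
  qed
  have mono: "(\<zeta>1 - \<zeta>2) \<bullet> (x1 - x2) \<ge> 0"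
    unfolding inner_vec_def inner_real_def
  proof (rule sum_nonneg)
    fix i
    show "0 \<le> (\<zeta>1 - \<zeta>2) $ i * (x1 - x2) $ i"
      using \<zeta>1[of i] \<zeta>2[of i]
      by (auto simp: sgn_set_def zero_le_mult_iff split: if_splits)
  qed
  have "norm (\<zeta>1 - \<zeta>2) \<le> real CARD('d) * 2"
  proof (rule norm_vec_le_card)
    fix i
    have "\<bar>\<zeta>1 $ i\<bar> \<le> 1" "\<bar>\<zeta>2 $ i\<bar> \<le> 1"
      using \<zeta>1[of i] \<zeta>2[of i] by (auto simp: sgn_set_def split: if_splits)
    then show "\<bar>(\<zeta>1 - \<zeta>2) $ i\<bar> \<le> 2" by simp
  qed
  then have "(\<zeta>1 - \<zeta>2) \<bullet> w \<le> real CARD('d) * 2 * r"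
    using norm_cauchy_schwarz[of "\<zeta>1 - \<zeta>2" w] mult_mono[of "norm (\<zeta>1 - \<zeta>2)" "real CARD('d) * 2" "norm w" r] \<open>norm w \<le> r\<close>
    by simp
  then have 1: "\<mu> * ((\<zeta>1 - \<zeta>2) \<bullet> w) \<le> \<mu> * (real CARD('d) * 2 * r)" using assms(1) by simp
  have 2: "a \<bullet> (A *v w) - a \<bullet> a \<le> (norm (A *v w))\<^sup>2 / 4"
  proof -
    have "0 \<le> (norm (a - (1/2) *\<^sub>R (A *v w)))\<^sup>2" by simp
    also have "\<dots> = a \<bullet> a - a \<bullet> (A *v w) + (norm (A *v w))\<^sup>2 / 4"
      unfolding power2_norm_eq_inner by (simp add: inner_diff_left inner_diff_right inner_commute algebra_simps)
    finally show ?thesis by simp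
  qed
  have "norm (A *v w) \<le> onorm ((*v) A) * r"
    using norm_matrix_vector_le[of A w] mult_left_mono[OF \<open>norm w \<le> r\<close>, of "onorm ((*v) A)"]
      onorm_pos_le[OF matrix_vector_mul_bounded_linear[of A]] by linarith
  then have 3: "(norm (A *v w))\<^sup>2 \<le> (onorm ((*v) A) * r)\<^sup>2" by (intro power_mono) auto
  have "\<mu> * ((\<zeta>1 - \<zeta>2) \<bullet> (x1 - x2)) \<ge> 0" using mono assms(1) by simp
  then show ?thesis
    using 1 2 3 dv[of w] dv[of "x1 - x2"] unfolding stability_const_def a_def[symmetric] by (simp add: algebra_simps)
qed

lemma has_integral_AE_upper_bound:
  fixes g :: "real \<Rightarrow> real"
  assumes g: "(g has_integral I) {a..b}" and "a \<le> b" and le: "AE t in lborel. t \<in> {a..b} \<longrightarrow> g t \<le> c"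
  shows "I \<le> c * (b - a)"
proof -
  obtain N where N: "{t \<in> space lborel. \<not> (t \<in> {a..b} \<longrightarrow> g t \<le> c)} \<subseteq> N" "emeasure lborel N = 0" "N \<in> sets lborel"
    using AE_E[OF le] by auto
  have neg: "negligible N" using N by (auto simp: negligible_iff_null_sets null_sets_completionI null_sets_def)
  \<comment> \<open>Truncating \<open>g\<close> at \<open>c\<close> changes it only on the null set
    \<open>N\<close> and yields a bound at every point, as the comparison of gauge integrals
    requires.\<close>
  have "((\<lambda>t. min (g t) c) has_integral I) {a..b}"
  proof (rule has_integral_spike[OF neg _ g])
    fix t assume t: "t \<in> {a..b} - N"
    have "g t \<le> c" by (rule ccontr) (use t subsetD[OF N(1), of t] in auto)
    then show "min (g t) c = g t" by simp
  qed
  moreover have "((\<lambda>t. c) has_integral (c * (b - a))) {a..b}"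
    using has_integral_const_real[of c a b] \<open>a \<le> b\<close> by (simp add: mult.commute)
  ultimately show ?thesis by (rule has_integral_le) simp
qed

text \<open>A driving path need not be differentiable, so the solutions cannot be differentiated
  directly. The difference \<open>e\<close> of \<open>x1 - u1\<close> and \<open>x2 - u2\<close>,
  however, is an integral of bounded drifts and hence Lipschitz. Its squared norm grows at rate at
  most \<open>2 * K\<close> by quasi-monotonicity, over a time of length at most 1.\<close>

lemma driven_solution_stable:
  fixes A :: "real ^ 'd ^ 'n"
  assumes "\<mu> > 0" and s1: "driven_solution A y \<mu> x0 u1 x1" and s2: "driven_solution A y \<mu> x0 u2 x2"
    and r: "\<And>t. t \<in> {0..1} \<Longrightarrow> norm (u1 t - u2 t) \<le> r" and t: "t \<in> {0..1}"
  shows "norm (x1 t - x2 t) \<le> r + sqrt (2 * stability_const A \<mu> r)"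
proof -
  obtain v1 where c1: "continuous_on {0..1} x1" and v1: "set_integrable lborel {0..1} v1"
    "AE t in lborel. t \<in> {0..1} \<longrightarrow> v1 t \<in> subdifferential (lasso_objective A y \<mu>) (x1 t)"
    "\<And>t. t \<in> {0..1} \<Longrightarrow> x1 t = x0 - (LINT s:{0..t}|lborel. v1 s) + u1 t"
    using s1 unfolding driven_solution_def by blast
  obtain v2 where c2: "continuous_on {0..1} x2" and v2: "set_integrable lborel {0..1} v2"
    "AE t in lborel. t \<in> {0..1} \<longrightarrow> v2 t \<in> subdifferential (lasso_objective A y \<mu>) (x2 t)"
    "\<And>t. t \<in> {0..1} \<Longrightarrow> x2 t = x0 - (LINT s:{0..t}|lborel. v2 s) + u2 t"
    using s2 unfolding driven_solution_def by blast
  obtain B1 where B1: "AE t in lborel. t \<in> {0..1} \<longrightarrow> norm (v1 t) \<le> B1"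
    using drift_bounded[OF assms(1) c1 v1(2)] by blast
  obtain B2 where B2: "AE t in lborel. t \<in> {0..1} \<longrightarrow> norm (v2 t) \<le> B2"
    using drift_bounded[OF assms(1) c2 v2(2)] by blast
  define v where "v t = v2 t - v1 t" for t
  define B where "B = B1 + B2"
  define e where "e t = (x1 t - u1 t) - (x2 t - u2 t)" for t
  define K where "K = stability_const A \<mu> r"
  have v: "set_integrable lborel {0..1} v" unfolding v_def by (rule set_integral_diff(1)[OF v2(1) v1(1)])
  have vB: "AE t in lborel. t \<in> {0..1} \<longrightarrow> norm (v t) \<le> B"
    using B1 B2
  proof eventually_elim
    case (elim t)
    then show ?case using norm_triangle_ineq4[of "v2 t" "v1 t"] by (auto simp: v_def B_def)
  qed
  have ev: "e t = 0 + (LINT r:{0..t}|lborel. v r)" if "t \<in> {0..1}" for t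
  proof -
    have "set_integrable lborel {0..t} v1" "set_integrable lborel {0..t} v2"
      using set_integrable_subset[OF v1(1)] set_integrable_subset[OF v2(1)] that by auto
    then have "(LINT r:{0..t}|lborel. v r) = (LINT r:{0..t}|lborel. v2 r) - (LINT r:{0..t}|lborel. v1 r)"
      unfolding v_def by (intro set_integral_diff(2))
    then show ?thesis using v1(3)[OF that] v2(3)[OF that] by (simp add: e_def)
  qed
  have est: "norm (e t - e s) \<le> B * (t - s)" if "0 \<le> s" "s \<le> t" "t \<le> 1" for s t
    using norm_set_integral_le_bound[OF v vB that] set_integral_Icc_split[OF v that] ev[of s] ev[of t] that by simp
  have e0: "e 0 = 0"
    using v1(3)[of 0] v2(3)[of 0] set_integral_Icc_split[OF v, of 0 0] ev[of 0] est[of 0 0]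
    norm_set_integral_le_bound[OF v vB, of 0 0] by simp
  have "norm (e 1 - e 0) \<le> B" using est[of 0 1] by simp
  then have "B \<ge> 0" using norm_ge_zero order_trans by blast
  have eB: "norm (e t) \<le> B" if "t \<in> {0..1}" for t
    using est[of 0 t] e0 that mult_left_mono[of t 1 B] \<open>B \<ge> 0\<close> by simp
  define \<phi> where "\<phi> t = e t \<bullet> e t" for t
  have lip: "norm (\<phi> t - \<phi> s) \<le> (2 * B * B) * (t - s)" if "0 \<le> s" "s \<le> t" "t \<le> 1" for s t
  proof -
    have "\<phi> t - \<phi> s = (e t - e s) \<bullet> (e t + e s)"
      by (simp add: \<phi>_def inner_diff_left inner_diff_right inner_add_left inner_add_right inner_commute)
    then have "norm (\<phi> t - \<phi> s) \<le> norm (e t - e s) * norm (e t + e s)"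
      using Cauchy_Schwarz_ineq2[of "e t - e s" "e t + e s"] by simp
    also have "\<dots> \<le> (B * (t - s)) * (2 * B)"
      using est[OF that] norm_triangle_ineq[of "e t" "e s"] eB[of s] eB[of t] that \<open>B \<ge> 0\<close>
      by (intro mult_mono) auto
    finally show ?thesis by (simp add: algebra_simps)
  qed
  have "abs_continuous_on_interval 0 1 \<phi>"
    using lip by (rule lipschitz_imp_abs_continuous_on_interval)
  from abs_continuous_on_interval_borel_derivative[OF this]
  obtain g where g: "AE t in lborel. t \<in> {0..1} \<longrightarrow> (\<phi> has_real_derivative g t) (at t)"
    "\<And>s t. 0 \<le> s \<Longrightarrow> s \<le> t \<Longrightarrow> t \<le> 1 \<Longrightarrow> (g has_integral (\<phi> t - \<phi> s)) {s..t}"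
    by auto
  have "AE t in lborel. t \<in> {0..1} \<longrightarrow> (e has_vector_derivative v t) (at t)"
    by (rule bounded_integral_has_vector_derivative[OF v vB ev])
  then have gle: "AE t in lborel. t \<in> {0..1} \<longrightarrow> g t \<le> 2 * K"
    using g(1) v1(2) v2(2)
  proof eventually_elim
    case (elim t)
    show ?case
    proof
      assume t: "t \<in> {0..1}"
      have d: "(e has_vector_derivative v t) (at t)" using elim t by blast
      have "(\<phi> has_derivative (\<lambda>h. e t \<bullet> (h *\<^sub>R v t) + (h *\<^sub>R v t) \<bullet> e t)) (at t)"
        unfolding \<phi>_def by (rule has_derivative_inner) (use d in \<open>auto simp: has_vector_derivative_def\<close>)
      moreover have "(\<lambda>h. e t \<bullet> (h *\<^sub>R v t) + (h *\<^sub>R v t) \<bullet> e t) = (*) (2 * (e t \<bullet> v t))"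
        by (auto simp: fun_eq_iff inner_commute algebra_simps)
      ultimately have "(\<phi> has_real_derivative (2 * (e t \<bullet> v t))) (at t)"
        by (simp only: has_field_derivative_def)
      then have "g t = 2 * (e t \<bullet> v t)" using DERIV_unique elim t by blast
      also have "e t \<bullet> v t = (v1 t - v2 t) \<bullet> (u1 t - u2 t) - (v1 t - v2 t) \<bullet> (x1 t - x2 t)"
        by (simp add: e_def v_def inner_diff_left inner_diff_right inner_commute algebra_simps)
      also have "\<dots> \<le> K" unfolding K_def
        by (rule subdifferential_lasso_quasi_monotone[OF assms(1)]) (use elim t r in auto)
      finally show "g t \<le> 2 * K" by simp
    qed
  qed
  have "0 \<le> r" using r[of 0] norm_ge_zero[of "u1 0 - u2 0"] by (metis atLeastAtMost_iff order_refl order_trans zero_le_one)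
  then have "K \<ge> 0" using assms(1) by (simp add: K_def stability_const_def)
  have "\<phi> t - \<phi> 0 \<le> (2 * K) * (t - 0)"
  proof (rule has_integral_AE_upper_bound)
    show "(g has_integral (\<phi> t - \<phi> 0)) {0..t}" using g(2)[of 0 t] t by simp
    show "AE r in lborel. r \<in> {0..t} \<longrightarrow> g r \<le> 2 * K" using gle by eventually_elim (use t in auto)
  qed (use t in simp)
  also have "\<dots> \<le> 2 * K" using t \<open>K \<ge> 0\<close> mult_left_mono[of t 1 "2 * K"] by simp
  finally have "(norm (e t))\<^sup>2 \<le> 2 * K" by (simp add: \<phi>_def e0 power2_norm_eq_inner)
  then have "norm (e t) \<le> sqrt (2 * K)" by (rule real_le_rsqrt)
  moreover have "x1 t - x2 t = (u1 t - u2 t) + e t" by (simp add: e_def)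
  ultimately show ?thesis using norm_triangle_ineq[of "u1 t - u2 t" "e t"] r[OF t] by (simp add: K_def)
qed

lemma stability_modulus:
  fixes A :: "real ^ 'd ^ 'n"
  assumes "e > 0"
  shows "\<exists>r>0. r + sqrt (2 * stability_const A \<mu> r) < e"
proof -
  have "((\<lambda>r. r + sqrt (2 * stability_const A \<mu> r)) \<longlongrightarrow> 0 + sqrt (2 * stability_const A \<mu> 0)) (at_right 0)"
    unfolding stability_const_def by (intro tendsto_intros) simp_all
  then have "((\<lambda>r. r + sqrt (2 * stability_const A \<mu> r)) \<longlongrightarrow> 0) (at_right 0)"
    by (simp add: stability_const_def)
  then have "\<forall>\<^sub>F r in at_right 0. r + sqrt (2 * stability_const A \<mu> r) < e"
    using assms by (rule order_tendstoD(2))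
  moreover have "\<forall>\<^sub>F r :: real in at_right 0. r > 0" by (simp add: eventually_at_right_less)
  ultimately have "\<forall>\<^sub>F r in at_right 0. r > 0 \<and> r + sqrt (2 * stability_const A \<mu> r) < e" by eventually_elim auto
  from eventually_happens'[OF trivial_limit_at_right_real this] show ?thesis by blast
qed

section \<open>Closedness of the solution relation\<close>

lemma continuous_on_lasso_objective:
  fixes A :: "real ^ 'd ^ 'n"
  shows "continuous_on UNIV (lasso_objective A y \<mu>)"
proof -
  have "continuous_on UNIV ((*v) A)" by (rule linear_continuous_on[OF matrix_vector_mul_bounded_linear])
  then show ?thesis unfolding lasso_objective_def by (intro continuous_intros) auto
qed

text \<open>Stability supplies a uniform limit of the solutions. The drifts \<open>v n\<close> may
  fail to converge, but the paths \<open>xn n - un n\<close> do, and their limit \<open>z\<close> is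
  Lipschitz. The derivative of \<open>z\<close> with changed sign is a subgradient: the subgradient
  inequality for \<open>v n\<close> is integrated over a short interval, passed to the limit in
  \<open>n\<close>, and localized again by differentiating \<open>z\<close>.\<close>

lemma driven_solution_closed:
  fixes A :: "real ^ 'd ^ 'n"
  assumes "\<mu> > 0" and sol: "\<And>n. driven_solution A y \<mu> x0 (un n) (xn n)"
    and lim: "uniform_limit {0..1} un u sequentially"
  shows "\<exists>x. driven_solution A y \<mu> x0 u x"
proof -
  have Cauchy: "uniformly_Cauchy_on {0..1} xn"
    unfolding uniformly_Cauchy_on_def
  proof (intro allI impI)
    fix e :: real assume "e > 0"
    obtain r where r: "r > 0" "r + sqrt (2 * stability_const A \<mu> r) < e"
      using stability_modulus[OF \<open>e > 0\<close>] by blast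
    have "\<forall>\<^sub>F n in sequentially. \<forall>t\<in>{0..1}. dist (un n t) (u t) < r / 2"
      using uniform_limitD[OF lim, of "r / 2"] r by simp
    then obtain N where N: "\<And>n t. n \<ge> N \<Longrightarrow> t \<in> {0..1} \<Longrightarrow> dist (un n t) (u t) < r / 2"
      unfolding eventually_sequentially by blast
    have "dist (xn m t) (xn n t) < e" if t: "t \<in> {0..1}" and "m \<ge> N" "n \<ge> N" for t m n
    proof -
      have "norm (un m s - un n s) \<le> r" if "s \<in> {0..1}" for s
        using N[OF \<open>m \<ge> N\<close> that] N[OF \<open>n \<ge> N\<close> that] dist_triangle2[of "un m s" "un n s" "u s"]
        by (simp add: dist_norm)
      from driven_solution_stable[OF assms(1) sol sol this t]
      show ?thesis using r by (simp add: dist_norm)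
    qed
    then show "\<exists>M. \<forall>x\<in>{0..1}. \<forall>m\<ge>M. \<forall>n\<ge>M. dist (xn m x) (xn n x) < e" by blast
  qed
  then obtain x where x: "uniform_limit {0..1} xn x sequentially"
    using Cauchy_uniformly_convergent uniformly_convergent_on_def by blast
  have cn: "continuous_on {0..1} (xn n)" for n using sol[of n] by (simp add: driven_solution_def)
  have cx: "continuous_on {0..1} x"
    by (rule uniform_limit_theorem[OF _ x]) (auto simp: cn)
  then have "bounded (x ` {0..1})" by (intro compact_imp_bounded compact_continuous_image) auto
  then obtain R where "\<forall>t\<in>{0..1}. norm (x t) \<le> R" unfolding bounded_iff by blast
  then have R: "\<And>t. t \<in> {0..1} \<Longrightarrow> norm (x t) \<le> R" by blast
  obtain C where C: "\<And>x v. norm x \<le> R + 1 \<Longrightarrow> v \<in> subdifferential (lasso_objective A y \<mu>) x \<Longrightarrow> norm v \<le> C"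
    using subdifferential_lasso_bounded[OF assms(1)] by blast
  have "\<forall>\<^sub>F n in sequentially. \<forall>t\<in>{0..1}. dist (xn n t) (x t) < 1"
    using uniform_limitD[OF x, of 1] by simp
  then obtain N where N: "\<And>n t. n \<ge> N \<Longrightarrow> t \<in> {0..1} \<Longrightarrow> dist (xn n t) (x t) < 1"
    unfolding eventually_sequentially by blast
  have Rn: "norm (xn n t) \<le> R + 1" if "n \<ge> N" "t \<in> {0..1}" for n t
    using N[OF that] R[OF that(2)] norm_triangle_ineq2[of "xn n t" "x t"] by (simp add: dist_norm)
  have "\<forall>n. \<exists>v. set_integrable lborel {0..1} v \<and>
       (AE t in lborel. t \<in> {0..1} \<longrightarrow> v t \<in> subdifferential (lasso_objective A y \<mu>) (xn n t)) \<and>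
       (\<forall>t\<in>{0..1}. xn n t = x0 - (LINT s:{0..t}|lborel. v s) + un n t)"
    using sol by (simp add: driven_solution_def)
  from choice[OF this] obtain v where v: "\<forall>n. set_integrable lborel {0..1} (v n) \<and>
       (AE t in lborel. t \<in> {0..1} \<longrightarrow> v n t \<in> subdifferential (lasso_objective A y \<mu>) (xn n t)) \<and>
       (\<forall>t\<in>{0..1}. xn n t = x0 - (LINT s:{0..t}|lborel. v n s) + un n t)" by (rule exE)
  have vi: "set_integrable lborel {0..1} (v n)"
    and vsub: "AE t in lborel. t \<in> {0..1} \<longrightarrow> v n t \<in> subdifferential (lasso_objective A y \<mu>) (xn n t)"
    and veq: "t \<in> {0..1} \<Longrightarrow> xn n t = x0 - (LINT s:{0..t}|lborel. v n s) + un n t" for n t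
    using v by blast+
  have vC: "AE t in lborel. t \<in> {0..1} \<longrightarrow> norm (v n t) \<le> C" if "n \<ge> N" for n
    using vsub[of n] by eventually_elim (use C Rn[OF that] in blast)
  define z where "z t = x t - u t" for t
  have vst: "(LINT r:{s..t}|lborel. v n r) = (xn n s - un n s) - (xn n t - un n t)" if "0 \<le> s" "s \<le> t" "t \<le> 1" for s t n
  proof -
    have "xn n p - un n p = x0 - (LINT r:{0..p}|lborel. v n r)" if "p \<in> {0..1}" for p
      using veq[OF that, of n] by simp
    then show ?thesis using that set_integral_Icc_split[OF vi[of n] that] by simp
  qed
  have znt: "(\<lambda>n. xn n t - un n t) \<longlonglongrightarrow> z t" if "t \<in> {0..1}" for t
    unfolding z_def by (intro tendsto_diff tendsto_uniform_limitI[OF x] tendsto_uniform_limitI[OF lim] that)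
  have lip: "norm (z t - z s) \<le> C * (t - s)" if st: "0 \<le> s" "s \<le> t" "t \<le> 1" for s t
  proof (rule Lim_bounded)
    show "(\<lambda>n. norm ((xn n t - un n t) - (xn n s - un n s))) \<longlonglongrightarrow> norm (z t - z s)"
      by (intro tendsto_norm tendsto_diff[OF znt znt]) (use st in auto)
    show "\<forall>n\<ge>N. norm ((xn n t - un n t) - (xn n s - un n s)) \<le> C * (t - s)"
      using norm_set_integral_le_bound[OF vi vC st] vst[OF st] by (metis norm_minus_commute)
  qed
  from lipschitz_vector_derivative[of z, OF lip]
  obtain g where g: "set_integrable lborel {0..1} g"
    "AE t in lborel. t \<in> {0..1} \<longrightarrow> (z has_vector_derivative g t) (at t)"
    "\<And>s t. 0 \<le> s \<Longrightarrow> s \<le> t \<Longrightarrow> t \<le> 1 \<Longrightarrow> z t - z s = (LINT r:{s..t}|lborel. g r)"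
    by blast
  have z0: "z 0 = x0"
  proof (rule LIMSEQ_unique[OF znt])
    have "xn n 0 - un n 0 = x0" for n
      using veq[of 0 n] set_integral_Icc_split[OF vi[of n], of 0 0] by (simp add: algebra_simps)
    then show "(\<lambda>n. xn n 0 - un n 0) \<longlonglongrightarrow> x0" by simp
  qed simp
  have "AE t in lborel. t \<in> {0<..<1} \<longrightarrow> - g t \<in> subdifferential (lasso_objective A y \<mu>) (x t)"
    using g(2)
  proof eventually_elim
    case (elim t)
    show ?case
    proof
      assume t: "t \<in> {0<..<1}"
      then have dz: "(z has_vector_derivative g t) (at t)" using elim by auto
      show "- g t \<in> subdifferential (lasso_objective A y \<mu>) (x t)"
        unfolding subdifferential_def mem_Collect_eq
      proof (intro allI)
        fix q
        define c where "c = q - x t"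
        define f where "f = lasso_objective A y \<mu>"
        have "(- g t) \<bullet> c \<le> f q - f (x t)"
        proof (rule field_le_epsilon)
          fix e :: real assume "e > 0"
          \<comment> \<open>The error consists of \<open>\<omega>\<close> from continuity of the
            objective and \<open>\<bar>C\<bar> * \<omega>\<close> from moving the base point in the
            inner product, and \<open>(1 + \<bar>C\<bar>) * \<omega> \<le> e\<close>.\<close>
          define \<omega> where "\<omega> = e / (2 + \<bar>C\<bar>)"
          have "\<omega> > 0" using \<open>e > 0\<close> by (simp add: \<omega>_def)
          have "isCont f (x t)" using continuous_on_lasso_objective[of A y \<mu>]
            by (simp add: f_def continuous_on_eq_continuous_at)
          then obtain \<eta> where \<eta>: "\<eta> > 0" "\<And>p. dist p (x t) < \<eta> \<Longrightarrow> dist (f p) (f (x t)) < \<omega>"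
            using \<open>\<omega> > 0\<close> unfolding continuous_at_eps_delta by blast
          define \<eta>' where "\<eta>' = min \<eta> \<omega> / 2"
          have "\<eta>' > 0" using \<open>\<eta> > 0\<close> \<open>\<omega> > 0\<close> by (simp add: \<eta>'_def)
          obtain d0 where d0: "d0 > 0" "\<And>r. r \<in> {0..1} \<Longrightarrow> dist r t < d0 \<Longrightarrow> dist (x r) (x t) < \<eta>'"
            using cx[unfolded continuous_on_iff, rule_format, of t \<eta>'] t \<open>\<eta>' > 0\<close> by auto
          define d where "d = min d0 (1 - t)"
          have d: "d > 0" "t + d \<le> 1" using d0 t by (auto simp: d_def)
          have "\<forall>\<^sub>F n in sequentially. \<forall>t\<in>{0..1}. dist (xn n t) (x t) < \<eta>'"
            using uniform_limitD[OF x \<open>\<eta>' > 0\<close>] .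
          then obtain N1 where N1: "\<And>n t. n \<ge> N1 \<Longrightarrow> t \<in> {0..1} \<Longrightarrow> dist (xn n t) (x t) < \<eta>'"
            unfolding eventually_sequentially by blast
          \<comment> \<open>\<open>z t - z s\<close> is the limit of the integrals of
            \<open>v n\<close> over \<open>{t..s}\<close>, so this is the subgradient inequality
            summed over a short interval to the right of \<open>t\<close>.\<close>
          have quot: "(z t - z s) \<bullet> c \<le> (f q - f (x t) + e) * (s - t)" if s: "t < s" "s < t + d" for s
          proof (rule Lim_bounded)
            show "(\<lambda>n. ((xn n t - un n t) - (xn n s - un n s)) \<bullet> c) \<longlonglongrightarrow> (z t - z s) \<bullet> c"
              by (intro tendsto_inner tendsto_diff[OF znt znt] tendsto_const) (use s t d in auto)
            show "\<forall>n\<ge>max N N1. ((xn n t - un n t) - (xn n s - un n s)) \<bullet> c \<le> (f q - f (x t) + e) * (s - t)"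
            proof (intro allI impI)
              fix n assume n: "n \<ge> max N N1"
              have nN: "n \<ge> N" using n by simp
              have st: "0 \<le> t" "t \<le> s" "s \<le> 1" using s t d by auto
              have vts: "set_integrable lborel {t..s} (v n)"
                by (rule set_integrable_subset[OF vi]) (use st in auto)
              have ae: "AE r in lborel. r \<in> {t..s} \<longrightarrow> v n r \<bullet> c \<le> f q - f (x t) + e"
                using vsub[of n] vC[OF nN]
              proof eventually_elim
                case (elim r)
                show ?case
                proof
                  assume r: "r \<in> {t..s}"
                  then have r01: "r \<in> {0..1}" using st by auto
                  have sub: "f (xn n r) + v n r \<bullet> (q - xn n r) \<le> f q"
                    using elim(1) r01 unfolding subdifferential_def f_def by blast
                  have nv: "norm (v n r) \<le> C" using elim(2) r01 by blast
                  have "dist r t < d0" using r s by (auto simp: dist_real_def d_def)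
                  then have "dist (xn n r) (x t) < 2 * \<eta>'"
                    using d0(2)[OF r01] N1[of n r] n r01 dist_triangle[of "xn n r" "x t" "x r"] by simp
                  then have D: "dist (xn n r) (x t) < \<eta>" "dist (xn n r) (x t) < \<omega>"
                    by (auto simp: \<eta>'_def)
                  have 1: "f (xn n r) \<ge> f (x t) - \<omega>" using \<eta>(2)[OF D(1)] by (simp add: dist_real_def)
                  have "v n r \<bullet> (xn n r - x t) \<le> norm (v n r) * norm (xn n r - x t)" by (rule norm_cauchy_schwarz)
                  also have "\<dots> \<le> \<bar>C\<bar> * \<omega>" using nv D(2) by (intro mult_mono) (auto simp: dist_norm)
                  finally have 2: "v n r \<bullet> (xn n r - x t) \<le> \<bar>C\<bar> * \<omega>" .
                  have "v n r \<bullet> c = v n r \<bullet> (q - xn n r) + v n r \<bullet> (xn n r - x t)"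
                    by (simp add: c_def inner_diff_right)
                  also have "\<dots> \<le> f q - f (x t) + (1 + \<bar>C\<bar>) * \<omega>"
                    using 1 2 sub by (simp add: algebra_simps)
                  also have "(1 + \<bar>C\<bar>) * \<omega> \<le> e" using \<open>e > 0\<close> by (simp add: \<omega>_def field_simps)
                  finally show "v n r \<bullet> c \<le> f q - f (x t) + e" by simp
                qed
              qed
              have bl: "bounded_linear (\<lambda>p. p \<bullet> c)" by (rule bounded_linear_inner_left)
              have "((xn n t - un n t) - (xn n s - un n s)) \<bullet> c = (LINT r:{t..s}|lborel. v n r) \<bullet> c"
                using vst[OF st] by simp
              also have "\<dots> = (LINT r:{t..s}|lborel. v n r \<bullet> c)"
                using integral_bounded_linear[OF bl vts[unfolded set_integrable_def]] by (simp add: set_lebesgue_integral_def)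
              also have "\<dots> \<le> (LINT r:{t..s}|lborel. f q - f (x t) + e)"
              proof (rule set_integral_mono_AE)
                show "set_integrable lborel {t..s} (\<lambda>r. v n r \<bullet> c)"
                  using integrable_bounded_linear[OF bl vts[unfolded set_integrable_def]] by (simp add: set_integrable_def)
                show "set_integrable lborel {t..s} (\<lambda>r. f q - f (x t) + e)"
                  by (rule set_integrable_bounded_Icc[where B="\<bar>f q - f (x t) + e\<bar>"]) auto
                show "AE r\<in>{t..s} in lborel. v n r \<bullet> c \<le> f q - f (x t) + e" using ae by simp
              qed
              also have "\<dots> = (f q - f (x t) + e) * (s - t)" using st by (simp add: set_integral_const)
              finally show "((xn n t - un n t) - (xn n s - un n s)) \<bullet> c \<le> (f q - f (x t) + e) * (s - t)" .
            qed
          qed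
          have dzc: "((\<lambda>s. z s \<bullet> c) has_real_derivative (g t \<bullet> c)) (at t)"
            using bounded_linear.has_vector_derivative[OF bounded_linear_inner_left dz, of c]
            by (simp add: has_real_derivative_iff_has_vector_derivative)
          have "((\<lambda>s. (z s \<bullet> c - z t \<bullet> c) / (s - t)) \<longlongrightarrow> g t \<bullet> c) (at_right t)"
            using dzc unfolding has_field_derivative_iff by (rule filterlim_mono) (auto simp: at_le)
          moreover have "\<forall>\<^sub>F s in at_right t. (z s \<bullet> c - z t \<bullet> c) / (s - t) \<ge> - (f q - f (x t) + e)"
          proof -
            have "t < t + d" using d by simp
            then show ?thesis
              unfolding eventually_at_right[OF \<open>t < t + d\<close>]
            proof (intro exI[of _ "t + d"] conjI allI impI)
              fix s assume s: "t < s" "s < t + d"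
              have "- (f q - f (x t) + e) * (s - t) \<le> z s \<bullet> c - z t \<bullet> c"
                using quot[OF s] by (simp add: inner_diff_left algebra_simps)
              then show "(z s \<bullet> c - z t \<bullet> c) / (s - t) \<ge> - (f q - f (x t) + e)"
                using s by (simp add: pos_le_divide_eq)
            qed
          qed
          ultimately have "- (f q - f (x t) + e) \<le> g t \<bullet> c"
            by (rule tendsto_lowerbound) simp
          then show "(- g t) \<bullet> c \<le> f q - f (x t) + e" by simp
        qed
        then show "lasso_objective A y \<mu> (x t) + - g t \<bullet> (q - x t) \<le> lasso_objective A y \<mu> q"
          by (simp add: f_def c_def)
      qed
    qed
  qed
  then have "AE t in lborel. t \<in> {0..1} \<longrightarrow> - g t \<in> subdifferential (lasso_objective A y \<mu>) (x t)"
    by (rule AE_lborel_Icc_imp_Ioo)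
  moreover have "set_integrable lborel {0..1} (\<lambda>t. - g t)"
    using g(1) by (simp add: set_integrable_def)
  moreover have "x t = x0 - (LINT s:{0..t}|lborel. - g s) + u t" if "t \<in> {0..1}" for t
  proof -
    have "(LINT s:{0..t}|lborel. - g s) = - (z t - z 0)"
      using g(3)[of 0 t] that by (simp add: set_lebesgue_integral_def)
    then show ?thesis using z0 by (simp add: z_def)
  qed
  ultimately have "driven_solution A y \<mu> x0 u x"
    unfolding driven_solution_def using cx by (intro conjI exI[of _ "\<lambda>t. - g t"]) auto
  then show ?thesis by blast
qed

section \<open>The rate function as an energy of driving paths\<close>

definition lasso_gradient :: "real ^ 'd ^ 'n \<Rightarrow> real ^ 'n \<Rightarrow> real ^ 'd \<Rightarrow> real ^ 'd" where
  "lasso_gradient A y x = transpose A *v (A *v x - y)"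

lemma b1_eq: "b1 A y \<mu> i x = - (lasso_gradient A y x $ i) + \<mu>"
  and b2_eq: "b2 A y \<mu> i x = - (lasso_gradient A y x $ i) - \<mu>"
  by (simp_all add: b1_def b2_def lasso_gradient_def matrix_vector_mul_component row_def del: transpose_matrix_vector)

section \<open>The running cost as a minimum over subgradients\<close>

lemma subdifferential_lasso_component:
  fixes A :: "real ^ 'd ^ 'n"
  assumes "\<mu> > 0"
  shows "v \<in> subdifferential (lasso_objective A y \<mu>) x \<longleftrightarrow>
    (\<forall>i. \<exists>\<zeta>. \<zeta> \<in> sgn_set (x $ i) \<and> v $ i = lasso_gradient A y x $ i + \<mu> * \<zeta>)" (is "?l \<longleftrightarrow> ?r")
proof
  assume ?l then show ?r
    unfolding subdifferential_lasso_objective[OF assms] lasso_gradient_def by auto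
next
  assume ?r
  then obtain \<zeta> where \<zeta>: "\<And>i. \<zeta> i \<in> sgn_set (x $ i)" "\<And>i. v $ i = lasso_gradient A y x $ i + \<mu> * \<zeta> i" by metis
  have "v = transpose A *v (A *v x - y) + \<mu> *\<^sub>R (\<chi> i. \<zeta> i)"
    using \<zeta>(2) by (simp add: vec_eq_iff lasso_gradient_def del: transpose_matrix_vector)
  then show ?l unfolding subdifferential_lasso_objective[OF assms] using \<zeta>(1) by (auto intro!: exI[of _ "\<chi> i. \<zeta> i"])
qed

text \<open>The velocities are chosen relative to their drifts, so that \<open>\<beta>1 - b1\<close>
  and \<open>\<beta>2 - b2\<close> are the same number, the one being squared; the weights
  \<open>(1 - \<zeta>) / 2\<close> and \<open>(1 + \<zeta>) / 2\<close> then give mean velocity 0.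
  Strictness of \<open>\<bar>\<zeta>\<bar> < 1\<close> matches the strictly positive weights of the
  set.\<close>

lemma L0_set_member:
  fixes A :: "real ^ 'd ^ 'n"
  assumes "\<mu> > 0" "\<bar>\<zeta>\<bar> < 1"
  shows "(lasso_gradient A y x $ i + \<mu> * \<zeta>)\<^sup>2 \<in>
    {p1 * \<bar>\<beta>1 - b1 A y \<mu> i x\<bar>\<^sup>2 + p2 * \<bar>\<beta>2 - b2 A y \<mu> i x\<bar>\<^sup>2 | p1 p2 \<beta>1 \<beta>2.
           p1 > 0 \<and> p2 > 0 \<and> p1 + p2 = 1 \<and> \<beta>1 \<ge> 0 \<and> \<beta>2 \<le> 0 \<and> p1 * \<beta>1 + p2 * \<beta>2 = 0}"
proof -
  define G where "G = lasso_gradient A y x $ i"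
  have 1: "\<mu> * (1 + \<zeta>) - b1 A y \<mu> i x = G + \<mu> * \<zeta>" "- (\<mu> * (1 - \<zeta>)) - b2 A y \<mu> i x = G + \<mu> * \<zeta>"
    by (simp_all add: b1_eq b2_eq G_def algebra_simps)
  have 2: "(G + \<mu> * \<zeta>)\<^sup>2 = (1 - \<zeta>) / 2 * \<bar>\<mu> * (1 + \<zeta>) - b1 A y \<mu> i x\<bar>\<^sup>2 + (1 + \<zeta>) / 2 * \<bar>- (\<mu> * (1 - \<zeta>)) - b2 A y \<mu> i x\<bar>\<^sup>2"
    unfolding 1 power2_abs by (simp add: field_simps)
  have "\<mu> * (1 + \<zeta>) \<ge> 0" "\<mu> * (1 - \<zeta>) \<ge> 0"
    using assms by (intro mult_nonneg_nonneg; simp add: abs_less_iff)+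
  moreover from this have "- (\<mu> * (1 - \<zeta>)) \<le> 0" by linarith
  moreover have "(1 - \<zeta>) / 2 > 0" "(1 + \<zeta>) / 2 > 0" "(1 - \<zeta>) / 2 + (1 + \<zeta>) / 2 = 1"
    "(1 - \<zeta>) / 2 * (\<mu> * (1 + \<zeta>)) + (1 + \<zeta>) / 2 * (- (\<mu> * (1 - \<zeta>))) = 0"
    using assms by (auto simp: field_simps)
  ultimately show ?thesis unfolding G_def[symmetric] 2 by blast
qed

text \<open>The weights of the preceding witness degenerate when
  \<open>\<bar>\<zeta>\<bar> = 1\<close>. This case is reached by replacing \<open>\<zeta>\<close>
  with \<open>s * \<zeta>\<close> and letting \<open>s\<close> tend to 1 from below.\<close>

lemma L0_zero_le:
  fixes A :: "real ^ 'd ^ 'n"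
  assumes "\<mu> > 0" "\<bar>\<zeta>\<bar> \<le> 1"
  shows "L0 A y \<mu> i x 0 \<le> (lasso_gradient A y x $ i + \<mu> * \<zeta>)\<^sup>2"
proof (rule tendsto_lowerbound)
  show "((\<lambda>s. (lasso_gradient A y x $ i + \<mu> * (s * \<zeta>))\<^sup>2) \<longlongrightarrow> (lasso_gradient A y x $ i + \<mu> * \<zeta>)\<^sup>2) (at_left 1)"
    by (auto intro!: tendsto_eq_intros)
  have "L0 A y \<mu> i x 0 \<le> (lasso_gradient A y x $ i + \<mu> * (s * \<zeta>))\<^sup>2" if "0 < s" "s < 1" for s
    unfolding L0_def
  proof (rule cInf_lower[OF L0_set_member[OF assms(1)]])
    have "\<bar>s * \<zeta>\<bar> \<le> s * 1" using that assms(2) by (simp add: abs_mult)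
    then show "\<bar>s * \<zeta>\<bar> < 1" using that by simp
    show "bdd_below {p1 * \<bar>\<beta>1 - b1 A y \<mu> i x\<bar>\<^sup>2 + p2 * \<bar>\<beta>2 - b2 A y \<mu> i x\<bar>\<^sup>2 | p1 p2 \<beta>1 \<beta>2.
           p1 > 0 \<and> p2 > 0 \<and> p1 + p2 = 1 \<and> \<beta>1 \<ge> 0 \<and> \<beta>2 \<le> 0 \<and> p1 * \<beta>1 + p2 * \<beta>2 = 0}"
      by (rule bdd_belowI[of _ 0]) auto
  qed
  moreover have "(0::real) < 1" by simp
  ultimately show "\<forall>\<^sub>F s in at_left 1. L0 A y \<mu> i x 0 \<le> (lasso_gradient A y x $ i + \<mu> * (s * \<zeta>))\<^sup>2"
    unfolding eventually_at_left[OF \<open>(0::real) < 1\<close>] by (intro exI[of _ 0]) auto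
qed simp

text \<open>The point of \<open>{-1..1}\<close> nearest to \<open>- G / \<mu>\<close>, that is, the
  sign that brings the drift \<open>G + \<mu> * \<zeta>\<close> closest to 0. The explicit formula
  keeps the optimal drift measurable along a path.\<close>

definition optimal_sign :: "real \<Rightarrow> real \<Rightarrow> real" where
  "optimal_sign \<mu> G = max (- 1) (min 1 (- G / \<mu>))"

lemma optimal_sign_le:
  assumes "\<mu> > 0" "\<bar>\<zeta>\<bar> \<le> 1"
  shows "(G + \<mu> * optimal_sign \<mu> G)\<^sup>2 \<le> (G + \<mu> * \<zeta>)\<^sup>2"
proof -
  have z: "\<mu> * \<zeta> \<le> \<mu>" "- \<mu> \<le> \<mu> * \<zeta>"
    using mult_left_mono[of \<zeta> 1 \<mu>] mult_left_mono[of "-1" \<zeta> \<mu>] assms by auto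
  consider "G > \<mu>" | "G < - \<mu>" | "\<bar>G\<bar> \<le> \<mu>" by linarith
  then show ?thesis
  proof cases
    case 1
    have "- G / \<mu> \<le> - 1" using 1 assms(1) by (simp add: field_simps)
    then have "optimal_sign \<mu> G = - 1" unfolding optimal_sign_def by linarith
    moreover have "(G - \<mu>)\<^sup>2 \<le> (G + \<mu> * \<zeta>)\<^sup>2" using 1 z by (intro power_mono) auto
    ultimately show ?thesis by simp
  next
    case 2
    have "- G / \<mu> \<ge> 1" using 2 assms(1) by (simp add: field_simps)
    then have "optimal_sign \<mu> G = 1" unfolding optimal_sign_def by linarith
    moreover have "(- G - \<mu>)\<^sup>2 \<le> (- G - \<mu> * \<zeta>)\<^sup>2" using 2 z by (intro power_mono) auto
    moreover have "(- G - \<mu>)\<^sup>2 = (G + \<mu>)\<^sup>2" "(- G - \<mu> * \<zeta>)\<^sup>2 = (G + \<mu> * \<zeta>)\<^sup>2"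
      by (simp_all add: power2_eq_square algebra_simps)
    ultimately show ?thesis by simp
  next
    case 3
    have "- G / \<mu> \<le> 1" "- 1 \<le> - G / \<mu>" using 3 assms(1) by (auto simp: field_simps)
    then have "optimal_sign \<mu> G = - G / \<mu>" unfolding optimal_sign_def by linarith
    then show ?thesis using assms(1) by simp
  qed
qed

lemma optimal_sign_bounds: "\<bar>optimal_sign \<mu> G\<bar> \<le> 1"
  unfolding optimal_sign_def by linarith

text \<open>Convexity of the square moves the weights inside, where they become the single number \<open>p2 - p1\<close> in \<open>[-1,1]\<close>.\<close>

lemma L0_zero_ge:
  fixes A :: "real ^ 'd ^ 'n" and y :: "real ^ 'n" and x :: "real ^ 'd" and i :: 'd
  assumes "\<mu> > 0"
  defines "G \<equiv> lasso_gradient A y x $ i"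
  shows "(G + \<mu> * optimal_sign \<mu> G)\<^sup>2 \<le> L0 A y \<mu> i x 0"
  unfolding L0_def
proof (rule cInf_greatest)
  show "{p1 * \<bar>\<beta>1 - b1 A y \<mu> i x\<bar>\<^sup>2 + p2 * \<bar>\<beta>2 - b2 A y \<mu> i x\<bar>\<^sup>2 | p1 p2 \<beta>1 \<beta>2.
           p1 > 0 \<and> p2 > 0 \<and> p1 + p2 = 1 \<and> \<beta>1 \<ge> 0 \<and> \<beta>2 \<le> 0 \<and> p1 * \<beta>1 + p2 * \<beta>2 = 0} \<noteq> {}"
    using L0_set_member[OF assms(1), of 0 A y x i] by auto
  fix q assume "q \<in> {p1 * \<bar>\<beta>1 - b1 A y \<mu> i x\<bar>\<^sup>2 + p2 * \<bar>\<beta>2 - b2 A y \<mu> i x\<bar>\<^sup>2 | p1 p2 \<beta>1 \<beta>2.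
           p1 > 0 \<and> p2 > 0 \<and> p1 + p2 = 1 \<and> \<beta>1 \<ge> 0 \<and> \<beta>2 \<le> 0 \<and> p1 * \<beta>1 + p2 * \<beta>2 = 0}"
  then obtain p1 p2 \<beta>1 \<beta>2 where q: "q = p1 * \<bar>\<beta>1 - b1 A y \<mu> i x\<bar>\<^sup>2 + p2 * \<bar>\<beta>2 - b2 A y \<mu> i x\<bar>\<^sup>2"
    and p: "p1 > 0" "p2 > 0" "p1 + p2 = 1" and \<beta>: "p1 * \<beta>1 + p2 * \<beta>2 = 0" by blast
  define c1 c2 where "c1 = \<beta>1 - b1 A y \<mu> i x" and "c2 = \<beta>2 - b2 A y \<mu> i x"
  have p2: "p2 = 1 - p1" using p by simp
  have "p1 * c1\<^sup>2 + p2 * c2\<^sup>2 - (p1 * c1 + p2 * c2)\<^sup>2 = p1 * p2 * (c1 - c2)\<^sup>2"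
    unfolding p2 by (simp add: power2_eq_square algebra_simps)
  moreover have "0 \<le> p1 * p2 * (c1 - c2)\<^sup>2" using p by simp
  ultimately have 1: "(p1 * c1 + p2 * c2)\<^sup>2 \<le> q" by (simp add: q c1_def c2_def)
  have "p1 * c1 + p2 * c2 = (p1 * \<beta>1 + p2 * \<beta>2) + (p1 + p2) * G + \<mu> * (p2 - p1)"
    by (simp add: c1_def c2_def b1_eq b2_eq G_def algebra_simps)
  then have 2: "p1 * c1 + p2 * c2 = G + \<mu> * (p2 - p1)" using \<beta> p by simp
  have "(G + \<mu> * optimal_sign \<mu> G)\<^sup>2 \<le> (G + \<mu> * (p2 - p1))\<^sup>2"
    by (rule optimal_sign_le[OF assms(1)]) (use p in auto)
  then show "(G + \<mu> * optimal_sign \<mu> G)\<^sup>2 \<le> q" using 1 2 by simp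
qed

text \<open>The zeros of \<open>f\<close> with nonzero derivative form the preimage of the null set
  \<open>{0}\<close> under a map whose derivative is injective there, hence a negligible set.
  Consequently \<open>L0\<close> matters to the rate function only at velocity 0.\<close>

lemma AE_derivative_zero_on_zero_set:
  fixes f :: "real \<Rightarrow> real"
  shows "AE t in lborel. \<forall>D. (f has_real_derivative D) (at t) \<longrightarrow> f t = 0 \<longrightarrow> D = 0"
proof -
  define S where "S = {t. \<exists>D. D \<noteq> 0 \<and> (f has_real_derivative D) (at t)}"
  have "negligible {t \<in> S. f t \<in> {0}}"
  proof (rule negligible_differentiable_vimage[where f'="\<lambda>t h. deriv f t * h"])
    fix t assume "t \<in> S"
    then obtain D where D: "D \<noteq> 0" "(f has_real_derivative D) (at t)" by (auto simp: S_def)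
    then have "deriv f t = D" by (simp add: DERIV_imp_deriv)
    then show "inj (\<lambda>h. deriv f t * h)" "(f has_derivative (\<lambda>h. deriv f t * h)) (at t within S)"
      using D by (auto simp: inj_def has_field_derivative_def intro: has_derivative_at_withinI)
  qed simp
  then have "{t \<in> S. f t \<in> {0}} \<in> null_sets (completion lborel)" by (simp add: negligible_iff_null_sets)
  then obtain N where N: "N \<in> null_sets lborel" "{t \<in> S. f t \<in> {0}} \<subseteq> N" unfolding null_sets_completion_iff2 by blast
  have "AE t in lborel. t \<notin> N" using N(1) by (rule AE_not_in)
  then show ?thesis
  proof eventually_elim
    case (elim t)
    then have "t \<notin> {t \<in> S. f t \<in> {0}}" using N(2) by blast
    then show ?case by (auto simp: S_def)
  qed
qed

section \<open>Comparison of the rate function with the energy of driving paths\<close>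

lemma nn_integral_norm_square_vec:
  fixes g :: "'a \<Rightarrow> real ^ 'd"
  assumes "g \<in> borel_measurable M" "S \<in> sets M"
  shows "(\<integral>\<^sup>+t\<in>S. ennreal ((norm (g t))\<^sup>2) \<partial>M) = (\<Sum>i\<in>UNIV. \<integral>\<^sup>+t\<in>S. ennreal ((g t $ i)\<^sup>2) \<partial>M)"
proof -
  have "(norm (g t))\<^sup>2 = (\<Sum>i\<in>UNIV. (g t $ i)\<^sup>2)" for t
    unfolding power2_norm_eq_inner inner_vec_def by (simp add: power2_eq_square)
  then have "ennreal ((norm (g t))\<^sup>2) * indicator S t = (\<Sum>i\<in>UNIV. ennreal ((g t $ i)\<^sup>2) * indicator S t)" for t
    by (simp add: sum_distrib_right[symmetric])
  then have "(\<integral>\<^sup>+t\<in>S. ennreal ((norm (g t))\<^sup>2) \<partial>M) = (\<integral>\<^sup>+t. (\<Sum>i\<in>UNIV. ennreal ((g t $ i)\<^sup>2) * indicator S t) \<partial>M)"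
    by simp
  also have "\<dots> = (\<Sum>i\<in>UNIV. \<integral>\<^sup>+t\<in>S. ennreal ((g t $ i)\<^sup>2) \<partial>M)"
  proof (rule nn_integral_sum)
    note assms[measurable]
    show "(\<lambda>t. ennreal ((g t $ i)\<^sup>2) * indicator S t) \<in> borel_measurable M" for i by measurable
  qed
  finally show ?thesis .
qed

lemma deriv_restrict_component:
  fixes x :: "real \<Rightarrow> real ^ 'd"
  assumes "((\<lambda>s. x s $ i) has_real_derivative D) (at t)" "t \<in> {0<..<1}"
  shows "deriv (\<lambda>s. restrict x {0..1} s $ i) t = D"
proof (rule DERIV_imp_deriv)
  show "((\<lambda>s. restrict x {0..1} s $ i) has_real_derivative D) (at t)"
    by (rule has_field_derivative_transform_within_open[OF assms(1), of "{0<..<1}"]) (use assms(2) in auto)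
qed

text \<open>Any drift occurring in the driven equation is a feasible choice in the minimum that
  \<open>L_tilde\<close> represents, and \<open>g\<close> is almost everywhere the sum of that drift
  and the velocity. The Lipschitz bound on \<open>u\<close> makes the solution absolutely
  continuous.\<close>

lemma rate_function_le_energy:
  fixes A :: "real ^ 'd ^ 'n"
  assumes "\<mu> > 0" and sol: "driven_solution A y \<mu> x0 u x" and u0: "u 0 = 0"
    and lip: "\<And>s t. 0 \<le> s \<Longrightarrow> s \<le> t \<Longrightarrow> t \<le> 1 \<Longrightarrow> norm (u t - u s) \<le> B * (t - s)"
    and g: "g \<in> borel_measurable borel" "AE t in lborel. t \<in> {0..1} \<longrightarrow> (u has_vector_derivative g t) (at t)"
  shows "rate_function A y \<mu> x0 (restrict x {0..1}) \<le> enn2ereal (\<integral>\<^sup>+t\<in>{0..1}. ennreal ((norm (g t))\<^sup>2) \<partial>lborel)"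
proof -
  define \<phi> where "\<phi> = restrict x {0..1}"
  obtain v where cx: "continuous_on {0..1} x" and v: "set_integrable lborel {0..1} v"
    "AE t in lborel. t \<in> {0..1} \<longrightarrow> v t \<in> subdifferential (lasso_objective A y \<mu>) (x t)"
    "\<And>t. t \<in> {0..1} \<Longrightarrow> x t = x0 - (LINT s:{0..t}|lborel. v s) + u t"
    using sol unfolding driven_solution_def by blast
  obtain C where C: "AE t in lborel. t \<in> {0..1} \<longrightarrow> norm (v t) \<le> C"
    using drift_bounded[OF assms(1) cx v(2)] by blast
  have mv: "set_integrable lborel {0..1} (\<lambda>t. - v t)" using v(1) by (simp add: set_integrable_def)
  have mC: "AE t in lborel. t \<in> {0..1} \<longrightarrow> norm (- v t) \<le> C" using C by simp
  have zeq: "x t - u t = x0 + (LINT s:{0..t}|lborel. - v s)" if "t \<in> {0..1}" for t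
    using v(3)[OF that] by (simp add: set_lebesgue_integral_def)
  have dz: "AE t in lborel. t \<in> {0..1} \<longrightarrow> ((\<lambda>t. x t - u t) has_vector_derivative (- v t)) (at t)"
    by (rule bounded_integral_has_vector_derivative[OF mv mC zeq])
  have xlip: "norm (x t - x s) \<le> (C + B) * (t - s)" if st: "0 \<le> s" "s \<le> t" "t \<le> 1" for s t
  proof -
    have "x t - x s = (LINT r:{s..t}|lborel. - v r) + (u t - u s)"
      using zeq[of s] zeq[of t] set_integral_Icc_split[OF mv st] st by (simp add: algebra_simps)
    then have "norm (x t - x s) \<le> norm (LINT r:{s..t}|lborel. - v r) + norm (u t - u s)"
      using norm_triangle_ineq by metis
    then show ?thesis using norm_set_integral_le_bound[OF mv mC st] lip[OF st] by (simp add: algebra_simps)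
  qed
  have AC: "abs_continuous_on_interval 0 1 \<phi>"
    by (rule lipschitz_imp_abs_continuous_on_interval[where B="C + B"]) (use xlip in \<open>auto simp: \<phi>_def\<close>)
  have \<phi>0: "\<phi> 0 = x0"
    using zeq[of 0] set_integral_Icc_split[OF mv, of 0 0] u0 by (simp add: \<phi>_def)
  have le: "AE t in lborel. t \<in> {0..1} \<longrightarrow> L_tilde A y \<mu> i (\<phi> t) (deriv (\<lambda>s. \<phi> s $ i) t) \<le> (g t $ i)\<^sup>2" for i
  proof (rule AE_lborel_Icc_imp_Ioo)
    show "AE t in lborel. t \<in> {0<..<1} \<longrightarrow> L_tilde A y \<mu> i (\<phi> t) (deriv (\<lambda>s. \<phi> s $ i) t) \<le> (g t $ i)\<^sup>2"
      using g(2) dz v(2) AE_derivative_zero_on_zero_set[of "\<lambda>t. x t $ i"]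
    proof eventually_elim
      case (elim t)
      show ?case
      proof
        assume t: "t \<in> {0<..<1}"
        have "(x has_vector_derivative (- v t + g t)) (at t)"
        proof -
          have "((\<lambda>t. x t - u t) has_vector_derivative - v t) (at t)" "(u has_vector_derivative g t) (at t)"
            using elim t by auto
          from has_vector_derivative_add[OF this] show ?thesis by simp
        qed
        then have d: "((\<lambda>s. x s $ i) has_real_derivative (- v t $ i + g t $ i)) (at t)"
          by (simp add: has_vector_derivative_vec_iff)
        have D: "deriv (\<lambda>s. \<phi> s $ i) t = - v t $ i + g t $ i"
          unfolding \<phi>_def by (rule deriv_restrict_component[OF d t])
        have \<phi>t: "\<phi> t = x t" using t by (simp add: \<phi>_def)
        obtain \<zeta> where \<zeta>: "\<zeta> \<in> sgn_set (x t $ i)" "v t $ i = lasso_gradient A y (x t) $ i + \<mu> * \<zeta>"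
          using elim(3) t unfolding subdifferential_lasso_component[OF assms(1)] by auto
        consider "x t $ i < 0" | "x t $ i > 0" | "x t $ i = 0" by linarith
        then show "L_tilde A y \<mu> i (\<phi> t) (deriv (\<lambda>s. \<phi> s $ i) t) \<le> (g t $ i)\<^sup>2"
        proof cases
          case 1
          then show ?thesis using \<zeta> by (simp add: D \<phi>t L_tilde_def L1_def b1_eq sgn_set_def)
        next
          case 2
          then show ?thesis using \<zeta> by (simp add: D \<phi>t L_tilde_def L2_def b2_eq sgn_set_def)
        next
          case 3
          have "- v t $ i + g t $ i = 0" using elim(4) d 3 by blast
          moreover have "L0 A y \<mu> i (x t) 0 \<le> (v t $ i)\<^sup>2"
            unfolding \<zeta>(2) by (rule L0_zero_le[OF assms(1)]) (use \<zeta>(1) 3 in \<open>auto simp: sgn_set_def\<close>)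
          ultimately show ?thesis using 3 by (simp add: D \<phi>t L_tilde_def)
        qed
      qed
    qed
  qed
  have "(\<Sum>i\<in>UNIV. \<integral>\<^sup>+t\<in>{0..1}. ennreal (L_tilde A y \<mu> i (\<phi> t) (deriv (\<lambda>s. \<phi> s $ i) t)) \<partial>lborel)
    \<le> (\<Sum>i\<in>UNIV. \<integral>\<^sup>+t\<in>{0..1}. ennreal ((g t $ i)\<^sup>2) \<partial>lborel)"
  proof (rule sum_mono)
    fix i
    show "(\<integral>\<^sup>+t\<in>{0..1}. ennreal (L_tilde A y \<mu> i (\<phi> t) (deriv (\<lambda>s. \<phi> s $ i) t)) \<partial>lborel)
      \<le> (\<integral>\<^sup>+t\<in>{0..1}. ennreal ((g t $ i)\<^sup>2) \<partial>lborel)"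
      using le[of i] by (intro nn_integral_mono_AE) (auto elim!: eventually_mono simp: indicator_def intro: ennreal_leI)
  qed
  also have "\<dots> = (\<integral>\<^sup>+t\<in>{0..1}. ennreal ((norm (g t))\<^sup>2) \<partial>lborel)"
    using g(1) by (intro nn_integral_norm_square_vec[symmetric]) auto
  finally show ?thesis
    unfolding rate_function_def \<phi>_def[symmetric] using AC \<phi>0 by (simp add: less_eq_ennreal.rep_eq)
qed

text \<open>Membership of \<open>\<psi> - \<psi> 0\<close> in the Cameron--Martin space with squared
  norm at most \<open>E\<close>. Naming the density \<open>g\<close> avoids any statement about
  differentiability.\<close>

definition energy_le :: "(real \<Rightarrow> real ^ 'd) \<Rightarrow> real \<Rightarrow> bool" where
  "energy_le \<psi> E \<longleftrightarrow> (\<exists>g. g \<in> borel_measurable borel \<and> set_integrable lborel {0..1} g \<and>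
     (\<forall>s t. 0 \<le> s \<longrightarrow> s \<le> t \<longrightarrow> t \<le> 1 \<longrightarrow> \<psi> t - \<psi> s = (LINT r:{s..t}|lborel. g r)) \<and>
     (\<integral>\<^sup>+t\<in>{0..1}. ennreal ((norm (g t))\<^sup>2) \<partial>lborel) \<le> ennreal E)"

text \<open>The converse comparison: taking the cost-minimizing subgradient \<open>v\<close> at
  every time gives a measurable drift, and \<open>\<psi>\<close> is the driving path that the
  equation then demands. Its density is velocity plus \<open>v\<close>, whose squared coordinates
  are bounded by \<open>L_tilde\<close> almost everywhere.\<close>

lemma rate_function_driving_path:
  fixes A :: "real ^ 'd ^ 'n"
  assumes "\<mu> > 0" and fin: "rate_function A y \<mu> x0 \<phi> \<noteq> \<infinity>"
  shows "\<exists>\<psi> E. driven_solution A y \<mu> x0 \<psi> \<phi> \<and> \<psi> 0 = 0 \<and> energy_le \<psi> E \<and> E \<ge> 0 \<and> rate_function A y \<mu> x0 \<phi> = ereal E"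
proof -
  define r where "r = (\<Sum>i\<in>UNIV. \<integral>\<^sup>+t\<in>{0..1}. ennreal (L_tilde A y \<mu> i (\<phi> t) (deriv (\<lambda>s. \<phi> s $ i) t)) \<partial>lborel)"
  have AC: "abs_continuous_on_interval 0 1 \<phi>" and \<phi>0: "\<phi> 0 = x0"
    using fin by (auto simp: rate_function_def split: if_splits)
  have rate: "rate_function A y \<mu> x0 \<phi> = enn2ereal r"
    using AC \<phi>0 by (simp add: rate_function_def r_def)
  have "r \<noteq> \<infinity>" using fin rate by auto
  then obtain E where E: "r = ennreal E" "E \<ge> 0" by (cases r) auto
  have c\<phi>: "continuous_on {0..1} \<phi>" by (rule abs_continuous_on_interval_imp_continuous_on[OF AC])
  \<comment> \<open>Only the values of the path on \<open>{0..1}\<close> are controlled; freezing it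
    outside gives a continuous, hence Borel, function on the line.\<close>
  define \<Phi> where "\<Phi> t = \<phi> (max 0 (min 1 t))" for t
  have \<Phi>: "\<Phi> t = \<phi> t" if "t \<in> {0..1}" for t using that by (simp add: \<Phi>_def)
  have "continuous_on UNIV \<Phi>"
    unfolding \<Phi>_def by (rule continuous_on_compose2[OF c\<phi>]) (auto intro!: continuous_intros)
  then have \<Phi>m: "\<Phi> \<in> borel_measurable borel" by (rule borel_measurable_continuous_onI)
  have "continuous_on UNIV (lasso_gradient A y)"
    unfolding lasso_gradient_def
    by (intro continuous_intros continuous_on_compose2[OF linear_continuous_on[OF matrix_vector_mul_bounded_linear]]
        linear_continuous_on[OF matrix_vector_mul_bounded_linear]) auto
  then have "lasso_gradient A y \<in> borel_measurable borel" by (rule borel_measurable_continuous_onI)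
  then have Gm: "(\<lambda>t. lasso_gradient A y (\<Phi> t) $ i) \<in> borel_measurable borel" for i
    using measurable_compose[OF \<Phi>m] by (intro borel_measurable_vec_nth) auto
  define \<zeta> where "\<zeta> i t = (if \<Phi> t $ i > 0 then 1 else if \<Phi> t $ i < 0 then - 1 else
    optimal_sign \<mu> (lasso_gradient A y (\<Phi> t) $ i))" for i t
  define v where "v t = (\<chi> i. lasso_gradient A y (\<Phi> t) $ i + \<mu> * \<zeta> i t)" for t
  have \<Phi>im: "(\<lambda>t. \<Phi> t $ i) \<in> borel_measurable borel" for i using \<Phi>m by (rule borel_measurable_vec_nth)
  have "\<zeta> i \<in> borel_measurable borel" for i
  proof -
    note \<Phi>im[measurable] Gm[measurable]
    show ?thesis unfolding \<zeta>_def optimal_sign_def by measurable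
  qed
  then have vm: "v \<in> borel_measurable borel"
    unfolding v_def using Gm by (intro borel_measurable_vec_lambda borel_measurable_add borel_measurable_times) auto
  have vsub: "v t \<in> subdifferential (lasso_objective A y \<mu>) (\<Phi> t)" for t
    unfolding subdifferential_lasso_component[OF assms(1)]
  proof
    fix i
    have "\<zeta> i t \<in> sgn_set (\<Phi> t $ i)"
      using optimal_sign_bounds[of \<mu> "lasso_gradient A y (\<Phi> t) $ i"] by (auto simp: \<zeta>_def sgn_set_def abs_le_iff)
    then show "\<exists>\<zeta>. \<zeta> \<in> sgn_set (\<Phi> t $ i) \<and> v t $ i = lasso_gradient A y (\<Phi> t) $ i + \<mu> * \<zeta>"
      by (auto simp: v_def)
  qed
  have vsub': "AE t in lborel. t \<in> {0..1} \<longrightarrow> v t \<in> subdifferential (lasso_objective A y \<mu>) (\<phi> t)"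
    using vsub \<Phi> by (intro AE_I2) metis
  obtain C where C: "AE t in lborel. t \<in> {0..1} \<longrightarrow> norm (v t) \<le> C"
    using drift_bounded[OF assms(1) c\<phi> vsub'] by blast
  have vi: "set_integrable lborel {0..1} v" by (rule set_integrable_bounded_Icc[OF vm C])
  have ACi: "abs_continuous_on_interval 0 1 (\<lambda>t. \<phi> t $ i)" for i
    unfolding abs_continuous_on_interval_def
  proof (intro allI impI)
    fix e :: real assume "e > 0"
    then obtain \<delta> where "\<delta> > 0" and \<delta>: "\<And>n s t. (\<forall>k<n. 0 \<le> s k \<and> s k \<le> t k \<and> t k \<le> 1) \<and>
        pairwise (\<lambda>j k. {s j<..<t j} \<inter> {s k<..<t k} = {}) {..<n::nat} \<and>
        (\<Sum>k<n. t k - s k) < \<delta> \<Longrightarrow> (\<Sum>k<n. norm (\<phi> (t k) - \<phi> (s k))) < e"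
      using AC unfolding abs_continuous_on_interval_def by meson
    have le: "(\<Sum>k<n. norm (\<phi> (t k) $ i - \<phi> (s k) $ i)) \<le> (\<Sum>k<n. norm (\<phi> (t k) - \<phi> (s k)))" for n :: nat and s t
      by (rule sum_mono) (metis component_le_norm_cart real_norm_def vector_minus_component)
    show "\<exists>\<delta>>0. \<forall>n s t. (\<forall>k<n. 0 \<le> s k \<and> s k \<le> t k \<and> t k \<le> 1) \<and>
        pairwise (\<lambda>j k. {s j<..<t j} \<inter> {s k<..<t k} = {}) {..<n::nat} \<and>
        (\<Sum>k<n. t k - s k) < \<delta> \<longrightarrow> (\<Sum>k<n. norm (\<phi> (t k) $ i - \<phi> (s k) $ i)) < e"
    proof (intro exI[of _ \<delta>] conjI allI impI \<open>\<delta> > 0\<close>)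
      fix n :: nat and s t
      assume H: "(\<forall>k<n. 0 \<le> s k \<and> s k \<le> t k \<and> t k \<le> 1) \<and>
        pairwise (\<lambda>j k. {s j<..<t j} \<inter> {s k<..<t k} = {}) {..<n} \<and> (\<Sum>k<n. t k - s k) < \<delta>"
      show "(\<Sum>k<n. norm (\<phi> (t k) $ i - \<phi> (s k) $ i)) < e"
        by (rule le_less_trans[OF le \<delta>[OF H]])
    qed
  qed
  define Q where "Q i p \<longleftrightarrow> p \<in> borel_measurable borel \<and>
    (AE t in lborel. t \<in> {0..1} \<longrightarrow> ((\<lambda>t. \<phi> t $ i) has_real_derivative p t) (at t)) \<and>
    (\<forall>s t. 0 \<le> s \<longrightarrow> s \<le> t \<longrightarrow> t \<le> 1 \<longrightarrow> (p has_integral (\<phi> t $ i - \<phi> s $ i)) {s..t})" for i p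
  have "\<forall>i. \<exists>p. Q i p"
    unfolding Q_def by (intro allI abs_continuous_on_interval_borel_derivative[OF ACi]) simp
  from choice[OF this] obtain p where Qp: "\<forall>i. Q i (p i)" by (rule exE)
  have p: "p i \<in> borel_measurable borel"
    "AE t in lborel. t \<in> {0..1} \<longrightarrow> ((\<lambda>t. \<phi> t $ i) has_real_derivative p i t) (at t)"
    "0 \<le> s \<Longrightarrow> s \<le> t \<Longrightarrow> t \<le> 1 \<Longrightarrow> (p i has_integral (\<phi> t $ i - \<phi> s $ i)) {s..t}" for i s t
    using Qp[rule_format, of i] unfolding Q_def by blast+
  define g where "g t = (\<chi> i. p i t) + v t" for t
  have gm: "g \<in> borel_measurable borel"
    unfolding g_def using vm p(1) by (intro borel_measurable_add borel_measurable_vec_lambda) auto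
  have ge: "AE t in lborel. t \<in> {0..1} \<longrightarrow> (g t $ i)\<^sup>2 \<le> L_tilde A y \<mu> i (\<phi> t) (deriv (\<lambda>s. \<phi> s $ i) t)" for i
    using p(2)[of i] AE_derivative_zero_on_zero_set[of "\<lambda>t. \<phi> t $ i"]
  proof eventually_elim
    case (elim t)
    show ?case
    proof
      assume t: "t \<in> {0..1}"
      have d: "((\<lambda>t. \<phi> t $ i) has_real_derivative p i t) (at t)" using elim t by blast
      then have D: "deriv (\<lambda>s. \<phi> s $ i) t = p i t" by (rule DERIV_imp_deriv)
      have \<Phi>t: "\<Phi> t = \<phi> t" using \<Phi> t by blast
      consider "\<phi> t $ i < 0" | "\<phi> t $ i > 0" | "\<phi> t $ i = 0" by linarith
      then show "(g t $ i)\<^sup>2 \<le> L_tilde A y \<mu> i (\<phi> t) (deriv (\<lambda>s. \<phi> s $ i) t)"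
      proof cases
        case 1
        then show ?thesis by (simp add: D g_def v_def \<zeta>_def \<Phi>t L_tilde_def L1_def b1_eq algebra_simps)
      next
        case 2
        then show ?thesis by (simp add: D g_def v_def \<zeta>_def \<Phi>t L_tilde_def L2_def b2_eq algebra_simps)
      next
        case 3
        then have "p i t = 0" using elim(2) d by blast
        then show ?thesis using 3 L0_zero_ge[OF assms(1), of A y "\<phi> t" i]
          by (simp add: D g_def v_def \<zeta>_def \<Phi>t L_tilde_def)
      qed
    qed
  qed
  have gE: "(\<integral>\<^sup>+t\<in>{0..1}. ennreal ((norm (g t))\<^sup>2) \<partial>lborel) \<le> ennreal E"
  proof -
    have "(\<integral>\<^sup>+t\<in>{0..1}. ennreal ((norm (g t))\<^sup>2) \<partial>lborel) = (\<Sum>i\<in>UNIV. \<integral>\<^sup>+t\<in>{0..1}. ennreal ((g t $ i)\<^sup>2) \<partial>lborel)"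
      using gm by (intro nn_integral_norm_square_vec) auto
    also have "\<dots> \<le> r" unfolding r_def
    proof (rule sum_mono)
      fix i
      show "(\<integral>\<^sup>+t\<in>{0..1}. ennreal ((g t $ i)\<^sup>2) \<partial>lborel)
        \<le> (\<integral>\<^sup>+t\<in>{0..1}. ennreal (L_tilde A y \<mu> i (\<phi> t) (deriv (\<lambda>s. \<phi> s $ i) t)) \<partial>lborel)"
        using ge[of i] by (intro nn_integral_mono_AE) (auto elim!: eventually_mono simp: indicator_def intro: ennreal_leI)
    qed
    finally show ?thesis using E by simp
  qed
  have gi: "set_integrable lborel {0..1} g"
    unfolding set_integrable_def
  proof (rule Bochner_Integration.integrable_bound)
    have "set_integrable lborel {0..1} (\<lambda>t. (norm (g t))\<^sup>2)"
      unfolding set_integrable_def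
    proof (rule integrableI_nonneg)
      show "(\<lambda>x. indicator {0..1} x *\<^sub>R (norm (g x))\<^sup>2) \<in> borel_measurable lborel" using gm by measurable
      have "(\<integral>\<^sup>+x. ennreal (indicator {0..1} x *\<^sub>R (norm (g x))\<^sup>2) \<partial>lborel) = (\<integral>\<^sup>+t\<in>{0..1}. ennreal ((norm (g t))\<^sup>2) \<partial>lborel)"
        by (intro nn_integral_cong) (auto simp: indicator_def)
      then show "(\<integral>\<^sup>+x. ennreal (indicator {0..1} x *\<^sub>R (norm (g x))\<^sup>2) \<partial>lborel) < \<infinity>"
        using gE by (simp add: le_less_trans)
    qed simp
    moreover have "set_integrable lborel {0..1} (\<lambda>t :: real. 1 :: real)"
      by (rule set_integrable_bounded_Icc[where B=1]) auto
    ultimately have "set_integrable lborel {0..1} (\<lambda>t. (norm (g t))\<^sup>2 + 1)" by (rule set_integral_add(1))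
    then show "integrable lborel (\<lambda>t. indicator {0..1} t *\<^sub>R ((norm (g t))\<^sup>2 + 1))" by (simp add: set_integrable_def)
    show "(\<lambda>x. indicat_real {0..1} x *\<^sub>R g x) \<in> borel_measurable lborel" using gm by measurable
    \<comment> \<open>On a bounded interval square integrability gives integrability, with
      \<open>(norm (g t))\<^sup>2 + 1\<close> as the dominating function.\<close>
    have "norm (g t) \<le> (norm (g t))\<^sup>2 + 1" for t
    proof -
      have "0 \<le> (norm (g t) - 1)\<^sup>2" by simp
      then have "2 * norm (g t) \<le> (norm (g t))\<^sup>2 + 1" by (simp add: power2_diff)
      then show ?thesis using norm_ge_zero[of "g t"] by linarith
    qed
    then show "AE x in lborel. norm (indicat_real {0..1} x *\<^sub>R g x) \<le> norm (indicat_real {0..1} x *\<^sub>R ((norm (g x))\<^sup>2 + 1))"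
      by (intro AE_I2) (auto simp: indicator_def intro: order_trans[OF _ abs_ge_self])
  qed
  define q where "q t = (\<chi> i. p i t)" for t
  have qi: "set_integrable lborel {0..1} q"
  proof -
    have "q = (\<lambda>t. g t - v t)" by (auto simp: q_def g_def)
    then show ?thesis using set_integral_diff(1)[OF gi vi] by simp
  qed
  have \<phi>q: "\<phi> t - \<phi> s = (LINT r:{s..t}|lborel. q r)" if st: "0 \<le> s" "s \<le> t" "t \<le> 1" for s t
  proof (rule vec_eq_iff[THEN iffD2], rule allI)
    fix i
    have qst: "set_integrable lborel {s..t} q" by (rule set_integrable_subset[OF qi]) (use st in auto)
    have "(LINT r:{s..t}|lborel. q r) $ i = (LINT r:{s..t}|lborel. q r $ i)" by (rule set_integral_vec_nth[OF qst])
    also have "\<dots> = integral {s..t} (\<lambda>r. q r $ i)"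
      using set_integral_vec_nth(1)[OF qst] by (rule set_borel_integral_eq_integral(2))
    also have "\<dots> = \<phi> t $ i - \<phi> s $ i"
      using p(3)[OF st, of i] by (intro integral_unique) (simp add: q_def)
    finally show "(\<phi> t - \<phi> s) $ i = (LINT r:{s..t}|lborel. q r) $ i" by simp
  qed
  define \<psi> where "\<psi> t = \<phi> t - x0 + (LINT s:{0..t}|lborel. v s)" for t
  have "driven_solution A y \<mu> x0 \<psi> \<phi>"
    unfolding driven_solution_def using c\<phi> vi vsub' by (intro conjI exI[of _ v]) (auto simp: \<psi>_def)
  moreover have "\<psi> 0 = 0"
    using set_integral_Icc_split[OF vi, of 0 0] by (simp add: \<psi>_def \<phi>0)
  moreover have "\<psi> t - \<psi> s = (LINT r:{s..t}|lborel. g r)" if st: "0 \<le> s" "s \<le> t" "t \<le> 1" for s t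
  proof -
    have "set_integrable lborel {s..t} q" "set_integrable lborel {s..t} v"
      by (rule set_integrable_subset[OF qi] set_integrable_subset[OF vi]; use st in auto)+
    then have "(LINT r:{s..t}|lborel. q r + v r) = (LINT r:{s..t}|lborel. q r) + (LINT r:{s..t}|lborel. v r)"
      by (rule set_integral_add(2))
    moreover have "(\<lambda>r. q r + v r) = g" by (auto simp: q_def g_def)
    ultimately have "(LINT r:{s..t}|lborel. g r) = (LINT r:{s..t}|lborel. q r) + (LINT r:{s..t}|lborel. v r)" by simp
    then show ?thesis
      using \<phi>q[OF st] set_integral_Icc_split[OF vi st] by (simp add: \<psi>_def algebra_simps)
  qed
  then have "energy_le \<psi> E" unfolding energy_le_def using gm gi gE by blast
  ultimately show ?thesis using E rate by (intro exI[of _ \<psi>] exI[of _ E]) (auto simp: enn2ereal_ennreal)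
qed

section \<open>Dyadic polygons\<close>

definition dyadic_incr :: "nat \<Rightarrow> (real \<Rightarrow> 'v :: real_normed_vector) \<Rightarrow> nat \<Rightarrow> 'v" where
  "dyadic_incr n f k = f (real (Suc k) / 2 ^ n) - f (real k / 2 ^ n)"

text \<open>Linear interpolation at the points \<open>k / 2 ^ n\<close>. At \<open>t = 1\<close> the
  index is \<open>2 ^ n\<close>, and the increment reaching beyond 1 enters with the factor
  0.\<close>

definition polygon :: "nat \<Rightarrow> (real \<Rightarrow> 'v :: real_normed_vector) \<Rightarrow> real \<Rightarrow> 'v" where
  "polygon n f t = (let k = nat \<lfloor>t * 2 ^ n\<rfloor> in f (real k / 2 ^ n) + (t * 2 ^ n - real k) *\<^sub>R dyadic_incr n f k)"

text \<open>The integral over \<open>{0..1}\<close> of the squared slope of the polygon: each of the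
  \<open>2 ^ n\<close> pieces has length \<open>1 / 2 ^ n\<close> and slope \<open>2 ^ n\<close>
  times its increment.\<close>

definition dyadic_energy :: "nat \<Rightarrow> (real \<Rightarrow> 'v :: real_normed_vector) \<Rightarrow> real" where
  "dyadic_energy n f = 2 ^ n * (\<Sum>k<2 ^ n. (norm (dyadic_incr n f k))\<^sup>2)"

lemma dyadic_energy_nonneg: "dyadic_energy n f \<ge> 0"
  by (simp add: dyadic_energy_def sum_nonneg)

lemma polygon_eq:
  assumes "real k \<le> t * 2 ^ n" "t * 2 ^ n \<le> real (Suc k)"
  shows "polygon n f t = f (real k / 2 ^ n) + (t * 2 ^ n - real k) *\<^sub>R dyadic_incr n f k"
proof (cases "t * 2 ^ n < real (Suc k)")
  case True
  then have "\<lfloor>t * 2 ^ n\<rfloor> = int k" using assms by (simp add: floor_eq_iff)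
  then show ?thesis by (simp add: polygon_def)
next
  case False
  then have t: "t * 2 ^ n = real (Suc k)" using assms by simp
  then have "\<lfloor>t * 2 ^ n\<rfloor> = int (Suc k)" by (simp only: floor_of_nat)
  then have "polygon n f t = f (real (Suc k) / 2 ^ n)" using t by (simp add: polygon_def)
  moreover have "t * 2 ^ n - real k = 1" using t by simp
  ultimately show ?thesis by (simp add: dyadic_incr_def)
qed

lemma dyadic_index:
  assumes "t \<in> {0..1}"
  shows "\<exists>k<2 ^ n. real k \<le> t * 2 ^ n \<and> t * 2 ^ n \<le> real (Suc k)"
proof (cases "t = 1")
  case True
  have "real (2 ^ n - 1) = 2 ^ n - 1" by (simp add: of_nat_diff)
  then show ?thesis using True by (intro exI[of _ "2 ^ n - 1"]) auto
next
  case False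
  define k where "k = nat \<lfloor>t * 2 ^ n\<rfloor>"
  have t0: "0 \<le> t * 2 ^ n" using assms by simp
  have k: "real k = real_of_int \<lfloor>t * 2 ^ n\<rfloor>" using t0 by (simp add: k_def)
  have "real k \<le> t * 2 ^ n" "t * 2 ^ n < real k + 1" unfolding k by linarith+
  moreover have lt: "t * 2 ^ n < 1 * 2 ^ n" using assms False by (intro mult_strict_right_mono) auto
  have "real k < real (2 ^ n)"
    using lt \<open>real k \<le> t * 2 ^ n\<close> unfolding of_nat_power of_nat_numeral by linarith
  then have "k < 2 ^ n" by (simp only: of_nat_less_iff)
  ultimately show ?thesis by (intro exI[of _ k]) auto
qed

text \<open>The polygons agree at the coarse grid points; in between they differ by a tent whose
  peak, at the midpoint, is half the difference of the two finer increments.\<close>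

lemma polygon_refine:
  fixes f :: "real \<Rightarrow> 'v :: real_normed_vector"
  assumes t: "t \<in> {0..1}" and c: "\<And>k. k < 2 ^ Suc n \<Longrightarrow> norm (dyadic_incr (Suc n) f k) \<le> c"
  shows "norm (polygon (Suc n) f t - polygon n f t) \<le> c"
proof -
  obtain k where k: "k < 2 ^ n" "real k \<le> t * 2 ^ n" "t * 2 ^ n \<le> real (Suc k)"
    using dyadic_index[OF t] by blast
  define s where "s = t * 2 ^ n - real k"
  have s: "0 \<le> s" "s \<le> 1" using k by (auto simp: s_def)
  define i0 i1 where "i0 = dyadic_incr (Suc n) f (2 * k)" and "i1 = dyadic_incr (Suc n) f (Suc (2 * k))"
  have ic: "norm i0 \<le> c" "norm i1 \<le> c" using c k(1) by (auto simp: i0_def i1_def)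
  have h: "real (2 * k) / 2 ^ Suc n = real k / 2 ^ n" "real (Suc (Suc (2 * k))) / 2 ^ Suc n = real (Suc k) / 2 ^ n"
    by (simp_all add: field_simps)
  have i: "dyadic_incr n f k = i0 + i1" "f (real (Suc (2 * k)) / 2 ^ Suc n) = f (real k / 2 ^ n) + i0"
    unfolding dyadic_incr_def i0_def i1_def h by (simp_all add: algebra_simps)
  have p: "polygon n f t = f (real k / 2 ^ n) + s *\<^sub>R (i0 + i1)"
    using polygon_eq[OF k(2,3), of f] i by (simp add: s_def)
  have t2: "t * 2 ^ Suc n = 2 * real k + 2 * s" by (simp add: s_def)
  show ?thesis
  proof (cases "s \<le> 1 / 2")
    case True
    have "real (2 * k) \<le> t * 2 ^ Suc n" "t * 2 ^ Suc n \<le> real (Suc (2 * k))" unfolding t2 using s True by auto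
    from polygon_eq[OF this, of f] have "polygon (Suc n) f t = f (real k / 2 ^ n) + (2 * s) *\<^sub>R i0"
      unfolding h i0_def[symmetric] t2 by simp
    moreover have "(2 * s) *\<^sub>R i0 = s *\<^sub>R i0 + s *\<^sub>R i0" by (simp add: scaleR_left_distrib[symmetric])
    ultimately have "polygon (Suc n) f t - polygon n f t = s *\<^sub>R (i0 - i1)"
      unfolding p by (simp add: scaleR_right_distrib scaleR_right_diff_distrib)
    then have "norm (polygon (Suc n) f t - polygon n f t) = s * norm (i0 - i1)" using s by simp
    also have "\<dots> \<le> (1 / 2) * (c + c)"
      using True s ic norm_triangle_ineq4[of i0 i1] by (intro mult_mono) auto
    finally show ?thesis by simp
  next
    case False
    have "real (Suc (2 * k)) \<le> t * 2 ^ Suc n" "t * 2 ^ Suc n \<le> real (Suc (Suc (2 * k)))" unfolding t2 using s False by auto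
    from polygon_eq[OF this, of f]
    have "polygon (Suc n) f t = f (real k / 2 ^ n) + i0 + (2 * s - 1) *\<^sub>R i1"
      unfolding i i1_def[symmetric] t2 by (simp add: algebra_simps)
    moreover have "(2 * s - 1) *\<^sub>R i1 = s *\<^sub>R i1 + s *\<^sub>R i1 - i1"
      by (simp add: scaleR_left_diff_distrib scaleR_left_distrib[symmetric])
    ultimately have "polygon (Suc n) f t - polygon n f t = (1 - s) *\<^sub>R (i0 - i1)"
      unfolding p by (simp add: scaleR_right_distrib scaleR_right_diff_distrib scaleR_left_diff_distrib)
    then have "norm (polygon (Suc n) f t - polygon n f t) = (1 - s) * norm (i0 - i1)" using s by simp
    also have "\<dots> \<le> (1 / 2) * (c + c)"
      using False s ic norm_triangle_ineq4[of i0 i1] by (intro mult_mono) auto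
    finally show ?thesis by simp
  qed
qed

lemma polygon_uniform_limit:
  fixes f :: "real \<Rightarrow> 'v :: real_normed_vector"
  assumes "continuous_on {0..1} f"
  shows "uniform_limit {0..1} (\<lambda>n. polygon n f) f sequentially"
proof (rule uniform_limitI)
  fix e :: real assume "e > 0"
  have "uniformly_continuous_on {0..1} f" using assms by (intro compact_uniformly_continuous) auto
  then obtain d where d: "d > 0" "\<And>s t. s \<in> {0..1} \<Longrightarrow> t \<in> {0..1} \<Longrightarrow> dist s t < d \<Longrightarrow> dist (f s) (f t) < e / 2"
    using \<open>e > 0\<close> unfolding uniformly_continuous_on_def by (metis half_gt_zero)
  have "(\<lambda>n. (1 / 2 :: real) ^ n) \<longlonglongrightarrow> 0" by (rule LIMSEQ_power_zero) simp
  then have "\<forall>\<^sub>F n in sequentially. (1 / 2 :: real) ^ n < d" using d(1) by (rule order_tendstoD(2))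
  then show "\<forall>\<^sub>F n in sequentially. \<forall>t\<in>{0..1}. dist (polygon n f t) (f t) < e"
  proof eventually_elim
    case (elim n)
    show ?case
    proof
      fix t :: real assume t: "t \<in> {0..1}"
      obtain k where k: "k < 2 ^ n" "real k \<le> t * 2 ^ n" "t * 2 ^ n \<le> real (Suc k)"
        using dyadic_index[OF t] by blast
      define s where "s = t * 2 ^ n - real k"
      have s: "0 \<le> s" "s \<le> 1" using k by (auto simp: s_def)
      define a b where "a = real k / 2 ^ n" and "b = real (Suc k) / 2 ^ n"
      have ab: "a \<le> t" "t \<le> b" "b - a = (1 / 2) ^ n"
        using k by (auto simp: a_def b_def field_simps power_one_over)
      have "real (Suc k) \<le> real (2 ^ n)" using k(1) by (simp only: of_nat_le_iff Suc_le_eq)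
      then have "b \<le> 1" "a \<ge> 0" by (auto simp: a_def b_def)
      then have f: "norm (f a - f t) < e / 2" "norm (f b - f t) < e / 2"
        using d(2)[of a t] d(2)[of b t] ab elim t by (auto simp: dist_real_def dist_norm)
      have "polygon n f t - f t = (1 - s) *\<^sub>R (f a - f t) + s *\<^sub>R (f b - f t)"
        using polygon_eq[OF k(2,3), of f] by (simp add: dyadic_incr_def a_def b_def s_def algebra_simps)
      then have "norm (polygon n f t - f t) \<le> (1 - s) * norm (f a - f t) + s * norm (f b - f t)"
        using norm_triangle_ineq[of "(1 - s) *\<^sub>R (f a - f t)" "s *\<^sub>R (f b - f t)"] s by simp
      also have "\<dots> \<le> (1 - s) * (e / 2) + s * (e / 2)"
        using f s by (intro add_mono mult_left_mono) auto
      also have "\<dots> < e" using \<open>e > 0\<close> by (simp add: field_simps)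
      finally show "dist (polygon n f t) (f t) < e" by (simp add: dist_norm)
    qed
  qed
qed

text \<open>Telescoping over the levels: the allowances \<open>\<delta> / 4 * (3 / 4) ^ j\<close>
  have the sum \<open>\<delta>\<close>, with partial sums
  \<open>\<delta> * (1 - (3 / 4) ^ m)\<close>.\<close>

lemma polygon_chaining:
  fixes f :: "real \<Rightarrow> 'v :: real_normed_vector"
  assumes "continuous_on {0..1} f" "\<delta> > 0"
    and incr: "\<And>j k. k < 2 ^ (n + j) \<Longrightarrow> norm (dyadic_incr (n + j) f k) \<le> \<delta> / 4 * (3 / 4) ^ j"
    and t: "t \<in> {0..1}"
  shows "norm (f t - polygon n f t) \<le> \<delta>"
proof -
  have le: "norm (polygon (n + m) f t - polygon n f t) \<le> \<delta> * (1 - (3 / 4) ^ m)" for m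
  proof (induction m)
    case (Suc m)
    have "norm (polygon (Suc (n + m)) f t - polygon (n + m) f t) \<le> \<delta> / 4 * (3 / 4) ^ Suc m"
      by (rule polygon_refine[OF t]) (use incr[of _ "Suc m"] in simp)
    \<comment> \<open>The step from level \<open>n + m\<close> to the next uses the finer increments
      and so has the exponent \<open>Suc m\<close>; it is relaxed to \<open>m\<close> to fit the
      partial sum.\<close>
    also have "\<dots> \<le> \<delta> / 4 * (3 / 4) ^ m" using \<open>\<delta> > 0\<close> by simp
    finally have "norm (polygon (Suc (n + m)) f t - polygon (n + m) f t) \<le> \<delta> / 4 * (3 / 4) ^ m" .
    moreover have "norm (polygon (n + Suc m) f t - polygon n f t) \<le>
      norm (polygon (Suc (n + m)) f t - polygon (n + m) f t) + norm (polygon (n + m) f t - polygon n f t)"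
      using norm_triangle_ineq[of "polygon (Suc (n + m)) f t - polygon (n + m) f t" "polygon (n + m) f t - polygon n f t"] by simp
    ultimately show ?case using Suc by (simp add: algebra_simps)
  qed simp
  have "(\<lambda>m. polygon (m + n) f t) \<longlonglongrightarrow> f t"
    by (rule LIMSEQ_ignore_initial_segment) (rule tendsto_uniform_limitI[OF polygon_uniform_limit[OF assms(1)] t])
  then have "(\<lambda>m. norm (polygon (n + m) f t - polygon n f t)) \<longlonglongrightarrow> norm (f t - polygon n f t)"
    by (intro tendsto_norm tendsto_diff tendsto_const) (simp add: add.commute)
  moreover have "norm (polygon (n + m) f t - polygon n f t) \<le> \<delta>" for m
  proof -
    have "\<delta> * (1 - (3 / 4) ^ m) \<le> \<delta> * 1" using \<open>\<delta> > 0\<close> by (intro mult_left_mono) auto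
    then show ?thesis using le[of m] by linarith
  qed
  ultimately show ?thesis by (intro LIMSEQ_le_const2) auto
qed

section \<open>Energy and dyadic increments\<close>

lemma energy_le_holder:
  fixes \<psi> :: "real \<Rightarrow> real ^ 'd"
  assumes "energy_le \<psi> E" "E \<ge> 0" "0 \<le> s" "s \<le> t" "t \<le> 1"
  shows "(norm (\<psi> t - \<psi> s))\<^sup>2 \<le> (t - s) * E"
proof -
  obtain g where g: "g \<in> borel_measurable borel" "set_integrable lborel {0..1} g"
     "\<And>s t. 0 \<le> s \<Longrightarrow> s \<le> t \<Longrightarrow> t \<le> 1 \<Longrightarrow> \<psi> t - \<psi> s = (LINT r:{s..t}|lborel. g r)"
     "(\<integral>\<^sup>+t\<in>{0..1}. ennreal ((norm (g t))\<^sup>2) \<partial>lborel) \<le> ennreal E"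
    using assms(1) unfolding energy_le_def by blast
  have gst: "set_integrable lborel {s..t} g" by (rule set_integrable_subset[OF g(2)]) (use assms in auto)
  have "ennreal ((norm (\<psi> t - \<psi> s))\<^sup>2) \<le> ennreal (t - s) * (\<integral>\<^sup>+r\<in>{s..t}. ennreal ((norm (g r))\<^sup>2) \<partial>lborel)"
    using nn_integral_Cauchy_Schwarz_interval[OF gst g(1)] g(3)[of s t] assms by simp
  also have "\<dots> \<le> ennreal (t - s) * (\<integral>\<^sup>+r\<in>{0..1}. ennreal ((norm (g r))\<^sup>2) \<partial>lborel)"
    by (intro mult_left_mono nn_integral_mono) (use assms in \<open>auto simp: indicator_def\<close>)
  also have "\<dots> \<le> ennreal (t - s) * ennreal E" using g(4) by (intro mult_left_mono) auto
  also have "\<dots> = ennreal ((t - s) * E)" using assms by (simp add: ennreal_mult)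
  finally show ?thesis using assms by (subst (asm) ennreal_le_iff) auto
qed

lemma dyadic_point_bounds:
  assumes "k < 2 ^ n"
  shows "0 \<le> real k / 2 ^ n" "real k / 2 ^ n \<le> real (Suc k) / 2 ^ n" "real (Suc k) / 2 ^ n \<le> 1"
    "real (Suc k) / 2 ^ n - real k / 2 ^ n = 1 / 2 ^ n"
proof -
  have "real (Suc k) \<le> real (2 ^ n)" using assms by (simp only: of_nat_le_iff Suc_le_eq)
  then show "real (Suc k) / 2 ^ n \<le> 1" by simp
qed (auto simp: field_simps)

lemma disjoint_dyadic_intervals:
  "disjoint_family_on (\<lambda>k. {real k / 2 ^ n..<real (Suc k) / 2 ^ n}) {..<m}"
proof -
  have "k = l" if "real k / 2 ^ n \<le> x" "x < real (Suc k) / 2 ^ n" "real l / 2 ^ n \<le> x" "x < real (Suc l) / 2 ^ n" for k l x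
  proof -
    have "real k < real (Suc l)" "real l < real (Suc k)"
      using le_less_trans[OF that(1) that(4)] le_less_trans[OF that(3) that(2)] by (simp_all add: divide_less_cancel)
    then show ?thesis by simp
  qed
  note eq = this
  show ?thesis
    unfolding disjoint_family_on_def
  proof (intro ballI impI)
    fix k l :: nat assume "k \<noteq> l"
    show "{real k / 2 ^ n..<real (Suc k) / 2 ^ n} \<inter> {real l / 2 ^ n..<real (Suc l) / 2 ^ n} = {}"
    proof (rule ccontr)
      assume "{real k / 2 ^ n..<real (Suc k) / 2 ^ n} \<inter> {real l / 2 ^ n..<real (Suc l) / 2 ^ n} \<noteq> {}"
      then obtain x where "x \<in> {real k / 2 ^ n..<real (Suc k) / 2 ^ n}" "x \<in> {real l / 2 ^ n..<real (Suc l) / 2 ^ n}" by blast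
      then have "k = l" unfolding atLeastLessThan_iff by (elim conjE) (rule eq)
      then show False using \<open>k \<noteq> l\<close> by blast
    qed
  qed
qed

text \<open>Cauchy--Schwarz on each dyadic interval bounds its term by the energy of
  \<open>g\<close> on that interval. Regarding the energy as the measure \<open>D\<close> turns
  summation over the half-open intervals into additivity of a measure.\<close>

lemma dyadic_energy_le:
  fixes \<psi> :: "real \<Rightarrow> real ^ 'd"
  assumes "energy_le \<psi> E" "E \<ge> 0"
  shows "dyadic_energy n \<psi> \<le> E"
proof -
  obtain g where g: "g \<in> borel_measurable borel" "set_integrable lborel {0..1} g"
     "\<And>s t. 0 \<le> s \<Longrightarrow> s \<le> t \<Longrightarrow> t \<le> 1 \<Longrightarrow> \<psi> t - \<psi> s = (LINT r:{s..t}|lborel. g r)"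
     "(\<integral>\<^sup>+t\<in>{0..1}. ennreal ((norm (g t))\<^sup>2) \<partial>lborel) \<le> ennreal E"
    using assms(1) unfolding energy_le_def by blast
  define D where "D = density lborel (\<lambda>t. ennreal ((norm (g t))\<^sup>2))"
  have Dm: "(\<lambda>t. ennreal ((norm (g t))\<^sup>2)) \<in> borel_measurable lborel" using g(1) by measurable
  have D: "emeasure D A = (\<integral>\<^sup>+r\<in>A. ennreal ((norm (g r))\<^sup>2) \<partial>lborel)" if "A \<in> sets borel" for A
    unfolding D_def using Dm that by (intro emeasure_density) auto
  define J where "J k = {real k / 2 ^ n..<real (Suc k) / 2 ^ n}" for k
  have le: "ennreal (2 ^ n * (norm (dyadic_incr n \<psi> k))\<^sup>2) \<le> emeasure D (J k)" if "k < 2 ^ n" for k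
  proof -
    define s t where "s = real k / 2 ^ n" and "t = real (Suc k) / 2 ^ n"
    have st: "0 \<le> s" "s \<le> t" "t \<le> 1" "t - s = 1 / 2 ^ n" using dyadic_point_bounds[OF that] by (auto simp: s_def t_def)
    have gst: "set_integrable lborel {s..t} g" by (rule set_integrable_subset[OF g(2)]) (use st in auto)
    have "(\<integral>\<^sup>+r\<in>{s..t}. ennreal ((norm (g r))\<^sup>2) \<partial>lborel) = (\<integral>\<^sup>+r\<in>{s..<t}. ennreal ((norm (g r))\<^sup>2) \<partial>lborel)"
      using AE_lborel_singleton[of t] by (intro nn_integral_cong_AE) (auto elim!: eventually_mono simp: indicator_def)
    then have "(\<integral>\<^sup>+r\<in>{s..t}. ennreal ((norm (g r))\<^sup>2) \<partial>lborel) = emeasure D (J k)"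
      using D[of "J k"] by (simp add: J_def s_def t_def)
    then have "ennreal ((norm (\<psi> t - \<psi> s))\<^sup>2) \<le> ennreal (1 / 2 ^ n) * emeasure D (J k)"
      using nn_integral_Cauchy_Schwarz_interval[OF gst g(1) st(2)] g(3)[OF st(1-3)] st(4) by simp
    then have "ennreal (2 ^ n) * ennreal ((norm (\<psi> t - \<psi> s))\<^sup>2) \<le> ennreal (2 ^ n) * (ennreal (1 / 2 ^ n) * emeasure D (J k))"
      by (rule mult_left_mono) simp
    also have "\<dots> = emeasure D (J k)" by (simp add: mult.assoc[symmetric] ennreal_mult'[symmetric])
    finally show ?thesis by (simp add: dyadic_incr_def s_def t_def ennreal_mult)
  qed
  have "ennreal (dyadic_energy n \<psi>) = (\<Sum>k<2 ^ n. ennreal (2 ^ n * (norm (dyadic_incr n \<psi> k))\<^sup>2))"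
    by (simp add: dyadic_energy_def sum_distrib_left)
  also have "\<dots> \<le> (\<Sum>k<2 ^ n. emeasure D (J k))" using le by (intro sum_mono) auto
  also have "\<dots> = emeasure D (\<Union>k<2 ^ n. J k)"
    using disjoint_dyadic_intervals[of n "2 ^ n"] by (intro sum_emeasure) (auto simp: J_def D_def)
  also have "\<dots> \<le> emeasure D {0..1}"
  proof (rule emeasure_mono)
    show "(\<Union>k<2 ^ n. J k) \<subseteq> {0..1}"
    proof (rule UN_least)
      fix k :: nat assume "k \<in> {..<2 ^ n}"
      then have "k < 2 ^ n" by simp
      note b = dyadic_point_bounds[OF this]
      show "J k \<subseteq> {0..1}"
      proof
        fix x assume "x \<in> J k"
        then have "real k / 2 ^ n \<le> x" "x < real (Suc k) / 2 ^ n" unfolding J_def atLeastLessThan_iff by blast+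
        then have "0 \<le> x" "x \<le> 1" using b by linarith+
        then show "x \<in> {0..1}" by simp
      qed
    qed
  qed (simp add: D_def)
  also have "\<dots> \<le> ennreal E" using g(4) D[of "{0..1}"] by simp
  finally show ?thesis using assms(2) by (subst (asm) ennreal_le_iff) auto
qed

section \<open>Polygons as paths of finite energy\<close>

definition polygon_slope :: "nat \<Rightarrow> (real \<Rightarrow> 'v :: real_normed_vector) \<Rightarrow> real \<Rightarrow> 'v" where
  "polygon_slope n f t = 2 ^ n *\<^sub>R dyadic_incr n f (nat \<lfloor>t * 2 ^ n\<rfloor>)"

lemma polygon_continuous_on:
  fixes f :: "real \<Rightarrow> 'v :: real_normed_vector"
  shows "continuous_on {0..1} (polygon n f)"
proof -
  have "continuous_on (\<Union>k<2 ^ n. {real k / 2 ^ n..real (Suc k) / 2 ^ n}) (polygon n f)"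
  proof (rule continuous_on_closed_Union)
    fix k :: nat
    have "polygon n f t = f (real k / 2 ^ n) + (t * 2 ^ n - real k) *\<^sub>R dyadic_incr n f k"
      if "t \<in> {real k / 2 ^ n..real (Suc k) / 2 ^ n}" for t
      by (rule polygon_eq) (use that in \<open>auto simp: field_simps\<close>)
    then show "continuous_on {real k / 2 ^ n..real (Suc k) / 2 ^ n} (polygon n f)"
      by (subst continuous_on_cong[OF refl]) (auto intro!: continuous_intros)
  qed auto
  moreover have "{0..1} \<subseteq> (\<Union>k<2 ^ n. {real k / 2 ^ n..real (Suc k) / 2 ^ n})"
  proof
    fix t :: real assume "t \<in> {0..1}"
    then obtain k where "k < 2 ^ n" "real k \<le> t * 2 ^ n" "t * 2 ^ n \<le> real (Suc k)" using dyadic_index by blast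
    then show "t \<in> (\<Union>k<2 ^ n. {real k / 2 ^ n..real (Suc k) / 2 ^ n})"
      by (intro UN_I[of k]) (auto simp: field_simps)
  qed
  ultimately show ?thesis by (rule continuous_on_subset)
qed

lemma polygon_has_vector_derivative:
  fixes f :: "real \<Rightarrow> 'v :: real_normed_vector"
  assumes t: "t \<in> {0<..<1}" and nd: "t \<notin> (\<lambda>k. real k / 2 ^ n) ` {..2 ^ n}"
  shows "(polygon n f has_vector_derivative polygon_slope n f t) (at t)"
proof -
  obtain k where k: "k < 2 ^ n" "real k \<le> t * 2 ^ n" "t * 2 ^ n \<le> real (Suc k)"
    using dyadic_index[of t n] t by auto
  have "t \<noteq> real k / 2 ^ n" "t \<noteq> real (Suc k) / 2 ^ n" using nd k(1) by (auto simp del: of_nat_Suc)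
  then have "t * 2 ^ n \<noteq> real k" "t * 2 ^ n \<noteq> real (Suc k)" by (auto simp: field_simps)
  then have k': "real k < t * 2 ^ n" "t * 2 ^ n < real (Suc k)" using k by auto
  then have fl: "nat \<lfloor>t * 2 ^ n\<rfloor> = k" by (simp add: floor_eq_iff nat_eq_iff)
  have "((\<lambda>t. f (real k / 2 ^ n) + (t * 2 ^ n - real k) *\<^sub>R dyadic_incr n f k) has_vector_derivative
      2 ^ n *\<^sub>R dyadic_incr n f k) (at t)"
    by (auto intro!: derivative_eq_intros simp: has_vector_derivative_def)
  then show ?thesis
    unfolding polygon_slope_def fl
  proof (rule has_vector_derivative_transform_within_open)
    show "open {real k / 2 ^ n<..<real (Suc k) / 2 ^ n}" by simp
    show "t \<in> {real k / 2 ^ n<..<real (Suc k) / 2 ^ n}" using k' by (auto simp: field_simps)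
    show "f (real k / 2 ^ n) + (s * 2 ^ n - real k) *\<^sub>R dyadic_incr n f k = polygon n f s"
      if "s \<in> {real k / 2 ^ n<..<real (Suc k) / 2 ^ n}" for s
      by (rule polygon_eq[symmetric]) (use that in \<open>auto simp: field_simps\<close>)
  qed
qed

lemma polygon_slope_measurable:
  fixes f :: "real \<Rightarrow> real ^ 'd"
  shows "polygon_slope n f \<in> borel_measurable borel"
proof -
  have "(\<lambda>t :: real. nat \<lfloor>t * 2 ^ n\<rfloor>) \<in> measurable borel (count_space UNIV)" by measurable
  then show ?thesis unfolding polygon_slope_def
    by (rule measurable_compose) simp
qed

lemma polygon_slope_bounded:
  fixes f :: "real \<Rightarrow> real ^ 'd"
  shows "\<exists>B. \<forall>t\<in>{0..1}. norm (polygon_slope n f t) \<le> B"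
proof -
  define B where "B = (\<Sum>k\<le>2 ^ n. norm (2 ^ n *\<^sub>R dyadic_incr n f k))"
  have "norm (polygon_slope n f t) \<le> B" if t: "t \<in> {0..1}" for t
  proof -
    have le: "t * 2 ^ n \<le> 2 ^ n" using t by simp
    have "nat \<lfloor>t * 2 ^ n\<rfloor> \<le> 2 ^ n" by (simp add: nat_le_iff floor_le_iff) (use le in linarith)
    then show ?thesis unfolding polygon_slope_def B_def by (intro member_le_sum) auto
  qed
  then show ?thesis by blast
qed

lemma polygon_slope_energy:
  fixes f :: "real \<Rightarrow> real ^ 'd"
  shows "(\<integral>\<^sup>+t\<in>{0..1}. ennreal ((norm (polygon_slope n f t))\<^sup>2) \<partial>lborel) \<le> ennreal (dyadic_energy n f)"
proof -
  define J where "J k = {real k / 2 ^ n..<real (Suc k) / 2 ^ n}" for k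
  define a where "a k = (2 ^ n)\<^sup>2 * (norm (dyadic_incr n f k))\<^sup>2" for k
  have "(\<integral>\<^sup>+t\<in>{0..1}. ennreal ((norm (polygon_slope n f t))\<^sup>2) \<partial>lborel) \<le> (\<integral>\<^sup>+t. (\<Sum>k<2 ^ n. ennreal (a k) * indicator (J k) t) \<partial>lborel)"
  proof (rule nn_integral_mono_AE)
    show "AE t in lborel. ennreal ((norm (polygon_slope n f t))\<^sup>2) * indicator {0..1} t \<le> (\<Sum>k<2 ^ n. ennreal (a k) * indicator (J k) t)"
      using AE_lborel_singleton[of 1]
    proof eventually_elim
      case (elim t)
      show ?case
      proof (cases "t \<in> {0..1}")
        case True
        define k where "k = nat \<lfloor>t * 2 ^ n\<rfloor>"
        have t0: "0 \<le> t * 2 ^ n" using True by simp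
        have k: "real k = real_of_int \<lfloor>t * 2 ^ n\<rfloor>" using t0 by (simp add: k_def)
        have k1: "real k \<le> t * 2 ^ n" "t * 2 ^ n < real k + 1" unfolding k by linarith+
        have lt: "t * 2 ^ n < 1 * 2 ^ n" using True elim by (intro mult_strict_right_mono) auto
        have "real k < real (2 ^ n)"
          using lt k1 unfolding of_nat_power of_nat_numeral by linarith
        then have "k < 2 ^ n" by (simp only: of_nat_less_iff)
        have "t \<in> J k" using k1 by (auto simp: J_def field_simps)
        have "ennreal ((norm (polygon_slope n f t))\<^sup>2) * indicator {0..1} t = ennreal (a k) * indicator (J k) t"
          using True \<open>t \<in> J k\<close> by (simp add: polygon_slope_def k_def[symmetric] a_def power_mult_distrib)
        also have "\<dots> \<le> (\<Sum>k<2 ^ n. ennreal (a k) * indicator (J k) t)"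
          using \<open>k < 2 ^ n\<close> by (intro member_le_sum) auto
        finally show ?thesis .
      qed simp
    qed
  qed
  also have "\<dots> = (\<Sum>k<2 ^ n. \<integral>\<^sup>+t. ennreal (a k) * indicator (J k) t \<partial>lborel)"
    by (intro nn_integral_sum) (auto simp: J_def)
  also have "\<dots> = (\<Sum>k<2 ^ n. ennreal (2 ^ n * (norm (dyadic_incr n f k))\<^sup>2))"
  proof (rule sum.cong)
    fix k :: nat assume "k \<in> {..<2 ^ n}"
    have "(\<integral>\<^sup>+t. ennreal (a k) * indicator (J k) t \<partial>lborel) = ennreal (a k) * emeasure lborel (J k)"
      by (intro nn_integral_cmult_indicator) (simp add: J_def)
    also have "emeasure lborel (J k) = ennreal (1 / 2 ^ n)"
    proof -
      have "real k / 2 ^ n \<le> real (Suc k) / 2 ^ n" "real (Suc k) / 2 ^ n - real k / 2 ^ n = 1 / 2 ^ n"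
        by (simp_all add: field_simps)
      then show ?thesis unfolding J_def by simp
    qed
    also have "ennreal (a k) * ennreal (1 / 2 ^ n) = ennreal (a k * (1 / 2 ^ n))"
      by (rule ennreal_mult[symmetric]) (auto simp: a_def)
    also have "a k * (1 / 2 ^ n) = 2 ^ n * (norm (dyadic_incr n f k))\<^sup>2"
      by (simp add: a_def power2_eq_square)
    finally show "(\<integral>\<^sup>+t. ennreal (a k) * indicator (J k) t \<partial>lborel) = ennreal (2 ^ n * (norm (dyadic_incr n f k))\<^sup>2)" .
  qed simp
  also have "\<dots> = ennreal (dyadic_energy n f)"
    by (simp add: dyadic_energy_def sum_distrib_left)
  finally show ?thesis .
qed

lemma polygon_diff:
  fixes f :: "real \<Rightarrow> real ^ 'd"
  assumes st: "0 \<le> s" "s \<le> t" "t \<le> 1"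
  shows "polygon n f t - polygon n f s = (LINT r:{s..t}|lborel. polygon_slope n f r)"
proof -
  obtain B where B: "\<And>t. t \<in> {0..1} \<Longrightarrow> norm (polygon_slope n f t) \<le> B" using polygon_slope_bounded by blast
  have i: "set_integrable lborel {s..t} (polygon_slope n f)"
    by (rule set_integrable_bounded_Icc[OF polygon_slope_measurable, where B=B]) (use B st in auto)
  have "(polygon_slope n f has_integral (polygon n f t - polygon n f s)) {s..t}"
  proof (rule fundamental_theorem_of_calculus_interior_strong[where S="(\<lambda>k. real k / 2 ^ n) ` {..2 ^ n}"])
    show "continuous_on {s..t} (polygon n f)"
      by (rule continuous_on_subset[OF polygon_continuous_on]) (use st in auto)
    show "(polygon n f has_vector_derivative polygon_slope n f r) (at r)"
      if "r \<in> {s<..<t} - (\<lambda>k. real k / 2 ^ n) ` {..2 ^ n}" for r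
      by (rule polygon_has_vector_derivative) (use that st in auto)
  qed (use st in auto)
  then show ?thesis using set_borel_integral_eq_integral(2)[OF i] by (simp add: integral_unique)
qed

lemma polygon_energy_le:
  fixes f :: "real \<Rightarrow> real ^ 'd"
  shows "energy_le (polygon n f) (dyadic_energy n f)"
proof -
  obtain B where B: "\<And>t. t \<in> {0..1} \<Longrightarrow> norm (polygon_slope n f t) \<le> B" using polygon_slope_bounded by blast
  have "set_integrable lborel {0..1} (polygon_slope n f)"
    by (rule set_integrable_bounded_Icc[OF polygon_slope_measurable, where B=B]) (use B in auto)
  then show ?thesis unfolding energy_le_def
    using polygon_slope_measurable polygon_diff polygon_slope_energy by blast
qed

lemma polygon_zero: "polygon n f 0 = f 0"
  by (simp add: polygon_def)

lemma rate_function_polygon: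
  fixes A :: "real ^ 'd ^ 'n"
  assumes "\<mu> > 0" "driven_solution A y \<mu> x0 (polygon n f) x" "f 0 = 0"
  shows "rate_function A y \<mu> x0 (restrict x {0..1}) \<le> ereal (dyadic_energy n f)"
proof -
  obtain B where B: "\<And>t. t \<in> {0..1} \<Longrightarrow> norm (polygon_slope n f t) \<le> B" using polygon_slope_bounded by blast
  have i: "set_integrable lborel {0..1} (polygon_slope n f)"
    by (rule set_integrable_bounded_Icc[OF polygon_slope_measurable, where B=B]) (use B in auto)
  have B': "AE t in lborel. t \<in> {0..1} \<longrightarrow> norm (polygon_slope n f t) \<le> B" using B by auto
  have "AE t in lborel. t \<notin> (\<lambda>k. real k / 2 ^ n) ` {..2 ^ n}"
    by (intro AE_not_in finite_imp_null_set_lborel) auto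
  then have "AE t in lborel. t \<in> {0<..<1} \<longrightarrow> (polygon n f has_vector_derivative polygon_slope n f t) (at t)"
    by eventually_elim (use polygon_has_vector_derivative in blast)
  then have d: "AE t in lborel. t \<in> {0..1} \<longrightarrow> (polygon n f has_vector_derivative polygon_slope n f t) (at t)"
    by (rule AE_lborel_Icc_imp_Ioo)
  have "rate_function A y \<mu> x0 (restrict x {0..1}) \<le> enn2ereal (\<integral>\<^sup>+t\<in>{0..1}. ennreal ((norm (polygon_slope n f t))\<^sup>2) \<partial>lborel)"
  proof (rule rate_function_le_energy[OF assms(1,2) _ _ polygon_slope_measurable d])
    show "polygon n f 0 = 0" using assms(3) by (simp add: polygon_zero)
    show "norm (polygon n f t - polygon n f s) \<le> B * (t - s)" if "0 \<le> s" "s \<le> t" "t \<le> 1" for s t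
      using norm_set_integral_le_bound[OF i B' that] polygon_diff[OF that, of n f] by simp
  qed
  also have "\<dots> \<le> enn2ereal (ennreal (dyadic_energy n f))"
    using polygon_slope_energy[of n f] by (simp add: less_eq_ennreal.rep_eq)
  also have "\<dots> = ereal (dyadic_energy n f)" by (simp add: enn2ereal_ennreal dyadic_energy_nonneg)
  finally show ?thesis .
qed

section \<open>Gaussian vectors\<close>

lemma nn_integral_normal_density: "\<sigma> > 0 \<Longrightarrow> (\<integral>\<^sup>+x. ennreal (normal_density 0 \<sigma> x) \<partial>lborel) = 1"
  by (subst nn_integral_eq_integral) auto

text \<open>The exponents add up, so the tilt changes the variance from
  \<open>\<sigma>\<^sup>2\<close> to \<open>\<sigma>\<^sup>2 / (1 - \<kappa>)\<close>, and the ratio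
  of the normalizing constants is left as a factor. The condition \<open>\<kappa> < 1\<close> keeps
  the new variance positive.\<close>

lemma normal_density_tilt:
  assumes "\<sigma> > 0" "\<kappa> < 1"
  shows "exp (\<kappa> * x\<^sup>2 / (2 * \<sigma>\<^sup>2)) * normal_density 0 \<sigma> x = 1 / sqrt (1 - \<kappa>) * normal_density 0 (\<sigma> / sqrt (1 - \<kappa>)) x"
proof -
  have pos: "1 - \<kappa> > 0" using assms by simp
  have s: "(\<sigma> / sqrt (1 - \<kappa>))\<^sup>2 = \<sigma>\<^sup>2 / (1 - \<kappa>)" using pos by (simp add: power_divide)
  have 1: "sqrt (2 * pi * (\<sigma>\<^sup>2 / (1 - \<kappa>))) = sqrt (2 * pi * \<sigma>\<^sup>2) / sqrt (1 - \<kappa>)"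
    by (simp add: real_sqrt_divide[symmetric])
  have 2: "\<kappa> * x\<^sup>2 / (2 * \<sigma>\<^sup>2) + - x\<^sup>2 / (2 * \<sigma>\<^sup>2) = - x\<^sup>2 / (2 * (\<sigma>\<^sup>2 / (1 - \<kappa>)))"
    using assms pos by (simp add: field_simps)
  have "exp (\<kappa> * x\<^sup>2 / (2 * \<sigma>\<^sup>2)) * normal_density 0 \<sigma> x =
      1 / sqrt (2 * pi * \<sigma>\<^sup>2) * exp (\<kappa> * x\<^sup>2 / (2 * \<sigma>\<^sup>2) + - x\<^sup>2 / (2 * \<sigma>\<^sup>2))"
    unfolding normal_density_def exp_add by (simp add: mult_ac)
  also have "\<dots> = 1 / sqrt (1 - \<kappa>) * normal_density 0 (\<sigma> / sqrt (1 - \<kappa>)) x"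
    unfolding 2 normal_density_def s 1 using pos by simp
  finally show ?thesis .
qed

definition gauss_density :: "real \<Rightarrow> real ^ 'd \<Rightarrow> real" where
  "gauss_density \<sigma> z = (\<Prod>i\<in>UNIV. normal_density 0 \<sigma> (z $ i))"

lemma gauss_density_nonneg: "gauss_density \<sigma> z \<ge> 0"
  by (simp add: gauss_density_def prod_nonneg)

lemma gauss_density_measurable[measurable]: "(gauss_density \<sigma> :: real ^ 'd \<Rightarrow> real) \<in> borel_measurable borel"
proof -
  have [measurable]: "(\<lambda>z :: real ^ 'd. z $ i) \<in> borel_measurable borel" for i
    by (rule borel_measurable_vec_nth) simp
  have "(\<lambda>z. normal_density 0 \<sigma> (z $ i)) \<in> borel_measurable borel" for i :: 'd
    by measurable
  then show ?thesis unfolding gauss_density_def by (intro borel_measurable_prod) auto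
qed

lemma norm_vec_square: "(norm (z :: real ^ 'd))\<^sup>2 = (\<Sum>i\<in>UNIV. (z $ i)\<^sup>2)"
  unfolding power2_norm_eq_inner inner_vec_def by (simp add: power2_eq_square)

lemma gauss_density_eq:
  "gauss_density \<sigma> (z :: real ^ 'd) = (1 / sqrt (2 * pi * \<sigma>\<^sup>2)) ^ CARD('d) * exp (- (norm z)\<^sup>2 / (2 * \<sigma>\<^sup>2))"
proof -
  have "gauss_density \<sigma> z = (\<Prod>i\<in>(UNIV :: 'd set). 1 / sqrt (2 * pi * \<sigma>\<^sup>2)) * (\<Prod>i\<in>UNIV. exp (- (z $ i)\<^sup>2 / (2 * \<sigma>\<^sup>2)))"
    unfolding gauss_density_def normal_density_def by (simp only: prod.distrib diff_0_right)
  also have "(\<Prod>i\<in>UNIV. exp (- (z $ i)\<^sup>2 / (2 * \<sigma>\<^sup>2))) = exp (- (norm z)\<^sup>2 / (2 * \<sigma>\<^sup>2))"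
    by (simp add: exp_sum[symmetric] norm_vec_square sum_negf sum_divide_distrib)
  finally show ?thesis by simp
qed

lemma nn_integral_lborel_vec_prod:
  fixes f :: "real \<Rightarrow> ennreal"
  assumes "f \<in> borel_measurable borel"
  shows "(\<integral>\<^sup>+z. (\<Prod>i\<in>UNIV. f ((z :: real ^ 'd) $ i)) \<partial>lborel) = (\<integral>\<^sup>+x. f x \<partial>lborel) ^ CARD('d)"
proof -
  have inj: "inj (\<lambda>i :: 'd. axis i (1 :: real))" by (auto simp: inj_def axis_eq_axis)
  have B: "(Basis :: (real ^ 'd) set) = range (\<lambda>i. axis i 1)" by (auto simp: Basis_vec_def)
  have 1: "(\<Prod>b\<in>Basis. f (z \<bullet> b)) = (\<Prod>i\<in>UNIV. f (z $ i))" for z :: "real ^ 'd"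
    unfolding B by (subst prod.reindex[OF inj]) (simp add: inner_axis)
  have 2: "(\<Prod>b\<in>(Basis :: (real ^ 'd) set). \<integral>\<^sup>+x. f x \<partial>lborel) = (\<integral>\<^sup>+x. f x \<partial>lborel) ^ CARD('d)"
    by simp
  show ?thesis
    using nn_integral_lborel_prod[of "\<lambda>b :: real ^ 'd. f"] assms unfolding 1 2 by simp
qed

lemma gauss_exp_square:
  assumes "\<sigma> > 0" "\<kappa> < 1"
  shows "(\<integral>\<^sup>+z. ennreal (gauss_density \<sigma> (z :: real ^ 'd)) * ennreal (exp (\<kappa> * (norm z)\<^sup>2 / (2 * \<sigma>\<^sup>2))) \<partial>lborel)
    = ennreal ((1 / sqrt (1 - \<kappa>)) ^ CARD('d))"
proof -
  define f where "f x = 1 / sqrt (1 - \<kappa>) * normal_density 0 (\<sigma> / sqrt (1 - \<kappa>)) x" for x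
  have fm: "f \<in> borel_measurable borel" unfolding f_def by measurable
  have f0: "f x \<ge> 0" for x using assms by (simp add: f_def)
  have e: "exp (\<kappa> * (norm z)\<^sup>2 / (2 * \<sigma>\<^sup>2)) = (\<Prod>i\<in>UNIV. exp (\<kappa> * (z $ i)\<^sup>2 / (2 * \<sigma>\<^sup>2)))" for z :: "real ^ 'd"
    by (simp add: exp_sum[symmetric] norm_vec_square sum_distrib_left sum_divide_distrib)
  have "gauss_density \<sigma> z * exp (\<kappa> * (norm z)\<^sup>2 / (2 * \<sigma>\<^sup>2)) = (\<Prod>i\<in>UNIV. f (z $ i))" for z :: "real ^ 'd"
    unfolding e gauss_density_def prod.distrib[symmetric] f_def normal_density_tilt[OF assms, symmetric]
    by (simp add: mult.commute)
  then have "ennreal (gauss_density \<sigma> z) * ennreal (exp (\<kappa> * (norm z)\<^sup>2 / (2 * \<sigma>\<^sup>2))) = (\<Prod>i\<in>UNIV. ennreal (f (z $ i)))" for z :: "real ^ 'd"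
    by (simp add: ennreal_mult[symmetric] gauss_density_nonneg prod_ennreal f0)
  then have "(\<integral>\<^sup>+z. ennreal (gauss_density \<sigma> (z :: real ^ 'd)) * ennreal (exp (\<kappa> * (norm z)\<^sup>2 / (2 * \<sigma>\<^sup>2))) \<partial>lborel)
    = (\<integral>\<^sup>+z. (\<Prod>i\<in>UNIV. ennreal (f ((z :: real ^ 'd) $ i))) \<partial>lborel)" by simp
  also have "\<dots> = (\<integral>\<^sup>+x. ennreal (f x) \<partial>lborel) ^ CARD('d)"
    using fm by (intro nn_integral_lborel_vec_prod) auto
  also have "(\<integral>\<^sup>+x. ennreal (f x) \<partial>lborel) = ennreal (1 / sqrt (1 - \<kappa>))"
  proof -
    have "(\<integral>\<^sup>+x. ennreal (f x) \<partial>lborel) = (\<integral>\<^sup>+x. ennreal (1 / sqrt (1 - \<kappa>)) * ennreal (normal_density 0 (\<sigma> / sqrt (1 - \<kappa>)) x) \<partial>lborel)"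
      using assms by (simp add: f_def ennreal_mult[symmetric])
    also have "\<dots> = ennreal (1 / sqrt (1 - \<kappa>)) * 1"
      using assms by (subst nn_integral_cmult) (auto simp: nn_integral_normal_density)
    finally show ?thesis by simp
  qed
  finally show ?thesis using assms by (simp add: ennreal_power)
qed

section \<open>Translation and reflection of the Gaussian density\<close>

lemma nn_integral_lborel_reflect:
  fixes f :: "real ^ 'd \<Rightarrow> ennreal"
  assumes "f \<in> borel_measurable borel" "c = 1 \<or> c = - 1"
  shows "(\<integral>\<^sup>+z. f z \<partial>lborel) = (\<integral>\<^sup>+z. f (a + c *\<^sub>R z) \<partial>lborel)"
proof -
  have "c \<noteq> 0" "\<bar>c\<bar> = 1" using assms(2) by auto
  then have l: "lborel = distr lborel borel (\<lambda>x. a + c *\<^sub>R x)"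
    using lborel_affine[of c a] by (simp add: density_1)
  show ?thesis using assms(1) by (subst l) (simp add: nn_integral_distr)
qed

text \<open>Averaging over the reflection \<open>z \<mapsto> -z\<close> turns the Cameron--Martin weight into a hyperbolic
  cosine, which is at least 1.\<close>

lemma gauss_shift_lower:
  fixes a :: "real ^ 'd"
  assumes "\<sigma> > 0" "A0 \<in> sets borel" and sym: "\<And>z. z \<in> A0 \<longleftrightarrow> - z \<in> A0"
  shows "ennreal (exp (- (norm a)\<^sup>2 / (2 * \<sigma>\<^sup>2))) * (\<integral>\<^sup>+z. ennreal (gauss_density \<sigma> z) * indicator A0 z \<partial>lborel)
    \<le> (\<integral>\<^sup>+z. ennreal (gauss_density \<sigma> z) * indicator A0 (z - a) \<partial>lborel)" (is "?l \<le> ?r")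
proof -
  define p where "p = (gauss_density \<sigma> :: real ^ 'd \<Rightarrow> real)"
  have pm[measurable]: "p \<in> borel_measurable borel" unfolding p_def by (rule gauss_density_measurable)
  note assms(2)[measurable]
  define e where "e = exp (- (norm a)\<^sup>2 / (2 * \<sigma>\<^sup>2))"
  have m: "(\<lambda>z. ennreal (p z) * indicator A0 (z - a)) \<in> borel_measurable borel" by measurable
  have r1: "?r = (\<integral>\<^sup>+z. ennreal (p (a + z)) * indicator A0 z \<partial>lborel)"
    using nn_integral_lborel_reflect[OF m, of 1 a] by (simp add: p_def)
  have r2: "?r = (\<integral>\<^sup>+z. ennreal (p (a - z)) * indicator A0 z \<partial>lborel)"
  proof -
    have "indicator A0 (- z) = (indicator A0 z :: ennreal)" for z using sym[of z] by (simp add: indicator_def)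
    then show ?thesis using nn_integral_lborel_reflect[OF m, of "-1" a] by (simp add: p_def)
  qed
  have pt: "2 * (e * p z) \<le> p (a + z) + p (a - z)" for z
  proof -
    define u where "u = (a \<bullet> z) / \<sigma>\<^sup>2"
    have 1: "p (a + z) = e * p z * exp (- u)"
    proof -
      have "- (norm (a + z))\<^sup>2 / (2 * \<sigma>\<^sup>2) = - (norm a)\<^sup>2 / (2 * \<sigma>\<^sup>2) + - (norm z)\<^sup>2 / (2 * \<sigma>\<^sup>2) + - u"
        using assms(1) by (simp add: u_def power2_norm_eq_inner inner_add_left inner_add_right inner_commute field_simps)
      then show ?thesis unfolding p_def gauss_density_eq e_def by (simp only: exp_add) (simp add: mult_ac)
    qed
    have 2: "p (a - z) = e * p z * exp u"
    proof -
      have "- (norm (a - z))\<^sup>2 / (2 * \<sigma>\<^sup>2) = - (norm a)\<^sup>2 / (2 * \<sigma>\<^sup>2) + - (norm z)\<^sup>2 / (2 * \<sigma>\<^sup>2) + u"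
        using assms(1) by (simp add: u_def power2_norm_eq_inner inner_diff_left inner_diff_right inner_commute field_simps)
      then show ?thesis unfolding p_def gauss_density_eq e_def by (simp only: exp_add) (simp add: mult_ac)
    qed
    have "2 \<le> exp (- u) + exp u" using exp_ge_add_one_self[of u] exp_ge_add_one_self[of "- u"] by linarith
    then have "e * p z * 2 \<le> e * p z * (exp (- u) + exp u)"
      by (intro mult_left_mono) (auto simp: e_def p_def gauss_density_nonneg)
    then show ?thesis unfolding 1 2 by (simp add: algebra_simps)
  qed
  have "2 * ?l = (\<integral>\<^sup>+z. ennreal (2 * (e * p z)) * indicator A0 z \<partial>lborel)"
  proof -
    have "ennreal (2 * (e * p z)) * indicator A0 z = ennreal (2 * e) * (ennreal (p z) * indicator A0 z)" for z
      by (simp add: e_def p_def gauss_density_nonneg ennreal_mult[symmetric] mult.assoc[symmetric])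
    then have "(\<integral>\<^sup>+z. ennreal (2 * (e * p z)) * indicator A0 z \<partial>lborel) = ennreal (2 * e) * (\<integral>\<^sup>+z. ennreal (p z) * indicator A0 z \<partial>lborel)"
      by (simp add: nn_integral_cmult)
    then show ?thesis by (simp add: e_def p_def ennreal_mult mult.assoc)
  qed
  also have "\<dots> \<le> (\<integral>\<^sup>+z. (ennreal (p (a + z)) * indicator A0 z + ennreal (p (a - z)) * indicator A0 z) \<partial>lborel)"
  proof (rule nn_integral_mono)
    fix z
    have "ennreal (2 * (e * p z)) \<le> ennreal (p (a + z)) + ennreal (p (a - z))"
      using pt[of z] by (simp add: p_def gauss_density_nonneg ennreal_plus[symmetric] ennreal_leI del: ennreal_plus)
    then show "ennreal (2 * (e * p z)) * indicator A0 z \<le> ennreal (p (a + z)) * indicator A0 z + ennreal (p (a - z)) * indicator A0 z"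
      by (simp add: indicator_def)
  qed
  also have "\<dots> = ?r + ?r"
    by (subst nn_integral_add) (auto simp: r1[symmetric] r2[symmetric])
  also have "\<dots> = 2 * ?r" by (simp add: mult_2)
  finally show ?thesis by (simp add: ennreal_mult_le_mult_iff)
qed

context prob_space
begin

definition gaussian_vector :: "real \<Rightarrow> ('a \<Rightarrow> real ^ 'd) \<Rightarrow> bool" where
  "gaussian_vector \<sigma> D \<longleftrightarrow> distributed M lborel D (\<lambda>z. ennreal (gauss_density \<sigma> z))"

lemma gaussian_vector_measurable: "gaussian_vector \<sigma> D \<Longrightarrow> D \<in> borel_measurable M"
  unfolding gaussian_vector_def distributed_def by simp

lemma gaussian_vector_exp_square:
  assumes "gaussian_vector \<sigma> (D :: 'a \<Rightarrow> real ^ 'd)" "\<sigma> > 0" "\<kappa> < 1"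
  shows "(\<integral>\<^sup>+\<omega>. ennreal (exp (\<kappa> * (norm (D \<omega>))\<^sup>2 / (2 * \<sigma>\<^sup>2))) \<partial>M) = ennreal ((1 / sqrt (1 - \<kappa>)) ^ CARD('d))"
  using distributed_nn_integral[OF assms(1)[unfolded gaussian_vector_def], of "\<lambda>z. ennreal (exp (\<kappa> * (norm z)\<^sup>2 / (2 * \<sigma>\<^sup>2)))"]
    gauss_exp_square[OF assms(2,3), where 'd='d] by simp

text \<open>Chernoff's bound with the exponential moment at \<open>\<kappa> = 1 / 2\<close>, which
  equals \<open>sqrt 2 ^ CARD('d)\<close> and produces the exponent
  \<open>r\<^sup>2 / (4 * \<sigma>\<^sup>2)\<close>.\<close>

lemma gaussian_vector_tail:
  assumes D: "gaussian_vector \<sigma> (D :: 'a \<Rightarrow> real ^ 'd)" and "\<sigma> > 0" "r \<ge> 0"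
  shows "prob {\<omega> \<in> space M. norm (D \<omega>) > r} \<le> sqrt 2 ^ CARD('d) * exp (- r\<^sup>2 / (4 * \<sigma>\<^sup>2))"
proof -
  note gaussian_vector_measurable[OF D, measurable]
  define S where "S = {\<omega> \<in> space M. norm (D \<omega>) > r}"
  have S[measurable]: "S \<in> events" unfolding S_def by measurable
  have "ennreal (exp (r\<^sup>2 / (4 * \<sigma>\<^sup>2))) * emeasure M S = (\<integral>\<^sup>+\<omega>. ennreal (exp (r\<^sup>2 / (4 * \<sigma>\<^sup>2))) * indicator S \<omega> \<partial>M)"
    by (simp add: nn_integral_cmult_indicator)
  also have "\<dots> \<le> (\<integral>\<^sup>+\<omega>. ennreal (exp ((1 / 2) * (norm (D \<omega>))\<^sup>2 / (2 * \<sigma>\<^sup>2))) \<partial>M)"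
  proof (rule nn_integral_mono)
    fix \<omega>
    have "exp (r\<^sup>2 / (4 * \<sigma>\<^sup>2)) \<le> exp ((1 / 2) * (norm (D \<omega>))\<^sup>2 / (2 * \<sigma>\<^sup>2))" if "\<omega> \<in> S"
    proof -
      have "r\<^sup>2 \<le> (norm (D \<omega>))\<^sup>2" using that \<open>r \<ge> 0\<close> by (intro power_mono) (auto simp: S_def)
      then have "r\<^sup>2 / (4 * \<sigma>\<^sup>2) \<le> (norm (D \<omega>))\<^sup>2 / (4 * \<sigma>\<^sup>2)" by (rule divide_right_mono) simp
      then show ?thesis by simp
    qed
    then show "ennreal (exp (r\<^sup>2 / (4 * \<sigma>\<^sup>2))) * indicator S \<omega> \<le> ennreal (exp ((1 / 2) * (norm (D \<omega>))\<^sup>2 / (2 * \<sigma>\<^sup>2)))"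
      by (cases "\<omega> \<in> S") (simp_all add: ennreal_leI del: times_divide_eq_left times_divide_eq_right)
  qed
  also have "\<dots> = ennreal (sqrt 2 ^ CARD('d))"
    using gaussian_vector_exp_square[OF D \<open>\<sigma> > 0\<close>, of "1 / 2"] by (simp add: real_sqrt_divide)
  finally have "ennreal (exp (r\<^sup>2 / (4 * \<sigma>\<^sup>2)) * prob S) \<le> ennreal (sqrt 2 ^ CARD('d))"
    by (simp add: emeasure_eq_measure ennreal_mult)
  then have "exp (r\<^sup>2 / (4 * \<sigma>\<^sup>2)) * prob S \<le> sqrt 2 ^ CARD('d)"
    by (subst (asm) ennreal_le_iff) auto
  then have "prob S \<le> sqrt 2 ^ CARD('d) / exp (r\<^sup>2 / (4 * \<sigma>\<^sup>2))" by (simp add: pos_le_divide_eq mult.commute)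
  moreover have "exp (- r\<^sup>2 / (4 * \<sigma>\<^sup>2)) = inverse (exp (r\<^sup>2 / (4 * \<sigma>\<^sup>2)))"
    by (simp only: minus_divide_left[symmetric] exp_minus)
  ultimately show ?thesis unfolding S_def by (simp only: divide_inverse)
qed

text \<open>The Cameron--Martin lower bound for one increment. Expressed in terms of
  \<open>D\<close>, the centred event is a ball symmetric about 0 and the shift is
  \<open>(1 / \<epsilon>) *\<^sub>R \<xi>\<close>.\<close>

lemma gaussian_vector_shift_lower:
  assumes D: "gaussian_vector \<sigma> (D :: 'a \<Rightarrow> real ^ 'd)" and "\<sigma> > 0" "\<epsilon> > 0"
  shows "exp (- (norm \<xi>)\<^sup>2 / (2 * \<epsilon>\<^sup>2 * \<sigma>\<^sup>2)) * prob {\<omega> \<in> space M. norm (\<epsilon> *\<^sub>R D \<omega>) < r}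
    \<le> prob {\<omega> \<in> space M. norm (\<epsilon> *\<^sub>R D \<omega> - \<xi>) < r}"
proof -
  define A0 where "A0 = {z :: real ^ 'd. norm (\<epsilon> *\<^sub>R z) < r}"
  define a where "a = (1 / \<epsilon>) *\<^sub>R \<xi>"
  have A0: "A0 \<in> sets borel" unfolding A0_def by measurable
  have A: "{z. z - a \<in> A0} \<in> sets borel" using A0 by measurable
  have aa: "\<epsilon> *\<^sub>R (z - a) = \<epsilon> *\<^sub>R z - \<xi>" for z using \<open>\<epsilon> > 0\<close> by (simp add: a_def scaleR_right_diff_distrib)
  have e0: "{\<omega> \<in> space M. norm (\<epsilon> *\<^sub>R D \<omega>) < r} = D -` A0 \<inter> space M" by (auto simp: A0_def)
  have e1: "{\<omega> \<in> space M. norm (\<epsilon> *\<^sub>R D \<omega> - \<xi>) < r} = D -` {z. z - a \<in> A0} \<inter> space M"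
    by (simp only: A0_def mem_Collect_eq aa vimage_def) auto
  note dist = distributed_emeasure[OF D[unfolded gaussian_vector_def]]
  have "(norm a)\<^sup>2 / (2 * \<sigma>\<^sup>2) = (norm \<xi>)\<^sup>2 / (2 * \<epsilon>\<^sup>2 * \<sigma>\<^sup>2)"
    using \<open>\<epsilon> > 0\<close> by (simp add: a_def power_divide field_simps)
  then have na: "- (norm a)\<^sup>2 / (2 * \<sigma>\<^sup>2) = - (norm \<xi>)\<^sup>2 / (2 * \<epsilon>\<^sup>2 * \<sigma>\<^sup>2)" by simp
  have "ennreal (exp (- (norm a)\<^sup>2 / (2 * \<sigma>\<^sup>2))) * emeasure M (D -` A0 \<inter> space M) \<le> emeasure M (D -` {z. z - a \<in> A0} \<inter> space M)"
    using gauss_shift_lower[OF \<open>\<sigma> > 0\<close> A0, of a] dist[of A0] dist[of "{z. z - a \<in> A0}"] A0 A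
    by (simp add: A0_def indicator_def)
  then show ?thesis
    unfolding e0 e1 na by (simp add: emeasure_eq_measure ennreal_mult[symmetric])
qed

end

section \<open>Dyadic estimates for Brownian motion\<close>

lemma dyadic_incr_scaleR: "dyadic_incr n (\<lambda>t. c *\<^sub>R f t) k = c *\<^sub>R dyadic_incr n f k"
  by (simp add: dyadic_incr_def scaleR_right_diff_distrib)

lemma dyadic_energy_scaleR: "dyadic_energy n (\<lambda>t. c *\<^sub>R f t) = c\<^sup>2 * dyadic_energy n f"
  by (simp add: dyadic_energy_def dyadic_incr_scaleR power_mult_distrib sum_distrib_left mult_ac)

lemma polygon_close:
  fixes f g :: "real \<Rightarrow> 'v :: real_normed_vector"
  assumes "f 0 = g 0" and r: "\<And>k. k < 2 ^ n \<Longrightarrow> norm (dyadic_incr n f k - dyadic_incr n g k) \<le> r" and t: "t \<in> {0..1}"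
  shows "norm (polygon n f t - polygon n g t) \<le> 2 ^ n * r"
proof -
  have "norm (dyadic_incr n f 0 - dyadic_incr n g 0) \<le> r" using r[of 0] by simp
  then have r0: "0 \<le> r" by (rule order_trans[OF norm_ge_zero])
  have pts: "norm (f (real k / 2 ^ n) - g (real k / 2 ^ n)) \<le> real k * r" if "k \<le> 2 ^ n" for k
    using that
  proof (induction k)
    case (Suc k)
    have "f (real (Suc k) / 2 ^ n) - g (real (Suc k) / 2 ^ n) =
        (f (real k / 2 ^ n) - g (real k / 2 ^ n)) + (dyadic_incr n f k - dyadic_incr n g k)"
      by (simp add: dyadic_incr_def)
    then have "norm (f (real (Suc k) / 2 ^ n) - g (real (Suc k) / 2 ^ n)) \<le>
        norm (f (real k / 2 ^ n) - g (real k / 2 ^ n)) + norm (dyadic_incr n f k - dyadic_incr n g k)"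
      using norm_triangle_ineq by metis
    also have "\<dots> \<le> real k * r + r" using Suc r[of k] by (intro add_mono) auto
    finally show ?case by (simp add: algebra_simps)
  qed (simp add: assms(1))
  obtain k where k: "k < 2 ^ n" "real k \<le> t * 2 ^ n" "t * 2 ^ n \<le> real (Suc k)"
    using dyadic_index[OF t] by blast
  define s where "s = t * 2 ^ n - real k"
  have s: "0 \<le> s" "s \<le> 1" using k by (auto simp: s_def)
  have "polygon n f t - polygon n g t = (f (real k / 2 ^ n) - g (real k / 2 ^ n)) + s *\<^sub>R (dyadic_incr n f k - dyadic_incr n g k)"
    using polygon_eq[OF k(2,3), of f] polygon_eq[OF k(2,3), of g] by (simp add: s_def scaleR_right_diff_distrib)
  then have "norm (polygon n f t - polygon n g t) \<le>
      norm (f (real k / 2 ^ n) - g (real k / 2 ^ n)) + s * norm (dyadic_incr n f k - dyadic_incr n g k)"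
    using norm_triangle_ineq[of "f (real k / 2 ^ n) - g (real k / 2 ^ n)" "s *\<^sub>R (dyadic_incr n f k - dyadic_incr n g k)"] s
    by simp
  also have "\<dots> \<le> real k * r + 1 * r" using pts[of k] k(1) r[OF k(1)] s r0 by (intro add_mono mult_mono) auto
  also have "\<dots> = real (Suc k) * r" by (simp add: algebra_simps)
  also have "\<dots> \<le> 2 ^ n * r"
  proof (rule mult_right_mono[OF _ r0])
    have "real (Suc k) \<le> real (2 ^ n)" using k(1) by (simp only: of_nat_le_iff Suc_le_eq)
    then show "real (Suc k) \<le> 2 ^ n" by simp
  qed
  finally show ?thesis .
qed

lemma exp_neg_inverse_square_tendsto_0:
  fixes a :: real
  assumes "a > 0"
  shows "((\<lambda>\<epsilon>. exp (- a / \<epsilon>\<^sup>2)) \<longlongrightarrow> 0) (at_right 0)"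
  using assms by real_asymp

context prob_space
begin

lemma brownian_incr_gaussian:
  fixes w :: "real \<Rightarrow> 'a \<Rightarrow> real ^ 'd"
  assumes "standard_brownian_motion w"
  shows "gaussian_vector (sqrt (1 / 2 ^ n)) (\<lambda>\<omega>. dyadic_incr n (\<lambda>t. w t \<omega>) k)"
proof -
  define s t where "s = real k / 2 ^ n" and "t = real (Suc k) / 2 ^ n"
  have st: "0 \<le> s" "s < t" "t - s = 1 / 2 ^ n" by (auto simp: s_def t_def field_simps)
  have "distributed M lborel (\<lambda>\<omega>. w t \<omega> - w s \<omega>)
          (\<lambda>z. ennreal (\<Prod>i\<in>UNIV. normal_density 0 (sqrt (t - s)) (z $ i)))"
    using assms st unfolding standard_brownian_motion_def by blast
  then show ?thesis unfolding gaussian_vector_def dyadic_incr_def gauss_density_def st(3) by (simp add: s_def t_def)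
qed

lemma brownian_incr_indep:
  fixes w :: "real \<Rightarrow> 'a \<Rightarrow> real ^ 'd"
  assumes "standard_brownian_motion w"
  shows "indep_vars (\<lambda>_. borel) (\<lambda>k \<omega>. dyadic_incr n (\<lambda>t. w t \<omega>) k) UNIV"
proof -
  define \<tau> where "\<tau> k = real k / 2 ^ n" for k
  have "0 \<le> \<tau> 0 \<and> mono \<tau>" by (auto simp: \<tau>_def mono_def divide_right_mono)
  then have "indep_vars (\<lambda>_. borel) (\<lambda>k \<omega>. w (\<tau> (Suc k)) \<omega> - w (\<tau> k) \<omega>) UNIV"
    using assms unfolding standard_brownian_motion_def by blast
  then show ?thesis by (simp add: \<tau>_def dyadic_incr_def)
qed

lemma brownian_incr_measurable:
  fixes w :: "real \<Rightarrow> 'a \<Rightarrow> real ^ 'd"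
  assumes "standard_brownian_motion w"
  shows "(\<lambda>\<omega>. dyadic_incr n (\<lambda>t. w t \<omega>) k) \<in> borel_measurable M"
  by (rule gaussian_vector_measurable[OF brownian_incr_gaussian[OF assms]])

text \<open>An increment of level \<open>n\<close> has variance
  \<open>\<sigma>\<^sup>2 = 1 / 2 ^ n\<close> in each coordinate, so \<open>\<kappa> / 2\<close>
  times the energy is a sum of terms
  \<open>\<kappa> * (norm D)\<^sup>2 / (2 * \<sigma>\<^sup>2)\<close>, one for each increment
  \<open>D\<close>, and independence factors the moment.\<close>

lemma brownian_energy_exp:
  fixes w :: "real \<Rightarrow> 'a \<Rightarrow> real ^ 'd"
  assumes bm: "standard_brownian_motion w" and "\<kappa> < 1"
  shows "(\<integral>\<^sup>+\<omega>. ennreal (exp (\<kappa> / 2 * dyadic_energy n (\<lambda>t. w t \<omega>))) \<partial>M)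
    = ennreal (((1 / sqrt (1 - \<kappa>)) ^ CARD('d)) ^ (2 ^ n))"
proof -
  define \<sigma> where "\<sigma> = sqrt (1 / 2 ^ n)"
  have \<sigma>: "\<sigma> > 0" "\<sigma>\<^sup>2 = 1 / 2 ^ n" by (auto simp: \<sigma>_def)
  define X where "X k \<omega> = ennreal (exp (\<kappa> * (norm (dyadic_incr n (\<lambda>t. w t \<omega>) k))\<^sup>2 / (2 * \<sigma>\<^sup>2)))" for k \<omega>
  have "indep_vars (\<lambda>_. borel) X UNIV"
    unfolding X_def
    by (rule indep_vars_compose2[OF brownian_incr_indep[OF bm], where Y="\<lambda>_ z. ennreal (exp (\<kappa> * (norm z)\<^sup>2 / (2 * \<sigma>\<^sup>2)))"]) measurable
  then have indep: "indep_vars (\<lambda>_. borel) X {..<2 ^ n}" by (rule indep_vars_subset) simp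
  have "ennreal (exp (\<kappa> / 2 * dyadic_energy n (\<lambda>t. w t \<omega>))) = (\<Prod>k<2 ^ n. X k \<omega>)" for \<omega>
  proof -
    have "\<kappa> / 2 * dyadic_energy n (\<lambda>t. w t \<omega>) = (\<Sum>k<2 ^ n. \<kappa> * (norm (dyadic_incr n (\<lambda>t. w t \<omega>) k))\<^sup>2 / (2 * \<sigma>\<^sup>2))"
      unfolding \<sigma> by (simp add: dyadic_energy_def sum_distrib_left mult_ac)
    then show ?thesis by (simp add: X_def prod_ennreal exp_sum)
  qed
  then have "(\<integral>\<^sup>+\<omega>. ennreal (exp (\<kappa> / 2 * dyadic_energy n (\<lambda>t. w t \<omega>))) \<partial>M) = (\<integral>\<^sup>+\<omega>. (\<Prod>k<2 ^ n. X k \<omega>) \<partial>M)" by simp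
  also have "\<dots> = (\<Prod>k<2 ^ n. \<integral>\<^sup>+\<omega>. X k \<omega> \<partial>M)" by (rule indep_vars_nn_integral[OF _ indep]) auto
  also have "\<dots> = (\<Prod>k<(2 ^ n :: nat). ennreal ((1 / sqrt (1 - \<kappa>)) ^ CARD('d)))"
    unfolding X_def using gaussian_vector_exp_square[OF brownian_incr_gaussian[OF bm, of n] _ assms(2)] \<sigma>(1)
    by (simp add: \<sigma>_def)
  finally show ?thesis using assms(2) by (simp add: ennreal_power)
qed

text \<open>The dyadic increments of level \<open>n + j\<close> are allowed to be of size \<open>\<delta>/4 (3/4)\<^sup>j\<close>: this is summable in \<open>j\<close>,
  while its ratio to the standard deviation \<open>sqrt (1 / 2 ^ (n + j))\<close> grows geometrically because \<open>2 (3/4)\<^sup>2 = 9/8 > 1\<close>.\<close>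

lemma brownian_polygon_tail:
  fixes w :: "real \<Rightarrow> 'a \<Rightarrow> real ^ 'd"
  assumes bm: "standard_brownian_motion w" and "\<delta> > 0"
  shows "\<exists>N. \<forall>n\<ge>N. \<exists>C\<ge>0. \<forall>\<epsilon>. 0 < \<epsilon> \<and> \<epsilon> \<le> 1 \<longrightarrow> (\<exists>S\<in>events. prob S \<le> C * exp (- R / \<epsilon>\<^sup>2) \<and>
    (\<forall>\<omega>\<in>space M - S. continuous_on {0..1} (\<lambda>t. w t \<omega>) \<longrightarrow>
      (\<forall>t\<in>{0..1}. norm (\<epsilon> *\<^sub>R w t \<omega> - polygon n (\<lambda>t. \<epsilon> *\<^sub>R w t \<omega>) t) \<le> \<delta>)))"
proof -
  \<comment> \<open>\<open>\<delta>\<^sup>2 / 64 * 2 ^ n\<close> is the Gaussian exponent for an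
    increment of level \<open>n\<close> and size \<open>\<delta> / 4\<close> at
    \<open>\<epsilon> = 1\<close>. Exceeding \<open>R\<close> gives the required rate, and exceeding
    16 gives the slack for summation over the levels.\<close>
  obtain N where N: "max R 16 / (\<delta>\<^sup>2 / 64) < 2 ^ N" using real_arch_pow[of 2 "max R 16 / (\<delta>\<^sup>2 / 64)"] by auto
  show ?thesis
  proof (rule exI[of _ N], intro allI impI)
    fix n assume "n \<ge> N"
    define q0 where "q0 = \<delta>\<^sup>2 / 64 * 2 ^ n"
    have "(2 :: real) ^ N \<le> 2 ^ n" using \<open>n \<ge> N\<close> by (intro power_increasing) auto
    then have "max R 16 / (\<delta>\<^sup>2 / 64) < 2 ^ n" using N by linarith
    then have "max R 16 < q0" using \<open>\<delta> > 0\<close> by (simp add: q0_def pos_divide_less_eq mult.commute)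
    then have q0: "R \<le> q0" "16 \<le> q0" by auto
    define cg :: real where "cg = sqrt 2 ^ CARD('d)"
    have "cg \<ge> 0" by (simp add: cg_def)
    \<comment> \<open>\<open>2 ^ n\<close> counts the increments of level \<open>n\<close>,
      \<open>cg\<close> is the prefactor of the tail bound, and 2 is the sum of the geometric series
      over the levels.\<close>
    define C where "C = 2 * (2 ^ n * cg)"
    show "\<exists>C\<ge>0. \<forall>\<epsilon>. 0 < \<epsilon> \<and> \<epsilon> \<le> 1 \<longrightarrow> (\<exists>S\<in>events. prob S \<le> C * exp (- R / \<epsilon>\<^sup>2) \<and>
      (\<forall>\<omega>\<in>space M - S. continuous_on {0..1} (\<lambda>t. w t \<omega>) \<longrightarrow>
        (\<forall>t\<in>{0..1}. norm (\<epsilon> *\<^sub>R w t \<omega> - polygon n (\<lambda>t. \<epsilon> *\<^sub>R w t \<omega>) t) \<le> \<delta>)))"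
    proof (intro exI[of _ C] conjI allI impI)
      show "0 \<le> C" using \<open>cg \<ge> 0\<close> by (simp add: C_def)
      fix \<epsilon> :: real assume \<epsilon>: "0 < \<epsilon> \<and> \<epsilon> \<le> 1"
      define q where "q = q0 / \<epsilon>\<^sup>2"
      have e2: "0 < \<epsilon>\<^sup>2" "\<epsilon>\<^sup>2 \<le> 1" using \<epsilon> by (auto simp: power_le_one)
      have "q0 * \<epsilon>\<^sup>2 \<le> q0 * 1" using q0 e2 by (intro mult_left_mono) auto
      then have "q0 \<le> q" using e2 by (simp add: q_def pos_le_divide_eq)
      then have q16: "16 \<le> q" using q0 by simp
      define c where "c j = \<delta> / 4 * (3 / 4) ^ j" for j
      have c0: "c j \<ge> 0" for j using \<open>\<delta> > 0\<close> by (simp add: c_def)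
      define T where "T j k = {\<omega> \<in> space M. norm (dyadic_incr (n + j) (\<lambda>t. w t \<omega>) k) > c j / \<epsilon>}" for j k
      have Tm: "T j k \<in> events" for j k
      proof -
        note brownian_incr_measurable[OF bm, measurable]
        show ?thesis unfolding T_def by measurable
      qed
      have PT: "prob (T j k) \<le> cg * (exp (- q) * (1 / 4) ^ j)" for j k
      proof -
        define \<sigma> where "\<sigma> = sqrt (1 / 2 ^ (n + j))"
        have \<sigma>: "\<sigma> > 0" "\<sigma>\<^sup>2 = 1 / 2 ^ (n + j)" by (auto simp: \<sigma>_def)
        have "(c j / \<epsilon>)\<^sup>2 / (4 * \<sigma>\<^sup>2) = (\<delta> / 4)\<^sup>2 * ((3 / 4) ^ j)\<^sup>2 / \<epsilon>\<^sup>2 * (2 ^ n * 2 ^ j) / 4"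
          unfolding \<sigma> by (simp add: c_def power_divide power_mult_distrib power_add)
        also have "((3 / 4 :: real) ^ j)\<^sup>2 = (9 / 16) ^ j" by (simp add: power2_eq_square power_mult_distrib[symmetric])
        also have "(\<delta> / 4)\<^sup>2 * (9 / 16) ^ j / \<epsilon>\<^sup>2 * (2 ^ n * 2 ^ j) / 4 = q * ((9 / 16) ^ j * 2 ^ j)"
          by (simp add: q_def q0_def power_divide mult_ac)
        also have "(9 / 16 :: real) ^ j * 2 ^ j = (9 / 8) ^ j" by (simp add: power_mult_distrib[symmetric])
        finally have ex: "(c j / \<epsilon>)\<^sup>2 / (4 * \<sigma>\<^sup>2) = q * (9 / 8) ^ j" .
        \<comment> \<open>Bernoulli's inequality turns \<open>(9 / 8) ^ j\<close> into linear
          growth: with \<open>q \<ge> 16\<close> the exponent is at least \<open>q + 2 * j\<close>.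
          The resulting factor \<open>(1 / 4) ^ j\<close> outweighs the \<open>2 ^ j\<close> growth
          in the number of increments.\<close>
        have "1 + real j * (1 / 8) \<le> (1 + 1 / 8) ^ j" by (rule Bernoulli_inequality) simp
        then have "q * (1 + real j * (1 / 8)) \<le> q * (9 / 8) ^ j" using q16 by (intro mult_left_mono) auto
        moreover have "16 * real j \<le> q * real j" using q16 by (intro mult_right_mono) auto
        ultimately have "q + 2 * real j \<le> q * (9 / 8) ^ j" by (simp add: algebra_simps)
        then have "exp (- (q * (9 / 8) ^ j)) \<le> exp (- q + real j * (- 2))" by simp
        also have "\<dots> = exp (- q) * exp (- 2) ^ j" by (simp only: exp_add exp_of_nat_mult)
        also have "exp (- 2 :: real) ^ j \<le> (1 / 4) ^ j"
        proof (rule power_mono)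
          have "2 \<le> exp (1 :: real)" using exp_ge_add_one_self[of 1] by simp
          then have "2 * 2 \<le> exp (1 :: real) * exp 1" by (intro mult_mono) auto
          then have "4 \<le> exp (2 :: real)" by (simp add: exp_add[symmetric])
          then show "exp (- 2 :: real) \<le> 1 / 4" by (simp add: exp_minus field_simps)
        qed simp
        finally have e: "exp (- (q * (9 / 8) ^ j)) \<le> exp (- q) * (1 / 4) ^ j" by simp
        have "prob (T j k) \<le> cg * exp (- (c j / \<epsilon>)\<^sup>2 / (4 * \<sigma>\<^sup>2))"
          unfolding T_def cg_def
          by (rule gaussian_vector_tail) (use brownian_incr_gaussian[OF bm, of "n + j" k] \<sigma> \<epsilon> c0[of j] in \<open>auto simp: \<sigma>_def\<close>)
        also have "- (c j / \<epsilon>)\<^sup>2 / (4 * \<sigma>\<^sup>2) = - (q * (9 / 8) ^ j)" using ex by simp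
        also have "cg * exp (- (q * (9 / 8) ^ j)) \<le> cg * (exp (- q) * (1 / 4) ^ j)"
          using e \<open>cg \<ge> 0\<close> by (rule mult_left_mono)
        finally show ?thesis .
      qed
      define A where "A j = (\<Union>k<2 ^ (n + j). T j k)" for j
      have Am: "A j \<in> events" for j unfolding A_def using Tm by auto
      define K where "K = 2 ^ n * cg * exp (- q)"
      have PA: "prob (A j) \<le> K * (1 / 2) ^ j" for j
      proof -
        have "prob (A j) \<le> (\<Sum>k<2 ^ (n + j). prob (T j k))" unfolding A_def using Tm by (intro measure_UNION_le) auto
        also have "\<dots> \<le> (\<Sum>k<(2 ^ (n + j) :: nat). cg * (exp (- q) * (1 / 4) ^ j))" using PT by (intro sum_mono) auto
        also have "\<dots> = 2 ^ n * 2 ^ j * (cg * (exp (- q) * (1 / 4) ^ j))" by (simp add: power_add)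
        also have "\<dots> = K * (2 ^ j * (1 / 4) ^ j)" by (simp add: K_def)
        also have "2 ^ j * (1 / 4 :: real) ^ j = (1 / 2) ^ j" by (simp add: power_mult_distrib[symmetric])
        finally show ?thesis .
      qed
      have sK: "(\<lambda>j. K * (1 / 2) ^ j) sums (K * 2)"
        using sums_mult[OF power_half_series[THEN sums_Suc_iff[THEN iffD1]], of K] geometric_sums[of "1 / 2 :: real", THEN sums_mult, of K] by simp
      have sumA: "summable (\<lambda>j. prob (A j))"
        by (rule summable_comparison_test'[OF sums_summable[OF sK]]) (use PA in simp)
      define S where "S = (\<Union>j. A j)"
      show "\<exists>S\<in>events. prob S \<le> C * exp (- R / \<epsilon>\<^sup>2) \<and>
        (\<forall>\<omega>\<in>space M - S. continuous_on {0..1} (\<lambda>t. w t \<omega>) \<longrightarrow>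
          (\<forall>t\<in>{0..1}. norm (\<epsilon> *\<^sub>R w t \<omega> - polygon n (\<lambda>t. \<epsilon> *\<^sub>R w t \<omega>) t) \<le> \<delta>))"
      proof (intro bexI[of _ S] conjI ballI impI)
        show "S \<in> events" unfolding S_def using Am by auto
        have "prob S \<le> (\<Sum>j. prob (A j))"
          unfolding S_def using Am sumA by (intro finite_measure_subadditive_countably) auto
        also have "\<dots> \<le> (\<Sum>j. K * (1 / 2) ^ j)" by (rule suminf_le[OF PA sumA sums_summable[OF sK]])
        also have "\<dots> = K * 2" using sK by (rule sums_unique[symmetric])
        also have "\<dots> = C * exp (- q)" by (simp add: K_def C_def)
        also have "\<dots> \<le> C * exp (- R / \<epsilon>\<^sup>2)"
        proof (rule mult_left_mono[OF _ \<open>0 \<le> C\<close>])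
          have "R / \<epsilon>\<^sup>2 \<le> q" unfolding q_def using q0 e2 by (intro divide_right_mono) auto
          then show "exp (- q) \<le> exp (- R / \<epsilon>\<^sup>2)" by simp
        qed
        finally show "prob S \<le> C * exp (- R / \<epsilon>\<^sup>2)" .
      next
        fix \<omega> t assume \<omega>: "\<omega> \<in> space M - S" and cont: "continuous_on {0..1} (\<lambda>t. w t \<omega>)" and t: "t \<in> {0..1 :: real}"
        show "norm (\<epsilon> *\<^sub>R w t \<omega> - polygon n (\<lambda>t. \<epsilon> *\<^sub>R w t \<omega>) t) \<le> \<delta>"
        proof (rule polygon_chaining[OF _ \<open>\<delta> > 0\<close> _ t])
          show "continuous_on {0..1} (\<lambda>t. \<epsilon> *\<^sub>R w t \<omega>)" using cont by (intro continuous_intros)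
          fix j k :: nat assume "k < 2 ^ (n + j)"
          then have "\<omega> \<notin> T j k" using \<omega> by (auto simp: S_def A_def)
          then have "norm (dyadic_incr (n + j) (\<lambda>t. w t \<omega>) k) \<le> c j / \<epsilon>" using \<omega> by (auto simp: T_def)
          then have "\<epsilon> * norm (dyadic_incr (n + j) (\<lambda>t. w t \<omega>) k) \<le> c j" using \<epsilon> by (simp add: field_simps)
          then show "norm (dyadic_incr (n + j) (\<lambda>t. \<epsilon> *\<^sub>R w t \<omega>) k) \<le> \<delta> / 4 * (3 / 4) ^ j"
            using \<epsilon> by (simp add: dyadic_incr_scaleR c_def)
        qed
      qed
    qed
  qed
qed

text \<open>The distance to \<open>\<psi>\<close> is split into thirds: from the noise to its
  polygon, from there to the polygon of \<open>\<psi>\<close>, and from there to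
  \<open>\<psi>\<close>. The second third is an event about \<open>2 ^ n\<close> independent
  increments, each shifted at the cost of its share of the energy; the first fails only on an event
  of faster exponential decay.\<close>

lemma brownian_ball_lower:
  fixes w :: "real \<Rightarrow> 'a \<Rightarrow> real ^ 'd"
  assumes bm: "standard_brownian_motion w" and \<psi>0: "\<psi> 0 = 0" and \<psi>c: "continuous_on {0..1} \<psi>"
    and E: "\<And>n. dyadic_energy n \<psi> \<le> E" and "\<delta> > 0"
  shows "\<exists>c>0. \<forall>\<^sub>F \<epsilon> in at_right 0. \<exists>S\<in>events. c * exp (- E / (2 * \<epsilon>\<^sup>2)) \<le> prob S \<and>
    (\<forall>\<omega>\<in>S. continuous_on {0..1} (\<lambda>t. w t \<omega>) \<longrightarrow> w 0 \<omega> = 0 \<longrightarrow> (\<forall>t\<in>{0..1}. norm (\<epsilon> *\<^sub>R w t \<omega> - \<psi> t) \<le> \<delta>))"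
proof -
  define \<delta>' where "\<delta>' = \<delta> / 3"
  have "\<delta>' > 0" using \<open>\<delta> > 0\<close> by (simp add: \<delta>'_def)
  \<comment> \<open>The rate \<open>E / 2 + 1\<close> exceeds the cost \<open>E / 2\<close> of the
    main event, so the discarded event is smaller by the factor
    \<open>exp (- 1 / \<epsilon>\<^sup>2)\<close> up to constants.\<close>
  obtain N1 where N1: "\<forall>n\<ge>N1. \<exists>C\<ge>0. \<forall>\<epsilon>. 0 < \<epsilon> \<and> \<epsilon> \<le> 1 \<longrightarrow> (\<exists>S\<in>events. prob S \<le> C * exp (- (E / 2 + 1) / \<epsilon>\<^sup>2) \<and>
    (\<forall>\<omega>\<in>space M - S. continuous_on {0..1} (\<lambda>t. w t \<omega>) \<longrightarrow>
      (\<forall>t\<in>{0..1}. norm (\<epsilon> *\<^sub>R w t \<omega> - polygon n (\<lambda>t. \<epsilon> *\<^sub>R w t \<omega>) t) \<le> \<delta>')))"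
    using brownian_polygon_tail[OF bm \<open>\<delta>' > 0\<close>, of "E / 2 + 1"] by blast
  have "\<forall>\<^sub>F n in sequentially. \<forall>t\<in>{0..1}. dist (polygon n \<psi> t) (\<psi> t) < \<delta>'"
    by (rule uniform_limitD[OF polygon_uniform_limit[OF \<psi>c] \<open>\<delta>' > 0\<close>])
  then obtain N2 where N2: "\<And>n t. n \<ge> N2 \<Longrightarrow> t \<in> {0..1} \<Longrightarrow> dist (polygon n \<psi> t) (\<psi> t) < \<delta>'"
    unfolding eventually_sequentially by blast
  define n where "n = max N1 N2"
  obtain C where "C \<ge> 0" and C: "\<And>\<epsilon>. 0 < \<epsilon> \<and> \<epsilon> \<le> 1 \<Longrightarrow> (\<exists>S\<in>events. prob S \<le> C * exp (- (E / 2 + 1) / \<epsilon>\<^sup>2) \<and>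
    (\<forall>\<omega>\<in>space M - S. continuous_on {0..1} (\<lambda>t. w t \<omega>) \<longrightarrow>
      (\<forall>t\<in>{0..1}. norm (\<epsilon> *\<^sub>R w t \<omega> - polygon n (\<lambda>t. \<epsilon> *\<^sub>R w t \<omega>) t) \<le> \<delta>')))"
    using N1[rule_format, of n] by (auto simp: n_def)
  \<comment> \<open>An error of \<open>r\<close> in each increment accumulates to at most
    \<open>2 ^ n * r\<close> along the polygon.\<close>
  define r where "r = \<delta>' / 2 ^ n"
  have "r > 0" using \<open>\<delta>' > 0\<close> by (simp add: r_def)
  define \<sigma> where "\<sigma> = sqrt (1 / 2 ^ n)"
  have \<sigma>: "\<sigma> > 0" "\<sigma>\<^sup>2 = 1 / 2 ^ n" by (auto simp: \<sigma>_def)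
  define cg :: real where "cg = sqrt 2 ^ CARD('d)"
  have "cg \<ge> 0" by (simp add: cg_def)
  define m :: nat where "m = 2 ^ n"
  \<comment> \<open>One factor 1/2 bounds the centred ball of each of the \<open>m\<close>
    increments; the last one pays for the part of the event lost to \<open>S0\<close>.\<close>
  define c where "c = (1 / 2) ^ m / (2 :: real)"
  define D where "D k \<omega> = dyadic_incr n (\<lambda>t. w t \<omega>) k" for k \<omega>
  have Dg: "gaussian_vector \<sigma> (D k)" for k
    using brownian_incr_gaussian[OF bm, of n k] unfolding D_def[abs_def] \<sigma>_def .
  note Dm[measurable] = gaussian_vector_measurable[OF Dg]
  have "((\<lambda>\<epsilon>. cg * exp (- ((r / 2)\<^sup>2 / (4 * \<sigma>\<^sup>2)) / \<epsilon>\<^sup>2)) \<longlongrightarrow> cg * 0) (at_right 0)"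
    using \<open>r > 0\<close> \<sigma> by (intro tendsto_mult tendsto_const exp_neg_inverse_square_tendsto_0) auto
  then have ev1: "\<forall>\<^sub>F \<epsilon> in at_right 0. cg * exp (- ((r / 2)\<^sup>2 / (4 * \<sigma>\<^sup>2)) / \<epsilon>\<^sup>2) < 1 / 2"
    by (rule order_tendstoD(2)) simp
  have "((\<lambda>\<epsilon>. C * exp (- 1 / \<epsilon>\<^sup>2)) \<longlongrightarrow> C * 0) (at_right 0)"
    by (intro tendsto_mult tendsto_const exp_neg_inverse_square_tendsto_0) auto
  then have ev2: "\<forall>\<^sub>F \<epsilon> in at_right 0. C * exp (- 1 / \<epsilon>\<^sup>2) < c"
    by (rule order_tendstoD(2)) (simp add: c_def)
  have ev3: "\<forall>\<^sub>F \<epsilon> :: real in at_right 0. 0 < \<epsilon> \<and> \<epsilon> < 1"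
    using eventually_at_right_real[of 0 1] by (rule eventually_mono) auto
  show ?thesis
  proof (intro exI[of _ c] conjI)
    show "0 < c" by (simp add: c_def)
    show "\<forall>\<^sub>F \<epsilon> in at_right 0. \<exists>S\<in>events. c * exp (- E / (2 * \<epsilon>\<^sup>2)) \<le> prob S \<and>
      (\<forall>\<omega>\<in>S. continuous_on {0..1} (\<lambda>t. w t \<omega>) \<longrightarrow> w 0 \<omega> = 0 \<longrightarrow> (\<forall>t\<in>{0..1}. norm (\<epsilon> *\<^sub>R w t \<omega> - \<psi> t) \<le> \<delta>))"
      using ev1 ev2 ev3
    proof eventually_elim
      case (elim \<epsilon>)
      have "\<epsilon> > 0" using elim by simp
      define \<xi> where "\<xi> k = dyadic_incr n \<psi> k" for k
      define B where "B k = {\<omega> \<in> space M. norm (\<epsilon> *\<^sub>R D k \<omega> - \<xi> k) < r}" for k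
      define b where "b = 1 / (2 :: real)"
      have half: "prob {\<omega> \<in> space M. norm (\<epsilon> *\<^sub>R D k \<omega>) < r} \<ge> b" for k
      proof -
        define T where "T = {\<omega> \<in> space M. norm (D k \<omega>) > r / (2 * \<epsilon>)}"
        have Tm: "T \<in> events" unfolding T_def by measurable
        have "prob T \<le> cg * exp (- (r / (2 * \<epsilon>))\<^sup>2 / (4 * \<sigma>\<^sup>2))"
          unfolding T_def cg_def by (rule gaussian_vector_tail[OF Dg \<sigma>(1)]) (use \<open>r > 0\<close> \<open>\<epsilon> > 0\<close> in simp)
        also have "- (r / (2 * \<epsilon>))\<^sup>2 / (4 * \<sigma>\<^sup>2) = - ((r / 2)\<^sup>2 / (4 * \<sigma>\<^sup>2)) / \<epsilon>\<^sup>2"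
          by (simp add: power_divide power_mult_distrib)
        finally have "prob T \<le> b" using elim(1) by (simp add: b_def)
        moreover have "prob (space M - T) = 1 - prob T" by (rule prob_compl[OF Tm])
        moreover have "prob (space M - T) \<le> prob {\<omega> \<in> space M. norm (\<epsilon> *\<^sub>R D k \<omega>) < r}"
        proof (rule finite_measure_mono)
          show "space M - T \<subseteq> {\<omega> \<in> space M. norm (\<epsilon> *\<^sub>R D k \<omega>) < r}"
          proof
            fix \<omega> assume "\<omega> \<in> space M - T"
            then have "\<omega> \<in> space M" "norm (D k \<omega>) \<le> r / (2 * \<epsilon>)" by (auto simp: T_def)
            moreover from this have "\<epsilon> * norm (D k \<omega>) \<le> \<epsilon> * (r / (2 * \<epsilon>))" using \<open>\<epsilon> > 0\<close> by (intro mult_left_mono) auto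
            moreover have "\<epsilon> * (r / (2 * \<epsilon>)) < r" using \<open>\<epsilon> > 0\<close> \<open>r > 0\<close> by simp
            ultimately show "\<omega> \<in> {\<omega> \<in> space M. norm (\<epsilon> *\<^sub>R D k \<omega>) < r}" using \<open>\<epsilon> > 0\<close> by simp
          qed
          show "{\<omega> \<in> space M. norm (\<epsilon> *\<^sub>R D k \<omega>) < r} \<in> events" by measurable
        qed
        ultimately show ?thesis by (simp add: b_def)
      qed
      have PB: "exp (- (norm (\<xi> k))\<^sup>2 / (2 * \<epsilon>\<^sup>2 * \<sigma>\<^sup>2)) * b \<le> prob (B k)" for k
      proof -
        have "exp (- (norm (\<xi> k))\<^sup>2 / (2 * \<epsilon>\<^sup>2 * \<sigma>\<^sup>2)) * b \<le>
          exp (- (norm (\<xi> k))\<^sup>2 / (2 * \<epsilon>\<^sup>2 * \<sigma>\<^sup>2)) * prob {\<omega> \<in> space M. norm (\<epsilon> *\<^sub>R D k \<omega>) < r}"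
          using half by (intro mult_left_mono) auto
        also have "\<dots> \<le> prob (B k)" unfolding B_def by (rule gaussian_vector_shift_lower[OF Dg \<sigma>(1) \<open>\<epsilon> > 0\<close>])
        finally show ?thesis .
      qed
      define G where "G = (\<Inter>k\<in>{..<m}. D k -` {z. norm (\<epsilon> *\<^sub>R z - \<xi> k) < r} \<inter> space M)"
      have "m > 0" by (simp add: m_def)
      have Bk: "D k -` {z. norm (\<epsilon> *\<^sub>R z - \<xi> k) < r} \<inter> space M = B k" for k by (auto simp: B_def)
      have Bm: "B k \<in> events" for k unfolding B_def by measurable
      have Gsub: "G \<subseteq> B k" if "k < m" for k unfolding G_def Bk using that by (intro INT_lower) simp
      have Gm: "G \<in> events" unfolding G_def Bk using \<open>m > 0\<close> Bm by (intro sets.finite_INT) auto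
      have "prob G = (\<Prod>k<m. prob (D k -` {z. norm (\<epsilon> *\<^sub>R z - \<xi> k) < r} \<inter> space M))"
        unfolding G_def
      proof (rule indep_varsD)
        show "indep_vars (\<lambda>_. borel) D UNIV" using brownian_incr_indep[OF bm, of n] unfolding D_def[abs_def] .
        show "{..<m} \<noteq> {}" using \<open>m > 0\<close> by auto
        show "{z. norm (\<epsilon> *\<^sub>R z - \<xi> k) < r} \<in> sets borel" for k by measurable
      qed auto
      then have PG: "prob G = (\<Prod>k<m. prob (B k))" unfolding Bk .
      have "(1 / 2) ^ m * exp (- E / (2 * \<epsilon>\<^sup>2)) \<le> b ^ m * exp (- dyadic_energy n \<psi> / (2 * \<epsilon>\<^sup>2))"
        unfolding b_def using E[of n] by (intro mult_left_mono) (auto intro!: divide_right_mono)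
      also have "- dyadic_energy n \<psi> / (2 * \<epsilon>\<^sup>2) = (\<Sum>k<m. - (norm (\<xi> k))\<^sup>2 / (2 * \<epsilon>\<^sup>2 * \<sigma>\<^sup>2))"
        unfolding \<sigma> by (simp add: dyadic_energy_def \<xi>_def m_def sum_distrib_left sum_divide_distrib sum_negf mult_ac)
      also have "b ^ m * exp (\<Sum>k<m. - (norm (\<xi> k))\<^sup>2 / (2 * \<epsilon>\<^sup>2 * \<sigma>\<^sup>2)) = (\<Prod>k<m. exp (- (norm (\<xi> k))\<^sup>2 / (2 * \<epsilon>\<^sup>2 * \<sigma>\<^sup>2)) * b)"
        by (simp add: exp_sum prod.distrib mult.commute)
      also have "\<dots> \<le> prob G" unfolding PG by (intro prod_mono) (use PB in \<open>auto simp: b_def\<close>)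
      finally have lowG: "(1 / 2) ^ m * exp (- E / (2 * \<epsilon>\<^sup>2)) \<le> prob G" .
      obtain S0 where S0: "S0 \<in> events" "prob S0 \<le> C * exp (- (E / 2 + 1) / \<epsilon>\<^sup>2)"
        "\<And>\<omega> t. \<omega> \<in> space M - S0 \<Longrightarrow> continuous_on {0..1} (\<lambda>t. w t \<omega>) \<Longrightarrow> t \<in> {0..1} \<Longrightarrow>
          norm (\<epsilon> *\<^sub>R w t \<omega> - polygon n (\<lambda>t. \<epsilon> *\<^sub>R w t \<omega>) t) \<le> \<delta>'"
        using C[of \<epsilon>] elim by auto
      have "prob S0 \<le> c * exp (- E / (2 * \<epsilon>\<^sup>2))"
      proof -
        have "- (E / 2 + 1) / \<epsilon>\<^sup>2 = - 1 / \<epsilon>\<^sup>2 + - E / (2 * \<epsilon>\<^sup>2)" using \<open>\<epsilon> > 0\<close> by (simp add: field_simps)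
        then have "C * exp (- (E / 2 + 1) / \<epsilon>\<^sup>2) = (C * exp (- 1 / \<epsilon>\<^sup>2)) * exp (- E / (2 * \<epsilon>\<^sup>2))" by (simp only: exp_add mult.assoc)
        also have "\<dots> \<le> c * exp (- E / (2 * \<epsilon>\<^sup>2))" using elim(2) by (intro mult_right_mono) auto
        finally show ?thesis using S0(2) by simp
      qed
      moreover have "prob (G - S0) \<ge> prob G - prob S0"
        using finite_measure_Diff'[OF Gm S0(1)] finite_measure_mono[of "G \<inter> S0" S0] S0(1) by auto
      moreover have "(1 / 2) ^ m * exp (- E / (2 * \<epsilon>\<^sup>2)) = 2 * (c * exp (- E / (2 * \<epsilon>\<^sup>2)))" by (simp add: c_def)
      ultimately have low: "c * exp (- E / (2 * \<epsilon>\<^sup>2)) \<le> prob (G - S0)" using lowG by linarith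
      show ?case
      proof (intro bexI[of _ "G - S0"] conjI ballI impI low)
        show "G - S0 \<in> events" using Gm S0(1) by auto
        fix \<omega> t assume \<omega>: "\<omega> \<in> G - S0" and cont: "continuous_on {0..1} (\<lambda>t. w t \<omega>)" and w0: "w 0 \<omega> = 0" and t: "t \<in> {0..1 :: real}"
        have "\<omega> \<in> space M" using \<omega> sets.sets_into_space[OF Gm] by auto
        then have 1: "norm (\<epsilon> *\<^sub>R w t \<omega> - polygon n (\<lambda>t. \<epsilon> *\<^sub>R w t \<omega>) t) \<le> \<delta>'" using S0(3)[OF _ cont t] \<omega> by auto
        have "norm (polygon n (\<lambda>t. \<epsilon> *\<^sub>R w t \<omega>) t - polygon n \<psi> t) \<le> 2 ^ n * r"
        proof (rule polygon_close[OF _ _ t])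
          show "\<epsilon> *\<^sub>R w 0 \<omega> = \<psi> 0" by (simp add: w0 \<psi>0)
          fix k :: nat assume "k < 2 ^ n"
          then have "\<omega> \<in> B k" using \<omega> Gsub[of k] by (auto simp: m_def)
          then have "norm (\<epsilon> *\<^sub>R D k \<omega> - \<xi> k) < r" by (simp add: B_def)
          then show "norm (dyadic_incr n (\<lambda>t. \<epsilon> *\<^sub>R w t \<omega>) k - dyadic_incr n \<psi> k) \<le> r"
            by (simp add: D_def \<xi>_def dyadic_incr_scaleR)
        qed
        then have 2: "norm (polygon n (\<lambda>t. \<epsilon> *\<^sub>R w t \<omega>) t - polygon n \<psi> t) \<le> \<delta>'" by (simp add: r_def)
        have 3: "norm (polygon n \<psi> t - \<psi> t) \<le> \<delta>'" using N2[of n t] t by (simp add: n_def dist_norm)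
        have "norm (\<epsilon> *\<^sub>R w t \<omega> - \<psi> t) \<le> \<delta>' + \<delta>' + \<delta>'"
          using norm_triangle_ineq[of "\<epsilon> *\<^sub>R w t \<omega> - polygon n (\<lambda>t. \<epsilon> *\<^sub>R w t \<omega>) t" "polygon n (\<lambda>t. \<epsilon> *\<^sub>R w t \<omega>) t - \<psi> t"]
            norm_triangle_ineq[of "polygon n (\<lambda>t. \<epsilon> *\<^sub>R w t \<omega>) t - polygon n \<psi> t" "polygon n \<psi> t - \<psi> t"] 1 2 3
          by simp
        then show "norm (\<epsilon> *\<^sub>R w t \<omega> - \<psi> t) \<le> \<delta>" by (simp add: \<delta>'_def)
      qed
    qed
  qed
qed

end

section \<open>The Laplace principle\<close>

lemma restrict_in_path_space:
  fixes x :: "real \<Rightarrow> real ^ 'd"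
  assumes "continuous_on {0..1} x"
  shows "restrict x {0..1} \<in> mspace path_space"
proof -
  have "continuous_on {0..1} (restrict x {0..1})"
    using assms by (rule continuous_on_eq) simp
  then show ?thesis by (simp add: mspace_path_space)
qed

text \<open>Continuity of \<open>h\<close> is given on extensional functions only, hence the
  restrictions. The metric is a supremum, so a pointwise bound by half the radius of a ball keeps
  the distance strictly below the radius.\<close>

lemma continuous_map_path_space_at:
  fixes h :: "(real \<Rightarrow> real ^ 'd) \<Rightarrow> real"
  assumes h: "continuous_map (mtopology_of path_space) euclideanreal h"
    and x: "continuous_on {0..1} x" and "e > 0"
  shows "\<exists>d>0. \<forall>x'. continuous_on {0..1} x' \<longrightarrow> (\<forall>t\<in>{0..1}. norm (x' t - x t) \<le> d) \<longrightarrow>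
    \<bar>h (restrict x' {0..1}) - h (restrict x {0..1})\<bar> < e"
proof -
  interpret P: Metric_space "mspace (path_space :: (real \<Rightarrow> real ^ 'd) metric)" "mdist path_space"
    by (rule Metric_space_mspace_mdist)
  define \<phi> where "\<phi> = restrict x {0..1}"
  have \<phi>: "\<phi> \<in> mspace path_space" unfolding \<phi>_def by (rule restrict_in_path_space[OF x])
  define U where "U = {g \<in> topspace (mtopology_of path_space). h g \<in> ball (h \<phi>) e}"
  have "openin (mtopology_of path_space) U"
    unfolding U_def by (rule openin_continuous_map_preimage[OF h]) (simp add: open_openin[symmetric])
  then have "openin P.mtopology U" by (simp add: mtopology_of_def)
  moreover have "\<phi> \<in> U" using \<phi> \<open>e > 0\<close> by (simp add: U_def)
  ultimately obtain r where r: "r > 0" "P.mball \<phi> r \<subseteq> U" unfolding P.openin_mtopology by blast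
  show ?thesis
  proof (intro exI[of _ "r / 2"] conjI allI impI)
    show "r / 2 > 0" using r by simp
    fix x' :: "real \<Rightarrow> real ^ 'd" assume x': "continuous_on {0..1} x'" and le: "\<forall>t\<in>{0..1}. norm (x' t - x t) \<le> r / 2"
    define g where "g = restrict x' {0..1}"
    have g: "g \<in> mspace path_space" unfolding g_def by (rule restrict_in_path_space[OF x'])
    have "mdist path_space \<phi> g = (SUP t\<in>{0..1}. dist (\<phi> t) (g t))" by (rule mdist_path_space[OF \<phi> g])
    also have "\<dots> \<le> r / 2"
      by (rule cSUP_least) (use le in \<open>auto simp: \<phi>_def g_def dist_norm norm_minus_commute\<close>)
    finally have "mdist path_space \<phi> g < r" using r by simp
    then have "g \<in> P.mball \<phi> r" using \<phi> g by (simp add: P.in_mball)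
    then have "g \<in> U" using r by blast
    then show "\<bar>h (restrict x' {0..1}) - h (restrict x {0..1})\<bar> < e"
      by (simp add: U_def \<phi>_def g_def dist_real_def abs_minus_commute)
  qed
qed

text \<open>The functional of a polygon is a continuous function of finitely many sample values,
  hence measurable; the polygons converge uniformly to the path and \<open>h\<close> is continuous.
  Thus the argument works with random vectors instead of a sigma-algebra on the path space.\<close>

lemma borel_measurable_path_functional:
  fixes h :: "(real \<Rightarrow> real ^ 'd) \<Rightarrow> real" and Z :: "real \<Rightarrow> 'a \<Rightarrow> real ^ 'd"
  assumes h: "continuous_map (mtopology_of path_space) euclideanreal h"
    and Zm: "\<And>t. t \<in> {0..1} \<Longrightarrow> Z t \<in> borel_measurable M"
    and Zc: "\<And>\<omega>. \<omega> \<in> space M \<Longrightarrow> continuous_on {0..1} (\<lambda>t. Z t \<omega>)"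
  shows "(\<lambda>\<omega>. h (restrict (\<lambda>t. Z t \<omega>) {0..1})) \<in> borel_measurable M"
proof (rule borel_measurable_LIMSEQ_real)
  define H where "H x = h (restrict x {0..1})" for x
  \<comment> \<open>\<open>F n\<close> reads a sequence of sample values: the step function handed
    to \<open>polygon\<close> takes the value \<open>c k\<close> at \<open>k / 2 ^ n\<close>. All
    sequences are admissible, so continuity can be expressed in the product topology.\<close>
  define F where "F n c = H (polygon n (\<lambda>s. c (nat \<lfloor>s * 2 ^ n\<rfloor>)))" for n and c :: "nat \<Rightarrow> real ^ 'd"
  have pc: "norm (polygon n f t - polygon n g t) \<le> d"
    if t: "t \<in> {0..1}" and d: "\<And>k. k \<le> 2 ^ n \<Longrightarrow> norm (f (real k / 2 ^ n) - g (real k / 2 ^ n)) \<le> d"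
    for f g :: "real \<Rightarrow> real ^ 'd" and d t n
  proof -
    obtain k where k: "k < 2 ^ n" "real k \<le> t * 2 ^ n" "t * 2 ^ n \<le> real (Suc k)"
      using dyadic_index[OF t] by blast
    define s where "s = t * 2 ^ n - real k"
    have s: "0 \<le> s" "s \<le> 1" using k by (auto simp: s_def)
    define a b where "a = f (real k / 2 ^ n) - g (real k / 2 ^ n)" and "b = f (real (Suc k) / 2 ^ n) - g (real (Suc k) / 2 ^ n)"
    have ab: "norm a \<le> d" "norm b \<le> d" unfolding a_def b_def using d k(1) by (auto simp del: of_nat_Suc)
    have pe: "polygon n u t = (1 - s) *\<^sub>R u (real k / 2 ^ n) + s *\<^sub>R u (real (Suc k) / 2 ^ n)" for u :: "real \<Rightarrow> real ^ 'd"
      unfolding polygon_eq[OF k(2,3)] s_def[symmetric] dyadic_incr_def by (simp add: algebra_simps del: of_nat_Suc)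
    have "polygon n f t - polygon n g t = (1 - s) *\<^sub>R a + s *\<^sub>R b"
      unfolding pe a_def b_def by (simp add: scaleR_right_diff_distrib del: of_nat_Suc)
    then have "norm (polygon n f t - polygon n g t) \<le> (1 - s) * norm a + s * norm b"
      using norm_triangle_ineq[of "(1 - s) *\<^sub>R a" "s *\<^sub>R b"] s by simp
    also have "\<dots> \<le> (1 - s) * d + s * d" using s ab by (intro add_mono mult_left_mono) auto
    finally show ?thesis by (simp add: algebra_simps)
  qed
  have idx: "nat \<lfloor>real k / 2 ^ n * 2 ^ n\<rfloor> = k" for k n by simp
  have Fc: "continuous_on UNIV (F n)" for n
    unfolding continuous_on_eq_continuous_at[OF open_UNIV] isCont_def
  proof (intro ballI tendstoI)
    fix c :: "nat \<Rightarrow> real ^ 'd" and e :: real assume "e > 0"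
    obtain d where d: "d > 0" "\<And>x'. continuous_on {0..1} x' \<Longrightarrow>
      (\<forall>t\<in>{0..1}. norm (x' t - polygon n (\<lambda>s. c (nat \<lfloor>s * 2 ^ n\<rfloor>)) t) \<le> d) \<Longrightarrow> \<bar>H x' - F n c\<bar> < e"
      using continuous_map_path_space_at[OF h polygon_continuous_on \<open>e > 0\<close>, of n "\<lambda>s. c (nat \<lfloor>s * 2 ^ n\<rfloor>)"]
      unfolding H_def F_def by blast
    have "\<forall>\<^sub>F c' in at c. dist (c' k) (c k) < d" for k
    proof -
      have "continuous_on UNIV (\<lambda>c :: nat \<Rightarrow> real ^ 'd. c k)" by (rule continuous_on_product_coordinates)
      then have "((\<lambda>c'. c' k) \<longlongrightarrow> c k) (at c)" unfolding continuous_on_eq_continuous_at[OF open_UNIV] isCont_def by (rule bspec) simp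
      then show ?thesis using d(1) by (rule tendstoD)
    qed
    then have "\<forall>\<^sub>F c' in at c. \<forall>k\<in>{..2 ^ n}. dist (c' k) (c k) < d"
      by (intro eventually_ball_finite) auto
    then show "\<forall>\<^sub>F c' in at c. dist (F n c') (F n c) < e"
    proof eventually_elim
      case (elim c')
      have "\<bar>H (polygon n (\<lambda>s. c' (nat \<lfloor>s * 2 ^ n\<rfloor>))) - F n c\<bar> < e"
      proof (rule d(2)[OF polygon_continuous_on], rule ballI)
        fix t :: real assume "t \<in> {0..1}"
        then show "norm (polygon n (\<lambda>s. c' (nat \<lfloor>s * 2 ^ n\<rfloor>)) t - polygon n (\<lambda>s. c (nat \<lfloor>s * 2 ^ n\<rfloor>)) t) \<le> d"
        proof (rule pc)
          fix k :: nat assume "k \<le> 2 ^ n"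
          then have "dist (c' k) (c k) < d" using elim by simp
          then show "norm (c' (nat \<lfloor>real k / 2 ^ n * 2 ^ n\<rfloor>) - c (nat \<lfloor>real k / 2 ^ n * 2 ^ n\<rfloor>)) \<le> d"
            unfolding idx by (simp add: dist_norm)
        qed
      qed
      then show ?case by (simp add: F_def dist_real_def)
    qed
  qed
  \<comment> \<open>Samples beyond time 1 are cut off because measurability of \<open>Z\<close> is
    known on \<open>{0..1}\<close> only; the values of the polygon on that interval depend only on
    the samples with \<open>k \<le> 2 ^ n\<close>.\<close>
  define c where "c n \<omega> k = (if k \<le> 2 ^ n then Z (real k / 2 ^ n) \<omega> else 0)" for n \<omega> k
  have cm: "c n \<in> borel_measurable M" for n
  proof (rule measurable_coordinatewise_then_product)
    fix k
    show "(\<lambda>\<omega>. c n \<omega> k) \<in> borel_measurable M"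
    proof (cases "k \<le> 2 ^ n")
      case True
      then have "real k \<le> real (2 ^ n)" by (simp only: of_nat_le_iff)
      then have "real k / 2 ^ n \<in> {0..1}" by simp
      from Zm[OF this] show ?thesis using True by (simp add: c_def)
    qed (simp add: c_def)
  qed
  show "(\<lambda>\<omega>. F n (c n \<omega>)) \<in> borel_measurable M" for n
    using measurable_compose[OF cm borel_measurable_continuous_onI[OF Fc]] .
  fix \<omega> assume \<omega>: "\<omega> \<in> space M"
  show "(\<lambda>n. F n (c n \<omega>)) \<longlonglongrightarrow> h (restrict (\<lambda>t. Z t \<omega>) {0..1})"
  proof (rule metric_LIMSEQ_I)
    fix e :: real assume "e > 0"
    obtain d where d: "d > 0" "\<And>x'. continuous_on {0..1} x' \<Longrightarrow>
      (\<forall>t\<in>{0..1}. norm (x' t - Z t \<omega>) \<le> d) \<Longrightarrow> \<bar>H x' - h (restrict (\<lambda>t. Z t \<omega>) {0..1})\<bar> < e"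
      using continuous_map_path_space_at[OF h Zc[OF \<omega>] \<open>e > 0\<close>] unfolding H_def by blast
    have "\<forall>\<^sub>F n in sequentially. \<forall>t\<in>{0..1}. dist (polygon n (\<lambda>t. Z t \<omega>) t) (Z t \<omega>) < d"
      by (rule uniform_limitD[OF polygon_uniform_limit[OF Zc[OF \<omega>]] d(1)])
    then obtain N where N: "\<And>n t. n \<ge> N \<Longrightarrow> t \<in> {0..1} \<Longrightarrow> dist (polygon n (\<lambda>t. Z t \<omega>) t) (Z t \<omega>) < d"
      unfolding eventually_sequentially by blast
    have "dist (F n (c n \<omega>)) (h (restrict (\<lambda>t. Z t \<omega>) {0..1})) < e" if "n \<ge> N" for n
    proof -
      have "\<bar>H (polygon n (\<lambda>s. c n \<omega> (nat \<lfloor>s * 2 ^ n\<rfloor>))) - h (restrict (\<lambda>t. Z t \<omega>) {0..1})\<bar> < e"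
      proof (rule d(2)[OF polygon_continuous_on], rule ballI)
        fix t :: real assume t: "t \<in> {0..1}"
        have "norm (polygon n (\<lambda>s. c n \<omega> (nat \<lfloor>s * 2 ^ n\<rfloor>)) t - polygon n (\<lambda>t. Z t \<omega>) t) \<le> 0"
        proof (rule pc[OF t])
          fix k :: nat assume k: "k \<le> 2 ^ n"
          show "norm (c n \<omega> (nat \<lfloor>real k / 2 ^ n * 2 ^ n\<rfloor>) - Z (real k / 2 ^ n) \<omega>) \<le> 0"
            unfolding idx using k by (simp add: c_def)
        qed
        then show "norm (polygon n (\<lambda>s. c n \<omega> (nat \<lfloor>s * 2 ^ n\<rfloor>)) t - Z t \<omega>) \<le> d"
          using N[OF that t] by (simp add: dist_norm)
      qed
      then show ?thesis by (simp add: F_def dist_real_def)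
    qed
    then show "\<exists>N. \<forall>n\<ge>N. dist (F n (c n \<omega>)) (h (restrict (\<lambda>t. Z t \<omega>) {0..1})) < e" by blast
  qed
qed

lemma rate_function_nonneg: "0 \<le> rate_function A y \<mu> x0 \<phi>"
  by (simp add: rate_function_def)

lemma dyadic_energy_zero: "dyadic_energy n (\<lambda>_. 0) = 0"
  by (simp add: dyadic_energy_def dyadic_incr_def)

section \<open>The small-noise setting and solutions for deterministic driving paths\<close>

locale lasso_small_noise = prob_space M for M :: "'a measure" +
  fixes A :: "real ^ 'd ^ 'n" and y :: "real ^ 'n" and \<mu> :: real and x0 :: "real ^ 'd"
    and w :: "real \<Rightarrow> 'a \<Rightarrow> real ^ 'd" and X :: "real \<Rightarrow> real \<Rightarrow> 'a \<Rightarrow> real ^ 'd"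
    and h :: "(real \<Rightarrow> real ^ 'd) \<Rightarrow> real"
  assumes \<mu>: "\<mu> > 0" and bm: "standard_brownian_motion w"
    and sol: "\<And>\<epsilon>. \<epsilon> > 0 \<Longrightarrow> strong_solution w A y \<mu> x0 \<epsilon> (X \<epsilon>)"
    and h_cont: "continuous_map (mtopology_of path_space) euclideanreal h"
    and h_bdd: "bounded (h ` mspace path_space)"
begin

abbreviation H :: "(real \<Rightarrow> real ^ 'd) \<Rightarrow> real" where
  "H x \<equiv> h (restrict x {0..1})"

abbreviation driven :: "(real \<Rightarrow> real ^ 'd) \<Rightarrow> (real \<Rightarrow> real ^ 'd) \<Rightarrow> bool" where
  "driven \<equiv> driven_solution A y \<mu> x0"

definition Y :: "real \<Rightarrow> 'a \<Rightarrow> real" where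
  "Y \<epsilon> \<omega> = h (sample_path (X \<epsilon>) \<omega>)"

lemma Y_eq: "Y \<epsilon> \<omega> = H (\<lambda>t. X \<epsilon> t \<omega>)"
  by (simp add: Y_def sample_path_def)

text \<open>The augmented filtration lies inside the sigma-algebra of \<open>M\<close>, since its
  generators are preimages under measurable maps and null sets of \<open>M\<close>.\<close>

lemma X_measurable:
  assumes "\<epsilon> > 0" "t \<in> {0..1}"
  shows "X \<epsilon> t \<in> borel_measurable M"
proof -
  have m: "X \<epsilon> t \<in> borel_measurable (augmented_filtration M w t)"
    using sol[OF assms(1)] assms(2) unfolding strong_solution_def by blast
  define G where "G = {w s -` B \<inter> space M | s B. s \<in> {0..t} \<and> B \<in> sets borel} \<union> null_sets M"
  have wm: "w s \<in> borel_measurable M" if "s \<ge> 0" for s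
    using bm that unfolding standard_brownian_motion_def by blast
  have G: "G \<subseteq> events"
    unfolding G_def using wm by (auto intro: measurable_sets)
  then have GP: "G \<subseteq> Pow (space M)" using sets.sets_into_space by blast
  have s: "space (augmented_filtration M w t) = space M" "sets (augmented_filtration M w t) = sigma_sets (space M) G"
    unfolding augmented_filtration_def G_def[symmetric] using GP by (simp_all add: space_measure_of sets_measure_of)
  show ?thesis
  proof (rule measurableI)
    fix B :: "(real ^ 'd) set" assume "B \<in> sets borel"
    then have "X \<epsilon> t -` B \<inter> space M \<in> sigma_sets (space M) G"
      using measurable_sets[OF m] s by simp
    then show "X \<epsilon> t -` B \<inter> space M \<in> events" using sets.sigma_sets_subset[OF G] by blast
  qed simp
qed

lemma X_continuous:
  assumes "\<epsilon> > 0" "\<omega> \<in> space M"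
  shows "continuous_on {0..1} (\<lambda>t. X \<epsilon> t \<omega>)"
  using sol[OF assms(1)] assms(2) unfolding strong_solution_def by blast

lemma Y_measurable: "\<epsilon> > 0 \<Longrightarrow> Y \<epsilon> \<in> borel_measurable M"
  unfolding Y_eq[abs_def] using X_measurable X_continuous by (intro borel_measurable_path_functional h_cont) auto

lemma AE_driven:
  assumes "\<epsilon> > 0"
  shows "AE \<omega> in M. \<omega> \<in> space M \<and> continuous_on {0..1} (\<lambda>t. w t \<omega>) \<and> w 0 \<omega> = 0 \<and>
    driven (\<lambda>t. \<epsilon> *\<^sub>R w t \<omega>) (\<lambda>t. X \<epsilon> t \<omega>)"
proof -
  obtain v where v: "AE \<omega> in M.
           set_integrable lborel {0..1} (\<lambda>t. v t \<omega>) \<and>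
           (AE t in lborel. t \<in> {0..1} \<longrightarrow> v t \<omega> \<in> subdifferential (lasso_objective A y \<mu>) (X \<epsilon> t \<omega>)) \<and>
           (\<forall>t\<in>{0..1}. X \<epsilon> t \<omega> = x0 - (LINT s:{0..t}|lborel. v s \<omega>) + \<epsilon> *\<^sub>R w t \<omega>)"
    using sol[OF assms] unfolding strong_solution_def by blast
  have w: "AE \<omega> in M. w 0 \<omega> = 0" "AE \<omega> in M. continuous_on {0..} (\<lambda>t. w t \<omega>)"
    using bm unfolding standard_brownian_motion_def by blast+
  show ?thesis
    using v w AE_space
  proof eventually_elim
    case (elim \<omega>)
    have "continuous_on {0..1} (\<lambda>t. w t \<omega>)" by (rule continuous_on_subset[OF elim(3)]) auto
    then show ?case
      unfolding driven_solution_def using elim X_continuous[OF assms, of \<omega>] by blast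
  qed
qed

lemma driven_exists:
  assumes "energy_le \<psi> E" "E \<ge> 0" "\<psi> 0 = 0" "continuous_on {0..1} \<psi>"
  shows "\<exists>x. driven \<psi> x"
proof -
  have "\<exists>u x. driven u x \<and> (\<forall>t\<in>{0..1}. norm (u t - \<psi> t) \<le> 1 / real (Suc j))" for j
  proof -
    have "1 / real (Suc j) > 0" by simp
    from brownian_ball_lower[OF bm assms(3,4) dyadic_energy_le[OF assms(1,2)] this]
    obtain c where "c > 0" and ev: "\<forall>\<^sub>F \<epsilon> in at_right 0. \<exists>S\<in>events. c * exp (- E / (2 * \<epsilon>\<^sup>2)) \<le> prob S \<and>
      (\<forall>\<omega>\<in>S. continuous_on {0..1} (\<lambda>t. w t \<omega>) \<longrightarrow> w 0 \<omega> = 0 \<longrightarrow> (\<forall>t\<in>{0..1}. norm (\<epsilon> *\<^sub>R w t \<omega> - \<psi> t) \<le> 1 / real (Suc j)))"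
      by blast
    have "\<forall>\<^sub>F \<epsilon> :: real in at_right 0. 0 < \<epsilon>" by (simp add: eventually_at_right_less)
    with ev have "\<forall>\<^sub>F \<epsilon> in at_right 0. 0 < \<epsilon> \<and> (\<exists>S\<in>events. c * exp (- E / (2 * \<epsilon>\<^sup>2)) \<le> prob S \<and>
      (\<forall>\<omega>\<in>S. continuous_on {0..1} (\<lambda>t. w t \<omega>) \<longrightarrow> w 0 \<omega> = 0 \<longrightarrow> (\<forall>t\<in>{0..1}. norm (\<epsilon> *\<^sub>R w t \<omega> - \<psi> t) \<le> 1 / real (Suc j))))"
      by eventually_elim blast
    from eventually_happens'[OF trivial_limit_at_right_real this]
    obtain \<epsilon> S where \<epsilon>: "\<epsilon> > 0" and S: "S \<in> events" "c * exp (- E / (2 * \<epsilon>\<^sup>2)) \<le> prob S"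
      "\<forall>\<omega>\<in>S. continuous_on {0..1} (\<lambda>t. w t \<omega>) \<longrightarrow> w 0 \<omega> = 0 \<longrightarrow> (\<forall>t\<in>{0..1}. norm (\<epsilon> *\<^sub>R w t \<omega> - \<psi> t) \<le> 1 / real (Suc j))"
      by blast
    have "0 < c * exp (- E / (2 * \<epsilon>\<^sup>2))" using \<open>c > 0\<close> by simp
    then have "prob S > 0" using S(2) by linarith
    \<comment> \<open>An event of positive probability meets the almost sure event on which the
      noise path really drives \<open>X \<epsilon>\<close>; one such \<open>\<omega>\<close>
      supplies a driving path near \<open>\<psi>\<close> together with its solution.\<close>
    have "\<exists>\<omega>\<in>S. continuous_on {0..1} (\<lambda>t. w t \<omega>) \<and> w 0 \<omega> = 0 \<and> driven (\<lambda>t. \<epsilon> *\<^sub>R w t \<omega>) (\<lambda>t. X \<epsilon> t \<omega>)"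
    proof (rule ccontr)
      assume no: "\<not> ?thesis"
      have "AE \<omega> in M. \<omega> \<notin> S" using AE_driven[OF \<epsilon>] by eventually_elim (use no in blast)
      then have "prob S = 0" using S(1) by (simp add: AE_iff_null_sets[symmetric] measure_eq_0_null_sets)
      then show False using \<open>prob S > 0\<close> by simp
    qed
    then show ?thesis using S(3) by blast
  qed
  then have "\<forall>j. \<exists>p. driven (fst p) (snd p) \<and> (\<forall>t\<in>{0..1}. norm (fst p t - \<psi> t) \<le> 1 / real (Suc j))" by simp
  from choice[OF this] obtain p where p: "\<forall>j. driven (fst (p j)) (snd (p j)) \<and> (\<forall>t\<in>{0..1}. norm (fst (p j) t - \<psi> t) \<le> 1 / real (Suc j))"
    by (rule exE)
  show ?thesis
  proof (rule driven_solution_closed[OF \<mu>])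
    show "driven (fst (p j)) (snd (p j))" for j using p by blast
    show "uniform_limit {0..1} (\<lambda>j. fst (p j)) \<psi> sequentially"
    proof (rule uniform_limitI)
      fix e :: real assume "e > 0"
      then obtain N where N: "inverse (real (Suc N)) < e" using reals_Archimedean by blast
      show "\<forall>\<^sub>F j in sequentially. \<forall>t\<in>{0..1}. dist (fst (p j) t) (\<psi> t) < e"
        unfolding eventually_sequentially
      proof (intro exI[of _ N] allI impI ballI)
        fix j t assume "N \<le> j" "t \<in> {0..1 :: real}"
        then have "norm (fst (p j) t - \<psi> t) \<le> 1 / real (Suc j)" using p by blast
        also have "\<dots> \<le> 1 / real (Suc N)" using \<open>N \<le> j\<close> by (simp add: frac_le)
        finally show "dist (fst (p j) t) (\<psi> t) < e" using N by (simp add: dist_norm inverse_eq_divide)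
      qed
    qed
  qed
qed

lemma driven_polygon_exists: "f 0 = 0 \<Longrightarrow> \<exists>x. driven (polygon n f) x"
  by (rule driven_exists[OF polygon_energy_le dyadic_energy_nonneg]) (simp_all add: polygon_zero polygon_continuous_on)

lemma functional_near_driven:
  assumes x: "driven u x" and "e > 0"
  shows "\<exists>r>0. \<forall>u' x'. driven u' x' \<longrightarrow> (\<forall>t\<in>{0..1}. norm (u' t - u t) \<le> r) \<longrightarrow> \<bar>H x' - H x\<bar> < e"
proof -
  have cx: "continuous_on {0..1} x" using x by (simp add: driven_solution_def)
  obtain d where d: "d > 0" "\<And>x'. continuous_on {0..1} x' \<Longrightarrow> (\<forall>t\<in>{0..1}. norm (x' t - x t) \<le> d) \<Longrightarrow> \<bar>H x' - H x\<bar> < e"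
    using continuous_map_path_space_at[OF h_cont cx \<open>e > 0\<close>] by blast
  obtain r where r: "r > 0" "r + sqrt (2 * stability_const A \<mu> r) < d" using stability_modulus[OF d(1)] by blast
  have "\<bar>H x' - H x\<bar> < e" if x': "driven u' x'" and le: "\<forall>t\<in>{0..1}. norm (u' t - u t) \<le> r" for u' x'
  proof (rule d(2))
    show "continuous_on {0..1} x'" using x' by (simp add: driven_solution_def)
    show "\<forall>t\<in>{0..1}. norm (x' t - x t) \<le> d"
    proof
      fix t :: real assume t: "t \<in> {0..1}"
      have "norm (x' t - x t) \<le> r + sqrt (2 * stability_const A \<mu> r)"
        by (rule driven_solution_stable[OF \<mu> x' x _ t]) (use le in blast)
      then show "norm (x' t - x t) \<le> d" using r by linarith
    qed
  qed
  then show ?thesis using r(1) by blast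
qed

text \<open>Polygons of bounded energy are relatively compact by Arzela--Ascoli, which makes the continuity of
  the functional uniform over them.\<close>

lemma functional_uniform_on_energy_ball:
  assumes "R \<ge> 0" "\<eta> > 0"
  shows "\<exists>\<delta>>0. \<forall>n f x u x'. f 0 = 0 \<longrightarrow> dyadic_energy n f \<le> R \<longrightarrow> driven (polygon n f) x \<longrightarrow> driven u x' \<longrightarrow>
    (\<forall>t\<in>{0..1}. norm (u t - polygon n f t) \<le> \<delta>) \<longrightarrow> \<bar>H x' - H x\<bar> < \<eta>"
proof (rule ccontr)
  assume neg: "\<not> ?thesis"
  define Q where "Q j p x u x' \<longleftrightarrow> (\<exists>n f. f 0 = 0 \<and> dyadic_energy n f \<le> R \<and> p = polygon n f) \<and> driven p x \<and> driven u x' \<and>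
    (\<forall>t\<in>{0..1}. norm (u t - p t) \<le> 1 / real (Suc j)) \<and> \<not> \<bar>H x' - H x\<bar> < \<eta>" for j p x u x'
  have "\<exists>q. Q j (fst q) (fst (snd q)) (fst (snd (snd q))) (snd (snd (snd q)))" for j
  proof -
    have "\<not> (\<forall>n f x u x'. f 0 = 0 \<longrightarrow> dyadic_energy n f \<le> R \<longrightarrow> driven (polygon n f) x \<longrightarrow> driven u x' \<longrightarrow>
      (\<forall>t\<in>{0..1}. norm (u t - polygon n f t) \<le> 1 / real (Suc j)) \<longrightarrow> \<bar>H x' - H x\<bar> < \<eta>)"
      using neg[simplified, rule_format, of "1 / real (Suc j)"] by fastforce
    then obtain n f x u x' where "f 0 = 0" "dyadic_energy n f \<le> R" "driven (polygon n f) x" "driven u x'"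
      "\<forall>t\<in>{0..1}. norm (u t - polygon n f t) \<le> 1 / real (Suc j)" "\<not> \<bar>H x' - H x\<bar> < \<eta>" by blast
    then have "Q j (polygon n f) x u x'" unfolding Q_def by blast
    then show ?thesis by (intro exI[of _ "(polygon n f, x, u, x')"]) simp
  qed
  then have "\<forall>j. \<exists>q. Q j (fst q) (fst (snd q)) (fst (snd (snd q))) (snd (snd (snd q)))" by blast
  from choice[OF this] obtain q where q: "\<forall>j. Q j (fst (q j)) (fst (snd (q j))) (fst (snd (snd (q j)))) (snd (snd (snd (q j))))"
    by (rule exE)
  define p x u x' where "p j = fst (q j)" and "x j = fst (snd (q j))" and "u j = fst (snd (snd (q j)))" and "x' j = snd (snd (snd (q j)))" for j
  have Q: "Q j (p j) (x j) (u j) (x' j)" for j using q by (simp add: p_def x_def u_def x'_def)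
  have p0: "p j 0 = 0" for j using Q[of j] unfolding Q_def by (auto simp: polygon_zero)
  \<comment> \<open>The energy bound makes all these polygons Hoelder continuous of exponent 1/2
    with a common constant. This gives equicontinuity and, as they start at 0, uniform
    boundedness.\<close>
  have hol: "norm (p j t - p j s) \<le> sqrt (\<bar>t - s\<bar> * R)" if "s \<in> {0..1}" "t \<in> {0..1}" for j s t
  proof -
    obtain n f where nf: "dyadic_energy n f \<le> R" "p j = polygon n f" using Q[of j] unfolding Q_def by blast
    have "(norm (p j b - p j a))\<^sup>2 \<le> (b - a) * R" if "0 \<le> a" "a \<le> b" "b \<le> 1" for a b
    proof -
      have "(norm (p j b - p j a))\<^sup>2 \<le> (b - a) * dyadic_energy n f"
        unfolding nf(2) by (rule energy_le_holder[OF polygon_energy_le dyadic_energy_nonneg that])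
      also have "\<dots> \<le> (b - a) * R" using nf(1) that by (intro mult_left_mono) auto
      finally show ?thesis .
    qed
    from this[of s t] this[of t s] have "(norm (p j t - p j s))\<^sup>2 \<le> \<bar>t - s\<bar> * R"
      using that by (cases "s \<le> t") (auto simp: norm_minus_commute)
    then show ?thesis by (rule real_le_rsqrt)
  qed
  obtain g k where g: "continuous_on {0..1} g" "strict_mono (k :: nat \<Rightarrow> nat)"
    and conv: "\<And>e. 0 < e \<Longrightarrow> \<exists>N. \<forall>n t. n \<ge> N \<and> t \<in> {0..1} \<longrightarrow> norm (p (k n) t - g t) < e"
  proof (rule Arzela_Ascoli[of "{0..1 :: real}" p "sqrt R"])
    show "norm (p n t) \<le> sqrt R" if "t \<in> {0..1}" for n t
    proof -
      have "norm (p n t) \<le> sqrt (\<bar>t\<bar> * R)" using hol[of 0 t n] that p0[of n] by simp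
      also have "\<dots> \<le> sqrt (1 * R)" using that \<open>R \<ge> 0\<close> by (intro real_sqrt_le_mono mult_right_mono) auto
      finally show ?thesis by simp
    qed
    show "\<exists>d>0. \<forall>n s. s \<in> {0..1} \<and> norm (t - s) < d \<longrightarrow> norm (p n t - p n s) < e" if "t \<in> {0..1}" "0 < e" for t e
    proof (intro exI[of _ "e\<^sup>2 / (R + 1)"] conjI allI impI)
      show "0 < e\<^sup>2 / (R + 1)" using that \<open>R \<ge> 0\<close> by simp
      fix n s assume s: "s \<in> {0..1} \<and> norm (t - s) < e\<^sup>2 / (R + 1)"
      have "\<bar>t - s\<bar> * R \<le> \<bar>t - s\<bar> * (R + 1)" by (intro mult_left_mono) auto
      also have "\<dots> < e\<^sup>2" using s \<open>R \<ge> 0\<close> by (simp add: pos_less_divide_eq)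
      finally have "sqrt (\<bar>t - s\<bar> * R) < sqrt (e\<^sup>2)" by (rule real_sqrt_less_mono)
      then show "norm (p n t - p n s) < e" using hol[of s t n] s that by simp
    qed
  qed auto
  have lim: "uniform_limit {0..1} (\<lambda>n. p (k n)) g sequentially"
  proof (rule uniform_limitI)
    fix e :: real assume "e > 0"
    then obtain N where "\<forall>n t. n \<ge> N \<and> t \<in> {0..1} \<longrightarrow> norm (p (k n) t - g t) < e" using conv by blast
    then show "\<forall>\<^sub>F n in sequentially. \<forall>t\<in>{0..1}. dist (p (k n) t) (g t) < e"
      unfolding eventually_sequentially by (intro exI[of _ N]) (auto simp: dist_norm)
  qed
  \<comment> \<open>The limit \<open>g\<close> may not be a polygon, but by closedness it drives a
    solution \<open>z\<close>. For large \<open>n\<close> both driving paths of the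
    \<open>k n\<close>-th counterexample are close to \<open>g\<close>, so both values of
    \<open>H\<close> lie within \<open>\<eta> / 2\<close> of \<open>H z\<close>.\<close>
  have "driven (p (k n)) (x (k n))" for n using Q[of "k n"] by (simp add: Q_def)
  from driven_solution_closed[OF \<mu> this lim] obtain z where z: "driven g z" by blast
  obtain r where r: "r > 0" "\<And>u' x'. driven u' x' \<Longrightarrow> \<forall>t\<in>{0..1}. norm (u' t - g t) \<le> r \<Longrightarrow> \<bar>H x' - H z\<bar> < \<eta> / 2"
    using functional_near_driven[OF z, of "\<eta> / 2"] \<open>\<eta> > 0\<close> by auto
  obtain N1 where N1: "\<forall>n t. n \<ge> N1 \<and> t \<in> {0..1} \<longrightarrow> norm (p (k n) t - g t) < r / 2" using conv[of "r / 2"] r by auto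
  obtain N2 where N2: "inverse (real (Suc N2)) < r / 2" using reals_Archimedean[of "r / 2"] r by auto
  define n where "n = max N1 N2"
  have "n \<le> k n" using g(2) by (rule seq_suble)
  then have "N2 \<le> k n" by (simp add: n_def)
  then have "1 / real (Suc (k n)) \<le> 1 / real (Suc N2)" by (simp add: frac_le)
  then have small: "1 / real (Suc (k n)) \<le> r / 2" using N2 by (simp add: inverse_eq_divide)
  have pn: "norm (p (k n) t - g t) \<le> r / 2" if "t \<in> {0..1}" for t
    using N1[rule_format, of n t] that by (simp add: n_def less_imp_le)
  have Qn: "driven (p (k n)) (x (k n))" "driven (u (k n)) (x' (k n))"
    "\<And>t. t \<in> {0..1} \<Longrightarrow> norm (u (k n) t - p (k n) t) \<le> 1 / real (Suc (k n))" "\<not> \<bar>H (x' (k n)) - H (x (k n))\<bar> < \<eta>"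
    using Q[of "k n"] unfolding Q_def by blast+
  have "\<bar>H (x (k n)) - H z\<bar> < \<eta> / 2"
  proof (rule r(2)[OF Qn(1)], rule ballI)
    fix t :: real assume "t \<in> {0..1}"
    from pn[OF this] show "norm (p (k n) t - g t) \<le> r" using r(1) by linarith
  qed
  moreover have "\<bar>H (x' (k n)) - H z\<bar> < \<eta> / 2"
  proof (rule r(2)[OF Qn(2)], rule ballI)
    fix t :: real assume t: "t \<in> {0..1}"
    have "norm (u (k n) t - g t) \<le> norm (u (k n) t - p (k n) t) + norm (p (k n) t - g t)"
      using norm_triangle_ineq[of "u (k n) t - p (k n) t" "p (k n) t - g t"] by simp
    then show "norm (u (k n) t - g t) \<le> r" using pn[OF t] Qn(3)[OF t] small by linarith
  qed
  ultimately show False using Qn(4) by linarith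
qed

section \<open>The two Laplace bounds and the limit\<close>

definition Z :: "real \<Rightarrow> real" where
  "Z \<epsilon> = (LINT \<omega>|M. exp (- Y \<epsilon> \<omega> / \<epsilon>\<^sup>2))"

lemma h_bound: "\<exists>b\<ge>0. \<forall>x. continuous_on {0..1} x \<longrightarrow> \<bar>H x\<bar> \<le> b"
proof -
  obtain b where b: "\<And>g. g \<in> mspace path_space \<Longrightarrow> \<bar>h g\<bar> \<le> b" using h_bdd unfolding bounded_iff by auto
  show ?thesis
  proof (intro exI[of _ "\<bar>b\<bar>"] conjI allI impI)
    fix x :: "real \<Rightarrow> real ^ 'd" assume "continuous_on {0..1} x"
    from b[OF restrict_in_path_space[OF this]] show "\<bar>H x\<bar> \<le> \<bar>b\<bar>" by linarith
  qed simp
qed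

lemma Y_exp_integrable:
  assumes "\<epsilon> > 0"
  shows "integrable M (\<lambda>\<omega>. exp (- Y \<epsilon> \<omega> / \<epsilon>\<^sup>2))"
proof -
  obtain b where b: "\<And>x. continuous_on {0..1} x \<Longrightarrow> \<bar>H x\<bar> \<le> b" using h_bound by blast
  note Y_measurable[OF assms, measurable]
  show ?thesis
  proof (rule integrable_const_bound[where B="exp (b / \<epsilon>\<^sup>2)"])
    show "AE \<omega> in M. norm (exp (- Y \<epsilon> \<omega> / \<epsilon>\<^sup>2)) \<le> exp (b / \<epsilon>\<^sup>2)"
      using AE_space
    proof eventually_elim
      case (elim \<omega>)
      have "- Y \<epsilon> \<omega> \<le> b" using b[OF X_continuous[OF assms elim]] unfolding Y_eq by linarith
      then have "- Y \<epsilon> \<omega> / \<epsilon>\<^sup>2 \<le> b / \<epsilon>\<^sup>2" by (rule divide_right_mono) simp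
      then show ?case by simp
    qed
  qed measurable
qed

lemma square_mult_tendsto_0: "((\<lambda>\<epsilon>. \<epsilon>\<^sup>2 * c) \<longlongrightarrow> (0::real)) (at_right 0)"
  by (auto intro!: tendsto_eq_intros)

text \<open>The expectation is restricted to the event that the noise stays near the driving path
  \<open>\<psi>\<close> of energy \<open>E\<close> that produces \<open>\<phi>\<close>. There the
  functional is close to \<open>h \<phi>\<close>, and the event costs \<open>E / 2\<close>.
  Positivity of \<open>Z \<epsilon>\<close> is recorded for the opposite bound, which takes a
  logarithm.\<close>

lemma Laplace_upper:
  assumes \<phi>: "\<phi> \<in> mspace path_space" and fin: "rate_function A y \<mu> x0 \<phi> = ereal E" and "\<eta> > 0"
  shows "\<forall>\<^sub>F \<epsilon> in at_right 0. 0 < Z \<epsilon> \<and> - \<epsilon>\<^sup>2 * ln (Z \<epsilon>) < E / 2 + h \<phi> + \<eta>"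
proof -
  have "rate_function A y \<mu> x0 \<phi> \<noteq> \<infinity>" using fin by simp
  from rate_function_driving_path[OF \<mu> this] fin
  obtain \<psi> where \<psi>: "driven \<psi> \<phi>" "\<psi> 0 = 0" "energy_le \<psi> E" "E \<ge> 0" by auto
  have \<phi>c: "continuous_on {0..1} \<phi>" and \<phi>r: "restrict \<phi> {0..1} = \<phi>"
    using \<phi> by (auto simp: mspace_path_space extensional_restrict)
  have \<psi>c: "continuous_on {0..1} \<psi>"
    unfolding continuous_on_iff
  proof (intro ballI allI impI)
    fix t e :: real assume t: "t \<in> {0..1}" and "e > 0"
    show "\<exists>d>0. \<forall>s\<in>{0..1}. dist s t < d \<longrightarrow> dist (\<psi> s) (\<psi> t) < e"
    proof (intro exI[of _ "e\<^sup>2 / (E + 1)"] conjI ballI impI)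
      show "0 < e\<^sup>2 / (E + 1)" using \<open>e > 0\<close> \<psi>(4) by simp
      fix s :: real assume s: "s \<in> {0..1}" "dist s t < e\<^sup>2 / (E + 1)"
      have "(norm (\<psi> s - \<psi> t))\<^sup>2 \<le> \<bar>s - t\<bar> * E"
        using energy_le_holder[OF \<psi>(3,4), of s t] energy_le_holder[OF \<psi>(3,4), of t s] s t
        by (cases "s \<le> t") (auto simp: norm_minus_commute)
      also have "\<dots> \<le> \<bar>s - t\<bar> * (E + 1)" by (intro mult_left_mono) auto
      also have "\<dots> < e\<^sup>2" using s(2) \<psi>(4) by (simp add: dist_real_def pos_less_divide_eq)
      finally show "dist (\<psi> s) (\<psi> t) < e" using \<open>e > 0\<close> by (simp add: dist_norm power2_less_imp_less)
    qed
  qed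
  obtain r where r: "r > 0" "\<And>u' x'. driven u' x' \<Longrightarrow> \<forall>t\<in>{0..1}. norm (u' t - \<psi> t) \<le> r \<Longrightarrow> \<bar>H x' - H \<phi>\<bar> < \<eta> / 2"
    using functional_near_driven[OF \<psi>(1), of "\<eta> / 2"] \<open>\<eta> > 0\<close> by auto
  obtain c where "c > 0" and ev: "\<forall>\<^sub>F \<epsilon> in at_right 0. \<exists>S\<in>events. c * exp (- E / (2 * \<epsilon>\<^sup>2)) \<le> prob S \<and>
      (\<forall>\<omega>\<in>S. continuous_on {0..1} (\<lambda>t. w t \<omega>) \<longrightarrow> w 0 \<omega> = 0 \<longrightarrow> (\<forall>t\<in>{0..1}. norm (\<epsilon> *\<^sub>R w t \<omega> - \<psi> t) \<le> r))"
    using brownian_ball_lower[OF bm \<psi>(2) \<psi>c dyadic_energy_le[OF \<psi>(3,4)] r(1)] by blast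
  have ev1: "\<forall>\<^sub>F \<epsilon> :: real in at_right 0. 0 < \<epsilon>" by (simp add: eventually_at_right_less)
  have ev2: "\<forall>\<^sub>F \<epsilon> in at_right 0. \<epsilon>\<^sup>2 * (- ln c) < \<eta> / 2"
    by (rule order_tendstoD(2)[OF square_mult_tendsto_0]) (use \<open>\<eta> > 0\<close> in simp)
  show ?thesis
    using ev ev1 ev2
  proof eventually_elim
    case (elim \<epsilon>)
    then obtain S where S: "S \<in> events" "c * exp (- E / (2 * \<epsilon>\<^sup>2)) \<le> prob S"
      "\<forall>\<omega>\<in>S. continuous_on {0..1} (\<lambda>t. w t \<omega>) \<longrightarrow> w 0 \<omega> = 0 \<longrightarrow> (\<forall>t\<in>{0..1}. norm (\<epsilon> *\<^sub>R w t \<omega> - \<psi> t) \<le> r)" by blast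
    define a where "a = h \<phi> + \<eta> / 2"
    have "AE \<omega> in M. exp (- a / \<epsilon>\<^sup>2) * indicator S \<omega> \<le> exp (- Y \<epsilon> \<omega> / \<epsilon>\<^sup>2)"
      using AE_driven[OF elim(2)]
    proof eventually_elim
      case (elim \<omega>)
      show ?case
      proof (cases "\<omega> \<in> S")
        case True
        then have "\<bar>Y \<epsilon> \<omega> - h \<phi>\<bar> < \<eta> / 2" using r(2)[of "\<lambda>t. \<epsilon> *\<^sub>R w t \<omega>" "\<lambda>t. X \<epsilon> t \<omega>"] elim S(3) by (simp add: Y_eq \<phi>r)
        then have "- a \<le> - Y \<epsilon> \<omega>" unfolding a_def by linarith
        then have "- a / \<epsilon>\<^sup>2 \<le> - Y \<epsilon> \<omega> / \<epsilon>\<^sup>2" by (rule divide_right_mono) simp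
        then show ?thesis using True by simp
      qed simp
    qed
    then have "(LINT \<omega>|M. exp (- a / \<epsilon>\<^sup>2) * indicator S \<omega>) \<le> Z \<epsilon>"
      unfolding Z_def using S(1) by (intro integral_mono_AE Y_exp_integrable[OF elim(2)]) (auto simp: integrable_real_indicator emeasure_eq_measure)
    then have "exp (- a / \<epsilon>\<^sup>2) * prob S \<le> Z \<epsilon>" using S(1) by simp
    moreover have "exp (- a / \<epsilon>\<^sup>2) * (c * exp (- E / (2 * \<epsilon>\<^sup>2))) \<le> exp (- a / \<epsilon>\<^sup>2) * prob S"
      using S(2) by (intro mult_left_mono) auto
    ultimately have low: "exp (- a / \<epsilon>\<^sup>2) * (c * exp (- E / (2 * \<epsilon>\<^sup>2))) \<le> Z \<epsilon>" by linarith
    have pos: "0 < exp (- a / \<epsilon>\<^sup>2) * (c * exp (- E / (2 * \<epsilon>\<^sup>2)))" using \<open>c > 0\<close> by simp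
    then have Zpos: "0 < Z \<epsilon>" using low by linarith
    have "ln (exp (- a / \<epsilon>\<^sup>2) * (c * exp (- E / (2 * \<epsilon>\<^sup>2)))) \<le> ln (Z \<epsilon>)" using low pos by simp
    then have "- a / \<epsilon>\<^sup>2 + (ln c + - E / (2 * \<epsilon>\<^sup>2)) \<le> ln (Z \<epsilon>)" using \<open>c > 0\<close> by (simp add: ln_mult)
    then have "\<epsilon>\<^sup>2 * (- a / \<epsilon>\<^sup>2 + (ln c + - E / (2 * \<epsilon>\<^sup>2))) \<le> \<epsilon>\<^sup>2 * ln (Z \<epsilon>)" by (rule mult_left_mono) simp
    moreover have "\<epsilon>\<^sup>2 * (- a / \<epsilon>\<^sup>2 + (ln c + - E / (2 * \<epsilon>\<^sup>2))) = - a + \<epsilon>\<^sup>2 * ln c - E / 2"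
      using elim(2) by (simp add: field_simps)
    ultimately have "- \<epsilon>\<^sup>2 * ln (Z \<epsilon>) \<le> a - \<epsilon>\<^sup>2 * ln c + E / 2" by simp
    then show ?case using elim(3) Zpos by (simp add: a_def)
  qed
qed

text \<open>On the event where the polygon of level \<open>n\<close> approximates the noise, \<open>Y\<close> is bounded below by
  \<open>J - \<eta>\<close> minus half the energy of the polygon. Half the energy is just not exponentially integrable, so a
  fraction \<open>\<theta>\<close> of the trivial bound \<open>Y \<ge> -b\<close> is mixed in.\<close>

lemma Laplace_lower:
  assumes J: "\<And>\<phi>. \<phi> \<in> mspace path_space \<Longrightarrow> ereal J \<le> ereal (1 / 2) * rate_function A y \<mu> x0 \<phi> + ereal (h \<phi>)"
    and b: "\<And>x. continuous_on {0..1} x \<Longrightarrow> \<bar>H x\<bar> \<le> b" and Jb: "- b \<le> J" and "e > 0"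
  shows "\<forall>\<^sub>F \<epsilon> in at_right 0. 0 < Z \<epsilon> \<longrightarrow> J - e < - \<epsilon>\<^sup>2 * ln (Z \<epsilon>)"
proof -
  \<comment> \<open>The accuracy \<open>\<eta>\<close> and the mixing weight \<open>\<theta>\<close>
    may each cost \<open>e / 4\<close>; the remaining \<open>e / 2\<close> is left for
    \<open>\<epsilon>\<^sup>2 * ln (C + K)\<close>. The 1 in the denominator covers the case
    \<open>J = - b\<close>.\<close>
  define \<eta> \<theta> where "\<eta> = e / 4" and "\<theta> = min (1 / 2) (e / (4 * (J + b + 1)))"
  have "\<eta> > 0" using \<open>e > 0\<close> by (simp add: \<eta>_def)
  have \<theta>: "0 < \<theta>" using \<open>e > 0\<close> Jb by (auto simp: \<theta>_def)
  have \<theta>2: "\<theta> \<le> 1 / 2" unfolding \<theta>_def by (rule min.cobounded1)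
  note \<theta> = \<theta> \<theta>2
  have \<theta>J: "\<theta> * (J + b) \<le> e / 4"
  proof -
    have "\<theta> * (J + b) \<le> (e / (4 * (J + b + 1))) * (J + b + 1)"
      using Jb \<theta> \<open>e > 0\<close> by (intro mult_mono) (auto simp: \<theta>_def)
    also have "\<dots> = e / 4"
    proof -
      have "J + b + 1 \<noteq> 0" using Jb by simp
      then show ?thesis by (simp add: field_simps)
    qed
    finally show ?thesis .
  qed
  \<comment> \<open>Beyond the energy \<open>2 * (J + b)\<close>, half the energy already exceeds
    \<open>J + b\<close>, so the desired lower bound follows from the trivial bound
    \<open>- b\<close> for \<open>Y\<close>.\<close>
  define R where "R = 2 * (J + b)"
  have "R \<ge> 0" using Jb by (simp add: R_def)
  obtain \<delta> where "\<delta> > 0" and \<delta>: "\<And>n f x u x'. f 0 = 0 \<Longrightarrow> dyadic_energy n f \<le> R \<Longrightarrow> driven (polygon n f) x \<Longrightarrow> driven u x' \<Longrightarrow>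
    \<forall>t\<in>{0..1}. norm (u t - polygon n f t) \<le> \<delta> \<Longrightarrow> \<bar>H x' - H x\<bar> < \<eta>"
    using functional_uniform_on_energy_ball[OF \<open>R \<ge> 0\<close> \<open>\<eta> > 0\<close>] by blast
  \<comment> \<open>With the rate \<open>J + b\<close>, the trivial bound
    \<open>exp (b / \<epsilon>\<^sup>2)\<close> on the bad event contributes only the order
    \<open>exp (- J / \<epsilon>\<^sup>2)\<close>.\<close>
  obtain N where N: "\<forall>n\<ge>N. \<exists>C\<ge>0. \<forall>\<epsilon>. 0 < \<epsilon> \<and> \<epsilon> \<le> 1 \<longrightarrow> (\<exists>S\<in>events. prob S \<le> C * exp (- (J + b) / \<epsilon>\<^sup>2) \<and>
    (\<forall>\<omega>\<in>space M - S. continuous_on {0..1} (\<lambda>t. w t \<omega>) \<longrightarrow>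
      (\<forall>t\<in>{0..1}. norm (\<epsilon> *\<^sub>R w t \<omega> - polygon n (\<lambda>t. \<epsilon> *\<^sub>R w t \<omega>) t) \<le> \<delta>)))"
    using brownian_polygon_tail[OF bm \<open>\<delta> > 0\<close>, of "J + b"] by blast
  obtain C where "C \<ge> 0" and C: "\<And>\<epsilon>. 0 < \<epsilon> \<and> \<epsilon> \<le> 1 \<Longrightarrow> (\<exists>S\<in>events. prob S \<le> C * exp (- (J + b) / \<epsilon>\<^sup>2) \<and>
    (\<forall>\<omega>\<in>space M - S. continuous_on {0..1} (\<lambda>t. w t \<omega>) \<longrightarrow>
      (\<forall>t\<in>{0..1}. norm (\<epsilon> *\<^sub>R w t \<omega> - polygon N (\<lambda>t. \<epsilon> *\<^sub>R w t \<omega>) t) \<le> \<delta>)))"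
    using N[rule_format, of N] by auto
  define W where "W \<omega> = dyadic_energy N (\<lambda>t. w t \<omega>)" for \<omega>
  \<comment> \<open>The exponential moment of the energy at \<open>\<kappa> = 1 - \<theta>\<close>.
    It does not depend on \<open>\<epsilon>\<close>: the level is fixed, and the factor
    \<open>\<epsilon>\<^sup>2\<close> in the energy of the scaled noise cancels against the division
    by \<open>\<epsilon>\<^sup>2\<close> in the exponent.\<close>
  define K where "K = ((1 / sqrt \<theta>) ^ CARD('d)) ^ (2 ^ N)"
  have "K > 0" using \<theta> by (simp add: K_def)
  have EK: "(\<integral>\<^sup>+\<omega>. ennreal (exp ((1 - \<theta>) / 2 * W \<omega>)) \<partial>M) = ennreal K"
    using brownian_energy_exp[OF bm, of "1 - \<theta>" N] \<theta> by (simp add: W_def K_def)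
  have Wm[measurable]: "W \<in> borel_measurable M"
  proof -
    note brownian_incr_measurable[OF bm, measurable]
    show ?thesis unfolding W_def dyadic_energy_def by measurable
  qed
  \<comment> \<open>\<open>J - \<eta>\<close> and \<open>- b\<close> mixed with weights
    \<open>1 - \<theta>\<close> and \<open>\<theta>\<close>: the constant part of the lower bound
    for \<open>Y\<close>, once the energy term has been separated.\<close>
  define D where "D = (1 - \<theta>) * (J - \<eta>) - \<theta> * b"
  have DJ: "J - e / 2 \<le> D"
  proof -
    have "D = J - \<eta> - \<theta> * (J + b) + \<theta> * \<eta>" by (simp add: D_def algebra_simps)
    moreover have "0 \<le> \<theta> * \<eta>" using \<theta> \<open>\<eta> > 0\<close> by simp
    ultimately show ?thesis using \<theta>J by (simp add: \<eta>_def)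
  qed
  have ev1: "\<forall>\<^sub>F \<epsilon> :: real in at_right 0. 0 < \<epsilon> \<and> \<epsilon> < 1"
    using eventually_at_right_real[of 0 1] by (rule eventually_mono) auto
  have ev2: "\<forall>\<^sub>F \<epsilon> in at_right 0. \<epsilon>\<^sup>2 * ln (C + K) < e / 2"
    by (rule order_tendstoD(2)[OF square_mult_tendsto_0]) (use \<open>e > 0\<close> in simp)
  show ?thesis
    using ev1 ev2
  proof eventually_elim
    case (elim \<epsilon>)
    have \<epsilon>: "\<epsilon> > 0" using elim by simp
    have e2: "\<epsilon>\<^sup>2 > 0" using \<epsilon> by simp
    note Y_measurable[OF \<epsilon>, measurable]
    obtain S where S: "S \<in> events" "prob S \<le> C * exp (- (J + b) / \<epsilon>\<^sup>2)"
      "\<And>\<omega>. \<omega> \<in> space M - S \<Longrightarrow> continuous_on {0..1} (\<lambda>t. w t \<omega>) \<Longrightarrow>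
        \<forall>t\<in>{0..1}. norm (\<epsilon> *\<^sub>R w t \<omega> - polygon N (\<lambda>t. \<epsilon> *\<^sub>R w t \<omega>) t) \<le> \<delta>"
      using C[of \<epsilon>] elim by auto
    have pt: "AE \<omega> in M. ennreal (exp (- Y \<epsilon> \<omega> / \<epsilon>\<^sup>2)) \<le>
      ennreal (exp (b / \<epsilon>\<^sup>2)) * indicator S \<omega> + ennreal (exp (- D / \<epsilon>\<^sup>2)) * ennreal (exp ((1 - \<theta>) / 2 * W \<omega>))"
      using AE_driven[OF \<epsilon>]
    proof eventually_elim
      case (elim \<omega>)
      have Yb: "- b \<le> Y \<epsilon> \<omega>" using b[OF X_continuous[OF \<epsilon>, of \<omega>]] elim unfolding Y_eq by linarith
      show ?case
      proof (cases "\<omega> \<in> S")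
        case True
        have "- Y \<epsilon> \<omega> / \<epsilon>\<^sup>2 \<le> b / \<epsilon>\<^sup>2" using Yb by (intro divide_right_mono) auto
        then have "ennreal (exp (- Y \<epsilon> \<omega> / \<epsilon>\<^sup>2)) \<le> ennreal (exp (b / \<epsilon>\<^sup>2))" by (simp add: ennreal_leI)
        also have "\<dots> \<le> ennreal (exp (b / \<epsilon>\<^sup>2)) * indicator S \<omega> + ennreal (exp (- D / \<epsilon>\<^sup>2)) * ennreal (exp ((1 - \<theta>) / 2 * W \<omega>))"
          using True by simp
        finally show ?thesis .
      next
        case False
        define f where "f t = \<epsilon> *\<^sub>R w t \<omega>" for t
        have f0: "f 0 = 0" using elim by (simp add: f_def)
        have Ef: "dyadic_energy N f = \<epsilon>\<^sup>2 * W \<omega>" unfolding f_def W_def by (rule dyadic_energy_scaleR)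
        have close: "\<forall>t\<in>{0..1}. norm (f t - polygon N f t) \<le> \<delta>" using S(3)[of \<omega>] elim False by (simp add: f_def[abs_def])
        have low: "J - \<eta> - dyadic_energy N f / 2 \<le> Y \<epsilon> \<omega>"
        proof (cases "dyadic_energy N f \<le> R")
          case True
          obtain x where x: "driven (polygon N f) x" using driven_polygon_exists[of f N, OF f0] by blast
          have cx: "continuous_on {0..1} x" using x by (simp add: driven_solution_def)
          have "driven f (\<lambda>t. X \<epsilon> t \<omega>)" using elim by (simp add: f_def[abs_def])
          from \<delta>[OF f0 True x this close] have "\<bar>Y \<epsilon> \<omega> - H x\<bar> < \<eta>" by (simp add: Y_eq)
          moreover have "J \<le> dyadic_energy N f / 2 + H x"
          proof -
            have "ereal J \<le> ereal (1 / 2) * rate_function A y \<mu> x0 (restrict x {0..1}) + ereal (H x)"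
              by (rule J[OF restrict_in_path_space[OF cx]])
            also have "\<dots> \<le> ereal (1 / 2) * ereal (dyadic_energy N f) + ereal (H x)"
              by (intro add_right_mono ereal_mult_left_mono rate_function_polygon[where f = f and n = N, OF \<mu> x f0]) simp
            finally show ?thesis by simp
          qed
          ultimately show ?thesis by linarith
        next
          case False
          then have "J - dyadic_energy N f / 2 \<le> - b" by (simp add: R_def)
          then show ?thesis using Yb \<open>\<eta> > 0\<close> by linarith
        qed
        have "(1 - \<theta>) * (J - \<eta> - dyadic_energy N f / 2) + \<theta> * (- b) \<le> (1 - \<theta>) * Y \<epsilon> \<omega> + \<theta> * Y \<epsilon> \<omega>"
          using low Yb \<theta> by (intro add_mono mult_left_mono) auto
        then have "- Y \<epsilon> \<omega> \<le> - D + (1 - \<theta>) / 2 * (\<epsilon>\<^sup>2 * W \<omega>)"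
          unfolding Ef D_def by (simp add: algebra_simps)
        then have "- Y \<epsilon> \<omega> / \<epsilon>\<^sup>2 \<le> (- D + (1 - \<theta>) / 2 * (\<epsilon>\<^sup>2 * W \<omega>)) / \<epsilon>\<^sup>2" by (rule divide_right_mono) simp
        also have "\<dots> = - D / \<epsilon>\<^sup>2 + (1 - \<theta>) / 2 * W \<omega>" using e2 by (simp add: field_simps)
        finally have "exp (- Y \<epsilon> \<omega> / \<epsilon>\<^sup>2) \<le> exp (- D / \<epsilon>\<^sup>2) * exp ((1 - \<theta>) / 2 * W \<omega>)"
          by (simp only: exp_add[symmetric] exp_le_cancel_iff)
        then have "ennreal (exp (- Y \<epsilon> \<omega> / \<epsilon>\<^sup>2)) \<le> ennreal (exp (- D / \<epsilon>\<^sup>2)) * ennreal (exp ((1 - \<theta>) / 2 * W \<omega>))"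
          by (simp add: ennreal_mult[symmetric] ennreal_leI)
        then show ?thesis using False by simp
      qed
    qed
    have "ennreal (Z \<epsilon>) = (\<integral>\<^sup>+\<omega>. ennreal (exp (- Y \<epsilon> \<omega> / \<epsilon>\<^sup>2)) \<partial>M)"
      unfolding Z_def by (rule nn_integral_eq_integral[symmetric, OF Y_exp_integrable[OF \<epsilon>]]) auto
    also have "\<dots> \<le> (\<integral>\<^sup>+\<omega>. ennreal (exp (b / \<epsilon>\<^sup>2)) * indicator S \<omega> + ennreal (exp (- D / \<epsilon>\<^sup>2)) * ennreal (exp ((1 - \<theta>) / 2 * W \<omega>)) \<partial>M)"
      by (rule nn_integral_mono_AE[OF pt])
    also have "\<dots> = ennreal (exp (b / \<epsilon>\<^sup>2)) * emeasure M S + ennreal (exp (- D / \<epsilon>\<^sup>2)) * ennreal K"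
      unfolding EK[symmetric] using S(1) by (subst nn_integral_add) (auto simp: nn_integral_cmult_indicator nn_integral_cmult)
    also have "\<dots> = ennreal (exp (b / \<epsilon>\<^sup>2) * prob S + exp (- D / \<epsilon>\<^sup>2) * K)"
      using \<open>K > 0\<close> by (simp add: emeasure_eq_measure ennreal_mult ennreal_plus)
    finally have Z1: "Z \<epsilon> \<le> exp (b / \<epsilon>\<^sup>2) * prob S + exp (- D / \<epsilon>\<^sup>2) * K"
      using \<open>K > 0\<close> by (subst (asm) ennreal_le_iff) (auto intro!: add_nonneg_nonneg)
    define Q where "Q = exp (- (J - e / 2) / \<epsilon>\<^sup>2)"
    have "exp (b / \<epsilon>\<^sup>2) * prob S \<le> exp (b / \<epsilon>\<^sup>2) * (C * exp (- (J + b) / \<epsilon>\<^sup>2))" using S(2) by (intro mult_left_mono) auto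
    also have "\<dots> = C * exp (b / \<epsilon>\<^sup>2 + - (J + b) / \<epsilon>\<^sup>2)" by (simp only: exp_add mult_ac)
    also have "b / \<epsilon>\<^sup>2 + - (J + b) / \<epsilon>\<^sup>2 = - J / \<epsilon>\<^sup>2" by (simp add: diff_divide_distrib add_divide_distrib)
    also have "C * exp (- J / \<epsilon>\<^sup>2) \<le> C * Q"
    proof -
      have "- J / \<epsilon>\<^sup>2 \<le> - (J - e / 2) / \<epsilon>\<^sup>2" using \<open>e > 0\<close> by (intro divide_right_mono) auto
      then show ?thesis unfolding Q_def using \<open>C \<ge> 0\<close> by (intro mult_left_mono) auto
    qed
    finally have 1: "exp (b / \<epsilon>\<^sup>2) * prob S \<le> C * Q" .
    have "- D / \<epsilon>\<^sup>2 \<le> - (J - e / 2) / \<epsilon>\<^sup>2" using DJ by (intro divide_right_mono) auto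
    then have "exp (- D / \<epsilon>\<^sup>2) * K \<le> Q * K" unfolding Q_def using \<open>K > 0\<close> by (intro mult_right_mono) auto
    then have ZQ: "Z \<epsilon> \<le> (C + K) * Q" using Z1 1 by (simp add: algebra_simps)
    have CK: "C + K > 0" using \<open>C \<ge> 0\<close> \<open>K > 0\<close> by simp
    show ?case
    proof
      assume "0 < Z \<epsilon>"
      then have "ln (Z \<epsilon>) \<le> ln ((C + K) * Q)" using ZQ by simp
      also have "\<dots> = ln (C + K) + - (J - e / 2) / \<epsilon>\<^sup>2" using CK by (simp add: ln_mult Q_def)
      finally have "\<epsilon>\<^sup>2 * ln (Z \<epsilon>) \<le> \<epsilon>\<^sup>2 * (ln (C + K) + - (J - e / 2) / \<epsilon>\<^sup>2)" by (rule mult_left_mono) simp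
      also have "\<dots> = \<epsilon>\<^sup>2 * ln (C + K) - (J - e / 2)" using e2 by (simp add: field_simps)
      finally show "J - e < - \<epsilon>\<^sup>2 * ln (Z \<epsilon>)" using elim(2) by simp
    qed
  qed
qed

text \<open>The infimum is a real number: it is bounded below because \<open>h\<close> is, and above
  because the solution driven by the zero path has rate 0. Convergence is therefore proved for
  reals, with a nearly optimal path in the upper bound.\<close>

lemma Laplace_principle:
  "((\<lambda>\<epsilon>. ereal (- \<epsilon>\<^sup>2 * ln (Z \<epsilon>)))
     \<longlongrightarrow> (INF \<phi>\<in>mspace path_space. ereal (1 / 2) * rate_function A y \<mu> x0 \<phi> + ereal (h \<phi>))) (at_right 0)"
proof -
  define V where "V \<phi> = ereal (1 / 2) * rate_function A y \<mu> x0 \<phi> + ereal (h \<phi>)" for \<phi>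
  define I where "I = (INF \<phi>\<in>mspace path_space. V \<phi>)"
  obtain b where b: "\<And>x. continuous_on {0..1} x \<Longrightarrow> \<bar>H x\<bar> \<le> b" using h_bound by blast
  have Vlow: "ereal (- b) \<le> V \<phi>" if "\<phi> \<in> mspace path_space" for \<phi>
  proof -
    have "continuous_on {0..1} \<phi>" "restrict \<phi> {0..1} = \<phi>" using that by (auto simp: mspace_path_space extensional_restrict)
    then have "- b \<le> h \<phi>" using b[of \<phi>] by simp
    moreover have "0 \<le> ereal (1 / 2) * rate_function A y \<mu> x0 \<phi>" by (simp add: rate_function_nonneg)
    ultimately have "0 + ereal (- b) \<le> V \<phi>" unfolding V_def by (intro add_mono) auto
    then show ?thesis by simp
  qed
  have Ilow: "ereal (- b) \<le> I" unfolding I_def using Vlow by (rule INF_greatest)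
  obtain x where x: "driven (polygon 0 (\<lambda>_. 0)) x" using driven_polygon_exists[of "\<lambda>_. 0" 0] by auto
  have cx: "continuous_on {0..1} x" using x by (simp add: driven_solution_def)
  have "I \<le> V (restrict x {0..1})" unfolding I_def by (rule INF_lower[OF restrict_in_path_space[OF cx]])
  also have "\<dots> \<le> ereal (1 / 2) * ereal (dyadic_energy 0 (\<lambda>_. 0 :: real ^ 'd)) + ereal (H x)"
    unfolding V_def by (intro add_right_mono ereal_mult_left_mono rate_function_polygon[OF \<mu> x]) auto
  finally have "I \<le> ereal (H x)" by (simp add: dyadic_energy_zero)
  then obtain J where J: "I = ereal J" using Ilow by (cases I) auto
  have Jb: "- b \<le> J" using Ilow J by simp
  have JV: "ereal J \<le> ereal (1 / 2) * rate_function A y \<mu> x0 \<phi> + ereal (h \<phi>)" if "\<phi> \<in> mspace path_space" for \<phi>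
  proof -
    have "I \<le> V \<phi>" unfolding I_def by (rule INF_lower[OF that])
    then show ?thesis unfolding J V_def .
  qed
  have "((\<lambda>\<epsilon>. - \<epsilon>\<^sup>2 * ln (Z \<epsilon>)) \<longlongrightarrow> J) (at_right 0)"
  proof (rule tendstoI)
    fix e :: real assume "e > 0"
    have "I < ereal (J + e / 2)" using J \<open>e > 0\<close> by simp
    then obtain \<phi> where \<phi>: "\<phi> \<in> mspace path_space" "V \<phi> < ereal (J + e / 2)"
      unfolding I_def INF_less_iff by blast
    have "rate_function A y \<mu> x0 \<phi> \<noteq> \<infinity>" using \<phi>(2) by (auto simp: V_def)
    then obtain E where E: "rate_function A y \<mu> x0 \<phi> = ereal E"
      using rate_function_nonneg[of A y \<mu> x0 \<phi>] by (cases "rate_function A y \<mu> x0 \<phi>") auto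
    have lt: "E / 2 + h \<phi> < J + e / 2" using \<phi>(2) by (simp add: V_def E)
    have "\<forall>\<^sub>F \<epsilon> in at_right 0. 0 < Z \<epsilon> \<and> - \<epsilon>\<^sup>2 * ln (Z \<epsilon>) < E / 2 + h \<phi> + e / 2"
      by (rule Laplace_upper[OF \<phi>(1) E]) (use \<open>e > 0\<close> in simp)
    moreover have "\<forall>\<^sub>F \<epsilon> in at_right 0. 0 < Z \<epsilon> \<longrightarrow> J - e < - \<epsilon>\<^sup>2 * ln (Z \<epsilon>)"
      by (rule Laplace_lower[OF JV b Jb \<open>e > 0\<close>])
    ultimately show "\<forall>\<^sub>F \<epsilon> in at_right 0. dist (- \<epsilon>\<^sup>2 * ln (Z \<epsilon>)) J < e"
      by eventually_elim (use lt in \<open>auto simp: dist_real_def abs_less_iff\<close>)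
  qed
  then show ?thesis unfolding V_def[symmetric] I_def[symmetric] J by (simp add: lim_ereal)
qed

end

theorem mainTheorem1:
  fixes A :: "real ^ 'd ^ 'n" and y :: "real ^ 'n" and \<mu> :: real and x0 :: "real ^ 'd"
    and M :: "'a measure" and w :: "real \<Rightarrow> 'a \<Rightarrow> real ^ 'd"
    and X :: "real \<Rightarrow> real \<Rightarrow> 'a \<Rightarrow> real ^ 'd"
    and h :: "(real \<Rightarrow> real ^ 'd) \<Rightarrow> real"
  assumes "\<mu> > 0"
    and "prob_space M"
    and "prob_space.standard_brownian_motion M w"
    and "\<And>\<epsilon>. \<epsilon> > 0 \<Longrightarrow> prob_space.strong_solution M w A y \<mu> x0 \<epsilon> (X \<epsilon>)"
    and "continuous_map (mtopology_of path_space) euclideanreal h"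
    and "bounded (h ` mspace path_space)"
  shows "((\<lambda>\<epsilon>. ereal (- \<epsilon>\<^sup>2 * ln (LINT \<omega>|M. exp (- h (sample_path (X \<epsilon>) \<omega>) / \<epsilon>\<^sup>2))))
           \<longlongrightarrow> (INF \<phi>\<in>mspace path_space. ereal (1/2) * rate_function A y \<mu> x0 \<phi> + ereal (h \<phi>)))
         (at_right 0)"
proof -
  interpret prob_space M by fact
  interpret lasso_small_noise M A y \<mu> x0 w X h
    by unfold_locales (use assms in auto)
  show ?thesis using Laplace_principle unfolding Z_def Y_def .
qed

end
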